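(* Assume the setting below, with $1<s<2$, $\gamma\in\mathbb{R}$ and $\gamma_s^*=3-2s$. Let $(u_\varepsilon,p_\varepsilon)$ be weak solutions of the power law slip Navier–Stokes problem in $\Omega^\varepsilon$, $\widetilde u_\varepsilon(z)=u_\varepsilon(z',\varepsilon z_3)$, $\widetilde p_\varepsilon(z)=p_\varepsilon(z',\varepsilon z_3)$, and let $(\widetilde u,\widetilde p)\in V_{z_3}\times L^2_0(\Omega)$, with $\widetilde u_3\equiv0$ and $\widetilde p=\widetilde p(z')$, be limits along a subsequence with $\varepsilon^{-2}\widetilde u_\varepsilon\rightharpoonup\widetilde u$ weakly in $V_{z_3}$ and $\widetilde p_\varepsilon\rightharpoonup\widetilde p$ weakly in $L^2(\Omega)$. Then $(\widetilde u',\widetilde p)$ satisfies $$\begin{cases}-\nu\,\partial_{z_3}^2\widetilde u'(z)=f'(z')-\nabla_{z'}\widetilde p(z') & \text{in }\Omega,\\ \mathrm{div}_{z'}\Big(\int_0^{h(z')}\widetilde u'(z)\,dz_3\Big)=0 & \text{in }\omega,\\ \Big(\int_0^{h(z')}\widetilde u'(z)\,dz_3\Big)\cdot\mathrm{n}=0 & \text{on }\partial\omega,\\ \widetilde u'=0 & \text{on }\Gamma_1,\end{cases}$$ together with the following boundary condition on $\Gamma_0$: (i) if $\gamma=\gamma_s^*$: $-\nu\partial_{z_3}\widetilde u'=-|K\widetilde u'|^{s-2}K^2\widetilde u'$ on $\Gamma_0$ (power law slip); (ii) if $\gamma>\gamma_s^*$: $-\nu\partial_{z_3}\widetilde u'=0$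 on $\Gamma_0$ (perfect slip); (iii) if $\gamma<\gamma_s^*$: $\widetilde u'=0$ on $\Gamma_0$ (no slip).
   Context: Setting: $\omega\subset\mathbb{R}^2$ is a smooth, bounded, connected open set; $h:\omega\to(0,\infty)$ is a positive bounded $C^1$ function. For $0<\varepsilon\ll1$, $\Omega^\varepsilon=\{(x',x_3): x'\in\omega,\ 0<x_3<\varepsilon h(x')\}$, $\Gamma_0=\omega\times\{0\}$, $\Omega=\{(z',z_3): z'\in\omega,\ 0<z_3<h(z')\}$, $\Gamma_1=\{(z',h(z')): z'\in\omega\}$; $\mathrm{n}$ is the outward unit normal to $\partial\omega$. Vectors are written $u=(u',u_3)$ with $u'=(u_1,u_2)$; $|\cdot|$ is the Euclidean norm. Data: $\nu>0$, $f'\in L^2(\omega)^2$ (force $(f'(x'),0)$), $K$ a $2\times2$ symmetric, bounded, uniformly positive definite tensor. $\mathbb{V}(\Omega^\varepsilon)=\{\varphi\in H^1(\Omega^\varepsilon)^3: \varphi=0\text{ on }\partial\Omega^\varepsilon\setminus\Gamma_0,\ \varphi_3=0\text{ on }\Gamma_0\}$, $L^2_0$ = $L^2$ functions with zero mean. A weak solution is $(u_\varepsilon,p_\varepsilon)\in\mathbb{V}(\Omega^\varepsilon)\times L^2_0(\Omega^\varepsilon)$ with $$\nu\int_{\Omega^\varepsilon}Du_\varepsilon:D\varphi\,dx+\int_{\Omega^\varepsilon}(u_\varepsilon\cdot\nabla)u_\varepsilon\cdot\varphi\,dx+\varepsilon^\gamma\int_{\Gamma_0}|Ku_\varepsilon'|^{s-2}Ku_\varepsilon'\cdot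 K\varphi'\,d\sigma-\int_{\Omega^\varepsilon}p_\varepsilon\,\mathrm{div}\,\varphi\,dx=\int_{\Omega^\varepsilon}f'\cdot\varphi'\,dx$$ for all $\varphi\in\mathbb{V}(\Omega^\varepsilon)$, and $\mathrm{div}\,u_\varepsilon=0$ in $\Omega^\varepsilon$ (weak form of Navier–Stokes with $u_\varepsilon=0$ on $\partial\Omega^\varepsilon\setminus\Gamma_0$ and $-\nu\partial_{x_3}u_\varepsilon'=-\varepsilon^\gamma|Ku_\varepsilon'|^{s-2}K^2u_\varepsilon'$, $u_{\varepsilon,3}=0$ on $\Gamma_0$). $V_{z_3}=\{\varphi\in L^2(\Omega)^3: \partial_{z_3}\varphi\in L^2(\Omega)^3\}$ with norm $\|\varphi\|_{V_{z_3}}^2=\|\varphi\|_{L^2}^2+\|\partial_{z_3}\varphi\|_{L^2}^2$. The limit system is understood in the weak (variational) sense. *)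

theory Defs
  imports "HOL-Analysis.Analysis"
begin

(* Points of R^3 are written z = (z', z3) with z' :: real^2, z3 :: real.
   Vector fields u = (u', u3) take values in the same type. *)
type_synonym pt = "(real^2) \<times> real"

definition smooth_bounded_domain :: "(real^2) set \<Rightarrow> bool" where
  "smooth_bounded_domain \<omega> \<longleftrightarrow> open \<omega> \<and> bounded \<omega> \<and> connected \<omega> \<and> \<omega> \<noteq> {} \<and>
     (\<forall>x \<in> frontier \<omega>. \<exists>r > 0. \<exists>Q g.
        orthogonal_transformation (Q :: real^2 \<Rightarrow> real^2) \<and>
        (\<forall>k t. ((deriv ^^ k) (g :: real \<Rightarrow> real)) differentiable (at t)) \<and>
        \<omega> \<inter> ball x r = {y \<in> ball x r. (Q (y - x)) $ 2 < g ((Q (y - x)) $ 1)})"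

definition C1_on :: "('a::real_normed_vector \<Rightarrow> 'b::real_normed_vector) \<Rightarrow> 'a set \<Rightarrow> bool" where
  "C1_on f S \<longleftrightarrow> (\<exists>D. continuous_on S D \<and> (\<forall>x\<in>S. (f has_derivative blinfun_apply (D x)) (at x)))"

(* Omega^eps = {(x',x3). x' in omega, 0 < x3 < eps h(x')};  Omega = Omega^1 *)
definition Omega_eps :: "(real^2) set \<Rightarrow> (real^2 \<Rightarrow> real) \<Rightarrow> real \<Rightarrow> pt set" where
  "Omega_eps \<omega> h \<epsilon> = {(x', x3). x' \<in> \<omega> \<and> 0 < x3 \<and> x3 < \<epsilon> * h x'}"

definition Gamma0 :: "(real^2) set \<Rightarrow> pt set" where
  "Gamma0 \<omega> = {(x', x3). x' \<in> \<omega> \<and> x3 = 0}"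

definition Gamma1 :: "(real^2) set \<Rightarrow> (real^2 \<Rightarrow> real) \<Rightarrow> pt set" where
  "Gamma1 \<omega> h = {(z', z3). z' \<in> \<omega> \<and> z3 = h z'}"

definition supp :: "('a::real_normed_vector \<Rightarrow> 'b::zero) \<Rightarrow> 'a set" where
  "supp f = closure {x. f x \<noteq> 0}"

definition C1fun :: "('a::real_normed_vector \<Rightarrow> 'b::real_normed_vector) \<Rightarrow> bool" where
  "C1fun f \<longleftrightarrow> C1_on f UNIV"

definition pd :: "('a::real_normed_vector \<Rightarrow> 'b::real_normed_vector) \<Rightarrow> 'a \<Rightarrow> 'a \<Rightarrow> 'b" where
  "pd f v x = frechet_derivative f (at x) v"

definition L2 :: "'a::euclidean_space set \<Rightarrow> ('a \<Rightarrow> 'b::euclidean_space) \<Rightarrow> bool" where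
  "L2 S f \<longleftrightarrow> set_borel_measurable lebesgue S f \<and>
              set_integrable lebesgue S (\<lambda>x. (norm (f x))\<^sup>2)"

abbreviation SInt :: "'a::euclidean_space set \<Rightarrow> ('a \<Rightarrow> 'b::euclidean_space) \<Rightarrow> 'b" where
  "SInt S f \<equiv> set_lebesgue_integral lebesgue S f"

definition weak_deriv :: "'a::euclidean_space set \<Rightarrow> 'a \<Rightarrow> ('a \<Rightarrow> 'b::euclidean_space) \<Rightarrow> ('a \<Rightarrow> 'b) \<Rightarrow> bool" where
  "weak_deriv S v w d \<longleftrightarrow>
     (\<forall>\<psi> :: 'a \<Rightarrow> real. C1fun \<psi> \<and> compact (supp \<psi>) \<and> supp \<psi> \<subseteq> S \<longrightarrow>
        SInt S (\<lambda>x. pd \<psi> v x *\<^sub>R w x) = - SInt S (\<lambda>x. \<psi> x *\<^sub>R d x))"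

definition H1 :: "pt set \<Rightarrow> (pt \<Rightarrow> pt) \<Rightarrow> (pt \<Rightarrow> pt \<Rightarrow> pt) \<Rightarrow> bool" where
  "H1 S u Du \<longleftrightarrow> L2 S u \<and> (\<forall>b\<in>Basis. L2 S (Du b) \<and> weak_deriv S b u (Du b))"

definition e3 :: pt where "e3 = (0, 1)"

(* g is the trace of w on Gamma0 = omega x {0}, where d = partial_{z3} w *)
definition trace_Gamma0 :: "(real^2) set \<Rightarrow> pt set \<Rightarrow> (pt \<Rightarrow> 'b::euclidean_space) \<Rightarrow> (pt \<Rightarrow> 'b)
     \<Rightarrow> (real^2 \<Rightarrow> 'b) \<Rightarrow> bool" where
  "trace_Gamma0 \<omega> S w d g \<longleftrightarrow> L2 \<omega> g \<and>
     (\<forall>\<psi> :: pt \<Rightarrow> real. C1fun \<psi> \<and> compact (supp \<psi>) \<and> supp \<psi> \<inter> (frontier S - Gamma0 \<omega>) = {} \<longrightarrow>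
        SInt S (\<lambda>x. \<psi> x *\<^sub>R d x + pd \<psi> e3 x *\<^sub>R w x) = - SInt \<omega> (\<lambda>y. \<psi> (y, 0) *\<^sub>R g y))"

(* w = 0 on Gamma1 in the trace sense, where d = partial_{z3} w *)
definition vanishes_Gamma1 :: "(real^2) set \<Rightarrow> (real^2 \<Rightarrow> real) \<Rightarrow> pt set \<Rightarrow> (pt \<Rightarrow> 'b::euclidean_space)
     \<Rightarrow> (pt \<Rightarrow> 'b) \<Rightarrow> bool" where
  "vanishes_Gamma1 \<omega> h S w d \<longleftrightarrow>
     (\<forall>\<psi> :: pt \<Rightarrow> real. C1fun \<psi> \<and> compact (supp \<psi>) \<and> supp \<psi> \<inter> (frontier S - Gamma1 \<omega> h) = {} \<longrightarrow>
        SInt S (\<lambda>x. \<psi> x *\<^sub>R d x + pd \<psi> e3 x *\<^sub>R w x) = 0)"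

definition admissible :: "(real^2) set \<Rightarrow> (real^2 \<Rightarrow> real) \<Rightarrow> real \<Rightarrow> (pt \<Rightarrow> pt) \<Rightarrow> bool" where
  "admissible \<omega> h \<epsilon> \<phi> \<longleftrightarrow> C1fun \<phi> \<and> compact (supp \<phi>) \<and>
     supp \<phi> \<inter> (frontier (Omega_eps \<omega> h \<epsilon>) - Gamma0 \<omega>) = {} \<and>
     (\<forall>y\<in>\<omega>. snd (\<phi> (y, 0)) = 0)"

definition in_V :: "(real^2) set \<Rightarrow> (real^2 \<Rightarrow> real) \<Rightarrow> real \<Rightarrow> (pt \<Rightarrow> pt) \<Rightarrow> (pt \<Rightarrow> pt \<Rightarrow> pt) \<Rightarrow> bool" where
  "in_V \<omega> h \<epsilon> u Du \<longleftrightarrow> (let S = Omega_eps \<omega> h \<epsilon> in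
     H1 S u Du \<and>
     (\<exists>\<phi>s. (\<forall>n. admissible \<omega> h \<epsilon> (\<phi>s n)) \<and>
        (\<lambda>n. SInt S (\<lambda>x. (norm (\<phi>s n x - u x))\<^sup>2) +
             (\<Sum>b\<in>Basis. SInt S (\<lambda>x. (norm (pd (\<phi>s n) b x - Du b x))\<^sup>2))) \<longlonglongrightarrow> 0))"

definition slip :: "real \<Rightarrow> real^2^2 \<Rightarrow> real^2 \<Rightarrow> real^2" where
  "slip s M v = (norm (M *v v) powr (s - 2)) *\<^sub>R (M *v v)"

definition weak_solution ::
  "(real^2) set \<Rightarrow> (real^2 \<Rightarrow> real) \<Rightarrow> real \<Rightarrow> (real^2 \<Rightarrow> real^2) \<Rightarrow> (real^2 \<Rightarrow> real^2^2) \<Rightarrow> real \<Rightarrow> real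
    \<Rightarrow> real \<Rightarrow> (pt \<Rightarrow> pt) \<Rightarrow> (pt \<Rightarrow> real) \<Rightarrow> bool" where
  "weak_solution \<omega> h \<nu> f K s \<gamma> \<epsilon> u p \<longleftrightarrow> (let S = Omega_eps \<omega> h \<epsilon> in
     (\<exists>Du g.
        in_V \<omega> h \<epsilon> u Du \<and> trace_Gamma0 \<omega> S u (Du e3) g \<and>
        L2 S p \<and> SInt S p = 0 \<and>
        (AE x in lebesgue. x \<in> S \<longrightarrow> (\<Sum>b\<in>Basis. Du b x \<bullet> b) = 0) \<and>
        (\<forall>\<phi> D\<phi> g\<phi>. in_V \<omega> h \<epsilon> \<phi> D\<phi> \<and> trace_Gamma0 \<omega> S \<phi> (D\<phi> e3) g\<phi> \<longrightarrow>
           \<nu> * SInt S (\<lambda>x. \<Sum>b\<in>Basis. Du b x \<bullet> D\<phi> b x)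
           + SInt S (\<lambda>x. (\<Sum>b\<in>Basis. (u x \<bullet> b) *\<^sub>R Du b x) \<bullet> \<phi> x)
           + \<epsilon> powr \<gamma> * SInt \<omega> (\<lambda>y. slip s (K y) (fst (g y)) \<bullet> (K y *v fst (g\<phi> y)))
           - SInt S (\<lambda>x. p x * (\<Sum>b\<in>Basis. D\<phi> b x \<bullet> b))
           = SInt S (\<lambda>x. f (fst x) \<bullet> fst (\<phi> x)))))"

definition Vz3 :: "pt set \<Rightarrow> (pt \<Rightarrow> pt) \<Rightarrow> (pt \<Rightarrow> pt) \<Rightarrow> bool" where
  "Vz3 S w d \<longleftrightarrow> L2 S w \<and> L2 S d \<and> weak_deriv S e3 w d"

(* weak convergence in the Hilbert space V_{z3} (functionals represented via its inner product) *)
definition weak_conv_Vz3 :: "pt set \<Rightarrow> (nat \<Rightarrow> pt \<Rightarrow> pt) \<Rightarrow> (nat \<Rightarrow> pt \<Rightarrow> pt) \<Rightarrow> (pt \<Rightarrow> pt) \<Rightarrow> (pt \<Rightarrow> pt) \<Rightarrow> bool" where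
  "weak_conv_Vz3 S w dw W dW \<longleftrightarrow>
     (\<forall>n. Vz3 S (w n) (dw n)) \<and> Vz3 S W dW \<and>
     (\<forall>\<psi> d\<psi>. Vz3 S \<psi> d\<psi> \<longrightarrow>
        (\<lambda>n. SInt S (\<lambda>z. w n z \<bullet> \<psi> z + dw n z \<bullet> d\<psi> z)) \<longlonglongrightarrow> SInt S (\<lambda>z. W z \<bullet> \<psi> z + dW z \<bullet> d\<psi> z))"

definition weak_conv_L2 :: "pt set \<Rightarrow> (nat \<Rightarrow> pt \<Rightarrow> real) \<Rightarrow> (pt \<Rightarrow> real) \<Rightarrow> bool" where
  "weak_conv_L2 S q Q \<longleftrightarrow> (\<forall>n. L2 S (q n)) \<and> L2 S Q \<and>
     (\<forall>r. L2 S r \<longrightarrow> (\<lambda>n. SInt S (\<lambda>z. q n z * r z)) \<longlonglongrightarrow> SInt S (\<lambda>z. Q z * r z))"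

definition grad2 :: "(real^2 \<Rightarrow> real) \<Rightarrow> real^2 \<Rightarrow> real^2" where
  "grad2 \<psi> y = (\<Sum>b\<in>Basis. pd \<psi> b y *\<^sub>R b)"

definition div2 :: "(pt \<Rightarrow> real^2) \<Rightarrow> pt \<Rightarrow> real" where
  "div2 \<phi> z = (\<Sum>b\<in>Basis. pd \<phi> (b, 0) z \<bullet> b)"

(* div_{z'}(int_0^h u' dz3) = 0 in omega and (int_0^h u' dz3).n = 0 on the boundary of omega *)
definition flux_condition :: "(real^2) set \<Rightarrow> (real^2 \<Rightarrow> real) \<Rightarrow> (pt \<Rightarrow> pt) \<Rightarrow> bool" where
  "flux_condition \<omega> h U \<longleftrightarrow>
     (\<forall>\<psi> :: real^2 \<Rightarrow> real. C1fun \<psi> \<longrightarrow>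
        SInt (Omega_eps \<omega> h 1) (\<lambda>z. fst (U z) \<bullet> grad2 \<psi> (fst z)) = 0)"

definition momentum_eq :: "(real^2) set \<Rightarrow> (real^2 \<Rightarrow> real) \<Rightarrow> real \<Rightarrow> (real^2 \<Rightarrow> real^2) \<Rightarrow> (pt \<Rightarrow> pt)
     \<Rightarrow> (real^2 \<Rightarrow> real) \<Rightarrow> ((pt \<Rightarrow> real^2) \<Rightarrow> real) \<Rightarrow> (pt \<Rightarrow> real^2) \<Rightarrow> bool" where
  "momentum_eq \<omega> h \<nu> f dU P bd \<phi> \<longleftrightarrow> (let \<Omega> = Omega_eps \<omega> h 1 in
     \<nu> * SInt \<Omega> (\<lambda>z. fst (dU z) \<bullet> pd \<phi> e3 z) + bd \<phi>
     - SInt \<Omega> (\<lambda>z. P (fst z) * div2 \<phi> z)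
     = SInt \<Omega> (\<lambda>z. f (fst z) \<bullet> \<phi> z))"

end

(*
  In the variables w = eps^(-2) u(z', eps z3) the friction coefficient becomes eps^beta with
  beta = gamma + 2 s - 3, and the horizontal viscous terms and the inertial term carry positive powers
  of eps. Testing with bounded saturations w / (1 + delta |w|^2)^2, on which the inertial term vanishes
  identically, and letting delta -> 0 yields the energy identity, hence uniform bounds. Passing to the
  limit in the equation identifies the limit of the friction term with the residual of the limit
  momentum equation.

  If beta > 0, that limit is 0. If beta < 0, the bound on eps^beta times the integral of |K g|^s
  forces the traces to 0 in L^1. If beta = 0, the traces must converge strongly: the viscous
  and friction terms together are monotone in the vertical derivative, and comparing the energy
  identity with the equation tested by the limit (reached through averages of the solutions, on which the
  pressure term vanishes) gives strong L^2 convergence of the vertical derivative of the horizontal velocity, thus of the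
  traces, so that the limit passes through the nonlinearity.

  Traces are never taken abstractly: a field vanishing on the upper boundary has the bottom trace
  - int_0^h d dz3, which is weakly continuous in its vertical derivative d.
*)
theory Submission
  imports Defs
begin

section \<open>Square-integrable functions\<close>

text \<open>Two obstacles shape the proof. The convergence hypothesis tests the pair (velocity,
  vertical derivative) only against pairs from V_z3, so neither component is known to converge
  weakly by itself, and no bound is stated. The force (f, 0) does not depend on z3, so it is an
  admissible partner with zero derivative. Its work is therefore bounded, the energy identity bounds
  the pairs in L^2, and bounded pairs whose inner products with each member and with the limit
  converge do converge weakly against all of L^2. Second, the solutions are only limits of C1 test
  fields. The momentum equation is used for C1 fields alone, where the inertial integrand is
  integrable; every nonlinear substitution is made in an approximating field and carried over with
  square-integrable majorants. Origin of \<beta>: the slip law is homogeneous of degree s - 1 and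
  velocities have size \<epsilon>^2, which gives \<epsilon>^(\<gamma> + 2(s - 1)); dividing by the
  vertical Jacobian \<epsilon> leaves \<gamma> + 2s - 3.\<close>

definition sqi :: "'a measure \<Rightarrow> ('a \<Rightarrow> 'b::euclidean_space) \<Rightarrow> bool" where
  "sqi M f \<longleftrightarrow> f \<in> borel_measurable M \<and> integrable M (\<lambda>x. (norm (f x))\<^sup>2)"

lemma sqiD: assumes "sqi M f" shows "f \<in> borel_measurable M" "integrable M (\<lambda>x. (norm (f x))\<^sup>2)"
  using assms unfolding sqi_def by auto

lemma sqi_bound:
  assumes "g \<in> borel_measurable M" "sqi M f" "AE x in M. norm (g x) \<le> C * norm (f x)"
  shows "sqi M g"
  unfolding sqi_def
proof (intro conjI)
  have "integrable M (\<lambda>x. C\<^sup>2 * (norm (f x))\<^sup>2)" using sqiD(2)[OF assms(2)] by simp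
  then show "integrable M (\<lambda>x. (norm (g x))\<^sup>2)"
  proof (rule Bochner_Integration.integrable_bound)
    show "AE x in M. norm ((norm (g x))\<^sup>2) \<le> norm (C\<^sup>2 * (norm (f x))\<^sup>2)"
      using assms(3)
    proof eventually_elim
      case (elim x)
      then show ?case using power_mono[OF elim, of 2] by (simp add: power_mult_distrib)
    qed
  qed (use assms(1) in measurable)
qed (fact assms(1))

lemma sqi_norm: "sqi M f \<Longrightarrow> sqi M (\<lambda>x. norm (f x))"
  unfolding sqi_def by auto

lemma sqi_norm_mult_integrable:
  assumes "sqi M f" "sqi M g" shows "integrable M (\<lambda>x. norm (f x) * norm (g x))"
proof (rule Bochner_Integration.integrable_bound)
  show "integrable M (\<lambda>x. (norm (f x))\<^sup>2 + (norm (g x))\<^sup>2)"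
    by (intro Bochner_Integration.integrable_add sqiD(2) assms)
  have "a * b \<le> a\<^sup>2 + b\<^sup>2" if "0 \<le> a" "0 \<le> b" for a b :: real
    using sum_squares_bound[of a b] mult_nonneg_nonneg[OF that] by linarith
  then show "AE x in M. norm (norm (f x) * norm (g x)) \<le> norm ((norm (f x))\<^sup>2 + (norm (g x))\<^sup>2)"
    by auto
  show "(\<lambda>x. norm (f x) * norm (g x)) \<in> borel_measurable M"
    using assms[THEN sqiD(1)] by measurable
qed

lemma sqi_mult_bound_integrable:
  fixes q :: "'a \<Rightarrow> 'c::euclidean_space"
  assumes "sqi M f" "sqi M g" "q \<in> borel_measurable M" "AE x in M. norm (q x) \<le> C * (norm (f x) * norm (g x))"
  shows "integrable M q"
proof (rule Bochner_Integration.integrable_bound)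
  show "integrable M (\<lambda>x. C * (norm (f x) * norm (g x)))"
    using sqi_norm_mult_integrable[OF assms(1,2)] by simp
  show "AE x in M. norm (q x) \<le> norm (C * (norm (f x) * norm (g x)))"
    using assms(4) by eventually_elim (metis abs_ge_self order_trans real_norm_def)
qed (fact assms(3))

lemma sqi_inner_integrable:
  assumes "sqi M f" "sqi M g" shows "integrable M (\<lambda>x. f x \<bullet> g x)"
  by (rule sqi_mult_bound_integrable[where C=1, OF assms])
     (use assms[THEN sqiD(1)] in \<open>auto simp: Cauchy_Schwarz_ineq2\<close>)

lemma sqi_add: assumes "sqi M f" "sqi M g" shows "sqi M (\<lambda>x. f x + g x)"
proof -
  have "integrable M (\<lambda>x. (norm (f x))\<^sup>2 + (norm (g x))\<^sup>2 + 2 * (f x \<bullet> g x))"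
    by (intro Bochner_Integration.integrable_add integrable_mult_right sqiD(2) sqi_inner_integrable assms)
  then have "integrable M (\<lambda>x. (norm (f x + g x))\<^sup>2)"
    by (rule back_subst[where P="integrable M"])
       (auto simp: fun_eq_iff power2_norm_eq_inner inner_add_left inner_add_right inner_commute)
  then show ?thesis using assms unfolding sqi_def by auto
qed

lemma sqi_linear: assumes "sqi M f" "bounded_linear L" shows "sqi M (\<lambda>x. L (f x))"
proof -
  obtain C where "\<And>x. norm (L x) \<le> norm x * C" using bounded_linear.bounded[OF assms(2)] by blast
  then have "AE x in M. norm (L (f x)) \<le> C * norm (f x)" by (simp add: mult.commute)
  moreover have "L \<in> borel_measurable borel"
    by (rule borel_measurable_continuous_onI[OF linear_continuous_on[OF assms(2)]])
  ultimately show ?thesis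
    using measurable_compose[OF sqiD(1)[OF assms(1)]] by (intro sqi_bound[OF _ assms(1)])
qed

lemma sqi_scaleR: "sqi M f \<Longrightarrow> sqi M (\<lambda>x. c *\<^sub>R f x)"
  by (erule sqi_linear) (rule bounded_linear_scaleR_right)

lemma sqi_diff: "sqi M f \<Longrightarrow> sqi M g \<Longrightarrow> sqi M (\<lambda>x. f x - g x)"
  using sqi_add[OF _ sqi_scaleR[of M g "-1"]] by simp

lemma sqi_zero: "sqi M (\<lambda>x. 0)" unfolding sqi_def by simp

lemma sqi_sum: "(\<And>i. i \<in> I \<Longrightarrow> sqi M (f i)) \<Longrightarrow> sqi M (\<lambda>x. \<Sum>i\<in>I. f i x)"
  by (induction I rule: infinite_finite_induct) (auto intro: sqi_add sqi_zero)

lemma sqi_inner_right: "sqi M f \<Longrightarrow> sqi M (\<lambda>x. f x \<bullet> b)"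
  by (erule sqi_linear) (rule bounded_linear_inner_left)

lemma sqi_Pair: assumes "sqi M f" "sqi M g" shows "sqi M (\<lambda>x. (f x, g x))"
proof -
  have "sqi M (\<lambda>x. (f x, 0) + (0, g x))"
    by (rule sqi_add[OF sqi_linear[OF assms(1) bounded_linear_Pair[OF bounded_linear_ident bounded_linear_zero]]
        sqi_linear[OF assms(2) bounded_linear_Pair[OF bounded_linear_zero bounded_linear_ident]]])
  then show ?thesis by simp
qed

lemma (in finite_measure) sqi_bounded:
  assumes "f \<in> borel_measurable M" "AE x in M. norm (f x) \<le> C" shows "sqi M f"
proof -
  have "sqi M (\<lambda>x. C)" unfolding sqi_def by simp
  moreover have "AE x in M. norm (f x) \<le> 1 * norm C"
    using assms(2) by eventually_elim simp
  ultimately show ?thesis by (rule sqi_bound[OF assms(1)])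
qed

lemma (in finite_measure) sqi_integrable: assumes "sqi M f" shows "integrable M f"
proof -
  have "sqi M (\<lambda>x. 1::real)" unfolding sqi_def by simp
  from sqi_mult_bound_integrable[OF assms this sqiD(1)[OF assms], of 1] show ?thesis by simp
qed

text \<open>Discriminant argument: the quadratic in \<open>t\<close> of \<open>q\<close> is
  nonnegative, and \<open>t = C / B\<close> is its minimiser. For \<open>B = 0\<close> there is no
  minimiser, but then \<open>g\<close> vanishes almost everywhere and so does
  \<open>C\<close>.\<close>

lemma sqi_Cauchy_Schwarz_norm:
  assumes "sqi M f" "sqi M g"
  shows "(\<integral>x. norm (f x) * norm (g x) \<partial>M)\<^sup>2 \<le> (\<integral>x. (norm (f x))\<^sup>2 \<partial>M) * (\<integral>x. (norm (g x))\<^sup>2 \<partial>M)"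
proof -
  define A B C where "A = (\<integral>x. (norm (f x))\<^sup>2 \<partial>M)" and "B = (\<integral>x. (norm (g x))\<^sup>2 \<partial>M)"
    and "C = (\<integral>x. norm (f x) * norm (g x) \<partial>M)"
  note int = sqiD(2)[OF assms(1)] sqiD(2)[OF assms(2)] sqi_norm_mult_integrable[OF assms]
  have q: "0 \<le> A - 2 * t * C + t\<^sup>2 * B" for t
  proof -
    have "0 \<le> (\<integral>x. (norm (f x) - t * norm (g x))\<^sup>2 \<partial>M)" by simp
    also have "\<dots> = (\<integral>x. ((norm (f x))\<^sup>2 - (2 * t) * (norm (f x) * norm (g x))) + t\<^sup>2 * (norm (g x))\<^sup>2 \<partial>M)"
      by (simp add: power2_eq_square algebra_simps)
    also have "\<dots> = A - 2 * t * C + t\<^sup>2 * B"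
      unfolding A_def B_def C_def using int by simp
    finally show ?thesis .
  qed
  have B0: "0 \<le> B" unfolding B_def by simp
  show ?thesis
  proof (cases "B = 0")
    case True
    then have "AE x in M. (norm (g x))\<^sup>2 = 0"
      unfolding B_def by (subst (asm) integral_nonneg_eq_0_iff_AE) (use int in auto)
    then have "C = (\<integral>x. 0 \<partial>M)" unfolding C_def
      by (intro integral_cong_AE) (use assms[THEN sqiD(1)] in auto)
    then show ?thesis using True unfolding A_def B_def C_def by simp
  next
    case False
    have "0 \<le> A - C\<^sup>2 / B" using q[of "C / B"] False B0 by (simp add: power2_eq_square field_simps)
    then show ?thesis using False B0 unfolding A_def[symmetric] B_def[symmetric] C_def[symmetric]
      by (simp add: field_simps)
  qed
qed

lemma sqi_Cauchy_Schwarz: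
  assumes "sqi M f" "sqi M g"
  shows "\<bar>\<integral>x. f x \<bullet> g x \<partial>M\<bar> \<le> sqrt (\<integral>x. (norm (f x))\<^sup>2 \<partial>M) * sqrt (\<integral>x. (norm (g x))\<^sup>2 \<partial>M)"
proof -
  have "\<bar>\<integral>x. f x \<bullet> g x \<partial>M\<bar> \<le> (\<integral>x. norm (f x) * norm (g x) \<partial>M)"
    by (rule integral_abs_bound[THEN order_trans])
       (intro integral_mono sqi_norm_mult_integrable assms integrable_abs sqi_inner_integrable,
        auto simp: Cauchy_Schwarz_ineq2)
  also have "\<dots> \<le> sqrt ((\<integral>x. (norm (f x))\<^sup>2 \<partial>M) * (\<integral>x. (norm (g x))\<^sup>2 \<partial>M))"
    by (rule real_le_rsqrt) (rule sqi_Cauchy_Schwarz_norm[OF assms])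
  finally show ?thesis by (simp add: real_sqrt_mult)
qed

lemma sqi_inner_tendsto:
  assumes X: "\<And>k. sqi M (X k)" "sqi M Y" "sqi M Z"
    and c: "(\<lambda>k. \<integral>x. (norm (X k x - Y x))\<^sup>2 \<partial>M) \<longlonglongrightarrow> 0"
  shows "(\<lambda>k. \<integral>x. X k x \<bullet> Z x \<partial>M) \<longlonglongrightarrow> (\<integral>x. Y x \<bullet> Z x \<partial>M)"
proof -
  have "\<bar>(\<integral>x. X k x \<bullet> Z x \<partial>M) - (\<integral>x. Y x \<bullet> Z x \<partial>M)\<bar>
      \<le> sqrt (\<integral>x. (norm (X k x - Y x))\<^sup>2 \<partial>M) * sqrt (\<integral>x. (norm (Z x))\<^sup>2 \<partial>M)" for k
  proof -
    have "(\<integral>x. X k x \<bullet> Z x \<partial>M) - (\<integral>x. Y x \<bullet> Z x \<partial>M) = (\<integral>x. (X k x - Y x) \<bullet> Z x \<partial>M)"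
      unfolding inner_diff_left
      by (rule Bochner_Integration.integral_diff[OF sqi_inner_integrable[OF X(1) X(3)] sqi_inner_integrable[OF X(2) X(3)], symmetric])
    then show ?thesis using sqi_Cauchy_Schwarz[OF sqi_diff[OF X(1)[of k] X(2)] X(3)] by (simp only:)
  qed
  moreover have "(\<lambda>k. sqrt (\<integral>x. (norm (X k x - Y x))\<^sup>2 \<partial>M) * sqrt (\<integral>x. (norm (Z x))\<^sup>2 \<partial>M)) \<longlonglongrightarrow> 0"
    by (rule tendsto_mult_left_zero) (rule tendsto_real_sqrt[OF c, unfolded real_sqrt_zero])
  ultimately have "(\<lambda>k. (\<integral>x. X k x \<bullet> Z x \<partial>M) - (\<integral>x. Y x \<bullet> Z x \<partial>M)) \<longlonglongrightarrow> 0"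
    by (metis (no_types, lifting) Lim_null_comparison always_eventually real_norm_def)
  then show ?thesis by (rule LIM_zero_cancel)
qed

text \<open>Summability of the integrals along the subsequence makes the sum of the \<open>e\<close>'s itself an integrable
  majorant, and forces their pointwise convergence.\<close>

lemma L1_null_dominated_subseq:
  fixes e :: "nat \<Rightarrow> 'a \<Rightarrow> real"
  assumes int: "\<And>k. integrable M (e k)" and nn: "\<And>k x. 0 \<le> e k x" and lim: "(\<lambda>k. \<integral>x. e k x \<partial>M) \<longlonglongrightarrow> 0"
  obtains r q where "strict_mono (r :: nat \<Rightarrow> nat)" "integrable M q" "\<And>x. 0 \<le> q x"
    "\<And>k. AE x in M. e (r k) x \<le> q x" "AE x in M. (\<lambda>k. e (r k) x) \<longlonglongrightarrow> 0"
proof -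
  have "\<exists>r. strict_mono r \<and> (\<forall>k. (\<integral>x. e (r k) x \<partial>M) \<le> (1/2)^k)"
  proof -
    have ex: "\<exists>j>i. (\<integral>x. e j x \<partial>M) \<le> (1/2)^k" for i k
    proof -
      have "eventually (\<lambda>j. (\<integral>x. e j x \<partial>M) < (1/2)^k) sequentially"
        using lim by (rule order_tendstoD) simp
      then have "eventually (\<lambda>j. j > i \<and> (\<integral>x. e j x \<partial>M) < (1/2)^k) sequentially"
        by (intro eventually_conj eventually_gt_at_top)
      then obtain j where "j > i \<and> (\<integral>x. e j x \<partial>M) < (1/2)^k"
        by (auto simp: eventually_sequentially)
      then show ?thesis by (intro exI[of _ j]) auto
    qed
    \<comment> \<open>Each value is chosen beyond the previous one, with integral at most the next
      power of 1/2; the first one only has to meet the bound 1.\<close>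
    define r where "r = rec_nat (SOME j. (\<integral>x. e j x \<partial>M) \<le> 1) (\<lambda>k i. SOME j. j > i \<and> (\<integral>x. e j x \<partial>M) \<le> (1/2)^Suc k)"
    have "r (Suc k) > r k \<and> (\<integral>x. e (r (Suc k)) x \<partial>M) \<le> (1/2)^Suc k" for k
      unfolding r_def by simp (rule someI_ex[where P="\<lambda>j. j > _ \<and> _ j"], use ex[of _ "Suc k"] in auto)
    moreover have "(\<integral>x. e (r 0) x \<partial>M) \<le> 1"
      unfolding r_def by simp (rule someI_ex, use ex[of 0 0] in auto)
    ultimately have "strict_mono r" "(\<integral>x. e (r k) x \<partial>M) \<le> (1/2)^k" for k
      by (auto simp: strict_mono_Suc_iff) (cases k; simp)
    then show ?thesis by blast
  qed
  then obtain r where r: "strict_mono r" "\<And>k. (\<integral>x. e (r k) x \<partial>M) \<le> (1/2)^k" by auto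
  have sm: "summable (\<lambda>k. \<integral>x. norm (e (r k) x) \<partial>M)"
    using nn by (intro summable_comparison_test[OF _ summable_geometric[of "1/2::real"]] exI[of _ 0])
       (auto simp: r(2))
  have "(\<integral>\<^sup>+x. (\<Sum>k. ennreal (e (r k) x)) \<partial>M) = (\<Sum>k. \<integral>\<^sup>+x. ennreal (e (r k) x) \<partial>M)"
    by (rule nn_integral_suminf) (use int in auto)
  also have "\<dots> = (\<Sum>k. ennreal (\<integral>x. e (r k) x \<partial>M))"
    by (intro suminf_cong nn_integral_eq_integral int) (auto simp: nn)
  also have "\<dots> < \<infinity>"
  proof -
    have "summable (\<lambda>k. \<integral>x. e (r k) x \<partial>M)" using sm nn by simp
    then show ?thesis using nn by (subst suminf_ennreal2) auto
  qed
  finally have "AE x in M. (\<Sum>k. ennreal (e (r k) x)) \<noteq> \<infinity>"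
    by (intro nn_integral_PInf_AE) (use int in auto)
  then have ae: "AE x in M. summable (\<lambda>k. e (r k) x)"
    by eventually_elim (intro summable_suminf_not_top, auto simp: nn)
  \<comment> \<open>The value 0 on the divergence set keeps \<open>q\<close> nonnegative everywhere;
    the almost-everywhere summability makes the choice harmless.\<close>
  define q where "q x = (if summable (\<lambda>k. e (r k) x) then \<Sum>k. e (r k) x else 0)" for x
  show thesis
  proof
    have "integrable M (\<lambda>x. \<Sum>k. e (r k) x)"
      by (rule integrable_suminf[OF int _ sm]) (use ae nn in auto)
    then show "integrable M q"
    proof (rule Bochner_Integration.integrable_bound)
      show "q \<in> borel_measurable M"
      proof -
      have [measurable]: "e k \<in> borel_measurable M" for k using int[of k] by simp
      have "Measurable.pred M (\<lambda>x. convergent (\<lambda>n. \<Sum>k<n. e (r k) x))"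
        unfolding Cauchy_convergent_iff[symmetric] by measurable
      then have [measurable]: "Measurable.pred M (\<lambda>x. summable (\<lambda>k. e (r k) x))"
        unfolding summable_iff_convergent .
      show ?thesis unfolding q_def by measurable
    qed
      show "AE x in M. norm (q x) \<le> norm (\<Sum>k. e (r k) x)"
        using ae by eventually_elim (simp add: q_def)
    qed
    show "0 \<le> q x" for x unfolding q_def by (auto intro: suminf_nonneg nn)
    show "AE x in M. e (r k) x \<le> q x" for k
      using ae by eventually_elim (auto simp: q_def intro: sum_le_suminf[of _ "{k}", simplified] nn)
    show "AE x in M. (\<lambda>k. e (r k) x) \<longlonglongrightarrow> 0"
      using ae by eventually_elim (rule summable_LIMSEQ_zero)
  qed (fact r)
qed

text \<open>Banach--Saks on the level of Gram matrices.\<close>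

lemma gram_average_small:
  fixes c :: "nat \<Rightarrow> nat \<Rightarrow> real"
  assumes sym: "\<And>i j. c i j = c j i" and diag: "\<And>i. c i i \<le> C" and lim: "\<And>j. (\<lambda>i. c i j) \<longlonglongrightarrow> 0"
    and I: "infinite I" and eta: "0 < \<eta>"
  obtains J where "finite J" "J \<noteq> {}" "J \<subseteq> I" "(\<Sum>i\<in>J. \<Sum>j\<in>J. c i j) / (real (card J))\<^sup>2 < \<eta>"
proof -
  \<comment> \<open>Half of \<eta> pays for the off-diagonal entries. The other half absorbs the
    diagonal, which contributes \<open>N * \<bar>C\<bar>\<close> against \<open>N\<^sup>2\<close>,
    once \<open>N\<close> exceeds \<open>\<bar>C\<bar> / \<delta>\<close>.\<close>
  define \<delta> where "\<delta> = \<eta> / 2"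
  have d: "0 < \<delta>" using eta by (simp add: \<delta>_def)
  \<comment> \<open>Greedy selection: by \<open>lim\<close>, every sufficiently late index has small
    entries against the finitely many indices already chosen, and symmetry settles the reversed
    order.\<close>
  have ex: "\<exists>J. finite J \<and> card J = N \<and> J \<subseteq> I \<and> (\<forall>i\<in>J. \<forall>j\<in>J. i \<noteq> j \<longrightarrow> c i j \<le> \<delta>)" for N
  proof (induction N)
    case 0 show ?case by (intro exI[of _ "{}"]) auto
  next
    case (Suc N)
    then obtain J where J: "finite J" "card J = N" "J \<subseteq> I" "\<forall>i\<in>J. \<forall>j\<in>J. i \<noteq> j \<longrightarrow> c i j \<le> \<delta>" by blast
    have "eventually (\<lambda>i. \<forall>j\<in>J. c i j < \<delta>) sequentially"
      using J(1) order_tendstoD(2)[OF lim d] by (intro eventually_ball_finite) auto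
    then obtain n where n: "\<And>i j. i \<ge> n \<Longrightarrow> j \<in> J \<Longrightarrow> c i j < \<delta>" by (auto simp: eventually_sequentially)
    have "infinite (I - ({..<n} \<union> J))" using I J(1) by simp
    then obtain i where i: "i \<in> I" "i \<ge> n" "i \<notin> J" by (metis DiffE Un_iff finite.emptyI equals0I lessThan_iff not_le)
    show ?case
    proof (intro exI[of _ "insert i J"] conjI ballI impI)
      fix a b assume ab: "a \<in> insert i J" "b \<in> insert i J" "a \<noteq> b"
      then consider "a \<in> J" "b \<in> J" | "a = i" "b \<in> J" | "b = i" "a \<in> J" by auto
      then show "c a b \<le> \<delta>"
      proof cases
        case 1 then show ?thesis using ab(3) J(4) by blast
      next
        case 2 then show ?thesis using n[OF i(2), of b] by simp
      next
        case 3 then show ?thesis using n[OF i(2), of a] sym[of a b] by simp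
      qed
    qed (use i J in auto)
  qed
  obtain N :: nat where N: "\<bar>C\<bar> / \<delta> < real N" using reals_Archimedean2 by blast
  have N0: "N > 0" using N d by (metis abs_ge_zero divide_nonneg_pos not_gr0 not_le of_nat_0)
  obtain J where J: "finite J" "card J = N" "J \<subseteq> I" "\<forall>i\<in>J. \<forall>j\<in>J. i \<noteq> j \<longrightarrow> c i j \<le> \<delta>" using ex by blast
  have "(\<Sum>i\<in>J. \<Sum>j\<in>J. c i j) \<le> (\<Sum>i\<in>J. \<Sum>j\<in>J. (if i = j then \<bar>C\<bar> else 0) + \<delta>)"
  proof (intro sum_mono)
    fix i j assume "i \<in> J" "j \<in> J"
    then show "c i j \<le> (if i = j then \<bar>C\<bar> else 0) + \<delta>"
      using J(4) d diag[of i] by (cases "i = j") auto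
  qed
  also have "\<dots> = real N * \<bar>C\<bar> + (real N)\<^sup>2 * \<delta>"
    using J(1,2) by (simp add: sum.distrib power2_eq_square algebra_simps)
  also have "\<dots> < (real N)\<^sup>2 * \<eta>"
    using N N0 d by (simp add: \<delta>_def power2_eq_square field_simps) 
  finally have "(\<Sum>i\<in>J. \<Sum>j\<in>J. c i j) / (real (card J))\<^sup>2 < \<eta>"
    using N0 J(2) by (simp add: field_simps)
  then show thesis using that[of J] J N0 by (metis card.empty less_irrefl)
qed

text \<open>The squared norm of an average of the \<open>v i - V\<close> is the mean of their Gram
  matrix, so the combinatorial lemma applies. Convergence is needed only against the members
  \<open>v m\<close> and against \<open>V\<close>, and the averages can be taken inside any infinite
  index set; both points matter below.\<close>

lemma sqi_weak_averages:
  fixes v :: "nat \<Rightarrow> 'a \<Rightarrow> 'b::euclidean_space"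
  assumes v: "\<And>n. sqi M (v n)" "sqi M V" and bd: "\<And>n. (\<integral>x. (norm (v n x))\<^sup>2 \<partial>M) \<le> C"
    and w1: "\<And>m. (\<lambda>n. \<integral>x. v n x \<bullet> v m x \<partial>M) \<longlonglongrightarrow> (\<integral>x. V x \<bullet> v m x \<partial>M)"
    and w2: "(\<lambda>n. \<integral>x. v n x \<bullet> V x \<partial>M) \<longlonglongrightarrow> (\<integral>x. V x \<bullet> V x \<partial>M)"
    and I: "infinite I" and eta: "0 < \<eta>"
  obtains J where "finite J" "J \<noteq> {}" "J \<subseteq> I"
    "(\<integral>x. (norm ((1 / real (card J)) *\<^sub>R (\<Sum>i\<in>J. v i x) - V x))\<^sup>2 \<partial>M) < \<eta>"
proof -
  note si = sqi_inner_integrable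
  define c where "c i j = (\<integral>x. (v i x - V x) \<bullet> (v j x - V x) \<partial>M)" for i j
  have c_eq: "c i j = (\<integral>x. v i x \<bullet> v j x \<partial>M) - (\<integral>x. v i x \<bullet> V x \<partial>M) - (\<integral>x. V x \<bullet> v j x \<partial>M) + (\<integral>x. V x \<bullet> V x \<partial>M)" for i j
  proof -
    have "c i j = (\<integral>x. (v i x \<bullet> v j x - v i x \<bullet> V x) - (V x \<bullet> v j x - V x \<bullet> V x) \<partial>M)"
      unfolding c_def by (simp only: inner_diff_left inner_diff_right algebra_simps)
    then show ?thesis by (simp add: si v)
  qed
  have lim: "(\<lambda>i. c i j) \<longlonglongrightarrow> 0" for j
    unfolding c_eq by (rule tendsto_eq_intros w1 w2 refl)+ simp
  have diag: "c i i \<le> 2 * C + 2 * (\<integral>x. (norm (V x))\<^sup>2 \<partial>M)" for i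
  proof -
    have "c i i = (\<integral>x. (norm (v i x - V x))\<^sup>2 \<partial>M)" unfolding c_def by (simp add: power2_norm_eq_inner)
    also have "\<dots> \<le> (\<integral>x. 2 * (norm (v i x))\<^sup>2 + 2 * (norm (V x))\<^sup>2 \<partial>M)"
    proof (rule integral_mono)
      show "(norm (v i x - V x))\<^sup>2 \<le> 2 * (norm (v i x))\<^sup>2 + 2 * (norm (V x))\<^sup>2" for x
        using zero_le_power2[of "norm (v i x + V x)"]
        unfolding power2_norm_eq_inner by (simp add: algebra_simps inner_commute)
    qed (intro Bochner_Integration.integrable_add integrable_mult_right sqiD(2) sqi_diff v)+
    also have "\<dots> \<le> 2 * C + 2 * (\<integral>x. (norm (V x))\<^sup>2 \<partial>M)"
      using bd[of i] v by (simp add: sqiD)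
    finally show ?thesis .
  qed
  obtain J where J: "finite J" "J \<noteq> {}" "J \<subseteq> I" "(\<Sum>i\<in>J. \<Sum>j\<in>J. c i j) / (real (card J))\<^sup>2 < \<eta>"
    by (rule gram_average_small[of c _ I \<eta>, OF _ diag lim I eta]) (auto simp: c_def inner_commute)
  have card: "real (card J) \<noteq> 0" using J by simp
  have "(1 / real (card J)) *\<^sub>R (\<Sum>i\<in>J. v i x) - V x = (1 / real (card J)) *\<^sub>R (\<Sum>i\<in>J. v i x - V x)" for x
    using card by (simp add: sum_subtractf scaleR_diff_right sum_constant_scaleR)
  then have "(norm ((1 / real (card J)) *\<^sub>R (\<Sum>i\<in>J. v i x) - V x))\<^sup>2
      = (\<Sum>i\<in>J. \<Sum>j\<in>J. (v i x - V x) \<bullet> (v j x - V x)) / (real (card J))\<^sup>2" for x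
    by (simp only: power2_norm_eq_inner inner_scaleR_left inner_scaleR_right inner_sum_left inner_sum_right)
       (simp add: power2_eq_square sum_divide_distrib inner_commute)
  then have "(\<integral>x. (norm ((1 / real (card J)) *\<^sub>R (\<Sum>i\<in>J. v i x) - V x))\<^sup>2 \<partial>M)
    = (\<integral>x. (\<Sum>i\<in>J. \<Sum>j\<in>J. (v i x - V x) \<bullet> (v j x - V x)) / (real (card J))\<^sup>2 \<partial>M)"
    by (simp only:)
  also have "\<dots> = (\<integral>x. (\<Sum>i\<in>J. \<Sum>j\<in>J. (v i x - V x) \<bullet> (v j x - V x)) \<partial>M) / (real (card J))\<^sup>2"
    by (rule integral_divide_zero)
  also have "(\<integral>x. (\<Sum>i\<in>J. \<Sum>j\<in>J. (v i x - V x) \<bullet> (v j x - V x)) \<partial>M) = (\<Sum>i\<in>J. \<Sum>j\<in>J. c i j)"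
    unfolding c_def
    by (subst Bochner_Integration.integral_sum, intro Bochner_Integration.integrable_sum si sqi_diff v,
        intro sum.cong refl Bochner_Integration.integral_sum si sqi_diff v)
  finally show thesis using J by (intro that[of J]) simp_all
qed

text \<open>If the pairings with \<open>b\<close> exceeded the limit by \<open>e\<close> infinitely
  often, averages over those indices would be strongly close to \<open>V\<close> and still keep the
  excess \<open>e\<close>, which Cauchy-Schwarz forbids. Applying this to \<open>b\<close> and
  \<open>-b\<close> bounds both sides. The result upgrades convergence against a restricted class of
  test pairs to full weak convergence.\<close>

lemma sqi_weak_convergence_from_gram:
  fixes v :: "nat \<Rightarrow> 'a \<Rightarrow> 'b::euclidean_space"
  assumes v: "\<And>n. sqi M (v n)" "sqi M V" and bd: "\<And>n. (\<integral>x. (norm (v n x))\<^sup>2 \<partial>M) \<le> C"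
    and w1: "\<And>m. (\<lambda>n. \<integral>x. v n x \<bullet> v m x \<partial>M) \<longlonglongrightarrow> (\<integral>x. V x \<bullet> v m x \<partial>M)"
    and w2: "(\<lambda>n. \<integral>x. v n x \<bullet> V x \<partial>M) \<longlonglongrightarrow> (\<integral>x. V x \<bullet> V x \<partial>M)"
    and b: "sqi M b"
  shows "(\<lambda>n. \<integral>x. v n x \<bullet> b x \<partial>M) \<longlonglongrightarrow> (\<integral>x. V x \<bullet> b x \<partial>M)"
proof -
  note si = sqi_inner_integrable
  have one_sided: "eventually (\<lambda>n. (\<integral>x. v n x \<bullet> b x \<partial>M) - (\<integral>x. V x \<bullet> b x \<partial>M) < e) sequentially"
    if e: "0 < e" and b: "sqi M b" for e b
  proof (rule ccontr)
    assume "\<not> ?thesis"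
    then have "infinite {n. \<not> ((\<integral>x. v n x \<bullet> b x \<partial>M) - (\<integral>x. V x \<bullet> b x \<partial>M) < e)}"
      unfolding cofinite_eq_sequentially[symmetric] eventually_cofinite by simp
    \<comment> \<open>Adding 1 makes \<open>B\<close> positive and strictly larger than the norm of
      \<open>b\<close>; the strict inequality produces the contradiction.\<close>
    moreover define B where "B = sqrt (\<integral>x. (norm (b x))\<^sup>2 \<partial>M) + 1"
    have B: "0 < B" unfolding B_def by (simp add: add_nonneg_pos)
    then have "0 < (e / B)\<^sup>2" using e by simp
    ultimately obtain J where J: "finite J" "J \<noteq> {}" "J \<subseteq> {n. \<not> ((\<integral>x. v n x \<bullet> b x \<partial>M) - (\<integral>x. V x \<bullet> b x \<partial>M) < e)}"
      "(\<integral>x. (norm ((1 / real (card J)) *\<^sub>R (\<Sum>i\<in>J. v i x) - V x))\<^sup>2 \<partial>M) < (e / B)\<^sup>2"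
      by (rule sqi_weak_averages[OF v bd w1 w2])
    define Y where "Y x = (1 / real (card J)) *\<^sub>R (\<Sum>i\<in>J. v i x)" for x
    have Y: "sqi M Y" unfolding Y_def by (intro sqi_scaleR sqi_sum v)
    have card: "real (card J) > 0" using J by (simp add: card_gt_0_iff)
    have eq: "(\<integral>x. (Y x - V x) \<bullet> b x \<partial>M) = (\<integral>x. Y x \<bullet> b x \<partial>M) - (\<integral>x. V x \<bullet> b x \<partial>M)"
      by (simp add: inner_diff_left si Y v b)
    have "(1 / real (card J)) * (\<Sum>i\<in>J. (\<integral>x. V x \<bullet> b x \<partial>M) + e) \<le> (1 / real (card J)) * (\<Sum>i\<in>J. \<integral>x. v i x \<bullet> b x \<partial>M)"
      by (intro mult_left_mono sum_mono) (use J(3) card in auto)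
    also have "\<dots> = (\<integral>x. Y x \<bullet> b x \<partial>M)"
      unfolding Y_def by (simp add: inner_sum_left si v b Bochner_Integration.integral_sum)
    also have "(1 / real (card J)) * (\<Sum>i\<in>J. (\<integral>x. V x \<bullet> b x \<partial>M) + e) = (\<integral>x. V x \<bullet> b x \<partial>M) + e"
      using card by simp
    finally have "e \<le> (\<integral>x. (Y x - V x) \<bullet> b x \<partial>M)" unfolding eq by linarith
    also have "\<dots> \<le> sqrt (\<integral>x. (norm (Y x - V x))\<^sup>2 \<partial>M) * sqrt (\<integral>x. (norm (b x))\<^sup>2 \<partial>M)"
      using sqi_Cauchy_Schwarz[OF sqi_diff[OF Y v(2)] b] by linarith
    also have "\<dots> \<le> (e / B) * sqrt (\<integral>x. (norm (b x))\<^sup>2 \<partial>M)"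
      using J(4) e B unfolding Y_def[symmetric]
      by (intro mult_right_mono real_le_lsqrt) auto
    also have "\<dots> < (e / B) * B" using e B unfolding B_def by (intro mult_strict_left_mono) auto
    finally show False using B by simp
  qed
  have "eventually (\<lambda>n. \<bar>(\<integral>x. v n x \<bullet> b x \<partial>M) - (\<integral>x. V x \<bullet> b x \<partial>M)\<bar> < e) sequentially" if "0 < e" for e
    using one_sided[OF that b] one_sided[OF that sqi_scaleR[OF b, of "-1"]]
    by eventually_elim (auto simp: abs_less_iff)
  then show ?thesis by (simp add: tendsto_iff dist_real_def)
qed

section \<open>Calculus of continuously differentiable functions\<close>

lemma pd_eqI: "(f has_derivative D) (at x) \<Longrightarrow> pd f v x = D v"
  unfolding pd_def using frechet_derivative_at by metis

lemma C1fun_has_derivative: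
  assumes "C1fun f" shows "(f has_derivative (\<lambda>v. pd f v x)) (at x)"
proof -
  obtain D where "(f has_derivative blinfun_apply (D x)) (at x)"
    using assms unfolding C1fun_def C1_on_def by blast
  moreover from this have "blinfun_apply (D x) = (\<lambda>v. pd f v x)" using pd_eqI by metis
  ultimately show ?thesis by metis
qed

lemma C1fun_continuous_pd_joint:
  assumes "C1fun f" "continuous_on S a" "continuous_on S b" shows "continuous_on S (\<lambda>x. pd f (a x) (b x))"
proof -
  obtain D where D: "continuous_on UNIV D" "\<And>x. (f has_derivative blinfun_apply (D x)) (at x)"
    using assms(1) unfolding C1fun_def C1_on_def by blast
  have "pd f v x = blinfun_apply (D x) v" for v x using pd_eqI[OF D(2)] .
  moreover have "continuous_on S (\<lambda>x. blinfun_apply (D (b x)) (a x))"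
    by (intro bounded_bilinear.continuous_on[OF bounded_bilinear_blinfun_apply] assms(2)
        continuous_on_compose2[OF D(1) assms(3)]) auto
  ultimately show ?thesis by simp
qed

lemma C1fun_continuous_pd: "C1fun f \<Longrightarrow> continuous_on S (pd f v)"
  using C1fun_continuous_pd_joint[of f S "\<lambda>_. v" "\<lambda>x. x"] by (simp add: continuous_on_const)

lemma C1fun_continuous: "C1fun f \<Longrightarrow> continuous_on S f"
  by (meson C1fun_has_derivative continuous_at_imp_continuous_on has_derivative_continuous)

text \<open>In finite dimension, continuity of the derivative as a bounded linear map can be tested
  direction by direction.\<close>

lemma C1funI:
  fixes f :: "'a::euclidean_space \<Rightarrow> 'b::real_normed_vector"
  assumes D: "\<And>x. (f has_derivative D x) (at x)" and c: "\<And>v. continuous_on UNIV (\<lambda>x. D x v)"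
  shows "C1fun f"
  unfolding C1fun_def C1_on_def
proof (intro exI conjI ballI)
  have E: "blinfun_apply (Blinfun (D x)) = D x" for x
    by (rule bounded_linear_Blinfun_apply[OF has_derivative_bounded_linear[OF D]])
  show "continuous_on UNIV (\<lambda>x. Blinfun (D x))"
    by (rule continuous_on_blinfun_componentwise) (simp add: E c)
  show "(f has_derivative blinfun_apply (Blinfun (D x))) (at x)" for x unfolding E by (rule D)
qed

lemma pd_linear: assumes "C1fun f" shows "linear (\<lambda>v. pd f v x)"
  using has_derivative_linear[OF C1fun_has_derivative[OF assms]] .

lemma C1fun_bounded_linear:
  fixes L :: "'a::euclidean_space \<Rightarrow> 'b::real_normed_vector"
  assumes "bounded_linear L" shows "C1fun L" "pd L v x = L v"
proof -
  have "(L has_derivative L) (at x)" for x by (rule bounded_linear_imp_has_derivative[OF assms])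
  then show "C1fun L" "pd L v x = L v" by (auto intro: C1funI[where D="\<lambda>x. L"] pd_eqI)
qed

lemma C1fun_const:
  fixes c :: "'b::real_normed_vector"
  shows "C1fun (\<lambda>x::'a::euclidean_space. c)" "pd (\<lambda>x::'a. c) v x = 0"
proof -
  have "((\<lambda>x::'a. c) has_derivative (\<lambda>v. 0)) (at x)" for x by (rule has_derivative_const)
  then show "C1fun (\<lambda>x::'a. c)" "pd (\<lambda>x::'a. c) v x = 0"
    by (auto intro: C1funI[where D="\<lambda>x v. 0"] pd_eqI)
qed

lemma C1fun_compose:
  fixes f :: "'a::euclidean_space \<Rightarrow> 'b::euclidean_space" and g :: "'b \<Rightarrow> 'c::real_normed_vector"
  assumes "C1fun f" "C1fun g"
  shows "C1fun (\<lambda>x. g (f x))" "pd (\<lambda>x. g (f x)) v x = pd g (pd f v x) (f x)"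
proof -
  have D: "((\<lambda>x. g (f x)) has_derivative (\<lambda>v. pd g (pd f v x) (f x))) (at x)" for x
    by (rule has_derivative_compose[OF C1fun_has_derivative[OF assms(1)] C1fun_has_derivative[OF assms(2)]])
  show "C1fun (\<lambda>x. g (f x))"
    by (rule C1funI[OF D]) (intro C1fun_continuous_pd_joint assms C1fun_continuous_pd C1fun_continuous)
  show "pd (\<lambda>x. g (f x)) v x = pd g (pd f v x) (f x)" by (rule pd_eqI[OF D])
qed

lemma C1fun_bilinear:
  fixes f :: "'a::euclidean_space \<Rightarrow> 'b::real_normed_vector" and g :: "'a \<Rightarrow> 'c::real_normed_vector"
  assumes p: "bounded_bilinear p" and "C1fun f" "C1fun g"
  shows "C1fun (\<lambda>x. p (f x) (g x))" "pd (\<lambda>x. p (f x) (g x)) v x = p (f x) (pd g v x) + p (pd f v x) (g x)"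
proof -
  have D: "((\<lambda>x. p (f x) (g x)) has_derivative (\<lambda>v. p (f x) (pd g v x) + p (pd f v x) (g x))) (at x)" for x
    by (rule bounded_bilinear.FDERIV[OF p C1fun_has_derivative[OF assms(2)] C1fun_has_derivative[OF assms(3)]])
  show "C1fun (\<lambda>x. p (f x) (g x))"
    by (rule C1funI[OF D]) (intro continuous_on_add bounded_bilinear.continuous_on[OF p] C1fun_continuous
        C1fun_continuous_pd assms)
  show "pd (\<lambda>x. p (f x) (g x)) v x = p (f x) (pd g v x) + p (pd f v x) (g x)" by (rule pd_eqI[OF D])
qed

lemmas C1fun_scaleR = C1fun_bilinear[OF bounded_bilinear_scaleR]
lemmas C1fun_inner = C1fun_bilinear[OF bounded_bilinear_inner]
lemmas C1fun_mult = C1fun_bilinear[OF bounded_bilinear_mult]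

lemma C1fun_add:
  fixes f g :: "'a::euclidean_space \<Rightarrow> 'b::real_normed_vector"
  assumes "C1fun f" "C1fun g"
  shows "C1fun (\<lambda>x. f x + g x)" "pd (\<lambda>x. f x + g x) v x = pd f v x + pd g v x"
proof -
  have D: "((\<lambda>x. f x + g x) has_derivative (\<lambda>v. pd f v x + pd g v x)) (at x)" for x
    by (rule has_derivative_add[OF assms[THEN C1fun_has_derivative]])
  show "C1fun (\<lambda>x. f x + g x)"
    by (rule C1funI[OF D]) (intro continuous_on_add C1fun_continuous_pd assms)
  show "pd (\<lambda>x. f x + g x) v x = pd f v x + pd g v x" by (rule pd_eqI[OF D])
qed

lemma C1fun_linear_compose:
  fixes f :: "'a::euclidean_space \<Rightarrow> 'b::euclidean_space" and L :: "'b \<Rightarrow> 'c::real_normed_vector"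
  assumes "C1fun f" "bounded_linear L"
  shows "C1fun (\<lambda>x. L (f x))" "pd (\<lambda>x. L (f x)) v x = L (pd f v x)"
  using C1fun_compose[OF assms(1) C1fun_bounded_linear(1)[OF assms(2)]] C1fun_bounded_linear(2)[OF assms(2)]
  by auto

lemma C1fun_real_compose:
  fixes f :: "'a::euclidean_space \<Rightarrow> real" and g g' :: "real \<Rightarrow> real"
  assumes "C1fun f" and g: "\<And>x. (g has_real_derivative g' (f x)) (at (f x))"
    "continuous_on UNIV (\<lambda>x. g' (f x))"
  shows "C1fun (\<lambda>x. g (f x))" "pd (\<lambda>x. g (f x)) v x = g' (f x) * pd f v x"
proof -
  have D: "((\<lambda>x. g (f x)) has_derivative (\<lambda>v. g' (f x) * pd f v x)) (at x)" for x
    using has_derivative_compose[OF C1fun_has_derivative[OF assms(1)] g(1)[unfolded has_field_derivative_def]] .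
  show "C1fun (\<lambda>x. g (f x))"
    by (rule C1funI[OF D]) (intro continuous_on_mult C1fun_continuous_pd assms)
  show "pd (\<lambda>x. g (f x)) v x = g' (f x) * pd f v x" by (rule pd_eqI[OF D])
qed

section \<open>Supports, and integrals of derivatives over open sets\<close>

lemma not_in_supp:
  assumes "x \<notin> supp f" shows "f x = 0" "\<forall>\<^sub>F y in nhds x. f y = 0"
proof -
  have "open (- supp f)" unfolding supp_def by (rule open_Compl[OF closed_closure])
  then have ev: "\<forall>\<^sub>F y in nhds x. y \<in> - supp f" using assms by (intro eventually_nhds_in_open) simp_all
  have z: "f y = 0" if "y \<in> - supp f" for y
  proof (rule ccontr)
    assume "f y \<noteq> 0"
    then have "y \<in> closure {x. f x \<noteq> 0}" by (intro subsetD[OF closure_subset]) simp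
    then show False using that by (simp add: supp_def)
  qed
  show "\<forall>\<^sub>F y in nhds x. f y = 0" by (rule eventually_mono[OF ev z])
  show "f x = 0" using assms by (intro z) simp
qed

lemma pd_not_in_supp:
  fixes f :: "'a::real_normed_vector \<Rightarrow> 'b::real_normed_vector"
  assumes "x \<notin> supp f" shows "pd f v x = 0"
proof (rule pd_eqI)
  show "(f has_derivative (\<lambda>v. 0)) (at x)"
  proof (rule has_derivative_transform_eventually)
    show "((\<lambda>x. 0) has_derivative (\<lambda>v. 0)) (at x)" by (rule has_derivative_const)
    show "\<forall>\<^sub>F y in at x. 0 = f y"
      unfolding eventually_at_filter by (rule eventually_mono[OF not_in_supp(2)[OF assms]]) simp
  qed (use not_in_supp(1)[OF assms] in auto)
qed

lemma closed_supp: "closed (supp f)" unfolding supp_def by (rule closed_closure)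

lemma supp_subsetI: assumes "closed K" "\<And>x. f x \<noteq> 0 \<Longrightarrow> x \<in> K" shows "supp f \<subseteq> K"
  unfolding supp_def by (rule closure_minimal) (use assms in auto)

lemma compact_suppI: assumes "compact K" "supp f \<subseteq> K" shows "compact (supp f)"
proof -
  have "compact (K \<inter> supp f)" by (rule compact_Int_closed[OF assms(1) closed_supp])
  then show ?thesis using assms(2) by (simp add: Int_absorb1)
qed

lemma continuous_compact_supp_bounded:
  fixes g :: "'a::real_normed_vector \<Rightarrow> 'c::real_normed_vector"
  assumes "continuous_on UNIV g" "compact K" "\<And>x. x \<notin> K \<Longrightarrow> g x = 0"
  shows "\<exists>C\<ge>0. \<forall>x. norm (g x) \<le> C"
proof -
  have "bounded (g ` K)"
    by (intro compact_imp_bounded compact_continuous_image continuous_on_subset[OF assms(1)] assms(2)) auto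
  then obtain C where C: "0 < C" "\<forall>y\<in>g ` K. norm y \<le> C" unfolding bounded_pos by blast
  have "norm (g x) \<le> C" for x using C assms(3)[of x] by (cases "x \<in> K") auto
  then show ?thesis using C by (intro exI[of _ C]) simp
qed

lemma C1fun_bounded: "C1fun f \<Longrightarrow> compact (supp f) \<Longrightarrow> \<exists>C\<ge>0. \<forall>x. norm (f x) \<le> C"
  by (rule continuous_compact_supp_bounded[OF C1fun_continuous _ not_in_supp(1)])

lemma pd_bounded: "C1fun f \<Longrightarrow> compact (supp f) \<Longrightarrow> \<exists>C\<ge>0. \<forall>x. norm (pd f v x) \<le> C"
  by (rule continuous_compact_supp_bounded[OF C1fun_continuous_pd _ pd_not_in_supp])

text \<open>The difference quotients of the zero extension of \<open>F\<close> along \<open>v\<close> integrate to zero by translation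
  invariance, and they converge boundedly.\<close>

lemma integral_pd_eq_0:
  fixes F :: "'a::euclidean_space \<Rightarrow> 'b::euclidean_space"
  assumes F: "C1fun F" "compact (supp F)" and S: "open S"
    and out: "\<And>x. x \<notin> S \<Longrightarrow> \<forall>\<^sub>F t in at (0::real). indicator S (x + t *\<^sub>R v) *\<^sub>R F (x + t *\<^sub>R v) = 0"
  shows "(\<integral>x. indicator S x *\<^sub>R pd F v x \<partial>lborel) = 0"
proof -
  define f f' where "f x = indicator S x *\<^sub>R F x" and "f' x = indicator S x *\<^sub>R pd F v x" for x :: 'a
  \<comment> \<open>Inside \<open>S\<close> the zero extension agrees with \<open>F\<close> near the
    point. Outside \<open>S\<close> the assumption \<open>out\<close> says that it vanishes along
    the line near parameter 0. So it is differentiable along \<open>v\<close> at every point,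
    although it need not be differentiable in other directions.\<close>
  have der0: "((\<lambda>t. f (x + t *\<^sub>R v)) has_vector_derivative f' x) (at 0)" for x
  proof (cases "x \<in> S")
    case True
    have aff: "((\<lambda>t. x + t *\<^sub>R v) has_derivative (\<lambda>t. t *\<^sub>R v)) (at (0::real))"
      by (auto intro!: derivative_eq_intros)
    have "((\<lambda>t. F (x + t *\<^sub>R v)) has_derivative (\<lambda>t. pd F (t *\<^sub>R v) (x + 0 *\<^sub>R v))) (at (0::real))"
      by (rule has_derivative_compose[OF aff C1fun_has_derivative[OF F(1)]])
    then have d: "((\<lambda>t. F (x + t *\<^sub>R v)) has_vector_derivative pd F v x) (at 0)"
      unfolding has_vector_derivative_def by (simp add: linear_cmul[OF pd_linear[OF F(1)]])
    have "((\<lambda>t. x + t *\<^sub>R v) \<longlongrightarrow> x) (nhds (0::real))"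
      by (auto intro!: tendsto_eq_intros filterlim_ident)
    then have "\<forall>\<^sub>F t in nhds (0::real). x + t *\<^sub>R v \<in> S"
      by (rule topological_tendstoD[OF _ S True])
    then have "\<forall>\<^sub>F t in nhds (0::real). F (x + t *\<^sub>R v) = f (x + t *\<^sub>R v)"
      by eventually_elim (simp add: f_def)
    then have ev: "\<forall>\<^sub>F t in at (0::real). F (x + t *\<^sub>R v) = f (x + t *\<^sub>R v)"
      unfolding eventually_at_filter by (rule eventually_mono) simp
    have "((\<lambda>t. f (x + t *\<^sub>R v)) has_vector_derivative pd F v x) (at 0)"
      using d unfolding has_vector_derivative_def
      by (rule has_derivative_transform_eventually[OF _ ev]) (use True in \<open>auto simp: f_def\<close>)
    then show ?thesis using True by (simp add: f'_def)
  next
    case False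
    have ev: "\<forall>\<^sub>F t in at (0::real). 0 = f (x + t *\<^sub>R v)"
      using out[OF False] by eventually_elim (simp add: f_def)
    have "((\<lambda>t. f (x + t *\<^sub>R v)) has_derivative (\<lambda>t. 0)) (at 0)"
      by (rule has_derivative_transform_eventually[OF has_derivative_const ev]) (use False in \<open>auto simp: f_def\<close>)
    then show ?thesis using False by (simp add: f'_def has_vector_derivative_def)
  qed
  have der: "((\<lambda>t. f (x + t *\<^sub>R v)) has_vector_derivative f' (x + t *\<^sub>R v)) (at t within T)" for x t T
  proof -
    have "((\<lambda>r. r - t) has_vector_derivative 1) (at t)"
      by (auto intro!: derivative_eq_intros simp: has_vector_derivative_def)
    from vector_diff_chain_at[OF this, of "\<lambda>r. f ((x + t *\<^sub>R v) + r *\<^sub>R v)" "f' (x + t *\<^sub>R v)"]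
    have "((\<lambda>r. f ((x + t *\<^sub>R v) + (r - t) *\<^sub>R v)) has_vector_derivative f' (x + t *\<^sub>R v)) (at t)"
      using der0[of "x + t *\<^sub>R v"] by (simp add: o_def)
    then show ?thesis by (simp add: algebra_simps has_vector_derivative_at_within)
  qed
  obtain C where C: "0 \<le> C" "\<And>x. norm (pd F v x) \<le> C" using pd_bounded[OF F, of v] by auto
  obtain R where R: "\<And>x. x \<in> supp F \<Longrightarrow> norm x \<le> R"
    using compact_imp_bounded[OF F(2)] unfolding bounded_iff by blast
  have f'C: "norm (f' x) \<le> C" for x unfolding f'_def using C by (auto simp: indicator_def)
  define q where "q n x = real (Suc n) *\<^sub>R (f (x + (1 / real (Suc n)) *\<^sub>R v) - f x)" for n x
  have qlim: "(\<lambda>n. q n x) \<longlonglongrightarrow> f' x" for x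
  proof -
    have "((\<lambda>t. norm ((f (x + t *\<^sub>R v) - f (x + 0 *\<^sub>R v)) - (t - 0) *\<^sub>R f' x) / norm (t - 0)) \<longlongrightarrow> 0) (at 0)"
      using der0[of x] unfolding has_vector_derivative_def has_derivative_iff_norm by blast
    moreover have "filterlim (\<lambda>n. 1 / real (Suc n)) (at 0) sequentially"
      by (rule filterlim_atI) (auto intro: LIMSEQ_Suc[OF lim_1_over_n, simplified])
    ultimately have l: "(\<lambda>n. norm ((f (x + (1 / real (Suc n)) *\<^sub>R v) - f (x + 0 *\<^sub>R v)) - (1 / real (Suc n) - 0) *\<^sub>R f' x)
        / norm (1 / real (Suc n) - 0)) \<longlonglongrightarrow> 0"
      by (rule filterlim_compose)
    have "norm ((f (x + (1 / real (Suc n)) *\<^sub>R v) - f (x + 0 *\<^sub>R v)) - (1 / real (Suc n) - 0) *\<^sub>R f' x)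
        / norm (1 / real (Suc n) - 0) = norm (q n x - f' x)" for n
    proof -
      have "q n x - f' x = real (Suc n) *\<^sub>R ((f (x + (1 / real (Suc n)) *\<^sub>R v) - f x) - (1 / real (Suc n)) *\<^sub>R f' x)"
        unfolding q_def scaleR_diff_right scaleR_scaleR by simp
      then have "norm (q n x - f' x) = real (Suc n) * norm ((f (x + (1 / real (Suc n)) *\<^sub>R v) - f x) - (1 / real (Suc n)) *\<^sub>R f' x)"
        by (simp only: norm_scaleR abs_of_nat)
      then show ?thesis by (simp add: mult.commute)
    qed
    then have "(\<lambda>n. norm (q n x - f' x)) \<longlonglongrightarrow> 0" using l by (simp only:)
    then show ?thesis by (simp only: tendsto_norm_zero_iff LIM_zero_iff)
  qed
  \<comment> \<open>The mean value inequality bounds the quotient by \<open>C\<close>. The step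
    length is at most 1, so translation moves points by at most \<open>norm v\<close>, and a ball of
    radius \<open>R + norm v\<close> contains everything that matters.\<close>
  have qb: "norm (q n x) \<le> C * indicator (cball 0 (R + norm v)) x" for n x
  proof (cases "x \<in> cball 0 (R + norm v)")
    case True
    have "norm (f (x + (1 / real (Suc n)) *\<^sub>R v) - f (x + 0 *\<^sub>R v)) \<le> C * norm (1 / real (Suc n) - 0)"
    proof (rule differentiable_bound[where S="{0..1 / real (Suc n)}" and f'="\<lambda>t s. s *\<^sub>R f' (x + t *\<^sub>R v)"])
      show "((\<lambda>t. f (x + t *\<^sub>R v)) has_derivative (\<lambda>s. s *\<^sub>R f' (x + t *\<^sub>R v))) (at t within {0..1 / real (Suc n)})" for t
        using der unfolding has_vector_derivative_def .
      show "onorm (\<lambda>s. s *\<^sub>R f' (x + t *\<^sub>R v)) \<le> C" for t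
        by (rule onorm_bound[OF C(1)]) (unfold norm_scaleR mult.commute[of C] real_norm_def, rule mult_left_mono[OF f'C abs_ge_zero])
    qed auto
    then have "norm (q n x) \<le> real (Suc n) * (C * (1 / real (Suc n)))"
      unfolding q_def norm_scaleR by (intro mult_mono) auto
    then show ?thesis using True by simp
  next
    case False
    then have n: "norm x > R + norm v" by simp
    have "x \<notin> supp F" using R[of x] n by (meson norm_ge_zero add_increasing2 linorder_not_less order_trans)
    moreover have "x + (1 / real (Suc n)) *\<^sub>R v \<notin> supp F"
    proof
      assume "x + (1 / real (Suc n)) *\<^sub>R v \<in> supp F"
      then have "norm (x + (1 / real (Suc n)) *\<^sub>R v) \<le> R" by (rule R)
      moreover have "norm x \<le> norm (x + (1 / real (Suc n)) *\<^sub>R v) + norm ((1 / real (Suc n)) *\<^sub>R v)"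
        using norm_triangle_ineq4[of "x + (1 / real (Suc n)) *\<^sub>R v" "(1 / real (Suc n)) *\<^sub>R v"] by simp
      moreover have "norm ((1 / real (Suc n)) *\<^sub>R v) \<le> 1 * norm v"
        unfolding norm_scaleR by (rule mult_right_mono) auto
      ultimately show False using n by linarith
    qed
    ultimately have "q n x = 0" unfolding q_def f_def by (simp add: not_in_supp)
    then show ?thesis using False by simp
  qed
  have [measurable]: "S \<in> sets borel" "F \<in> borel_measurable borel" "pd F v \<in> borel_measurable borel"
    using borel_measurable_continuous_onI[OF C1fun_continuous[OF F(1)]] S
      borel_measurable_continuous_onI[OF C1fun_continuous_pd[OF F(1)], of v] by auto
  have fm[measurable]: "f \<in> borel_measurable borel" unfolding f_def by measurable
  have f'm[measurable]: "f' \<in> borel_measurable borel" unfolding f'_def by measurable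
  have qm: "q n \<in> borel_measurable lborel" for n unfolding q_def by measurable
  obtain C0 where C0: "0 \<le> C0" "\<And>x. norm (F x) \<le> C0" using C1fun_bounded[OF F] by auto
  have fint: "integrable lborel f"
  proof (rule Bochner_Integration.integrable_bound)
    show "integrable lborel (\<lambda>x::'a. C0 * indicator (cball 0 R) x)"
      using emeasure_bounded_finite[OF bounded_cball, of "0::'a" R]
      by (intro integrable_mult_right integrable_real_indicator) simp_all
    show "AE x in lborel. norm (f x) \<le> norm (C0 * indicator (cball 0 R) x)"
    proof (rule AE_I2)
      fix x show "norm (f x) \<le> norm (C0 * indicator (cball 0 R) x)"
        using C0 R[of x] not_in_supp(1)[of x F] by (cases "x \<in> supp F") (auto simp: f_def indicator_def)
    qed
  qed simp
  have q0: "integral\<^sup>L lborel (q n) = 0" for n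
  proof -
    define a where "a = (1 / real (Suc n)) *\<^sub>R v"
    have L: "integrable lborel (\<lambda>x. f (a + x))" "(\<integral>x. f (a + x) \<partial>lborel) = (\<integral>x. f x \<partial>lborel)"
      using fint integrable_distr_eq[of "(+) a" lborel borel f] integral_distr[of "(+) a" lborel borel f]
      by (simp_all add: lborel_distr_plus)
    show ?thesis unfolding q_def a_def[symmetric] using L fint by (simp add: add.commute)
  qed
  have "(\<lambda>n. integral\<^sup>L lborel (q n)) \<longlonglongrightarrow> integral\<^sup>L lborel f'"
  proof (rule integral_dominated_convergence)
    show "integrable lborel (\<lambda>x::'a. C * indicator (cball 0 (R + norm v)) x)"
      using emeasure_bounded_finite[OF bounded_cball, of "0::'a" "R + norm v"]
      by (intro integrable_mult_right integrable_real_indicator) simp_all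
  qed (use qlim qb qm in auto)
  then have "integral\<^sup>L lborel f' = 0" unfolding q0 using LIMSEQ_unique tendsto_const by blast
  then show ?thesis unfolding f'_def .
qed

lemma integral_pd_eq_0_supp:
  fixes F :: "'a::euclidean_space \<Rightarrow> 'b::euclidean_space"
  assumes F: "C1fun F" "compact (supp F)" and S: "open S" "supp F \<subseteq> S"
  shows "(\<integral>x. indicator S x *\<^sub>R pd F v x \<partial>lborel) = 0"
proof (rule integral_pd_eq_0[OF F S(1)])
  fix x assume "x \<notin> S"
  then have "x \<notin> supp F" using S by blast
  then have ev: "\<forall>\<^sub>F y in nhds x. F y = 0" by (rule not_in_supp)
  have "((\<lambda>t. x + t *\<^sub>R v) \<longlongrightarrow> x) (at (0::real))"
    by (auto intro!: tendsto_eq_intros)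
  then have "filterlim (\<lambda>t. x + t *\<^sub>R v) (nhds x) (at (0::real))" .
  from eventually_compose_filterlim[OF ev this]
  show "\<forall>\<^sub>F t in at 0. indicator S (x + t *\<^sub>R v) *\<^sub>R F (x + t *\<^sub>R v) = 0"
    by eventually_elim simp
qed

section \<open>Lebesgue measure on products\<close>

text \<open>Product measures and Fubini work with Borel functions, while the integrals of the
  problem use the completed measure. The passage is made by modifying each coordinate on a null
  set.\<close>

lemma lebesgue_borel_version:
  fixes G :: "'a::euclidean_space \<Rightarrow> 'b::euclidean_space"
  assumes "G \<in> borel_measurable lebesgue"
  obtains G' where "G' \<in> borel_measurable borel" "AE x in lborel. G x = G' x"
proof -
  have "\<exists>g'\<in>borel_measurable lborel. AE x in lborel. G x \<bullet> b = g' x" for b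
    by (rule completion_ex_borel_measurable_real) (use assms in measurable)
  then obtain g where g: "\<And>b. g b \<in> borel_measurable lborel" "\<And>b. AE x in lborel. G x \<bullet> b = g b x" by metis
  show thesis
  proof
    show "(\<lambda>x. \<Sum>b\<in>Basis. g b x *\<^sub>R b) \<in> borel_measurable borel" using g(1) by simp
    have "AE x in lborel. \<forall>b\<in>Basis. G x \<bullet> b = g b x" using g(2) by (intro AE_finite_allI) auto
    then show "AE x in lborel. G x = (\<Sum>b\<in>Basis. g b x *\<^sub>R b)"
    proof eventually_elim
      case (elim x)
      have "G x = (\<Sum>b\<in>Basis. (G x \<bullet> b) *\<^sub>R b)" by (simp add: euclidean_representation)
      also have "\<dots> = (\<Sum>b\<in>Basis. g b x *\<^sub>R b)" using elim by (intro sum.cong) auto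
      finally show ?case .
    qed
  qed
qed

lemma lebesgue_measurable_AE_eq:
  assumes G': "G' \<in> borel_measurable borel" and ae: "AE x in lborel. G x = G' x"
  shows "G \<in> borel_measurable lebesgue"
proof (rule measurableI)
  fix A :: "'b set" assume A: "A \<in> sets borel"
  obtain N where N: "N \<in> null_sets lborel" "\<And>x. x \<in> space lborel - N \<Longrightarrow> G x = G' x"
    using AE_E3[OF ae] by blast
  have "G -` A \<inter> N \<in> null_sets lebesgue"
    by (rule completion.complete2[OF Int_lower2 null_sets_completionI[OF N(1)]])
  moreover have "G' -` A \<in> sets borel" using measurable_sets[OF G' A] by simp
  then have "G' -` A \<in> sets lebesgue" by simp
  then have "G' -` A - N \<in> sets lebesgue" using null_setsD2[OF null_sets_completionI[OF N(1)]] by (rule sets.Diff)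
  ultimately have "(G' -` A - N) \<union> (G -` A \<inter> N) \<in> sets lebesgue" by (intro sets.Un[OF _ null_setsD2])
  moreover have "G -` A \<inter> space lebesgue = (G' -` A - N) \<union> (G -` A \<inter> N)" using N(2) by auto
  ultimately show "G -` A \<inter> space lebesgue \<in> sets lebesgue" by simp
qed simp

lemma AE_lborel_pair:
  fixes P :: "'a::euclidean_space \<Rightarrow> 'b::euclidean_space \<Rightarrow> bool"
  assumes "AE z in lborel. P (fst z) (snd z)" shows "AE y in lborel. AE t in lborel. P y t"
proof -
  have "AE z in lborel \<Otimes>\<^sub>M lborel. P (fst z) (snd z)" unfolding lborel_prod by (rule assms)
  from lborel_pair.AE_pair[OF this] show ?thesis by simp
qed

text \<open>The completed measure on the product is not the product of the completed measures.
  Fubini is therefore applied to a Borel version, and the exceptional null set is itself sliced: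
  almost every slice of it is null, so slice integrals of \<open>G\<close> and of its Borel version
  agree almost everywhere.\<close>

lemma lebesgue_Fubini:
  fixes G :: "'a::euclidean_space \<times> 'b::euclidean_space \<Rightarrow> 'c::euclidean_space"
  assumes G: "integrable lebesgue G"
  shows "AE y in lebesgue. integrable lebesgue (\<lambda>t. G (y, t))"
    and "integrable lebesgue (\<lambda>y. \<integral>t. G (y, t) \<partial>lebesgue)"
    and "(\<integral>y. \<integral>t. G (y, t) \<partial>lebesgue \<partial>lebesgue) = (\<integral>z. G z \<partial>lebesgue)"
proof -
  obtain G' where G': "G' \<in> borel_measurable borel" "AE x in lborel. G x = G' x"
    using lebesgue_borel_version[OF borel_measurable_integrable[OF G]] .
  have [measurable]: "G' \<in> borel_measurable (borel \<Otimes>\<^sub>M borel)" using G'(1) by (simp add: borel_prod)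
  have aeL: "AE x in lebesgue. G x = G' x" by (rule AE_completion[OF G'(2)])
  have "integrable lebesgue G'"
    by (rule integrable_cong_AE_imp[OF G]) (use G' aeL in \<open>auto intro: measurable_completion\<close>)
  then have "integrable lborel G'" using G'(1) by (simp add: integrable_completion)
  then have iG': "integrable (lborel \<Otimes>\<^sub>M lborel) G'" by (simp add: lborel_prod)
  have ae: "AE y in lborel. AE t in lborel. G (y, t) = G' (y, t)"
    by (rule AE_lborel_pair) (use G'(2) in simp)
  have sl: "(\<lambda>t. G' (y, t)) \<in> borel_measurable borel" for y by measurable
  have in2: "(\<lambda>y. \<integral>t. G' (y, t) \<partial>lborel) \<in> borel_measurable borel" by measurable
  have ae1: "AE y in lborel. integrable lebesgue (\<lambda>t. G (y, t)) \<and>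
      (\<integral>t. G (y, t) \<partial>lebesgue) = (\<integral>t. G' (y, t) \<partial>lborel)"
    using ae lborel_pair.AE_integrable_fst'[OF iG']
  proof eventually_elim
    case (elim y)
    have m: "(\<lambda>t. G (y, t)) \<in> borel_measurable lebesgue"
      by (rule lebesgue_measurable_AE_eq[OF sl elim(1)])
    have i: "integrable lebesgue (\<lambda>t. G' (y, t))" using elim(2) sl by (simp add: integrable_completion)
    have "AE t in lebesgue. G' (y, t) = G (y, t)" using AE_completion[OF elim(1)] by eventually_elim simp
    from integrable_cong_AE_imp[OF i m this] integral_cong_AE[OF borel_measurable_integrable[OF i] m this]
    show ?case using sl by (simp add: integral_completion)
  qed
  show "AE y in lebesgue. integrable lebesgue (\<lambda>t. G (y, t))"
    by (rule AE_completion) (use ae1 in \<open>eventually_elim, simp\<close>)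
  have ae2: "AE y in lborel. (\<integral>t. G (y, t) \<partial>lebesgue) = (\<integral>t. G' (y, t) \<partial>lborel)"
    using ae1 by eventually_elim simp
  have m2: "(\<lambda>y. \<integral>t. G (y, t) \<partial>lebesgue) \<in> borel_measurable lebesgue"
    by (rule lebesgue_measurable_AE_eq[OF in2 ae2])
  have i2: "integrable lebesgue (\<lambda>y. \<integral>t. G' (y, t) \<partial>lborel)"
    using lborel_pair.integrable_fst'[OF iG'] in2 by (simp add: integrable_completion)
  have ae3: "AE y in lebesgue. (\<integral>t. G' (y, t) \<partial>lborel) = (\<integral>t. G (y, t) \<partial>lebesgue)"
    using AE_completion[OF ae2] by eventually_elim simp
  show "integrable lebesgue (\<lambda>y. \<integral>t. G (y, t) \<partial>lebesgue)" by (rule integrable_cong_AE_imp[OF i2 m2 ae3])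
  have "(\<integral>y. \<integral>t. G (y, t) \<partial>lebesgue \<partial>lebesgue) = (\<integral>y. \<integral>t. G' (y, t) \<partial>lborel \<partial>lebesgue)"
    using integral_cong_AE[OF borel_measurable_integrable[OF i2] m2 ae3] by simp
  also have "\<dots> = (\<integral>y. \<integral>t. G' (y, t) \<partial>lborel \<partial>lborel)" by (rule integral_completion) (use in2 in simp)
  also have "\<dots> = integral\<^sup>L lborel G'" using lborel_pair.integral_fst'[OF iG'] by (simp add: lborel_prod)
  also have "\<dots> = integral\<^sup>L lebesgue G'" using G'(1) by (intro integral_completion[symmetric]) simp
  also have "\<dots> = integral\<^sup>L lebesgue G"
    by (rule integral_cong_AE) (use G' aeL borel_measurable_integrable[OF G] in \<open>auto intro: measurable_completion\<close>)
  finally show "(\<integral>y. \<integral>t. G (y, t) \<partial>lebesgue \<partial>lebesgue) = (\<integral>z. G z \<partial>lebesgue)" .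
qed

section \<open>Functions of the horizontal variable alone\<close>

lemma fst_null_sets:
  assumes "N \<in> null_sets (lborel :: 'a::euclidean_space measure)"
  shows "fst -` N \<in> null_sets (lborel :: ('a \<times> 'b::euclidean_space) measure)"
proof -
  have "N \<times> (UNIV :: 'b set) \<in> null_sets (lborel \<Otimes>\<^sub>M lborel)"
    by (rule lborel.times_in_null_sets1) (use assms in auto)
  moreover have "N \<times> (UNIV :: 'b set) = fst -` N" by auto
  ultimately show ?thesis by (simp add: lborel_prod)
qed

text \<open>Continuity alone does not give measurability between completed measures; preimages of
  null sets must be null, which holds here because they are cylinders over null sets.\<close>

lemma fst_measurable_lebesgue:
  "(fst :: 'a::euclidean_space \<times> 'b::euclidean_space \<Rightarrow> 'a) \<in> lebesgue \<rightarrow>\<^sub>M lebesgue"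
proof (rule completion.measurable_completion2)
  have b: "(fst :: 'a \<times> 'b \<Rightarrow> 'a) \<in> borel_measurable borel"
    by (intro borel_measurable_continuous_onI continuous_intros)
  then show m: "(fst :: 'a \<times> 'b \<Rightarrow> 'a) \<in> lebesgue \<rightarrow>\<^sub>M lborel" by (auto intro: measurable_completion)
  show "null_sets lborel \<subseteq> null_sets (distr lebesgue lborel (fst :: 'a \<times> 'b \<Rightarrow> 'a))"
  proof
    fix N :: "'a set" assume N: "N \<in> null_sets lborel"
    have "fst -` N \<in> null_sets (lborel :: ('a \<times> 'b) measure)" by (rule fst_null_sets[OF N])
    then have "emeasure lebesgue (fst -` N :: ('a \<times> 'b) set) = 0"
      using null_sets_completionI by blast
    then show "N \<in> null_sets (distr lebesgue lborel (fst :: 'a \<times> 'b \<Rightarrow> 'a))"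
      using N m by (simp add: null_sets_def emeasure_distr)
  qed
qed

lemma AE_lebesgue_fst:
  assumes "AE y in lebesgue. P y" shows "AE z in (lebesgue :: ('a::euclidean_space \<times> 'b::euclidean_space) measure). P (fst z)"
proof -
  have "AE y in lborel. P y" using assms by (simp add: AE_completion_iff)
  from AE_E3[OF this] obtain N where N: "N \<in> null_sets lborel" "\<And>x. x \<in> space lborel - N \<Longrightarrow> P x"
    by blast
  have "AE z in (lborel :: ('a \<times> 'b) measure). P (fst z)"
    by (rule AE_I'[OF fst_null_sets[OF N(1)]]) (use N(2) in auto)
  then show ?thesis by (rule AE_completion)
qed

text \<open>The factor \<open>indicator B\<close> cuts the infinite fibres down to finite measure;
  without it a function of the base variable is not integrable unless it vanishes almost
  everywhere.\<close>

lemma integrable_lebesgue_fst_slab: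
  fixes a :: "'a::euclidean_space \<Rightarrow> real" and B :: "'b::euclidean_space set"
  assumes a: "integrable lebesgue a" and B: "B \<in> sets borel" "emeasure lborel B < \<infinity>"
  shows "integrable lebesgue (\<lambda>z. indicator B (snd z) * a (fst z))"
proof -
  obtain b where b: "b \<in> borel_measurable borel" "AE x in lborel. a x = b x"
    using lebesgue_borel_version[OF borel_measurable_integrable[OF a]] .
  have aeL: "AE x in lebesgue. a x = b x" by (rule AE_completion[OF b(2)])
  have "integrable lebesgue b"
    by (rule integrable_cong_AE_imp[OF a]) (use b aeL in \<open>auto intro: measurable_completion\<close>)
  then have ib: "integrable lborel b" using b(1) by (simp add: integrable_completion)
  have [measurable]: "b \<in> borel_measurable borel" "B \<in> sets borel" using b(1) B(1) by auto
  have iB: "integrable lborel (indicat_real B)"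
    using B by (intro integrable_real_indicator) auto
  have "integrable (lborel \<Otimes>\<^sub>M lborel) (\<lambda>z::'a\<times>'b. indicator B (snd z) * b (fst z))"
  proof (rule lborel_pair.Fubini_integrable)
    show "integrable lborel (\<lambda>x. \<integral>y. norm (indicator B (snd (x, y)) * b (fst (x, y))) \<partial>(lborel :: 'b measure))"
      using ib iB by (simp add: abs_mult)
    show "AE x in lborel. integrable lborel (\<lambda>y. indicator B (snd (x, y)) * b (fst (x, y)))"
      using iB by simp
  qed measurable
  then have "integrable lborel (\<lambda>z::'a\<times>'b. indicator B (snd z) * b (fst z))" by (simp only: lborel_prod)
  then have i: "integrable lebesgue (\<lambda>z::'a\<times>'b. indicator B (snd z) * b (fst z))"
    by (subst integrable_completion) (auto dest: borel_measurable_integrable)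
  show ?thesis
  proof (rule integrable_cong_AE_imp[OF i])
    have "(\<lambda>z. a (fst z)) \<in> borel_measurable (lebesgue :: ('a \<times> 'b) measure)"
      by (rule measurable_compose[OF fst_measurable_lebesgue borel_measurable_integrable[OF a]])
    moreover have "snd \<in> borel_measurable (lebesgue :: ('a \<times> 'b) measure)"
      by (intro measurable_completion) (auto intro!: borel_measurable_continuous_onI continuous_intros)
    ultimately show "(\<lambda>z. indicator B (snd z) * a (fst z)) \<in> borel_measurable (lebesgue :: ('a \<times> 'b) measure)"
      using measurable_compose[of snd lebesgue borel "indicat_real B" borel] by measurable
    show "AE z in (lebesgue :: ('a \<times> 'b) measure). indicator B (snd z) * b (fst z) = indicator B (snd z) * a (fst z)"
      using AE_lebesgue_fst[OF aeL] by eventually_elim simp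
  qed
qed

lemma integral_lebesgue_on_eq: "S \<in> sets lebesgue \<Longrightarrow> integral\<^sup>L (lebesgue_on S) f = SInt S f"
  for f :: "'a::euclidean_space \<Rightarrow> 'b::euclidean_space"
  unfolding set_lebesgue_integral_def by (rule integral_restrict_space) simp

lemma L2_iff_sqi: "S \<in> sets lebesgue \<Longrightarrow> L2 S f \<longleftrightarrow> sqi (lebesgue_on S) f"
  for f :: "'a::euclidean_space \<Rightarrow> 'b::euclidean_space"
  unfolding L2_def sqi_def set_borel_measurable_def set_integrable_def
  by (simp add: borel_measurable_restrict_space_iff integrable_restrict_space)

lemma AE_lebesgue_on_iff: "S \<in> sets lebesgue \<Longrightarrow> (AE x in lebesgue_on S. P x) \<longleftrightarrow> (AE x in lebesgue. x \<in> S \<longrightarrow> P x)"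
  by (rule AE_restrict_space_iff) simp

section \<open>The fundamental lemma of the calculus of variations\<close>

text \<open>Open boxes form an intersection-stable generator of the Borel sets, so the vanishing of
  the integral spreads from boxes to all Borel sets, and a density with this property is zero.
  Restricting \<open>D\<close> to one open box first means that only boxes whose closure stays
  inside \<open>cbox p q\<close> are tested.\<close>

lemma integral_eq_0_of_boxes:
  fixes D :: "'a::euclidean_space \<Rightarrow> 'b::euclidean_space"
  assumes D: "integrable lborel D"
    and box: "\<And>a b. cbox a b \<subseteq> cbox p q \<Longrightarrow> (\<integral>x. indicator (box a b) x *\<^sub>R D x \<partial>lborel) = 0"
  shows "AE x in lborel. x \<in> box p q \<longrightarrow> D x = 0"
proof -
  define E where "E x = indicator (box p q) x *\<^sub>R D x" for x
  have E: "integrable lborel E" unfolding E_def by (rule integrable_mult_indicator[OF _ D]) simp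
  have zero: "set_lebesgue_integral lborel A E = 0" if A: "A \<in> sets borel" for A
  proof -
    have "Int_stable (range (\<lambda>(a, b). box a b :: 'a set))"
      by (auto simp: Int_stable_def box_Int_box)
    moreover have "range (\<lambda>(a, b). box a b :: 'a set) \<subseteq> Pow UNIV" by auto
    moreover have "A \<in> sigma_sets UNIV (range (\<lambda>(a, b). box a b))"
      using A unfolding borel_eq_box by simp
    ultimately show ?thesis
    proof (induction rule: sigma_sets_induct_disjoint)
      case (basic A)
      then obtain a b where A: "A = box a b" by auto
      define a' b' where "a' = (\<Sum>i\<in>Basis. max (a \<bullet> i) (p \<bullet> i) *\<^sub>R i)" and "b' = (\<Sum>i\<in>Basis. min (b \<bullet> i) (q \<bullet> i) *\<^sub>R i)"
      have "box a b \<inter> box p q = box a' b'" unfolding a'_def b'_def by (rule box_Int_box)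
      moreover have "cbox a' b' \<subseteq> cbox p q" unfolding a'_def b'_def by (auto simp: mem_box)
      ultimately have "(\<integral>x. indicator (box a b \<inter> box p q) x *\<^sub>R D x \<partial>lborel) = 0" using box by metis
      then show ?case unfolding A E_def set_lebesgue_integral_def
        by (simp add: indicator_inter_arith)
    next
      case empty
      show ?case by (simp add: set_lebesgue_integral_def)
    next
      case (compl A)
      then have A: "A \<in> sets borel" by (simp add: borel_eq_box)
      have "set_lebesgue_integral lborel (UNIV - A) E = (\<integral>x. E x - indicator A x *\<^sub>R E x \<partial>lborel)"
        unfolding set_lebesgue_integral_def by (intro Bochner_Integration.integral_cong) (auto simp: indicator_def)
      also have "\<dots> = integral\<^sup>L lborel E - set_lebesgue_integral lborel A E"
        unfolding set_lebesgue_integral_def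
        by (intro Bochner_Integration.integral_diff E integrable_mult_indicator) (use A in auto)
      also have "integral\<^sup>L lborel E = 0" unfolding E_def by (rule box) simp
      finally show ?case using compl by simp
    next
      case (union F)
      then have F: "range F \<subseteq> sets borel" by (simp add: borel_eq_box subset_eq)
      have "set_lebesgue_integral lborel (\<Union>i. F i) E = (\<Sum>i. set_lebesgue_integral lborel (F i) E)"
        by (rule lebesgue_integral_countable_add)
           (use F union(1) E in \<open>auto simp: disjoint_family_on_def set_integrable_def intro!: integrable_mult_indicator\<close>)
      then show ?case using union(3) by simp
    qed
  qed
  have "AE x in lborel. E x = 0"
    by (rule sigma_finite_measure.density_zero[OF sigma_finite_lborel E]) (use zero in simp)
  then show ?thesis by eventually_elim (auto simp: E_def)
qed

text \<open>Squaring removes the kink of the positive part: at 0 the difference quotient is at most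
  \<open>\<bar>h\<bar>\<close>. This is the building block of the C1 bumps and cutoffs.\<close>

lemma pos_part_square_derivative:
  fixes t :: real shows "((\<lambda>t. (max 0 t)\<^sup>2) has_real_derivative 2 * max 0 t) (at t)"
proof -
  consider "t < 0" | "t = 0" | "t > 0" by linarith
  then show ?thesis
  proof cases
    case 1
    have "((\<lambda>t::real. 0) has_real_derivative 0) (at t)" by simp
    moreover have "\<forall>\<^sub>F s in nhds t. (0::real) = (max 0 s)\<^sup>2"
      using eventually_nhds_in_open[of "{..<0}" t] 1 by (auto elim!: eventually_mono)
    ultimately show ?thesis using 1 DERIV_cong_ev[of t t "\<lambda>t. 0" "\<lambda>t. (max 0 t)\<^sup>2" 0 0] by simp
  next
    case 2
    have "((\<lambda>h. ((max 0 (0 + h))\<^sup>2 - (max 0 0)\<^sup>2) / h) \<longlongrightarrow> 0) (at (0::real))"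
    proof (rule Lim_null_comparison)
      show "\<forall>\<^sub>F h in at 0. norm (((max 0 (0 + h))\<^sup>2 - (max 0 0)\<^sup>2) / h) \<le> \<bar>h\<bar>" for h :: real
        by (rule always_eventually) (auto simp: max_def power2_eq_square)
      show "((\<lambda>h. \<bar>h\<bar>) \<longlongrightarrow> 0) (at (0::real))" by (auto intro!: tendsto_eq_intros)
    qed
    then show ?thesis using 2 by (simp add: DERIV_def)
  next
    case 3
    have "((\<lambda>t::real. t\<^sup>2) has_real_derivative 2 * t) (at t)" by (auto intro!: derivative_eq_intros)
    moreover have "\<forall>\<^sub>F s in nhds t. s\<^sup>2 = (max 0 s)\<^sup>2"
      using eventually_nhds_in_open[of "{0<..}" t] 3 by (auto elim!: eventually_mono)
    ultimately show ?thesis using 3 DERIV_cong_ev[of t t "\<lambda>t. t\<^sup>2" "\<lambda>t. (max 0 t)\<^sup>2" "2 * t" "2 * t"] by simp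
  qed
qed

lemma C1fun_pos_part_square:
  fixes f :: "'a::euclidean_space \<Rightarrow> real"
  assumes "C1fun f" shows "C1fun (\<lambda>x. (max 0 (f x))\<^sup>2)"
  by (rule C1fun_real_compose(1)[OF assms, of "\<lambda>t. (max 0 t)\<^sup>2" "\<lambda>t. 2 * max 0 t"])
     (intro pos_part_square_derivative continuous_intros C1fun_continuous[OF assms])+

lemma C1fun_prod:
  fixes f :: "'i \<Rightarrow> 'a::euclidean_space \<Rightarrow> real"
  assumes "\<And>i. i \<in> I \<Longrightarrow> C1fun (f i)" shows "C1fun (\<lambda>x. \<Prod>i\<in>I. f i x)"
  using assms by (induction I rule: infinite_finite_induct) (auto intro: C1fun_const C1fun_mult(1))

text \<open>In each coordinate the parabola with zeros at the two faces is positive exactly between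
  them; the product of the squared positive parts is C1 and positive exactly on the box.\<close>

lemma box_bump:
  fixes a b :: "'a::euclidean_space"
  assumes ab: "box a b \<noteq> {}"
  obtains \<theta> :: "'a \<Rightarrow> real" where "C1fun \<theta>" "\<And>x. 0 \<le> \<theta> x" "\<And>x. 0 < \<theta> x \<longleftrightarrow> x \<in> box a b"
proof
  define \<theta> where "\<theta> x = (\<Prod>i\<in>Basis. (max 0 ((x \<bullet> i - a \<bullet> i) * (b \<bullet> i - x \<bullet> i)))\<^sup>2)" for x
  have lin: "C1fun (\<lambda>x::'a. x \<bullet> i + c)" "C1fun (\<lambda>x::'a. - (x \<bullet> i) + c)" for i c
    by (rule C1fun_add(1)[OF C1fun_bounded_linear(1)[OF bounded_linear_inner_left] C1fun_const(1)],
        rule C1fun_add(1)[OF C1fun_bounded_linear(1)[OF bounded_linear_minus[OF bounded_linear_inner_left]] C1fun_const(1)])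
  have "C1fun (\<lambda>x::'a. (x \<bullet> i - a \<bullet> i) * (b \<bullet> i - x \<bullet> i))" for i
    using C1fun_mult(1)[OF lin(1)[of i "- (a \<bullet> i)"] lin(2)[of i "b \<bullet> i"]] by (simp add: algebra_simps)
  then show "C1fun \<theta>" unfolding \<theta>_def by (intro C1fun_prod C1fun_pos_part_square)
  show "0 \<le> \<theta> x" for x unfolding \<theta>_def by (intro prod_nonneg) simp
  have lt: "a \<bullet> i < b \<bullet> i" if "i \<in> Basis" for i using ab that by (simp add: box_ne_empty)
  \<comment> \<open>Since \<open>a \<bullet> i < b \<bullet> i\<close>, the two factors cannot both
    be negative, so a positive product means that both are positive.\<close>
  have pos: "0 < (x \<bullet> i - a \<bullet> i) * (b \<bullet> i - x \<bullet> i) \<longleftrightarrow> a \<bullet> i < x \<bullet> i \<and> x \<bullet> i < b \<bullet> i" if "i \<in> Basis" for x i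
    using lt[OF that] by (auto simp: zero_less_mult_iff)
  show "0 < \<theta> x \<longleftrightarrow> x \<in> box a b" for x
  proof
    assume "x \<in> box a b"
    then have p: "0 < (x \<bullet> i - a \<bullet> i) * (b \<bullet> i - x \<bullet> i)" if "i \<in> Basis" for i
      using pos[OF that] that unfolding mem_box by blast
    show "0 < \<theta> x" unfolding \<theta>_def
    proof (rule prod_pos)
      fix i :: 'a assume "i \<in> Basis"
      from p[OF this] show "0 < (max 0 ((x \<bullet> i - a \<bullet> i) * (b \<bullet> i - x \<bullet> i)))\<^sup>2"
        by (intro zero_less_power) (simp add: less_max_iff_disj)
    qed
  next
    assume "0 < \<theta> x"
    then have "\<theta> x \<noteq> 0" by simp
    then have nz: "\<forall>i\<in>Basis. (max 0 ((x \<bullet> i - a \<bullet> i) * (b \<bullet> i - x \<bullet> i)))\<^sup>2 \<noteq> 0"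
      unfolding \<theta>_def by (simp only: prod_zero_iff[OF finite_Basis] bex_simps not_not)
    have "0 < (x \<bullet> i - a \<bullet> i) * (b \<bullet> i - x \<bullet> i)" if "i \<in> Basis" for i
    proof (rule ccontr)
      assume "\<not> ?thesis"
      then have "max 0 ((x \<bullet> i - a \<bullet> i) * (b \<bullet> i - x \<bullet> i)) = 0" by (simp only: not_less max_absorb1)
      then show False using bspec[OF nz that] by (simp only: zero_power2)
    qed
    then show "x \<in> box a b" using pos unfolding mem_box by blast
  qed
qed

text \<open>C1 functions that stay below 1 converge to the indicator of an open box, so integrals
  over all boxes with closure in \<open>S\<close> vanish. A countable cover of \<open>S\<close> by
  closed boxes then collects the exceptional null sets.\<close>

lemma fundamental_lemma:
  fixes D :: "'a::euclidean_space \<Rightarrow> 'b::euclidean_space"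
  assumes S: "open S" and D: "integrable (lebesgue_on S) D"
    and z: "\<And>\<psi>::'a \<Rightarrow> real. C1fun \<psi> \<Longrightarrow> compact (supp \<psi>) \<Longrightarrow> supp \<psi> \<subseteq> S \<Longrightarrow> SInt S (\<lambda>x. \<psi> x *\<^sub>R D x) = 0"
  shows "AE x in lebesgue. x \<in> S \<longrightarrow> D x = 0"
proof -
  have Sm: "S \<in> sets lebesgue" using S by auto
  define E where "E x = indicator S x *\<^sub>R D x" for x
  have E: "integrable lebesgue E" using D Sm unfolding E_def by (simp add: integrable_restrict_space)
  obtain E' where E': "E' \<in> borel_measurable borel" "AE x in lborel. E x = E' x"
    using lebesgue_borel_version[OF borel_measurable_integrable[OF E]] .
  have aeL: "AE x in lebesgue. E x = E' x" by (rule AE_completion[OF E'(2)])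
  have "integrable lebesgue E'"
    by (rule integrable_cong_AE_imp[OF E]) (use E' aeL in \<open>auto intro: measurable_completion\<close>)
  then have iE': "integrable lborel E'" using E'(1) by (simp add: integrable_completion)
  have [measurable]: "E' \<in> borel_measurable borel" by (fact E')
  have box0: "(\<integral>x. indicator (box a b) x *\<^sub>R E' x \<partial>lborel) = 0" if sub: "cbox a b \<subseteq> S" for a b
  proof (cases "box a b = {}")
    case False
    obtain \<theta> :: "'a \<Rightarrow> real" where \<theta>: "C1fun \<theta>" "\<And>x. 0 \<le> \<theta> x" "\<And>x. 0 < \<theta> x \<longleftrightarrow> x \<in> box a b"
      using box_bump[OF False] by blast
    \<comment> \<open>A saturated multiple of the bump: values in [0, 1), zero outside the box, and
      tending to 1 where \<theta> is positive.\<close>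
    define \<zeta> where "\<zeta> k x = real k * \<theta> x / (1 + real k * \<theta> x)" for k :: nat and x
    have den: "1 + real k * \<theta> x > 0" for k x using \<theta>(2)[of x] by (simp add: add_pos_nonneg)
    have \<zeta>C1: "C1fun (\<zeta> k)" for k
      unfolding \<zeta>_def
    proof (rule C1fun_real_compose(1)[OF \<theta>(1), of "\<lambda>t. real k * t / (1 + real k * t)" "\<lambda>t. real k / (1 + real k * t)\<^sup>2"])
      fix x show "((\<lambda>t. real k * t / (1 + real k * t)) has_real_derivative real k / (1 + real k * \<theta> x)\<^sup>2) (at (\<theta> x))"
        using den[of k x] by (auto intro!: derivative_eq_intros simp: power2_eq_square field_simps)
      show "continuous_on UNIV (\<lambda>x. real k / (1 + real k * \<theta> x)\<^sup>2)"
        using den by (intro continuous_intros C1fun_continuous[OF \<theta>(1)]) (metis less_irrefl power_eq_0_iff)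
    qed
    have \<zeta>0: "x \<in> box a b" if "\<zeta> k x \<noteq> 0" for k x
      using that \<theta>(2,3)[of x] unfolding \<zeta>_def by (metis div_0 less_eq_real_def mult_zero_right)
    have sz: "supp (\<zeta> k) \<subseteq> cbox a b" for k
      by (rule supp_subsetI[OF closed_cbox]) (rule subsetD[OF box_subset_cbox \<zeta>0])
    have "SInt S (\<lambda>x. \<zeta> k x *\<^sub>R D x) = 0" for k
      by (rule z[OF \<zeta>C1 compact_suppI[OF compact_cbox sz] order_trans[OF sz sub]])
    then have "(\<integral>x. \<zeta> k x *\<^sub>R E x \<partial>lebesgue) = 0" for k
      unfolding E_def set_lebesgue_integral_def by (simp add: mult.commute)
    moreover have \<zeta>m[measurable]: "\<zeta> k \<in> borel_measurable borel" for k
      by (rule borel_measurable_continuous_onI[OF C1fun_continuous[OF \<zeta>C1]])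
    moreover have "(\<integral>x. \<zeta> k x *\<^sub>R E x \<partial>lebesgue) = (\<integral>x. \<zeta> k x *\<^sub>R E' x \<partial>lebesgue)" for k
    proof (rule integral_cong_AE)
      have "\<zeta> k \<in> borel_measurable lebesgue" "E' \<in> borel_measurable lebesgue"
        using \<zeta>m E'(1) by (auto intro: measurable_completion)
      then show "(\<lambda>x. \<zeta> k x *\<^sub>R E x) \<in> borel_measurable lebesgue" "(\<lambda>x. \<zeta> k x *\<^sub>R E' x) \<in> borel_measurable lebesgue"
        using borel_measurable_integrable[OF E] by measurable
      show "AE x in lebesgue. \<zeta> k x *\<^sub>R E x = \<zeta> k x *\<^sub>R E' x" using aeL by eventually_elim simp
    qed
    ultimately have zk: "(\<integral>x. \<zeta> k x *\<^sub>R E' x \<partial>lborel) = 0" for k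
      using integral_completion[of "\<lambda>x. \<zeta> k x *\<^sub>R E' x" lborel] by simp
    have lim: "(\<lambda>k. \<zeta> k x) \<longlonglongrightarrow> indicator (box a b) x" for x
    proof (cases "x \<in> box a b")
      case True
      then have p: "0 < \<theta> x" using \<theta>(3) by simp
      have "(\<lambda>k. 1 - inverse (1 + real k * \<theta> x)) \<longlonglongrightarrow> 1 - 0"
      proof (intro tendsto_diff tendsto_const tendsto_inverse_0_at_top)
        show "filterlim (\<lambda>k. 1 + real k * \<theta> x) at_top sequentially"
          by (intro filterlim_tendsto_add_at_top[OF tendsto_const] filterlim_at_top_mult_tendsto_pos[OF tendsto_const p]
              filterlim_real_sequentially)
      qed
      moreover have "\<zeta> k x = 1 - inverse (1 + real k * \<theta> x)" for k
        using den[of k x] unfolding \<zeta>_def by (simp add: field_simps)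
      ultimately show ?thesis using True by simp
    next
      case False
      then have "\<zeta> k x = 0" for k using \<zeta>0 by blast
      then show ?thesis using False by simp
    qed
    have b1: "norm (\<zeta> k x) \<le> 1" for k x
      using den[of k x] \<theta>(2)[of x] unfolding \<zeta>_def by (simp add: divide_le_eq)
    have "(\<lambda>k. \<integral>x. \<zeta> k x *\<^sub>R E' x \<partial>lborel) \<longlonglongrightarrow> (\<integral>x. indicator (box a b) x *\<^sub>R E' x \<partial>lborel)"
    proof (rule integral_dominated_convergence)
      show "integrable lborel (\<lambda>x. norm (E' x))" using iE' by simp
      show "AE x in lborel. (\<lambda>k. \<zeta> k x *\<^sub>R E' x) \<longlonglongrightarrow> indicator (box a b) x *\<^sub>R E' x"
        by (intro AE_I2 tendsto_scaleR lim tendsto_const)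
      show "AE x in lborel. norm (\<zeta> k x *\<^sub>R E' x) \<le> norm (E' x)" for k
        by (intro AE_I2) (use b1 in \<open>simp add: mult_left_le_one_le\<close>)
    qed measurable
    then show ?thesis unfolding zk using LIMSEQ_unique tendsto_const by blast
  qed simp
  \<comment> \<open>The previous lemma reaches the open boxes; their frontiers are negligible, so
    the closed boxes of the cover are reached as well.\<close>
  obtain \<D> where \<D>: "countable \<D>" "\<D> \<subseteq> Pow S" "\<And>X. X \<in> \<D> \<Longrightarrow> \<exists>a b. X = cbox a b" "\<Union>\<D> = S"
    using open_countable_Union_open_cbox[OF S] by metis
  have "AE x in lebesgue. x \<in> X \<longrightarrow> E' x = 0" if X: "X \<in> \<D>" for X
  proof -
    obtain p q where pq: "X = cbox p q" using \<D>(3)[OF X] by blast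
    have "cbox p q \<subseteq> S" using \<D>(2) X pq by blast
    then have "AE x in lborel. x \<in> box p q \<longrightarrow> E' x = 0"
      by (intro integral_eq_0_of_boxes[OF iE'] box0) blast
    then have "AE x in lebesgue. x \<in> box p q \<longrightarrow> E' x = 0" by (rule AE_completion)
    moreover have "AE x in lebesgue. x \<notin> cbox p q - box p q"
      using negligible_frontier_interval[of p q] by (intro AE_not_in) (simp add: negligible_iff_null_sets)
    ultimately show ?thesis by eventually_elim (auto simp: pq)
  qed
  then have "AE x in lebesgue. \<forall>X\<in>\<D>. x \<in> X \<longrightarrow> E' x = 0"
    by (rule AE_ball_countable'[OF _ \<D>(1)])
  then show ?thesis using aeL
  proof eventually_elim
    case (elim x)
    show ?case
    proof
      assume x: "x \<in> S"
      then obtain X where "X \<in> \<D>" "x \<in> X" using \<D>(4) by blast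
      then have "E' x = 0" using elim(1) by blast
      then show "D x = 0" using elim(2) x by (simp add: E_def)
    qed
  qed
qed

lemma integrable_lebesgue_on:
  fixes f :: "'a::euclidean_space \<Rightarrow> 'b::euclidean_space"
  assumes "integrable lebesgue f" "S \<in> sets lebesgue" shows "integrable (lebesgue_on S) f"
  using assms by (simp add: integrable_restrict_space integrable_mult_indicator)

section \<open>The thin domain\<close>

locale thin_domain =
  fixes \<omega> :: "(real^2) set" and h :: "real^2 \<Rightarrow> real" and H :: real
  assumes open_base: "open \<omega>" and bounded_base: "bounded \<omega>"
    and h_pos: "y \<in> \<omega> \<Longrightarrow> 0 < h y" and h_le: "y \<in> \<omega> \<Longrightarrow> h y \<le> H" and h_cont: "continuous_on \<omega> h"
    and H_nonneg: "0 \<le> H"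
begin

abbreviation "Dm c \<equiv> Omega_eps \<omega> h c"
abbreviation "Mdom c \<equiv> lebesgue_on (Omega_eps \<omega> h c)"
abbreviation "Mb \<equiv> lebesgue_on \<omega>"

lemma mem_dom: "z \<in> Dm c \<longleftrightarrow> fst z \<in> \<omega> \<and> 0 < snd z \<and> snd z < c * h (fst z)"
  by (cases z) (simp add: Omega_eps_def)

lemma open_dom: "open (Dm c)"
proof -
  have o: "open (\<omega> \<times> (UNIV :: real set))" by (intro open_Times open_base open_UNIV)
  have f: "continuous_on (\<omega> \<times> (UNIV :: real set)) fst" and sn: "continuous_on (\<omega> \<times> (UNIV :: real set)) snd"
    by (rule continuous_on_fst[OF continuous_on_id], rule continuous_on_snd[OF continuous_on_id])
  have hf: "continuous_on (\<omega> \<times> (UNIV :: real set)) (\<lambda>z. h (fst z))"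
    by (rule continuous_on_compose2[OF h_cont f]) auto
  have "continuous_on (\<omega> \<times> UNIV) (\<lambda>z. c * h (fst z) - snd z)"
    by (rule continuous_on_diff[OF continuous_on_mult_left[OF hf] sn])
  then have 1: "open ((\<omega> \<times> UNIV) \<inter> (\<lambda>z. c * h (fst z) - snd z) -` {0<..})"
    by (rule continuous_open_preimage[OF _ o open_greaterThan])
  have 2: "open ((\<omega> \<times> UNIV) \<inter> snd -` {0::real<..})"
    by (rule continuous_open_preimage[OF sn o open_greaterThan])
  have 3: "Dm c = ((\<omega> \<times> UNIV) \<inter> (\<lambda>z. c * h (fst z) - snd z) -` {0<..}) \<inter> ((\<omega> \<times> UNIV) \<inter> snd -` {0<..})"
    by (auto simp: mem_dom)
  show ?thesis unfolding 3 by (rule open_Int[OF 1 2])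
qed

lemma bounded_dom: assumes "0 < c" shows "bounded (Dm c)"
proof (rule bounded_subset)
  show "bounded (\<omega> \<times> {0..c * H})" by (intro bounded_Times bounded_base bounded_closed_interval)
  show "Dm c \<subseteq> \<omega> \<times> {0..c * H}"
  proof
    fix z assume z: "z \<in> Dm c"
    then have "c * h (fst z) \<le> c * H" using assms h_le by (simp add: mem_dom)
    then show "z \<in> \<omega> \<times> {0..c * H}" using z by (cases z) (simp add: mem_dom)
  qed
qed

lemma lmeasurable_dom: "0 < c \<Longrightarrow> Dm c \<in> lmeasurable"
  by (intro bounded_set_imp_lmeasurable bounded_dom) (use open_dom in auto)

lemma lmeasurable_base: "\<omega> \<in> lmeasurable"
  by (intro bounded_set_imp_lmeasurable bounded_base) (use open_base in auto)

lemma sets_dom: "Dm c \<in> sets lebesgue" and sets_base: "\<omega> \<in> sets lebesgue"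
  using open_dom open_base by auto

lemma finite_Mdom: "0 < c \<Longrightarrow> finite_measure (Mdom c)" and finite_Mb: "finite_measure Mb"
  by (intro finite_measure_lebesgue_on lmeasurable_dom lmeasurable_base; assumption)+

text \<open>Convex combinations of the given height with the midpoint height lie strictly inside the
  fibre. The lemma places the bottom and top endpoints of each fibre on the frontier, where test
  fields are known to vanish or not.\<close>

lemma segment_closure:
  assumes c: "0 < c" and y: "y \<in> \<omega>" and \<tau>: "0 \<le> \<tau>" "\<tau> \<le> c * h y"
  shows "(y, \<tau>) \<in> closure (Dm c)"
  unfolding closure_sequential
proof (intro exI conjI allI)
  define m where "m = c * h y / 2"
  have m: "0 < m" "m < c * h y" using c h_pos[OF y] by (auto simp: m_def)
  define a where "a n = 1 / real (Suc n)" for n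
  have a: "0 < a n" "a n \<le> 1" for n by (auto simp: a_def)
  show "(y, (1 - a n) * \<tau> + a n * m) \<in> Dm c" for n
  proof -
    have "0 \<le> (1 - a n) * \<tau>" "0 < a n * m" using a \<tau> m by simp_all
    moreover have "(1 - a n) * \<tau> \<le> (1 - a n) * (c * h y)" "a n * m < a n * (c * h y)"
      using a \<tau> m by (auto intro: mult_left_mono)
    moreover have "(1 - a n) * (c * h y) + a n * (c * h y) = c * h y" by (simp add: algebra_simps)
    ultimately show ?thesis unfolding mem_dom using y by simp
  qed
  have "a \<longlonglongrightarrow> 0" unfolding a_def by (rule LIMSEQ_Suc[OF lim_1_over_n])
  then have "(\<lambda>n. (y, (1 - a n) * \<tau> + a n * m)) \<longlonglongrightarrow> (y, (1 - 0) * \<tau> + 0 * m)"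
    by (intro tendsto_intros)
  then show "(\<lambda>n. (y, (1 - a n) * \<tau> + a n * m)) \<longlonglongrightarrow> (y, \<tau>)" by simp
qed

lemma frontier_dom_eq: "frontier (Dm c) = closure (Dm c) - Dm c"
  using open_dom by (simp add: frontier_def interior_open)

lemma bottom_in_frontier: "0 < c \<Longrightarrow> y \<in> \<omega> \<Longrightarrow> (y, 0) \<in> frontier (Dm c)"
  using segment_closure[of c y 0] h_pos[of y] by (simp add: frontier_dom_eq mem_dom)

lemma top_in_frontier: "0 < c \<Longrightarrow> y \<in> \<omega> \<Longrightarrow> (y, c * h y) \<in> frontier (Dm c) - Gamma0 \<omega>"
  using segment_closure[of c y "c * h y"] h_pos[of y] by (simp add: frontier_dom_eq mem_dom Gamma0_def)

text \<open>One class for scalar and vector fields. The support meets the boundary of the domain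
  only on the bottom, so of all boundary terms in an integration by parts just the bottom term
  survives. The tangency condition of \<open>admissible\<close> is kept separate because scalar
  multipliers do not have it.\<close>

definition test_field :: "real \<Rightarrow> (pt \<Rightarrow> 'b::euclidean_space) \<Rightarrow> bool" where
  "test_field c \<phi> \<longleftrightarrow> C1fun \<phi> \<and> compact (supp \<phi>) \<and> supp \<phi> \<inter> (frontier (Dm c) - Gamma0 \<omega>) = {}"

lemma test_fieldD:
  assumes "test_field c \<phi>"
  shows "C1fun \<phi>" "compact (supp \<phi>)" "supp \<phi> \<inter> (frontier (Dm c) - Gamma0 \<omega>) = {}"
  using assms unfolding test_field_def by auto

lemma test_field_subset:
  assumes "C1fun \<phi>" "supp \<phi> \<subseteq> supp \<psi>" "test_field c \<psi>" shows "test_field c \<phi>"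
  using assms compact_suppI[of "supp \<psi>" \<phi>] unfolding test_field_def by blast

lemma C1fun_sqi:
  assumes "C1fun \<phi>" "compact (supp \<phi>)" "S \<in> lmeasurable"
  shows "sqi (lebesgue_on S) \<phi>" "sqi (lebesgue_on S) (pd \<phi> v)"
proof -
  interpret finite_measure "lebesgue_on S" by (rule finite_measure_lebesgue_on[OF assms(3)])
  have m: "g \<in> borel_measurable (lebesgue_on S)" if "continuous_on UNIV g" for g :: "'a \<Rightarrow> 'b"
    by (intro measurable_restrict_space1 measurable_completion) (use borel_measurable_continuous_onI[OF that] in simp)
  obtain C where "\<And>x. norm (\<phi> x) \<le> C" using C1fun_bounded[OF assms(1,2)] by auto
  then show "sqi (lebesgue_on S) \<phi>" by (intro sqi_bounded[of _ C] m C1fun_continuous assms AE_I2)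
  obtain C where "\<And>x. norm (pd \<phi> v x) \<le> C" using pd_bounded[OF assms(1,2)] by auto
  then show "sqi (lebesgue_on S) (pd \<phi> v)" by (intro sqi_bounded[of _ C] m C1fun_continuous_pd assms AE_I2)
qed

text \<open>A horizontal line stays at constant height. At height at most 0 it never meets the
  domain; at positive height it can leave the domain only through a frontier point off the bottom,
  near which \<open>G\<close> vanishes. Hence the bottom produces no boundary term.\<close>

lemma horizontal_integral_eq_0:
  fixes G :: "pt \<Rightarrow> 'b::euclidean_space"
  assumes G: "test_field c G" and v: "snd v = 0"
  shows "SInt (Dm c) (pd G v) = 0"
proof -
  have [measurable]: "pd G v \<in> borel_measurable borel" "Dm c \<in> sets borel"
    using borel_measurable_continuous_onI[OF C1fun_continuous_pd[OF test_fieldD(1)[OF G]]] open_dom by auto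
  have "(\<integral>x. indicator (Dm c) x *\<^sub>R pd G v x \<partial>lborel) = 0"
  proof (rule integral_pd_eq_0[OF test_fieldD(1,2)[OF G] open_dom])
    fix x assume x: "x \<notin> Dm c"
    show "\<forall>\<^sub>F t in at 0. indicator (Dm c) (x + t *\<^sub>R v) *\<^sub>R G (x + t *\<^sub>R v) = 0"
    proof (cases "0 < snd x")
      case False
      then show ?thesis using v by (intro always_eventually) (auto simp: mem_dom)
    next
      case True
      have flim: "filterlim (\<lambda>t. x + t *\<^sub>R v) (nhds x) (at (0::real))"
        by (auto intro!: tendsto_eq_intros)
      have "\<forall>\<^sub>F y in nhds x. indicator (Dm c) y *\<^sub>R G y = 0"
      proof (cases "x \<in> closure (Dm c)")
        case False
        have "\<forall>\<^sub>F y in nhds x. y \<in> - closure (Dm c)"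
          by (rule eventually_nhds_in_open) (use False in auto)
        then show ?thesis by (rule eventually_mono) (use closure_subset[of "Dm c"] in \<open>auto simp: indicator_def\<close>)
      next
        case c: True
        then have "x \<in> frontier (Dm c) - Gamma0 \<omega>"
          using x True by (auto simp: frontier_dom_eq Gamma0_def)
        then have "x \<notin> supp G" using test_fieldD(3)[OF G] by blast
        then show ?thesis by (rule eventually_mono[OF not_in_supp(2)]) simp
      qed
      from eventually_compose_filterlim[OF this flim] show ?thesis .
    qed
  qed
  then show ?thesis unfolding set_lebesgue_integral_def by (subst integral_completion) simp_all
qed

text \<open>Fundamental theorem of calculus on one fibre; the upper endpoint is a frontier point off
  the bottom, so only the lower one contributes.\<close>

lemma vertical_integral:
  fixes G :: "pt \<Rightarrow> 'b::euclidean_space"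
  assumes G: "test_field c G" and c: "0 < c" and y: "y \<in> \<omega>"
  shows "(\<integral>t. pd G e3 (y, t) \<partial>lebesgue_on {0<..<c * h y}) = - G (y, 0)"
proof -
  define k where "k = c * h y"
  have k: "0 \<le> k" using c h_pos[OF y] by (simp add: k_def)
  note C1 = test_fieldD(1)[OF G]
  have der: "((\<lambda>t. G (y, t)) has_vector_derivative pd G e3 (y, t)) (at t within T)" for t T
  proof -
    have "((\<lambda>t. (y, t)) has_derivative (\<lambda>s. (0, s))) (at t within T)"
      by (auto intro!: derivative_eq_intros)
    then have "((\<lambda>t. G (y, t)) has_derivative (\<lambda>s. pd G (0, s) (y, t))) (at t within T)"
      by (rule has_derivative_compose[OF _ C1fun_has_derivative[OF C1]])
    moreover have "pd G (0, s) (y, t) = s *\<^sub>R pd G e3 (y, t)" for s :: real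
    proof -
      have "(0, s) = s *\<^sub>R e3" by (simp add: e3_def)
      then show ?thesis using linear_cmul[OF pd_linear[OF C1]] by metis
    qed
    ultimately show ?thesis unfolding has_vector_derivative_def by simp
  qed
  have cont: "continuous_on UNIV (\<lambda>t. pd G e3 (y, t))"
    by (rule continuous_on_compose2[OF C1fun_continuous_pd[OF C1, of UNIV]]) (auto intro!: continuous_intros)
  then have m[measurable]: "(\<lambda>t. pd G e3 (y, t)) \<in> borel_measurable borel" by (rule borel_measurable_continuous_onI)
  have "(\<integral>t. pd G e3 (y, t) \<partial>lebesgue_on {0<..<k}) = (\<integral>t. indicator {0<..<k} t *\<^sub>R pd G e3 (y, t) \<partial>lebesgue)"
    by (rule integral_restrict_space) simp
  also have "\<dots> = (\<integral>t. indicator {0<..<k} t *\<^sub>R pd G e3 (y, t) \<partial>lborel)"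
    by (rule integral_completion) simp
  also have "\<dots> = (\<integral>t. indicator {0..k} t *\<^sub>R pd G e3 (y, t) \<partial>lborel)"
  proof (rule integral_cong_AE)
    show "AE t in lborel. indicator {0<..<k} t *\<^sub>R pd G e3 (y, t) = indicator {0..k} t *\<^sub>R pd G e3 (y, t)"
      using AE_lborel_singleton[of "0::real"] AE_lborel_singleton[of k]
      by eventually_elim (auto simp: indicator_def)
  qed measurable
  also have "\<dots> = G (y, k) - G (y, 0)"
    by (rule integral_FTC_Icc[OF k der continuous_on_subset[OF cont]]) auto
  also have "G (y, k) = 0"
    using top_in_frontier[OF c y] test_fieldD(3)[OF G] by (intro not_in_supp(1)) (auto simp: k_def)
  finally show ?thesis by (simp add: k_def)
qed

lemma Fubini_dom:
  fixes F :: "pt \<Rightarrow> 'b::euclidean_space"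
  assumes F: "integrable (Mdom c) F"
  shows "AE y in Mb. integrable (lebesgue_on {0<..<c * h y}) (\<lambda>t. F (y, t))"
    and "integrable Mb (\<lambda>y. \<integral>t. F (y, t) \<partial>lebesgue_on {0<..<c * h y})"
    and "(\<integral>y. \<integral>t. F (y, t) \<partial>lebesgue_on {0<..<c * h y} \<partial>Mb) = integral\<^sup>L (Mdom c) F"
proof -
  define G where "G z = indicator (Dm c) z *\<^sub>R F z" for z
  have G: "integrable lebesgue G" using F sets_dom unfolding G_def by (simp add: integrable_restrict_space)
  have Geq: "G (y, t) = indicator {0<..<c * h y} t *\<^sub>R F (y, t)" if "y \<in> \<omega>" for y t
    using that by (auto simp: G_def mem_dom indicator_def)
  have G0: "G (y, t) = 0" if "y \<notin> \<omega>" for y t using that by (auto simp: G_def mem_dom indicator_def)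
  have int: "(\<integral>t. G (y, t) \<partial>lebesgue) = indicator \<omega> y *\<^sub>R (\<integral>t. F (y, t) \<partial>lebesgue_on {0<..<c * h y})" for y
    by (cases "y \<in> \<omega>") (simp_all add: Geq G0 integral_restrict_space)
  show "AE y in Mb. integrable (lebesgue_on {0<..<c * h y}) (\<lambda>t. F (y, t))"
    unfolding AE_lebesgue_on_iff[OF sets_base] using lebesgue_Fubini(1)[OF G]
  proof eventually_elim
    case (elim y)
    show ?case
    proof
      assume y: "y \<in> \<omega>"
      have "(\<lambda>t. G (y, t)) = (\<lambda>t. indicator {0<..<c * h y} t *\<^sub>R F (y, t))" using Geq[OF y] by blast
      then show "integrable (lebesgue_on {0<..<c * h y}) (\<lambda>t. F (y, t))"
        using elim by (simp add: integrable_restrict_space)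
    qed
  qed
  show "integrable Mb (\<lambda>y. \<integral>t. F (y, t) \<partial>lebesgue_on {0<..<c * h y})"
    using lebesgue_Fubini(2)[OF G] sets_base unfolding int by (simp add: integrable_restrict_space)
  show "(\<integral>y. \<integral>t. F (y, t) \<partial>lebesgue_on {0<..<c * h y} \<partial>Mb) = integral\<^sup>L (Mdom c) F"
    using lebesgue_Fubini(3)[OF G] sets_base sets_dom unfolding int
    by (simp add: integral_restrict_space G_def[symmetric])
qed

lemma vertical_integral_dom:
  fixes G :: "pt \<Rightarrow> 'b::euclidean_space"
  assumes G: "test_field c G" and c: "0 < c"
  shows "SInt (Dm c) (pd G e3) = - SInt \<omega> (\<lambda>y. G (y, 0))"
proof -
  interpret finite_measure "Mdom c" by (rule finite_Mdom[OF c])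
  have "integrable (Mdom c) (pd G e3)"
    by (intro sqi_integrable C1fun_sqi lmeasurable_dom c test_fieldD[OF G])
  note F = Fubini_dom(3)[OF this]
  have "SInt (Dm c) (pd G e3) = integral\<^sup>L (Mdom c) (pd G e3)"
    by (rule integral_lebesgue_on_eq[OF sets_dom, symmetric])
  also have "\<dots> = (\<integral>y. - G (y, 0) \<partial>Mb)"
    unfolding F[symmetric]
    by (rule Bochner_Integration.integral_cong) (auto simp: vertical_integral[OF G c] space_restrict_space)
  also have "\<dots> = - SInt \<omega> (\<lambda>y. G (y, 0))"
    by (simp add: integral_lebesgue_on_eq[OF sets_base])
  finally show ?thesis .
qed

lemma sqi_fst_dom:
  fixes a :: "real^2 \<Rightarrow> 'b::euclidean_space"
  assumes a: "sqi Mb a" and c: "0 < c" shows "sqi (Mdom c) (\<lambda>z. a (fst z))"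
  unfolding sqi_def
proof (intro conjI)
  \<comment> \<open>Extension by zero gives a function on the whole plane, to which measurability of
    the projection applies. The slab of height \<open>c * H\<close> contains every fibre.\<close>
  define a0 where "a0 y = indicator \<omega> y *\<^sub>R a y" for y
  have a0m: "a0 \<in> borel_measurable lebesgue"
    using sqiD(1)[OF a] sets_base unfolding a0_def by (simp add: borel_measurable_restrict_space_iff)
  have "(\<lambda>z. a0 (fst z)) \<in> borel_measurable (lebesgue :: pt measure)"
    by (rule measurable_compose[OF fst_measurable_lebesgue a0m])
  then have "(\<lambda>z. a0 (fst z)) \<in> borel_measurable (Mdom c)" by (rule measurable_restrict_space1)
  then show m: "(\<lambda>z. a (fst z)) \<in> borel_measurable (Mdom c)"
    by (rule measurable_cong[THEN iffD1, rotated]) (auto simp: a0_def mem_dom space_restrict_space)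
  have "integrable lebesgue (\<lambda>y. (norm (a0 y))\<^sup>2)"
  proof -
    have "integrable lebesgue (\<lambda>y. indicator \<omega> y *\<^sub>R (norm (a y))\<^sup>2)"
      using sqiD(2)[OF a] sets_base by (simp add: integrable_restrict_space)
    then show ?thesis
      by (rule back_subst[where P="integrable lebesgue"]) (auto simp: a0_def indicator_def fun_eq_iff)
  qed
  then have "integrable lebesgue (\<lambda>z::pt. indicator {0<..<c * H} (snd z) * (norm (a0 (fst z)))\<^sup>2)"
    by (rule integrable_lebesgue_fst_slab) (use emeasure_bounded_finite[of "{0<..<c * H}"] in auto)
  then have "integrable (Mdom c) (\<lambda>z::pt. indicator {0<..<c * H} (snd z) * (norm (a0 (fst z)))\<^sup>2)"
    by (rule integrable_lebesgue_on[OF _ sets_dom])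
  then show "integrable (Mdom c) (\<lambda>z. (norm (a (fst z)))\<^sup>2)"
  proof (rule Bochner_Integration.integrable_bound)
    show "AE z in Mdom c. norm ((norm (a (fst z)))\<^sup>2) \<le> norm (indicator {0<..<c * H} (snd z) * (norm (a0 (fst z)))\<^sup>2)"
    proof (rule AE_I2)
      fix z assume "z \<in> space (Mdom c)"
      then have z: "z \<in> Dm c" by (simp add: space_restrict_space)
      then have "c * h (fst z) \<le> c * H" using c h_le by (simp add: mem_dom)
      then have "snd z \<in> {0<..<c * H}" using z by (simp add: mem_dom)
      then show "norm ((norm (a (fst z)))\<^sup>2) \<le> norm (indicator {0<..<c * H} (snd z) * (norm (a0 (fst z)))\<^sup>2)"
        using z by (simp add: a0_def mem_dom)
    qed
  qed (use m in measurable)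
qed

text \<open>For a field vanishing on the top boundary with vertical derivative \<open>d\<close>, this is its trace on the
  bottom; the bound \<open>1 * h y\<close> has the shape of the slice lemmas at scale \<open>c = 1\<close>.\<close>

definition vtrace :: "(pt \<Rightarrow> 'b::euclidean_space) \<Rightarrow> real^2 \<Rightarrow> 'b" where
  "vtrace d y = - (\<integral>t. d (y, t) \<partial>lebesgue_on {0<..<1 * h y})"

lemma vtrace_pd: "test_field 1 G \<Longrightarrow> y \<in> \<omega> \<Longrightarrow> vtrace (pd G e3) y = G (y, 0)"
  unfolding vtrace_def using vertical_integral[of 1 G y] by simp

text \<open>Cauchy-Schwarz against the constant 1 on each fibre costs the fibre length, which is at
  most \<open>H\<close>.\<close>

lemma vtrace_bound:
  fixes d :: "pt \<Rightarrow> 'b::euclidean_space"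
  assumes d: "sqi (Mdom 1) d"
  shows "sqi Mb (vtrace d)" "(\<integral>y. (norm (vtrace d y))\<^sup>2 \<partial>Mb) \<le> H * (\<integral>z. (norm (d z))\<^sup>2 \<partial>Mdom 1)"
proof -
  interpret finite_measure "Mdom 1" by (rule finite_Mdom) simp
  have di: "integrable (Mdom 1) d" by (rule sqi_integrable[OF d])
  note F1 = Fubini_dom[OF di] and F2 = Fubini_dom[OF sqiD(2)[OF d]]
  have ptw: "AE y in Mb. (norm (vtrace d y))\<^sup>2 \<le> H * (\<integral>t. (norm (d (y, t)))\<^sup>2 \<partial>lebesgue_on {0<..<1 * h y})"
    using F1(1) F2(1) AE_space
  proof eventually_elim
    case (elim y)
    then have y: "y \<in> \<omega>" by (simp add: space_restrict_space)
    let ?M = "lebesgue_on {0<..<1 * h y}"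
    interpret I: finite_measure ?M by (rule finite_measure_lebesgue_on) (auto intro: bounded_set_imp_lmeasurable)
    have s: "sqi ?M (\<lambda>t. d (y, t))"
      unfolding sqi_def using borel_measurable_integrable[OF elim(1)] elim(2) by blast
    have one: "sqi ?M (\<lambda>t. 1::real)"
      unfolding sqi_def by (intro conjI I.integrable_const borel_measurable_const)
    have "norm (vtrace d y) \<le> (\<integral>t. norm (d (y, t)) \<partial>?M)"
      unfolding vtrace_def norm_minus_cancel by (rule integral_norm_bound)
    then have "(norm (vtrace d y))\<^sup>2 \<le> (\<integral>t. norm (d (y, t)) * norm (1::real) \<partial>?M)\<^sup>2"
      by (intro power_mono) (simp_all only: norm_one mult_1_right norm_ge_zero)
    also have "\<dots> \<le> (\<integral>t. (norm (d (y, t)))\<^sup>2 \<partial>?M) * (\<integral>t. (norm (1::real))\<^sup>2 \<partial>?M)"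
      by (rule sqi_Cauchy_Schwarz_norm[OF s one])
    also have "(\<integral>t. (norm (1::real))\<^sup>2 \<partial>?M) = h y"
      using h_pos[OF y] by (simp add: measure_restrict_space space_restrict_space)
    also have "(\<integral>t. (norm (d (y, t)))\<^sup>2 \<partial>?M) * h y \<le> (\<integral>t. (norm (d (y, t)))\<^sup>2 \<partial>?M) * H"
      by (rule mult_left_mono[OF h_le[OF y]]) simp
    finally show ?case by (simp only: mult.commute[of H])
  qed
  have m: "vtrace d \<in> borel_measurable Mb"
    unfolding vtrace_def[abs_def] using borel_measurable_integrable[OF F1(2)] by measurable
  have iH: "integrable Mb (\<lambda>y. H * (\<integral>t. (norm (d (y, t)))\<^sup>2 \<partial>lebesgue_on {0<..<1 * h y}))"
    by (intro integrable_mult_right F2(2))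
  have i: "integrable Mb (\<lambda>y. (norm (vtrace d y))\<^sup>2)"
  proof (rule Bochner_Integration.integrable_bound[OF iH])
    show "AE y in Mb. norm ((norm (vtrace d y))\<^sup>2) \<le> norm (H * (\<integral>t. (norm (d (y, t)))\<^sup>2 \<partial>lebesgue_on {0<..<1 * h y}))"
      using ptw
    proof eventually_elim
      case (elim y)
      have "norm ((norm (vtrace d y))\<^sup>2) = (norm (vtrace d y))\<^sup>2" by simp
      also note elim
      also have "a \<le> norm a" for a :: real by simp
      finally show ?case .
    qed
  qed (use m in measurable)
  show "sqi Mb (vtrace d)" using m i by (simp add: sqi_def)
  have "(\<integral>y. (norm (vtrace d y))\<^sup>2 \<partial>Mb) \<le> (\<integral>y. H * (\<integral>t. (norm (d (y, t)))\<^sup>2 \<partial>lebesgue_on {0<..<1 * h y}) \<partial>Mb)"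
    by (rule integral_mono_AE[OF i iH ptw])
  also have "\<dots> = H * (\<integral>z. (norm (d z))\<^sup>2 \<partial>Mdom 1)"
    using F2(3) by simp
  finally show "(\<integral>y. (norm (vtrace d y))\<^sup>2 \<partial>Mb) \<le> H * (\<integral>z. (norm (d z))\<^sup>2 \<partial>Mdom 1)" .
qed

text \<open>The adjoint of the trace extends a bottom function constantly along the fibres. Boundary
  pairings thereby become pairings over the domain, on which weak convergence of \<open>d\<close>
  acts directly.\<close>

lemma vtrace_inner:
  fixes d :: "pt \<Rightarrow> 'b::euclidean_space"
  assumes d: "sqi (Mdom 1) d" and a: "sqi Mb a"
  shows "(\<integral>y. a y \<bullet> vtrace d y \<partial>Mb) = - (\<integral>z. a (fst z) \<bullet> d z \<partial>Mdom 1)"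
proof -
  interpret finite_measure "Mdom 1" by (rule finite_Mdom) simp
  have di: "integrable (Mdom 1) d" by (rule sqi_integrable[OF d])
  have i: "integrable (Mdom 1) (\<lambda>z. a (fst z) \<bullet> d z)"
    by (intro sqi_inner_integrable sqi_fst_dom a d) simp
  have "AE y in Mb. a y \<bullet> vtrace d y = - (\<integral>t. a (fst (y, t)) \<bullet> d (y, t) \<partial>lebesgue_on {0<..<1 * h y})"
    using Fubini_dom(1)[OF di] by eventually_elim (simp add: vtrace_def)
  then have "(\<integral>y. a y \<bullet> vtrace d y \<partial>Mb) = (\<integral>y. - (\<integral>t. a (fst (y, t)) \<bullet> d (y, t) \<partial>lebesgue_on {0<..<1 * h y}) \<partial>Mb)"
    by (intro integral_cong_AE borel_measurable_uminus borel_measurable_integrable[OF Fubini_dom(2)[OF i]])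
       (use sqiD(1)[OF a] sqiD(1)[OF vtrace_bound(1)[OF d]] in measurable)
  also have "\<dots> = - (\<integral>y. (\<integral>t. a (fst (y, t)) \<bullet> d (y, t) \<partial>lebesgue_on {0<..<1 * h y}) \<partial>Mb)"
    by (rule integral_minus)
  also have "\<dots> = - (\<integral>z. a (fst z) \<bullet> d z \<partial>Mdom 1)" by (simp only: Fubini_dom(3)[OF i])
  finally show ?thesis .
qed

lemma vtrace_diff:
  assumes "sqi (Mdom 1) d" "sqi (Mdom 1) d'"
  shows "AE y in Mb. vtrace (\<lambda>z. d z - d' z) y = vtrace d y - vtrace d' y"
proof -
  interpret finite_measure "Mdom 1" by (rule finite_Mdom) simp
  show ?thesis
    using Fubini_dom(1)[OF sqi_integrable[OF assms(1)]] Fubini_dom(1)[OF sqi_integrable[OF assms(2)]]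
    by eventually_elim (simp add: vtrace_def)
qed

end

section \<open>The vertical dilation and its change of variables\<close>

context thin_domain
begin

definition stretch :: "real \<Rightarrow> pt \<Rightarrow> pt" where "stretch r z = (fst z, r * snd z)"

lemma fst_stretch [simp]: "fst (stretch r z) = fst z" and snd_stretch [simp]: "snd (stretch r z) = r * snd z"
  by (simp_all add: stretch_def)

lemma stretch_mem: "0 < r \<Longrightarrow> stretch r z \<in> Dm (r * c) \<longleftrightarrow> z \<in> Dm c"
  by (auto simp: mem_dom zero_less_mult_iff mult.assoc)

lemma stretch_inverse: "r \<noteq> 0 \<Longrightarrow> stretch (1 / r) (stretch r z) = z"
  by (simp add: stretch_def)

lemma bounded_linear_stretch: "bounded_linear (stretch r)"
  unfolding stretch_def[abs_def]
  by (intro bounded_linear_Pair bounded_linear_fst bounded_linear_compose[OF bounded_linear_mult_right bounded_linear_snd])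

lemma e3_Basis: "e3 \<in> Basis"
  unfolding e3_def by (simp add: Basis_prod_def)

lemma inner_e3: "z \<bullet> e3 = snd z"
  by (cases z) (simp add: e3_def)

definition hor :: "pt set" where "hor = Basis - {e3}"

lemma Basis_hor: "Basis = insert e3 hor" "e3 \<notin> hor" "finite hor"
  using e3_Basis by (auto simp: hor_def)

lemma snd_hor: "b \<in> hor \<Longrightarrow> snd b = 0"
  by (auto simp: hor_def Basis_prod_def e3_def)

lemma sum_Basis_hor: "(\<Sum>b\<in>Basis. F b) = (\<Sum>b\<in>hor. F b) + F e3" for F :: "pt \<Rightarrow> 'b::ab_group_add"
  unfolding Basis_hor(1) by (simp add: Basis_hor(2,3) add.commute)

lemma stretch_hor: "b \<in> hor \<Longrightarrow> stretch r b = b"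
  using snd_hor[of b] by (cases b) (simp add: stretch_def)

lemma stretch_e3: "stretch r e3 = r *\<^sub>R e3"
  by (simp add: stretch_def e3_def)

lemma pd_stretch:
  fixes \<phi> :: "pt \<Rightarrow> 'b::real_normed_vector"
  assumes "C1fun \<phi>"
  shows "C1fun (\<lambda>z. \<phi> (stretch r z))"
    and "b \<in> hor \<Longrightarrow> pd (\<lambda>z. \<phi> (stretch r z)) b z = pd \<phi> b (stretch r z)"
    and "pd (\<lambda>z. \<phi> (stretch r z)) e3 z = r *\<^sub>R pd \<phi> e3 (stretch r z)"
proof -
  have C: "C1fun (stretch r)" "pd (stretch r) v z = stretch r v" for v z
    by (rule C1fun_bounded_linear[OF bounded_linear_stretch])+
  show "C1fun (\<lambda>z. \<phi> (stretch r z))" by (rule C1fun_compose(1)[OF C(1) assms])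
  have *: "pd (\<lambda>z. \<phi> (stretch r z)) v z = pd \<phi> (stretch r v) (stretch r z)" for v
    unfolding C1fun_compose(2)[OF C(1) assms] C(2) ..
  show "b \<in> hor \<Longrightarrow> pd (\<lambda>z. \<phi> (stretch r z)) b z = pd \<phi> b (stretch r z)"
    unfolding * by (simp add: stretch_hor)
  show "pd (\<lambda>z. \<phi> (stretch r z)) e3 z = r *\<^sub>R pd \<phi> e3 (stretch r z)"
    unfolding * stretch_e3 by (rule linear_cmul[OF pd_linear[OF assms]])
qed

lemma test_field_stretch:
  fixes \<phi> :: "pt \<Rightarrow> 'b::euclidean_space"
  assumes \<phi>: "test_field (r * c) \<phi>" and r: "0 < r"
  shows "test_field c (\<lambda>z. \<phi> (stretch r z))"
proof -
  let ?f = "\<lambda>z. \<phi> (stretch r z)"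
  define K where "K = stretch (1 / r) ` supp \<phi>"
  have K: "compact K" unfolding K_def
    by (rule compact_continuous_image[OF linear_continuous_on[OF bounded_linear_stretch] test_fieldD(2)[OF \<phi>]])
  have sub: "supp ?f \<subseteq> K"
  proof (rule supp_subsetI[OF compact_imp_closed[OF K]])
    fix z assume "?f z \<noteq> 0"
    then have "stretch r z \<in> supp \<phi>" using not_in_supp(1) by blast
    then have "stretch (1 / r) (stretch r z) \<in> K" unfolding K_def by (rule imageI)
    then show "z \<in> K" using r by (simp add: stretch_inverse)
  qed
  have cl: "stretch r z \<in> closure (Dm (r * c))" if "z \<in> closure (Dm c)" for z
  proof -
    have "stretch r ` closure (Dm c) \<subseteq> closure (Dm (r * c))"
    proof (rule image_closure_subset[OF linear_continuous_on[OF bounded_linear_stretch] closed_closure])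
      show "stretch r ` Dm c \<subseteq> closure (Dm (r * c))"
        using stretch_mem[OF r] closure_subset[of "Dm (r * c)"] by blast
    qed
    then show ?thesis using that by blast
  qed
  have "supp ?f \<inter> (frontier (Dm c) - Gamma0 \<omega>) = {}"
  proof (rule ccontr)
    assume "\<not> ?thesis"
    then obtain z where z: "z \<in> supp ?f" "z \<in> frontier (Dm c)" "z \<notin> Gamma0 \<omega>" by blast
    from z(1) sub obtain x where x: "x \<in> supp \<phi>" "z = stretch (1 / r) x" unfolding K_def by blast
    then have sz: "stretch r z = x" using stretch_inverse[of "1 / r" x] r by simp
    have "x \<in> frontier (Dm (r * c))"
      using z(2) cl[of z] stretch_mem[OF r, of z c] unfolding frontier_dom_eq sz by blast
    moreover have "x \<notin> Gamma0 \<omega>"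
      using z(3) r unfolding sz[symmetric] by (cases z) (auto simp: Gamma0_def stretch_def)
    ultimately show False using x(1) test_fieldD(3)[OF \<phi>] by blast
  qed
  then show ?thesis unfolding test_field_def
    using compact_suppI[OF K sub] pd_stretch(1)[OF test_fieldD(1)[OF \<phi>]] by blast
qed

lemma lebesgue_stretch:
  assumes r: "0 < r"
  shows "stretch r \<in> lebesgue \<rightarrow>\<^sub>M lebesgue"
    and "(lebesgue :: pt measure) = density (distr lebesgue lebesgue (stretch r)) (\<lambda>_. ennreal r)"
proof -
  \<comment> \<open>Coordinatewise scaling factors: the dilation is a diagonal affine map with
    determinant \<open>r\<close>, so the general affine change of variables applies.\<close>
  define k where "k j = (if j = e3 then r else 1)" for j :: pt
  have k0: "\<And>j. j \<in> Basis \<Longrightarrow> k j \<noteq> 0" using r by (simp add: k_def)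
  have T: "(\<lambda>x. 0 + (\<Sum>j\<in>Basis. (k j * (x \<bullet> j)) *\<^sub>R j)) = stretch r"
  proof
    fix x :: pt
    have "(0 + (\<Sum>j\<in>Basis. (k j * (x \<bullet> j)) *\<^sub>R j)) = (\<Sum>j\<in>Basis. (stretch r x \<bullet> j) *\<^sub>R j)"
    proof (simp, intro sum.cong refl)
      fix j :: pt assume j: "j \<in> Basis"
      have "k j * (x \<bullet> j) = stretch r x \<bullet> j"
      proof (cases "j = e3")
        case True then show ?thesis by (simp add: k_def inner_e3)
      next
        case False
        then have "snd j = 0" using j by (intro snd_hor) (simp add: hor_def)
        then show ?thesis using False by (simp add: k_def inner_prod_def)
      qed
      then show "(k j * (x \<bullet> j)) *\<^sub>R j = (stretch r x \<bullet> j) *\<^sub>R j" by simp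
    qed
    then show "(0 + (\<Sum>j\<in>Basis. (k j * (x \<bullet> j)) *\<^sub>R j)) = stretch r x" by (simp add: euclidean_representation)
  qed
  have P: "(\<Prod>j\<in>Basis. \<bar>k j\<bar>) = r"
    unfolding Basis_hor(1) using r Basis_hor(2,3) by (simp add: k_def)
  show "stretch r \<in> lebesgue \<rightarrow>\<^sub>M lebesgue"
    using lebesgue_affine_measurable[of k 0, OF k0] unfolding T .
  show "(lebesgue :: pt measure) = density (distr lebesgue lebesgue (stretch r)) (\<lambda>_. ennreal r)"
    using lebesgue_affine_euclidean[of k 0, OF k0] unfolding T P .
qed

lemma stretch_integral_lebesgue:
  fixes F :: "pt \<Rightarrow> 'b::euclidean_space"
  assumes r: "0 < r" and F: "F \<in> borel_measurable lebesgue"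
  shows "integrable lebesgue F \<longleftrightarrow> integrable lebesgue (\<lambda>z. F (stretch r z))"
    and "integral\<^sup>L lebesgue F = r *\<^sub>R (\<integral>z. F (stretch r z) \<partial>lebesgue)"
proof -
  note m = lebesgue_stretch(1)[OF r] and eq = lebesgue_stretch(2)[OF r]
  have Fd: "F \<in> borel_measurable (distr lebesgue lebesgue (stretch r))" using F by simp
  have "integrable lebesgue F \<longleftrightarrow> integrable (density (distr lebesgue lebesgue (stretch r)) (\<lambda>_. ennreal r)) F"
    using eq by simp
  also have "\<dots> \<longleftrightarrow> integrable (distr lebesgue lebesgue (stretch r)) (\<lambda>x. r *\<^sub>R F x)"
    by (rule integrable_density) (use r Fd in auto)
  also have "\<dots> \<longleftrightarrow> integrable lebesgue (\<lambda>z. r *\<^sub>R F (stretch r z))"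
    by (rule integrable_distr_eq[OF m]) (use F in measurable)
  also have "\<dots> \<longleftrightarrow> integrable lebesgue (\<lambda>z. F (stretch r z))"
  proof
    assume "integrable lebesgue (\<lambda>z. r *\<^sub>R F (stretch r z))"
    from integrable_scaleR_right[OF this, of "1 / r"] show "integrable lebesgue (\<lambda>z. F (stretch r z))"
      using r by simp
  qed (rule integrable_scaleR_right)
  finally show "integrable lebesgue F \<longleftrightarrow> integrable lebesgue (\<lambda>z. F (stretch r z))" .
  have "integral\<^sup>L lebesgue F = integral\<^sup>L (density (distr lebesgue lebesgue (stretch r)) (\<lambda>_. ennreal r)) F"
    using eq by simp
  also have "\<dots> = integral\<^sup>L (distr lebesgue lebesgue (stretch r)) (\<lambda>x. r *\<^sub>R F x)"
    by (rule integral_density) (use r Fd in auto)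
  also have "\<dots> = (\<integral>z. r *\<^sub>R F (stretch r z) \<partial>lebesgue)"
    by (rule integral_distr[OF m]) (use F in measurable)
  finally show "integral\<^sup>L lebesgue F = r *\<^sub>R (\<integral>z. F (stretch r z) \<partial>lebesgue)" by simp
qed

lemma stretch_measurable:
  assumes r: "0 < r" and F: "F \<in> borel_measurable (Mdom r)"
  shows "(\<lambda>z. F (stretch r z)) \<in> borel_measurable (Mdom 1)"
proof (rule measurable_compose[OF _ F])
  show "stretch r \<in> measurable (Mdom 1) (Mdom r)"
  proof (rule measurable_restrict_space2)
    show "stretch r \<in> space (Mdom 1) \<rightarrow> Dm r"
      using stretch_mem[OF r, of _ 1] by (auto simp: space_restrict_space)
    show "stretch r \<in> Mdom 1 \<rightarrow>\<^sub>M lebesgue"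
      by (rule measurable_restrict_space1[OF lebesgue_stretch(1)[OF r]])
  qed
qed

lemma stretch_integral:
  fixes F :: "pt \<Rightarrow> 'b::euclidean_space"
  assumes r: "0 < r" and F: "F \<in> borel_measurable (Mdom r)"
  shows "integrable (Mdom r) F \<longleftrightarrow> integrable (Mdom 1) (\<lambda>z. F (stretch r z))"
    and "integral\<^sup>L (Mdom r) F = r *\<^sub>R (\<integral>z. F (stretch r z) \<partial>Mdom 1)"
proof -
  define G where "G x = indicator (Dm r) x *\<^sub>R F x" for x
  have G: "G \<in> borel_measurable lebesgue"
    using F sets_dom unfolding G_def by (simp add: borel_measurable_restrict_space_iff)
  have Gs: "G (stretch r z) = indicator (Dm 1) z *\<^sub>R F (stretch r z)" for z
    using stretch_mem[OF r, of z 1] by (simp add: G_def indicator_def)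
  show "integrable (Mdom r) F \<longleftrightarrow> integrable (Mdom 1) (\<lambda>z. F (stretch r z))"
    using stretch_integral_lebesgue(1)[OF r G] sets_dom unfolding Gs
    by (simp add: integrable_restrict_space G_def[abs_def])
  show "integral\<^sup>L (Mdom r) F = r *\<^sub>R (\<integral>z. F (stretch r z) \<partial>Mdom 1)"
    using stretch_integral_lebesgue(2)[OF r G] sets_dom unfolding Gs
    by (simp add: integral_restrict_space G_def[abs_def])
qed

lemma stretch_AE:
  assumes r: "0 < r" and P: "AE x in Mdom r. P x" shows "AE z in Mdom 1. P (stretch r z)"
proof -
  have "AE x in lebesgue. x \<in> Dm r \<longrightarrow> P x" using P unfolding AE_lebesgue_on_iff[OF sets_dom] .
  then have "AE x in density (distr lebesgue lebesgue (stretch r)) (\<lambda>_. ennreal r). x \<in> Dm r \<longrightarrow> P x"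
    by (subst lebesgue_stretch(2)[OF r, symmetric])
  then have "AE x in distr lebesgue lebesgue (stretch r). x \<in> Dm r \<longrightarrow> P x"
    using r by (subst (asm) AE_density) auto
  then have "AE z in lebesgue. stretch r z \<in> Dm r \<longrightarrow> P (stretch r z)"
    by (rule AE_distrD[OF lebesgue_stretch(1)[OF r]])
  then show ?thesis unfolding AE_lebesgue_on_iff[OF sets_dom]
    using stretch_mem[OF r, of _ 1] by (auto elim!: eventually_mono)
qed

lemma stretch_sqi:
  fixes F :: "pt \<Rightarrow> 'b::euclidean_space"
  assumes r: "0 < r" and F: "sqi (Mdom r) F" shows "sqi (Mdom 1) (\<lambda>z. F (stretch r z))"
  unfolding sqi_def
proof
  show "(\<lambda>z. F (stretch r z)) \<in> borel_measurable (Mdom 1)" by (rule stretch_measurable[OF r sqiD(1)[OF F]])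
  have "(\<lambda>x. (norm (F x))\<^sup>2) \<in> borel_measurable (Mdom r)" using sqiD(1)[OF F] by measurable
  from stretch_integral(1)[OF r this] show "integrable (Mdom 1) (\<lambda>z. (norm (F (stretch r z)))\<^sup>2)"
    using sqiD(2)[OF F] by simp
qed

end

lemma in_supp: "f x \<noteq> 0 \<Longrightarrow> x \<in> supp f"
  using not_in_supp(1) by metis

lemma sqi_scaleR_integrable:
  fixes a :: "'a \<Rightarrow> real" and X :: "'a \<Rightarrow> 'b::euclidean_space"
  assumes "sqi M a" "sqi M X" shows "integrable M (\<lambda>x. a x *\<^sub>R X x)"
  by (rule sqi_mult_bound_integrable[OF assms, of _ 1]) (use assms[THEN sqiD(1)] in \<open>auto intro: AE_I2\<close>)

lemma integral_scaleR_inner: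
  fixes a :: "'a \<Rightarrow> real" and X :: "'a \<Rightarrow> 'b::euclidean_space"
  assumes "sqi M a" "sqi M X"
  shows "(\<integral>x. a x *\<^sub>R X x \<partial>M) \<bullet> b = (\<integral>x. X x \<bullet> (a x *\<^sub>R b) \<partial>M)"
proof -
  have "(\<integral>x. a x *\<^sub>R X x \<partial>M) \<bullet> b = (\<integral>x. (a x *\<^sub>R X x) \<bullet> b \<partial>M)"
    by (rule integral_inner_left[symmetric]) (rule sqi_scaleR_integrable[OF assms])
  then show ?thesis by simp
qed

lemma sqi_scaleR_const: "sqi M a \<Longrightarrow> sqi M (\<lambda>x. a x *\<^sub>R b)" for a :: "'a \<Rightarrow> real" and b :: "'b::euclidean_space"
  by (erule sqi_linear) (rule bounded_linear_scaleR_left)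

lemma sqi_scaleR_tendsto:
  fixes a :: "'a \<Rightarrow> real" and X :: "nat \<Rightarrow> 'a \<Rightarrow> 'b::euclidean_space"
  assumes X: "\<And>k. sqi M (X k)" "sqi M Y" and a: "sqi M a"
    and c: "(\<lambda>k. \<integral>x. (norm (X k x - Y x))\<^sup>2 \<partial>M) \<longlonglongrightarrow> 0"
  shows "(\<lambda>k. \<integral>x. a x *\<^sub>R X k x \<partial>M) \<longlonglongrightarrow> (\<integral>x. a x *\<^sub>R Y x \<partial>M)"
proof (subst tendsto_componentwise_iff, intro ballI)
  fix b :: 'b
  show "(\<lambda>k. (\<integral>x. a x *\<^sub>R X k x \<partial>M) \<bullet> b) \<longlonglongrightarrow> (\<integral>x. a x *\<^sub>R Y x \<partial>M) \<bullet> b"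
    unfolding integral_scaleR_inner[OF a X(1)] integral_scaleR_inner[OF a X(2)]
    by (rule sqi_inner_tendsto[OF X sqi_scaleR_const[OF a] c])
qed

lemma weak_deriv_C1:
  fixes \<phi> :: "'a::euclidean_space \<Rightarrow> 'b::euclidean_space"
  assumes \<phi>: "C1fun \<phi>" and s: "sqi (lebesgue_on S) \<phi>" "sqi (lebesgue_on S) (pd \<phi> v)" and S: "open S"
    and S\<psi>: "\<And>\<psi>::'a \<Rightarrow> real. C1fun \<psi> \<Longrightarrow> compact (supp \<psi>) \<Longrightarrow> sqi (lebesgue_on S) \<psi> \<and> sqi (lebesgue_on S) (pd \<psi> v)"
  shows "weak_deriv S v \<phi> (pd \<phi> v)"
  unfolding weak_deriv_def
proof (intro allI impI)
  fix \<psi> :: "'a \<Rightarrow> real" assume \<psi>: "C1fun \<psi> \<and> compact (supp \<psi>) \<and> supp \<psi> \<subseteq> S"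
  then have \<psi>1: "C1fun \<psi>" "compact (supp \<psi>)" "supp \<psi> \<subseteq> S" by auto
  have Sm: "S \<in> sets lebesgue" using S by auto
  let ?G = "\<lambda>x. \<psi> x *\<^sub>R \<phi> x"
  have sub: "supp ?G \<subseteq> supp \<psi>"
  proof (rule supp_subsetI[OF closed_supp])
    fix x assume "?G x \<noteq> 0" then show "x \<in> supp \<psi>" using not_in_supp(1)[of x \<psi>] by auto
  qed
  have GC: "C1fun ?G" and Gpd: "\<And>x. pd ?G v x = \<psi> x *\<^sub>R pd \<phi> v x + pd \<psi> v x *\<^sub>R \<phi> x"
    using C1fun_scaleR[OF \<psi>1(1) \<phi>] by auto
  have [measurable]: "S \<in> sets borel" "pd ?G v \<in> borel_measurable borel"
    using S borel_measurable_continuous_onI[OF C1fun_continuous_pd[OF GC]] by auto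
  have "(\<integral>x. indicator S x *\<^sub>R pd ?G v x \<partial>lborel) = 0"
    by (rule integral_pd_eq_0_supp[OF GC compact_suppI[OF \<psi>1(2) sub] S order_trans[OF sub \<psi>1(3)]])
  moreover have "(\<integral>x. indicator S x *\<^sub>R pd ?G v x \<partial>lebesgue) = (\<integral>x. indicator S x *\<^sub>R pd ?G v x \<partial>lborel)"
    by (rule integral_completion) simp
  ultimately have "(\<integral>x. \<psi> x *\<^sub>R pd \<phi> v x + pd \<psi> v x *\<^sub>R \<phi> x \<partial>lebesgue_on S) = 0"
    using integral_lebesgue_on_eq[OF Sm, of "pd ?G v"] unfolding set_lebesgue_integral_def Gpd by simp
  moreover have "(\<integral>x. \<psi> x *\<^sub>R pd \<phi> v x + pd \<psi> v x *\<^sub>R \<phi> x \<partial>lebesgue_on S)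
      = (\<integral>x. \<psi> x *\<^sub>R pd \<phi> v x \<partial>lebesgue_on S) + (\<integral>x. pd \<psi> v x *\<^sub>R \<phi> x \<partial>lebesgue_on S)"
    by (rule Bochner_Integration.integral_add)
       (intro sqi_scaleR_integrable s conjunct1[OF S\<psi>[OF \<psi>1(1,2)]] conjunct2[OF S\<psi>[OF \<psi>1(1,2)]])+
  ultimately show "SInt S (\<lambda>x. pd \<psi> v x *\<^sub>R \<phi> x) = - SInt S (\<lambda>x. \<psi> x *\<^sub>R pd \<phi> v x)"
    by (simp add: integral_lebesgue_on_eq[OF Sm] add_eq_0_iff)
qed

text \<open>Needed to identify the vertical derivative supplied with the convergence hypothesis with
  the one obtained by rescaling the gradient of the solution.\<close>

lemma weak_deriv_unique:
  fixes d d' :: "'a::euclidean_space \<Rightarrow> 'b::euclidean_space"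
  assumes S: "open S" "S \<in> lmeasurable" and d: "sqi (lebesgue_on S) d" "sqi (lebesgue_on S) d'"
    and w: "weak_deriv S v w d" "weak_deriv S v w d'"
    and S\<psi>: "\<And>\<psi>::'a \<Rightarrow> real. C1fun \<psi> \<Longrightarrow> compact (supp \<psi>) \<Longrightarrow> sqi (lebesgue_on S) \<psi>"
  shows "AE x in lebesgue_on S. d x = d' x"
proof -
  have Sm: "S \<in> sets lebesgue" using S by auto
  interpret finite_measure "lebesgue_on S" by (rule finite_measure_lebesgue_on[OF S(2)])
  have "AE x in lebesgue. x \<in> S \<longrightarrow> d x - d' x = 0"
  proof (rule fundamental_lemma[OF S(1)])
    show "integrable (lebesgue_on S) (\<lambda>x. d x - d' x)" by (intro sqi_integrable sqi_diff d)
    fix \<psi> :: "'a \<Rightarrow> real" assume \<psi>: "C1fun \<psi>" "compact (supp \<psi>)" "supp \<psi> \<subseteq> S"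
    then have "SInt S (\<lambda>x. \<psi> x *\<^sub>R d x) = SInt S (\<lambda>x. \<psi> x *\<^sub>R d' x)"
      using w unfolding weak_deriv_def by (metis neg_equal_iff_equal)
    moreover have "(\<integral>x. \<psi> x *\<^sub>R (d x - d' x) \<partial>lebesgue_on S)
        = (\<integral>x. \<psi> x *\<^sub>R d x \<partial>lebesgue_on S) - (\<integral>x. \<psi> x *\<^sub>R d' x \<partial>lebesgue_on S)"
      unfolding scaleR_diff_right
      by (rule Bochner_Integration.integral_diff) (intro sqi_scaleR_integrable d S\<psi> \<psi>)+
    ultimately show "SInt S (\<lambda>x. \<psi> x *\<^sub>R (d x - d' x)) = 0"
      by (simp add: integral_lebesgue_on_eq[OF Sm])
  qed
  then show ?thesis unfolding AE_lebesgue_on_iff[OF Sm] by (auto elim!: eventually_mono)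
qed

section \<open>Closures of test fields and integrated boundary conditions\<close>

context thin_domain
begin

abbreviation "M1 \<equiv> lebesgue_on (Omega_eps \<omega> h 1)"

lemma C1_sqi_Mdom: "0 < c \<Longrightarrow> C1fun \<phi> \<Longrightarrow> compact (supp \<phi>) \<Longrightarrow> sqi (Mdom c) \<phi>"
  and C1_sqi_Mdom_pd: "0 < c \<Longrightarrow> C1fun \<phi> \<Longrightarrow> compact (supp \<phi>) \<Longrightarrow> sqi (Mdom c) (pd \<phi> v)"
  by (intro C1fun_sqi lmeasurable_dom; assumption)+

lemma test_field_scaleR:
  fixes \<psi> :: "pt \<Rightarrow> real" and \<phi> :: "pt \<Rightarrow> 'b::euclidean_space"
  assumes "C1fun \<psi>" "C1fun \<phi>" "test_field c \<psi> \<or> test_field c \<phi>"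
  shows "test_field c (\<lambda>x. \<psi> x *\<^sub>R \<phi> x)"
proof -
  have C: "C1fun (\<lambda>x. \<psi> x *\<^sub>R \<phi> x)" by (rule C1fun_scaleR(1)[OF assms(1,2)])
  have 1: "supp (\<lambda>x. \<psi> x *\<^sub>R \<phi> x) \<subseteq> supp \<psi>"
    by (rule supp_subsetI[OF closed_supp in_supp]) auto
  have 2: "supp (\<lambda>x. \<psi> x *\<^sub>R \<phi> x) \<subseteq> supp \<phi>"
    by (rule supp_subsetI[OF closed_supp in_supp]) auto
  show ?thesis using assms(3) test_field_subset[OF C 1] test_field_subset[OF C 2] by blast
qed

lemma bottom_sqi:
  fixes \<phi> :: "pt \<Rightarrow> 'b::euclidean_space"
  assumes "C1fun \<phi>" "compact (supp \<phi>)" shows "sqi Mb (\<lambda>y. \<phi> (y, 0))"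
proof -
  interpret finite_measure Mb by (rule finite_Mb)
  obtain C where "\<And>x. norm (\<phi> x) \<le> C" using C1fun_bounded[OF assms] by auto
  moreover have "(\<lambda>y. \<phi> (y, 0)) \<in> borel_measurable Mb"
  proof (intro measurable_restrict_space1 measurable_completion)
    have "continuous_on UNIV (\<lambda>y. \<phi> (y, 0))"
      by (rule continuous_on_compose2[OF C1fun_continuous[OF assms(1), of UNIV]]) (auto intro!: continuous_intros)
    then show "(\<lambda>y. \<phi> (y, 0)) \<in> borel_measurable lborel" using borel_measurable_continuous_onI by simp
  qed
  ultimately show ?thesis by (intro sqi_bounded[of _ C] AE_I2)
qed

lemma vertical_by_parts:
  fixes \<psi> :: "pt \<Rightarrow> real" and \<phi> :: "pt \<Rightarrow> 'b::euclidean_space"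
  assumes "C1fun \<psi>" "C1fun \<phi>" "test_field c \<psi> \<or> test_field c \<phi>" "0 < c"
  shows "SInt (Dm c) (\<lambda>x. \<psi> x *\<^sub>R pd \<phi> e3 x + pd \<psi> e3 x *\<^sub>R \<phi> x) = - SInt \<omega> (\<lambda>y. \<psi> (y, 0) *\<^sub>R \<phi> (y, 0))"
  using vertical_integral_dom[OF test_field_scaleR[OF assms(1-3)] assms(4)]
  unfolding C1fun_scaleR(2)[OF assms(1,2), abs_def] by simp

lemma trace_Gamma0_C1:
  fixes \<phi> :: "pt \<Rightarrow> 'b::euclidean_space"
  assumes "C1fun \<phi>" "compact (supp \<phi>)" "0 < c"
  shows "trace_Gamma0 \<omega> (Dm c) \<phi> (pd \<phi> e3) (\<lambda>y. \<phi> (y, 0))"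
  unfolding trace_Gamma0_def L2_iff_sqi[OF sets_base]
  using bottom_sqi[OF assms(1,2)] vertical_by_parts[OF _ assms(1) _ assms(3)] unfolding test_field_def by blast

lemma admissible_iff: "admissible \<omega> h c \<phi> \<longleftrightarrow> test_field c \<phi> \<and> (\<forall>y\<in>\<omega>. snd (\<phi> (y, 0)) = 0)"
  by (auto simp: admissible_def test_field_def)

lemma in_V_C1:
  assumes "admissible \<omega> h c \<phi>" "0 < c"
  shows "in_V \<omega> h c \<phi> (pd \<phi>)"
proof -
  have C: "C1fun \<phi>" "compact (supp \<phi>)" using assms(1) by (auto simp: admissible_def)
  have "weak_deriv (Dm c) b \<phi> (pd \<phi> b)" for b
    by (rule weak_deriv_C1[OF C(1) C1_sqi_Mdom[OF assms(2) C] C1_sqi_Mdom_pd[OF assms(2) C] open_dom])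
       (intro conjI C1fun_sqi lmeasurable_dom assms(2))
  then have "H1 (Dm c) \<phi> (pd \<phi>)"
    unfolding H1_def using C1_sqi_Mdom[OF assms(2) C] C1_sqi_Mdom_pd[OF assms(2) C] by (simp add: L2_iff_sqi[OF sets_dom])
  then show ?thesis
    unfolding in_V_def Let_def by (intro conjI exI[of _ "\<lambda>_. \<phi>"] allI assms(1)) (simp_all add: set_lebesgue_integral_def)
qed

lemma vtrace_scaleR:
  fixes d :: "pt \<Rightarrow> 'b::euclidean_space" and a :: "real^2 \<Rightarrow> real"
  assumes d: "sqi M1 d" and a: "sqi Mb a"
  shows "(\<integral>y. a y *\<^sub>R vtrace d y \<partial>Mb) = - (\<integral>z. a (fst z) *\<^sub>R d z \<partial>M1)"
proof (rule euclidean_eqI)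
  fix b :: 'b
  have a1: "sqi M1 (\<lambda>z. a (fst z))" by (rule sqi_fst_dom[OF a]) simp
  show "(\<integral>y. a y *\<^sub>R vtrace d y \<partial>Mb) \<bullet> b = (- (\<integral>z. a (fst z) *\<^sub>R d z \<partial>M1)) \<bullet> b"
    using vtrace_inner[OF d sqi_scaleR_const[OF a, of b]]
    unfolding inner_minus_left integral_scaleR_inner[OF a vtrace_bound(1)[OF d]] integral_scaleR_inner[OF a1 d]
    by (simp only: inner_commute)
qed

text \<open>Closure of the test fields in the graph norm of the vertical derivative alone.
  Membership carries the homogeneous condition on the upper boundary without any trace operator:
  each boundary identity is proved for C1 fields and extended by density.\<close>

definition vapprox :: "(pt \<Rightarrow> 'b::euclidean_space) \<Rightarrow> (pt \<Rightarrow> 'b) \<Rightarrow> bool" where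
  "vapprox w d \<longleftrightarrow> sqi M1 w \<and> sqi M1 d \<and> (\<exists>\<phi>. (\<forall>n. test_field 1 (\<phi> n)) \<and>
     (\<lambda>n. \<integral>z. (norm (\<phi> n z - w z))\<^sup>2 \<partial>M1) \<longlonglongrightarrow> 0 \<and> (\<lambda>n. \<integral>z. (norm (pd (\<phi> n) e3 z - d z))\<^sup>2 \<partial>M1) \<longlonglongrightarrow> 0)"

lemma vapprox_ex:
  assumes "vapprox w d"
  shows "\<exists>\<phi>. (\<forall>n. test_field 1 (\<phi> n) \<and> sqi M1 (\<phi> n) \<and> sqi M1 (pd (\<phi> n) e3)) \<and>
    (\<lambda>n. \<integral>z. (norm (\<phi> n z - w z))\<^sup>2 \<partial>M1) \<longlonglongrightarrow> 0 \<and>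
    (\<lambda>n. \<integral>z. (norm (pd (\<phi> n) e3 z - d z))\<^sup>2 \<partial>M1) \<longlonglongrightarrow> 0"
proof -
  obtain \<phi> where \<phi>: "\<forall>n. test_field 1 (\<phi> n)"
    "(\<lambda>n. \<integral>z. (norm (\<phi> n z - w z))\<^sup>2 \<partial>M1) \<longlonglongrightarrow> 0" "(\<lambda>n. \<integral>z. (norm (pd (\<phi> n) e3 z - d z))\<^sup>2 \<partial>M1) \<longlonglongrightarrow> 0"
    using assms unfolding vapprox_def by blast
  then have t: "test_field 1 (\<phi> n)" for n by blast
  have "sqi M1 (\<phi> n)" "sqi M1 (pd (\<phi> n) e3)" for n
    by (intro C1_sqi_Mdom C1_sqi_Mdom_pd test_fieldD[OF t] zero_less_one)+
  then show ?thesis using \<phi> by blast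
qed

lemma vapproxD: "vapprox w d \<Longrightarrow> sqi M1 w" "vapprox w d \<Longrightarrow> sqi M1 d"
  unfolding vapprox_def by auto

text \<open>Identities linear in the field and its vertical derivative, with square-integrable
  multipliers, extend to the closure. The boundary identities are written without boundary integrals
  precisely so that they fit this pattern.\<close>

lemma vapprox_limit:
  fixes w d :: "pt \<Rightarrow> 'b::euclidean_space"
  assumes wd: "vapprox w d" and a: "sqi M1 a" "sqi M1 b" "sqi M1 c"
    and eq: "\<And>\<phi> :: pt \<Rightarrow> 'b. test_field 1 \<phi> \<Longrightarrow> (\<integral>z. a z *\<^sub>R pd \<phi> e3 z \<partial>M1) + (\<integral>z. b z *\<^sub>R \<phi> z \<partial>M1) = (\<integral>z. c z *\<^sub>R pd \<phi> e3 z \<partial>M1)"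
  shows "(\<integral>z. a z *\<^sub>R d z + b z *\<^sub>R w z \<partial>M1) = (\<integral>z. c z *\<^sub>R d z \<partial>M1)"
proof -
  obtain \<phi> where \<phi>0: "\<forall>n. test_field 1 (\<phi> n) \<and> sqi M1 (\<phi> n) \<and> sqi M1 (pd (\<phi> n) e3)"
    and \<phi>l: "(\<lambda>n. \<integral>z. (norm (\<phi> n z - w z))\<^sup>2 \<partial>M1) \<longlonglongrightarrow> 0"
      "(\<lambda>n. \<integral>z. (norm (pd (\<phi> n) e3 z - d z))\<^sup>2 \<partial>M1) \<longlonglongrightarrow> 0"
    using vapprox_ex[OF wd] by blast
  note \<phi> = \<phi>0[THEN spec, THEN conjunct1] \<phi>0[THEN spec, THEN conjunct2, THEN conjunct1]
    \<phi>0[THEN spec, THEN conjunct2, THEN conjunct2] \<phi>l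
  note sq = vapproxD[OF wd]
  have "(\<lambda>n. (\<integral>z. a z *\<^sub>R pd (\<phi> n) e3 z \<partial>M1) + (\<integral>z. b z *\<^sub>R \<phi> n z \<partial>M1)) \<longlonglongrightarrow> (\<integral>z. a z *\<^sub>R d z \<partial>M1) + (\<integral>z. b z *\<^sub>R w z \<partial>M1)"
    by (intro tendsto_add sqi_scaleR_tendsto \<phi> a sq)
  moreover have "(\<lambda>n. (\<integral>z. c z *\<^sub>R pd (\<phi> n) e3 z \<partial>M1)) \<longlonglongrightarrow> (\<integral>z. c z *\<^sub>R d z \<partial>M1)"
    by (intro sqi_scaleR_tendsto \<phi> a sq)
  ultimately have "(\<integral>z. a z *\<^sub>R d z \<partial>M1) + (\<integral>z. b z *\<^sub>R w z \<partial>M1) = (\<integral>z. c z *\<^sub>R d z \<partial>M1)"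
    unfolding eq[OF \<phi>(1)] by (rule LIMSEQ_unique)
  then show ?thesis by (simp add: sqi_scaleR_integrable a sq)
qed

text \<open>The right-hand side is the bottom term rewritten with the adjoint of
  \<open>vtrace\<close>, so it makes sense, and is continuous, for every square-integrable
  \<open>d\<close>.\<close>

lemma vapprox_trace:
  fixes w d :: "pt \<Rightarrow> 'b::euclidean_space" and \<psi> :: "pt \<Rightarrow> real"
  assumes wd: "vapprox w d" and \<psi>: "test_field 1 \<psi>"
  shows "(\<integral>z. \<psi> z *\<^sub>R d z + pd \<psi> e3 z *\<^sub>R w z \<partial>M1) = (\<integral>z. \<psi> (fst z, 0) *\<^sub>R d z \<partial>M1)"
proof (rule vapprox_limit[OF wd])
  note C = test_fieldD(1,2)[OF \<psi>]
  have s\<psi>: "sqi M1 \<psi>" "sqi M1 (pd \<psi> e3)" by (intro C1_sqi_Mdom C1_sqi_Mdom_pd C; simp)+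
  then show "sqi M1 \<psi>" "sqi M1 (pd \<psi> e3)" .
  have b\<psi>: "sqi Mb (\<lambda>y. \<psi> (y, 0))" by (rule bottom_sqi[OF C])
  show "sqi M1 (\<lambda>z. \<psi> (fst z, 0))" by (rule sqi_fst_dom[OF b\<psi>]) simp
  fix \<phi> :: "pt \<Rightarrow> 'b" assume \<phi>: "test_field 1 \<phi>"
  note C' = test_fieldD(1,2)[OF \<phi>]
  have s\<phi>: "sqi M1 \<phi>" "sqi M1 (pd \<phi> e3)" by (intro C1_sqi_Mdom C1_sqi_Mdom_pd C'; simp)+
  have "(\<integral>z. \<psi> z *\<^sub>R pd \<phi> e3 z \<partial>M1) + (\<integral>z. pd \<psi> e3 z *\<^sub>R \<phi> z \<partial>M1)
      = (\<integral>z. \<psi> z *\<^sub>R pd \<phi> e3 z + pd \<psi> e3 z *\<^sub>R \<phi> z \<partial>M1)"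
    by (simp add: sqi_scaleR_integrable s\<psi> s\<phi>)
  also have "\<dots> = - (\<integral>y. \<psi> (y, 0) *\<^sub>R \<phi> (y, 0) \<partial>Mb)"
    using vertical_by_parts[OF C(1) C'(1), of 1] \<psi>
    by (simp add: integral_lebesgue_on_eq[OF sets_dom] integral_lebesgue_on_eq[OF sets_base])
  also have "(\<integral>y. \<psi> (y, 0) *\<^sub>R \<phi> (y, 0) \<partial>Mb) = (\<integral>y. \<psi> (y, 0) *\<^sub>R vtrace (pd \<phi> e3) y \<partial>Mb)"
    by (rule Bochner_Integration.integral_cong) (auto simp: vtrace_pd[OF \<phi>] space_restrict_space)
  also have "- \<dots> = (\<integral>z. \<psi> (fst z, 0) *\<^sub>R pd \<phi> e3 z \<partial>M1)"
    using vtrace_scaleR[OF s\<phi>(2) b\<psi>] by simp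
  finally show "(\<integral>z. \<psi> z *\<^sub>R pd \<phi> e3 z \<partial>M1) + (\<integral>z. pd \<psi> e3 z *\<^sub>R \<phi> z \<partial>M1) = (\<integral>z. \<psi> (fst z, 0) *\<^sub>R pd \<phi> e3 z \<partial>M1)" .
qed

text \<open>Here \<psi> may be nonzero on the upper boundary, where the approximating fields vanish,
  and it is zero on the bottom, where they need not vanish. Every boundary term of the product is
  therefore zero.\<close>

lemma vapprox_top:
  fixes w d :: "pt \<Rightarrow> 'b::euclidean_space" and \<psi> :: "pt \<Rightarrow> real"
  assumes wd: "vapprox w d" and \<psi>: "C1fun \<psi>" "compact (supp \<psi>)" "supp \<psi> \<inter> (frontier (Dm 1) - Gamma1 \<omega> h) = {}"
  shows "(\<integral>z. \<psi> z *\<^sub>R d z + pd \<psi> e3 z *\<^sub>R w z \<partial>M1) = 0"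
proof -
  have s\<psi>: "sqi M1 \<psi>" "sqi M1 (pd \<psi> e3)" by (intro C1_sqi_Mdom C1_sqi_Mdom_pd \<psi>; simp)+
  have "(\<integral>z. \<psi> z *\<^sub>R d z + pd \<psi> e3 z *\<^sub>R w z \<partial>M1) = (\<integral>z. 0 *\<^sub>R d z \<partial>M1)"
  proof (rule vapprox_limit[OF wd s\<psi> sqi_zero])
    fix \<phi> :: "pt \<Rightarrow> 'b" assume \<phi>: "test_field 1 \<phi>"
    note C' = test_fieldD(1,2)[OF \<phi>]
    have s\<phi>: "sqi M1 \<phi>" "sqi M1 (pd \<phi> e3)" by (intro C1_sqi_Mdom C1_sqi_Mdom_pd C'; simp)+
    have "\<psi> (y, 0) = 0" if "y \<in> \<omega>" for y
    proof (rule not_in_supp(1)[of "(y, 0)" \<psi>])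
      have "(y, 0) \<in> frontier (Dm 1) - Gamma1 \<omega> h"
        using bottom_in_frontier[of 1 y] that h_pos[OF that] by (simp add: Gamma1_def)
      then show "(y, 0) \<notin> supp \<psi>" using \<psi>(3) by blast
    qed
    then have "(\<integral>y. \<psi> (y, 0) *\<^sub>R \<phi> (y, 0) \<partial>Mb) = (\<integral>y. 0 \<partial>Mb)"
      by (intro Bochner_Integration.integral_cong) (auto simp: space_restrict_space)
    moreover have "(\<integral>z. \<psi> z *\<^sub>R pd \<phi> e3 z + pd \<psi> e3 z *\<^sub>R \<phi> z \<partial>M1) = - (\<integral>y. \<psi> (y, 0) *\<^sub>R \<phi> (y, 0) \<partial>Mb)"
      using vertical_by_parts[OF \<psi>(1) C'(1), of 1] \<phi>
      by (simp add: integral_lebesgue_on_eq[OF sets_dom] integral_lebesgue_on_eq[OF sets_base])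
    ultimately show "(\<integral>z. \<psi> z *\<^sub>R pd \<phi> e3 z \<partial>M1) + (\<integral>z. pd \<psi> e3 z *\<^sub>R \<phi> z \<partial>M1) = (\<integral>z. 0 *\<^sub>R pd \<phi> e3 z \<partial>M1)"
      by (simp add: sqi_scaleR_integrable s\<psi> s\<phi>)
  qed
  then show ?thesis by simp
qed

lemma vapprox_weak_deriv:
  fixes w d :: "pt \<Rightarrow> 'b::euclidean_space"
  assumes wd: "vapprox w d" shows "weak_deriv (Dm 1) e3 w d"
  unfolding weak_deriv_def
proof (intro allI impI)
  fix \<psi> :: "pt \<Rightarrow> real" assume \<psi>: "C1fun \<psi> \<and> compact (supp \<psi>) \<and> supp \<psi> \<subseteq> Dm 1"
  then have C: "C1fun \<psi>" "compact (supp \<psi>)" and sub: "supp \<psi> \<subseteq> Dm 1" by auto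
  have s\<psi>: "sqi M1 \<psi>" "sqi M1 (pd \<psi> e3)" by (intro C1_sqi_Mdom C1_sqi_Mdom_pd C zero_less_one)+
  have "supp \<psi> \<inter> (frontier (Dm 1) - Gamma1 \<omega> h) = {}"
    using sub unfolding frontier_dom_eq by blast
  then have "(\<integral>z. \<psi> z *\<^sub>R d z + pd \<psi> e3 z *\<^sub>R w z \<partial>M1) = 0" by (rule vapprox_top[OF wd C])
  then have "(\<integral>z. \<psi> z *\<^sub>R d z \<partial>M1) + (\<integral>z. pd \<psi> e3 z *\<^sub>R w z \<partial>M1) = 0"
    by (simp add: sqi_scaleR_integrable s\<psi> vapproxD[OF wd])
  then show "SInt (Dm 1) (\<lambda>x. pd \<psi> e3 x *\<^sub>R w x) = - SInt (Dm 1) (\<lambda>x. \<psi> x *\<^sub>R d x)"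
    by (simp add: integral_lebesgue_on_eq[OF sets_dom] add_eq_0_iff)
qed

end

lemma sqi_norm_tendsto:
  fixes X :: "nat \<Rightarrow> 'a \<Rightarrow> 'b::euclidean_space"
  assumes X: "\<And>k. sqi M (X k)" "sqi M Y"
    and c: "(\<lambda>k. \<integral>x. (norm (X k x - Y x))\<^sup>2 \<partial>M) \<longlonglongrightarrow> 0"
  shows "(\<lambda>k. \<integral>x. (norm (X k x))\<^sup>2 \<partial>M) \<longlonglongrightarrow> (\<integral>x. (norm (Y x))\<^sup>2 \<partial>M)"
proof -
  have eq: "(\<integral>x. (norm (X k x))\<^sup>2 \<partial>M)
      = (\<integral>x. (norm (X k x - Y x))\<^sup>2 \<partial>M) + 2 * (\<integral>x. X k x \<bullet> Y x \<partial>M) - (\<integral>x. Y x \<bullet> Y x \<partial>M)" for k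
  proof -
    have "(norm (X k x))\<^sup>2 = (norm (X k x - Y x))\<^sup>2 + 2 * (X k x \<bullet> Y x) - Y x \<bullet> Y x" for x
      by (simp add: power2_norm_eq_inner inner_diff_left inner_diff_right inner_commute)
    then have "(\<integral>x. (norm (X k x))\<^sup>2 \<partial>M) = (\<integral>x. ((norm (X k x - Y x))\<^sup>2 + 2 * (X k x \<bullet> Y x)) - Y x \<bullet> Y x \<partial>M)"
      by (simp only:)
    also have "\<dots> = (\<integral>x. (norm (X k x - Y x))\<^sup>2 + 2 * (X k x \<bullet> Y x) \<partial>M) - (\<integral>x. Y x \<bullet> Y x \<partial>M)"
      by (intro Bochner_Integration.integral_diff Bochner_Integration.integrable_add integrable_mult_right
          sqi_inner_integrable X sqiD(2) sqi_diff)
    also have "(\<integral>x. (norm (X k x - Y x))\<^sup>2 + 2 * (X k x \<bullet> Y x) \<partial>M)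
        = (\<integral>x. (norm (X k x - Y x))\<^sup>2 \<partial>M) + (\<integral>x. 2 * (X k x \<bullet> Y x) \<partial>M)"
      by (intro Bochner_Integration.integral_add integrable_mult_right sqi_inner_integrable X sqiD(2) sqi_diff)
    finally show ?thesis by simp
  qed
  have "(\<lambda>k. (\<integral>x. (norm (X k x - Y x))\<^sup>2 \<partial>M) + 2 * (\<integral>x. X k x \<bullet> Y x \<partial>M) - (\<integral>x. Y x \<bullet> Y x \<partial>M))
      \<longlonglongrightarrow> 0 + 2 * (\<integral>x. Y x \<bullet> Y x \<partial>M) - (\<integral>x. Y x \<bullet> Y x \<partial>M)"
    by (intro tendsto_intros c sqi_inner_tendsto[OF X X(2) c])
  then show ?thesis unfolding eq by (simp add: power2_norm_eq_inner)
qed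

section \<open>Vertical Poincare inequality and uniqueness of the trace\<close>

context thin_domain
begin

text \<open>Integrate the vertical derivative of \<open>z\<^sub>3 |\<phi>|\<^sup>2\<close>, which vanishes on the bottom and on the top.\<close>

lemma Poincare_test:
  fixes \<phi> :: "pt \<Rightarrow> 'b::euclidean_space"
  assumes \<phi>: "test_field 1 \<phi>"
  shows "(\<integral>z. (norm (\<phi> z))\<^sup>2 \<partial>M1) \<le> (2 * H)\<^sup>2 * (\<integral>z. (norm (pd \<phi> e3 z))\<^sup>2 \<partial>M1)"
proof -
  note C = test_fieldD(1,2)[OF \<phi>]
  have s\<phi>: "sqi M1 \<phi>" "sqi M1 (pd \<phi> e3)" by (intro C1_sqi_Mdom C1_sqi_Mdom_pd C; simp)+
  define A B where "A = sqrt (\<integral>z. (norm (\<phi> z))\<^sup>2 \<partial>M1)" and "B = sqrt (\<integral>z. (norm (pd \<phi> e3 z))\<^sup>2 \<partial>M1)"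
  have AB: "0 \<le> A" "0 \<le> B" by (simp_all add: A_def B_def)
  have sndC: "C1fun (snd :: pt \<Rightarrow> real)" "pd (snd :: pt \<Rightarrow> real) e3 z = 1" for z
    by (rule C1fun_bounded_linear(1)[OF bounded_linear_snd],
        subst C1fun_bounded_linear(2)[OF bounded_linear_snd], simp add: e3_def)
  have innC: "C1fun (\<lambda>z. \<phi> z \<bullet> \<phi> z)" "pd (\<lambda>z. \<phi> z \<bullet> \<phi> z) e3 z = 2 * (\<phi> z \<bullet> pd \<phi> e3 z)" for z
    using C1fun_inner[OF C(1) C(1)] by (auto simp: inner_commute)
  let ?G = "\<lambda>z. snd z * (\<phi> z \<bullet> \<phi> z)"
  have GC: "C1fun ?G" by (rule C1fun_mult(1)[OF sndC(1) innC(1)])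
  have Gpd: "pd ?G e3 z = 2 * (snd z * (\<phi> z \<bullet> pd \<phi> e3 z)) + \<phi> z \<bullet> \<phi> z" for z
    unfolding C1fun_mult(2)[OF sndC(1) innC(1)] sndC(2) innC(2) by simp
  have sub: "supp ?G \<subseteq> supp \<phi>"
    by (rule supp_subsetI[OF closed_supp in_supp]) auto
  have "SInt (Dm 1) (pd ?G e3) = - SInt \<omega> (\<lambda>y. 0)"
    using vertical_integral_dom[OF test_field_subset[OF GC sub \<phi>] zero_less_one] by simp
  then have z: "(\<integral>z. 2 * (snd z * (\<phi> z \<bullet> pd \<phi> e3 z)) + \<phi> z \<bullet> \<phi> z \<partial>M1) = 0"
    unfolding Gpd[abs_def] by (simp add: integral_lebesgue_on_eq[OF sets_dom] set_lebesgue_integral_def)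
  have snd_le: "AE z in M1. \<bar>snd z\<bar> \<le> H"
  proof (rule AE_I2)
    fix z assume "z \<in> space M1"
    then have "fst z \<in> \<omega>" "0 < snd z" "snd z < h (fst z)" by (simp_all add: space_restrict_space mem_dom)
    then show "\<bar>snd z\<bar> \<le> H" using h_le[of "fst z"] by simp
  qed
  have sndm: "snd \<in> borel_measurable M1"
    by (intro measurable_restrict_space1 measurable_completion)
       (use borel_measurable_continuous_onI[OF C1fun_continuous[OF sndC(1)]] in simp)
  have bnd: "AE z in M1. norm (snd z * (\<phi> z \<bullet> pd \<phi> e3 z)) \<le> H * (norm (\<phi> z) * norm (pd \<phi> e3 z))"
    using snd_le
  proof eventually_elim
    case (elim z)
    show ?case unfolding real_norm_def abs_mult
      by (intro mult_mono elim Cauchy_Schwarz_ineq2 H_nonneg) simp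
  qed
  have i1: "integrable M1 (\<lambda>z. snd z * (\<phi> z \<bullet> pd \<phi> e3 z))"
    by (rule sqi_mult_bound_integrable[OF s\<phi> _ bnd]) (use sndm s\<phi>[THEN sqiD(1)] in measurable)
  have "A\<^sup>2 = (\<integral>z. \<phi> z \<bullet> \<phi> z \<partial>M1)" unfolding A_def by (simp add: power2_norm_eq_inner)
  also have "\<dots> = - 2 * (\<integral>z. snd z * (\<phi> z \<bullet> pd \<phi> e3 z) \<partial>M1)"
    using z i1 sqi_inner_integrable[OF s\<phi>(1) s\<phi>(1)] by simp
  also have "\<dots> \<le> 2 * \<bar>\<integral>z. snd z * (\<phi> z \<bullet> pd \<phi> e3 z) \<partial>M1\<bar>" by simp
  also have "\<bar>\<integral>z. snd z * (\<phi> z \<bullet> pd \<phi> e3 z) \<partial>M1\<bar> \<le> (\<integral>z. H * (norm (\<phi> z) * norm (pd \<phi> e3 z)) \<partial>M1)"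
    unfolding real_norm_def[symmetric]
    by (rule order_trans[OF integral_norm_bound
          integral_mono_AE[OF integrable_norm[OF i1] integrable_mult_right[OF sqi_norm_mult_integrable[OF s\<phi>]] bnd]])
  also have "\<dots> = H * (\<integral>z. norm (\<phi> z) * norm (pd \<phi> e3 z) \<partial>M1)" by simp
  also have "(\<integral>z. norm (\<phi> z) * norm (pd \<phi> e3 z) \<partial>M1) \<le> A * B"
    unfolding A_def B_def real_sqrt_mult[symmetric] by (rule real_le_rsqrt) (rule sqi_Cauchy_Schwarz_norm[OF s\<phi>])
  finally have "A\<^sup>2 \<le> 2 * (H * (A * B))" using H_nonneg by (simp add: mult_left_mono)
  then have "A * A \<le> A * (2 * H * B)" by (simp add: power2_eq_square algebra_simps)
  \<comment> \<open>One factor \<open>A\<close> is cancelled; the degenerate case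
    \<open>A = 0\<close> is immediate. The 2 in the constant comes from differentiating the
    square.\<close>
  then have "A \<le> 2 * H * B" using AB H_nonneg by (cases "A = 0") (simp_all add: mult_le_cancel_left_pos)
  then have "A\<^sup>2 \<le> (2 * H)\<^sup>2 * B\<^sup>2" using AB power_mono[of A "2 * H * B" 2] by (simp add: power_mult_distrib)
  then show ?thesis unfolding A_def B_def by simp
qed

lemma Poincare:
  fixes w d :: "pt \<Rightarrow> 'b::euclidean_space"
  assumes wd: "vapprox w d"
  shows "(\<integral>z. (norm (w z))\<^sup>2 \<partial>M1) \<le> (2 * H)\<^sup>2 * (\<integral>z. (norm (d z))\<^sup>2 \<partial>M1)"
proof -
  obtain \<phi> where \<phi>0: "\<forall>n. test_field 1 (\<phi> n) \<and> sqi M1 (\<phi> n) \<and> sqi M1 (pd (\<phi> n) e3)"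
    and \<phi>l: "(\<lambda>n. \<integral>z. (norm (\<phi> n z - w z))\<^sup>2 \<partial>M1) \<longlonglongrightarrow> 0"
      "(\<lambda>n. \<integral>z. (norm (pd (\<phi> n) e3 z - d z))\<^sup>2 \<partial>M1) \<longlonglongrightarrow> 0"
    using vapprox_ex[OF wd] by blast
  note \<phi> = \<phi>0[THEN spec, THEN conjunct1] \<phi>0[THEN spec, THEN conjunct2, THEN conjunct1]
    \<phi>0[THEN spec, THEN conjunct2, THEN conjunct2] \<phi>l
  show ?thesis
  proof (rule LIMSEQ_le)
    show "(\<lambda>n. \<integral>z. (norm (\<phi> n z))\<^sup>2 \<partial>M1) \<longlonglongrightarrow> (\<integral>z. (norm (w z))\<^sup>2 \<partial>M1)"
      by (rule sqi_norm_tendsto[OF \<phi>(2) vapproxD(1)[OF wd] \<phi>(4)])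
    show "(\<lambda>n. (2 * H)\<^sup>2 * (\<integral>z. (norm (pd (\<phi> n) e3 z))\<^sup>2 \<partial>M1)) \<longlonglongrightarrow> (2 * H)\<^sup>2 * (\<integral>z. (norm (d z))\<^sup>2 \<partial>M1)"
      by (intro tendsto_mult_left sqi_norm_tendsto[OF \<phi>(3) vapproxD(2)[OF wd] \<phi>(5)])
    show "\<exists>N. \<forall>n\<ge>N. (\<integral>z. (norm (\<phi> n z))\<^sup>2 \<partial>M1) \<le> (2 * H)\<^sup>2 * (\<integral>z. (norm (pd (\<phi> n) e3 z))\<^sup>2 \<partial>M1)"
      using Poincare_test[OF \<phi>(1)] by blast
  qed
qed

text \<open>Near the bottom a function of the horizontal variable can be cut off vertically, since \<open>h\<close> is bounded
  below on compact subsets of the base.\<close>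

lemma cutoff_extension:
  fixes \<psi> :: "real^2 \<Rightarrow> real"
  assumes \<psi>: "C1fun \<psi>" "compact (supp \<psi>)" "supp \<psi> \<subseteq> \<omega>"
  shows "\<exists>\<Psi>::pt \<Rightarrow> real. test_field 1 \<Psi> \<and> (\<forall>y. \<Psi> (y, 0) = \<psi> y)"
proof -
  \<comment> \<open>Half of the minimum of \<open>h\<close> on the compact support leaves strict
    room below the upper boundary; for an empty support any positive number serves.\<close>
  obtain \<delta> where \<delta>: "0 < \<delta>" "\<And>y. y \<in> supp \<psi> \<Longrightarrow> \<delta> < h y"
  proof (cases "supp \<psi> = {}")
    case True then show ?thesis by (intro that[of 1]) simp_all
  next
    case False
    obtain y0 where y0: "y0 \<in> supp \<psi>" "\<forall>y\<in>supp \<psi>. h y0 \<le> h y"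
      using continuous_attains_inf[OF \<psi>(2) False continuous_on_subset[OF h_cont \<psi>(3)]] by blast
    have "0 < h y0" using h_pos y0(1) \<psi>(3) by blast
    show ?thesis
    proof (rule that[of "h y0 / 2"])
      fix y assume "y \<in> supp \<psi>"
      then have "h y0 \<le> h y" using y0(2) by blast
      then show "h y0 / 2 < h y" using \<open>0 < h y0\<close> by linarith
    qed (use \<open>0 < h y0\<close> in simp)
  qed
  \<comment> \<open>A C1 cutoff with \<open>b 0 = 1\<close> that vanishes for |t| at least
    \<delta>.\<close>
  define b where "b t = (max 0 (1 - (t / \<delta>)\<^sup>2))\<^sup>2" for t :: real
  define \<Psi> where "\<Psi> z = \<psi> (fst z) * b (snd z)" for z :: pt
  have C\<psi>: "C1fun (\<lambda>z::pt. \<psi> (fst z))"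
    by (rule C1fun_compose(1)[OF C1fun_bounded_linear(1)[OF bounded_linear_fst] \<psi>(1)])
  have Cs: "C1fun (\<lambda>z::pt. snd z / \<delta>)"
    by (rule C1fun_bounded_linear(1)) (rule bounded_linear_compose[OF bounded_linear_divide bounded_linear_snd])
  have "C1fun (\<lambda>z::pt. 1 + - 1 * ((snd z / \<delta>) * (snd z / \<delta>)))"
    by (intro C1fun_add(1) C1fun_mult(1) C1fun_const(1) Cs)
  then have "C1fun (\<lambda>z::pt. b (snd z))"
    unfolding b_def by (intro C1fun_pos_part_square) (simp add: power2_eq_square)
  then have C: "C1fun \<Psi>" unfolding \<Psi>_def by (rule C1fun_mult(1)[OF C\<psi>])
  define Z where "Z = supp \<psi> \<times> {-\<delta>..\<delta>}"
  have Zc: "compact Z" unfolding Z_def by (intro compact_Times \<psi>(2) compact_Icc)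
  have sub: "supp \<Psi> \<subseteq> Z"
  proof (rule supp_subsetI[OF compact_imp_closed[OF Zc]])
    fix z assume nz: "\<Psi> z \<noteq> 0"
    then have 1: "fst z \<in> supp \<psi>" using not_in_supp(1)[of "fst z" \<psi>] by (auto simp: \<Psi>_def)
    have "\<not> 1 \<le> (snd z / \<delta>)\<^sup>2" using nz by (auto simp: \<Psi>_def b_def)
    then have "\<bar>snd z / \<delta>\<bar> < 1" by (simp only: not_le abs_square_less_1)
    then have "\<bar>snd z\<bar> < \<delta>" using \<delta>(1) by (simp add: abs_divide)
    then show "z \<in> Z" using 1 by (cases z) (auto simp: Z_def abs_less_iff)
  qed
  have "Z \<inter> (frontier (Dm 1) - Gamma0 \<omega>) = {}"
  proof (rule ccontr)
    assume "\<not> ?thesis"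
    then obtain y t where z: "y \<in> supp \<psi>" "-\<delta> \<le> t" "t \<le> \<delta>" "(y, t) \<in> closure (Dm 1)" "(y, t) \<notin> Dm 1" "(y, t) \<notin> Gamma0 \<omega>"
      unfolding Z_def frontier_dom_eq by auto
    have y: "y \<in> \<omega>" using z(1) \<psi>(3) by blast
    have "closure (Dm 1) \<subseteq> {z. 0 \<le> snd z}"
      by (rule closure_minimal) (auto simp: mem_dom intro!: closed_Collect_le continuous_intros)
    then have "0 \<le> t" using z(4) by auto
    moreover have "t \<noteq> 0" using z(6) y by (auto simp: Gamma0_def)
    moreover have "t < h y" using \<delta>(2)[OF z(1)] z(3) by simp
    ultimately show False using z(5) y by (simp add: mem_dom)
  qed
  then have "test_field 1 \<Psi>" unfolding test_field_def
    using C compact_suppI[OF Zc sub] sub by blast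
  moreover have "\<Psi> (y, 0) = \<psi> y" for y by (simp add: \<Psi>_def b_def)
  ultimately show ?thesis by blast
qed

text \<open>A trace is specified only through an integral identity. Testing it with cutoff
  extensions of arbitrary base functions and applying the fundamental lemma on the base identifies
  it with the fibre integral. The factor \<open>\<epsilon>\<^sup>2\<close> combines the fibre length
  scale \<epsilon> with the factor \<epsilon> between the original vertical derivative and
  \<open>d\<close>.\<close>

lemma trace_unique:
  fixes u Du :: "pt \<Rightarrow> 'b::euclidean_space"
  assumes \<epsilon>: "0 < \<epsilon>" and u: "sqi (Mdom \<epsilon>) u" "sqi (Mdom \<epsilon>) Du"
    and tr: "trace_Gamma0 \<omega> (Dm \<epsilon>) u Du g"
    and wd: "vapprox (\<lambda>z. (1 / \<epsilon>\<^sup>2) *\<^sub>R u (stretch \<epsilon> z)) (\<lambda>z. (1 / \<epsilon>) *\<^sub>R Du (stretch \<epsilon> z))"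
  shows "AE y in Mb. g y = \<epsilon>\<^sup>2 *\<^sub>R vtrace (\<lambda>z. (1 / \<epsilon>) *\<^sub>R Du (stretch \<epsilon> z)) y"
proof -
  define w d where "w z = (1 / \<epsilon>\<^sup>2) *\<^sub>R u (stretch \<epsilon> z)" and "d z = (1 / \<epsilon>) *\<^sub>R Du (stretch \<epsilon> z)" for z
  have wd': "vapprox w d" using wd unfolding w_def d_def .
  have sd: "sqi M1 w" "sqi M1 d" by (rule vapproxD[OF wd'])+
  have g: "sqi Mb g" using tr unfolding trace_Gamma0_def L2_iff_sqi[OF sets_base] by blast
  have T: "sqi Mb (\<lambda>y. \<epsilon>\<^sup>2 *\<^sub>R vtrace d y)" by (intro sqi_scaleR vtrace_bound(1) sd)
  interpret finite_measure Mb by (rule finite_Mb)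
  have "AE y in lebesgue. y \<in> \<omega> \<longrightarrow> g y - \<epsilon>\<^sup>2 *\<^sub>R vtrace d y = 0"
  proof (rule fundamental_lemma[OF open_base sqi_integrable[OF sqi_diff[OF g T]]])
    fix \<psi> :: "real^2 \<Rightarrow> real" assume \<psi>: "C1fun \<psi>" "compact (supp \<psi>)" "supp \<psi> \<subseteq> \<omega>"
    have s\<psi>: "sqi Mb \<psi>" by (rule C1fun_sqi(1)[OF \<psi>(1,2) lmeasurable_base])
    obtain \<Psi> :: "pt \<Rightarrow> real" where \<Psi>1: "test_field 1 \<Psi>" "\<forall>y. \<Psi> (y, 0) = \<psi> y"
      using cutoff_extension[OF \<psi>] by blast
    note \<Psi> = \<Psi>1(1) \<Psi>1(2)[rule_format]
    define \<Phi> where "\<Phi> x = \<Psi> (stretch (1 / \<epsilon>) x)" for x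
    have \<Phi>: "test_field \<epsilon> \<Phi>" unfolding \<Phi>_def
      by (rule test_field_stretch) (use \<Psi>(1) \<epsilon> in simp_all)
    note C = test_fieldD(1,2)[OF \<Phi>]
    have s\<Phi>: "sqi (Mdom \<epsilon>) \<Phi>" "sqi (Mdom \<epsilon>) (pd \<Phi> e3)" by (intro C1_sqi_Mdom C1_sqi_Mdom_pd C \<epsilon>)+
    have \<Phi>s: "\<Phi> (stretch \<epsilon> z) = \<Psi> z" "pd \<Phi> e3 (stretch \<epsilon> z) = (1 / \<epsilon>) *\<^sub>R pd \<Psi> e3 z" for z
      unfolding \<Phi>_def pd_stretch(3)[OF test_fieldD(1)[OF \<Psi>(1)]] using \<epsilon> by (simp_all add: stretch_inverse)
    have \<Phi>0: "\<Phi> (y, 0) = \<psi> y" for y unfolding \<Phi>_def using \<Psi>(2) by (simp add: stretch_def)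
    have "- (\<integral>y. \<psi> y *\<^sub>R g y \<partial>Mb) = (\<integral>x. \<Phi> x *\<^sub>R Du x + pd \<Phi> e3 x *\<^sub>R u x \<partial>Mdom \<epsilon>)"
      using tr test_fieldD[OF \<Phi>] \<Phi>0 unfolding trace_Gamma0_def
      by (simp add: integral_lebesgue_on_eq[OF sets_dom] integral_lebesgue_on_eq[OF sets_base])
    also have "\<dots> = \<epsilon> *\<^sub>R (\<integral>z. \<Phi> (stretch \<epsilon> z) *\<^sub>R Du (stretch \<epsilon> z) + pd \<Phi> e3 (stretch \<epsilon> z) *\<^sub>R u (stretch \<epsilon> z) \<partial>M1)"
      by (rule stretch_integral(2)[OF \<epsilon>]) (use s\<Phi>[THEN sqiD(1)] u[THEN sqiD(1)] in measurable)
    also have "(\<lambda>z. \<Phi> (stretch \<epsilon> z) *\<^sub>R Du (stretch \<epsilon> z) + pd \<Phi> e3 (stretch \<epsilon> z) *\<^sub>R u (stretch \<epsilon> z))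
        = (\<lambda>z. \<epsilon> *\<^sub>R (\<Psi> z *\<^sub>R d z + pd \<Psi> e3 z *\<^sub>R w z))"
      unfolding \<Phi>s w_def d_def using \<epsilon> by (auto simp: fun_eq_iff scaleR_add_right power2_eq_square)
    also have "(\<integral>z. \<epsilon> *\<^sub>R (\<Psi> z *\<^sub>R d z + pd \<Psi> e3 z *\<^sub>R w z) \<partial>M1) = \<epsilon> *\<^sub>R (\<integral>z. \<Psi> (fst z, 0) *\<^sub>R d z \<partial>M1)"
      using vapprox_trace[OF wd' \<Psi>(1)] by simp
    also have "(\<integral>z. \<Psi> (fst z, 0) *\<^sub>R d z \<partial>M1) = - (\<integral>y. \<psi> y *\<^sub>R vtrace d y \<partial>Mb)"
      unfolding \<Psi>(2) using vtrace_scaleR[OF sd(2) s\<psi>] by simp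
    finally have "(\<integral>y. \<psi> y *\<^sub>R g y \<partial>Mb) = \<epsilon>\<^sup>2 *\<^sub>R (\<integral>y. \<psi> y *\<^sub>R vtrace d y \<partial>Mb)"
      by (simp add: power2_eq_square)
    also have "\<dots> = (\<integral>y. \<psi> y *\<^sub>R (\<epsilon>\<^sup>2 *\<^sub>R vtrace d y) \<partial>Mb)"
    proof -
      have "(\<lambda>y. \<psi> y *\<^sub>R (\<epsilon>\<^sup>2 *\<^sub>R vtrace d y)) = (\<lambda>y. \<epsilon>\<^sup>2 *\<^sub>R (\<psi> y *\<^sub>R vtrace d y))"
        by (simp add: fun_eq_iff mult.commute)
      then show ?thesis by (simp only: integral_scaleR_right)
    qed
    finally have "(\<integral>y. \<psi> y *\<^sub>R g y \<partial>Mb) = (\<integral>y. \<psi> y *\<^sub>R (\<epsilon>\<^sup>2 *\<^sub>R vtrace d y) \<partial>Mb)" .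
    moreover have "(\<integral>y. \<psi> y *\<^sub>R (g y - \<epsilon>\<^sup>2 *\<^sub>R vtrace d y) \<partial>Mb)
        = (\<integral>y. \<psi> y *\<^sub>R g y \<partial>Mb) - (\<integral>y. \<psi> y *\<^sub>R (\<epsilon>\<^sup>2 *\<^sub>R vtrace d y) \<partial>Mb)"
      by (subst scaleR_diff_right) (intro Bochner_Integration.integral_diff sqi_scaleR_integrable s\<psi> g T)
    ultimately show "SInt \<omega> (\<lambda>y. \<psi> y *\<^sub>R (g y - \<epsilon>\<^sup>2 *\<^sub>R vtrace d y)) = 0"
      by (simp add: integral_lebesgue_on_eq[OF sets_base])
  qed
  then show ?thesis unfolding AE_lebesgue_on_iff[OF sets_base] d_def[abs_def] by (auto elim!: eventually_mono)
qed

end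

section \<open>Rescaling weak solutions\<close>

lemma continuous_matrix_vector: "continuous_on UNIV (\<lambda>x :: (real^2^2) \<times> (real^2). fst x *v snd x)"
  unfolding matrix_vector_mult_def
  by (intro continuous_on_vec_lambda continuous_on_sum continuous_on_mult continuous_on_component
      continuous_on_fst continuous_on_snd continuous_on_id)

lemma matrix_vector_measurable:
  fixes K :: "'a \<Rightarrow> real^2^2" and X :: "'a \<Rightarrow> real^2"
  assumes "K \<in> borel_measurable M" "X \<in> borel_measurable M"
  shows "(\<lambda>y. K y *v X y) \<in> borel_measurable M"
  using borel_measurable_continuous_Pair[OF assms, of "\<lambda>A x. A *v x"] continuous_matrix_vector by simp

lemma slip_measurable:
  fixes K :: "'a \<Rightarrow> real^2^2" and X :: "'a \<Rightarrow> real^2"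
  assumes "K \<in> borel_measurable M" "X \<in> borel_measurable M"
  shows "(\<lambda>y. slip s (K y) (X y)) \<in> borel_measurable M"
proof -
  have [measurable]: "(\<lambda>y. K y *v X y) \<in> borel_measurable M" by (rule matrix_vector_measurable[OF assms])
  show ?thesis unfolding slip_def by measurable
qed

text \<open>Homogeneity of degree s - 1, the source of the friction exponent after
  rescaling.\<close>

lemma slip_scaleR:
  assumes "0 < c" shows "slip s M (c *\<^sub>R v) = (c powr (s - 1)) *\<^sub>R slip s M v"
proof -
  have "M *v (c *\<^sub>R v) = c *\<^sub>R (M *v v)" by (rule matrix_vector_mult_scaleR)
  then have "slip s M (c *\<^sub>R v) = ((c * norm (M *v v)) powr (s - 2) * c) *\<^sub>R (M *v v)"
    using assms by (simp add: slip_def)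
  also have "(c * norm (M *v v)) powr (s - 2) * c = c powr (s - 2) * c powr 1 * norm (M *v v) powr (s - 2)"
    using assms by (simp add: powr_mult)
  also have "c powr (s - 2) * c powr 1 = c powr (s - 1)"
    unfolding powr_add[symmetric] by simp
  finally show ?thesis by (simp add: slip_def)
qed

context thin_domain
begin

lemma test_field_linear:
  fixes \<phi> :: "pt \<Rightarrow> 'b::euclidean_space" and L :: "'b \<Rightarrow> 'c::euclidean_space"
  assumes "test_field c \<phi>" "bounded_linear L" shows "test_field c (\<lambda>z. L (\<phi> z))"
proof (rule test_field_subset[OF _ _ assms(1)])
  show "C1fun (\<lambda>z. L (\<phi> z))" by (rule C1fun_linear_compose(1)[OF test_fieldD(1)[OF assms(1)] assms(2)])
  have "L 0 = 0" by (rule linear_0[OF bounded_linear.linear[OF assms(2)]])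
  then have "\<phi> x \<noteq> 0" if "L (\<phi> x) \<noteq> 0" for x using that by auto
  then show "supp (\<lambda>z. L (\<phi> z)) \<subseteq> supp \<phi>" by (intro supp_subsetI[OF closed_supp in_supp])
qed

definition bottom_tangential :: "(pt \<Rightarrow> pt) \<Rightarrow> bool" where
  "bottom_tangential \<phi> \<longleftrightarrow> (\<forall>y\<in>\<omega>. snd (\<phi> (y, 0)) = 0)"

text \<open>All squared errors are collected in one integrable function, so a single subsequence and
  a single majorant serve the field and all its derivatives.\<close>

definition approx_error :: "(pt \<Rightarrow> pt) \<Rightarrow> (pt \<Rightarrow> pt \<Rightarrow> pt) \<Rightarrow> (pt \<Rightarrow> pt) \<Rightarrow> (pt \<Rightarrow> pt) \<Rightarrow> pt \<Rightarrow> real" where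
  "approx_error w E d \<phi> z = (norm (\<phi> z - w z))\<^sup>2 + (\<Sum>b\<in>hor. (norm (pd \<phi> b z - E b z))\<^sup>2) + (norm (pd \<phi> e3 z - d z))\<^sup>2"

text \<open>The weak formulation for \<open>w = \<epsilon>\<^sup>-\<^sup>2 u(z', \<epsilon> z\<^sub>3)\<close> after division by \<open>\<epsilon>\<close>, where \<open>E b\<close> is the derivative of \<open>w\<close>
  in the horizontal direction \<open>b\<close>, \<open>d\<close> its vertical derivative, and \<open>\<beta> = \<gamma> + 2 s - 3\<close>.\<close>

definition scaled_equation :: "real \<Rightarrow> (real^2 \<Rightarrow> real^2) \<Rightarrow> (real^2 \<Rightarrow> real^2^2) \<Rightarrow> real \<Rightarrow> real \<Rightarrow> real
    \<Rightarrow> (pt \<Rightarrow> pt) \<Rightarrow> (pt \<Rightarrow> pt \<Rightarrow> pt) \<Rightarrow> (pt \<Rightarrow> pt) \<Rightarrow> (pt \<Rightarrow> real) \<Rightarrow> (pt \<Rightarrow> pt) \<Rightarrow> bool" where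
  "scaled_equation \<nu> f K s \<beta> \<epsilon> w E d q \<phi> \<longleftrightarrow>
     \<nu> * (\<integral>z. \<epsilon>\<^sup>2 * (\<Sum>b\<in>hor. E b z \<bullet> pd \<phi> b z) + d z \<bullet> pd \<phi> e3 z \<partial>M1)
     + (\<integral>z. \<epsilon>^4 * (\<Sum>b\<in>hor. (w z \<bullet> b) * (E b z \<bullet> \<phi> z)) + \<epsilon>^3 * (snd (w z) * (d z \<bullet> \<phi> z)) \<partial>M1)
     + \<epsilon> powr \<beta> * (\<integral>y. slip s (K y) (fst (vtrace d y)) \<bullet> (K y *v fst (\<phi> (y, 0))) \<partial>Mb)
     - (\<integral>z. q z * ((\<Sum>b\<in>hor. pd \<phi> b z \<bullet> b) + (1 / \<epsilon>) * snd (pd \<phi> e3 z)) \<partial>M1)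
     = (\<integral>z. f (fst z) \<bullet> fst (\<phi> z) \<partial>M1)"

text \<open>The equation is demanded for C1 test fields only, and membership in the energy space is
  recorded by an approximating sequence. The approximants are tangential on the bottom, which is how
  the normal condition there reaches the limit.\<close>

definition scaled_solution :: "real \<Rightarrow> (real^2 \<Rightarrow> real^2) \<Rightarrow> (real^2 \<Rightarrow> real^2^2) \<Rightarrow> real \<Rightarrow> real \<Rightarrow> real
    \<Rightarrow> (pt \<Rightarrow> pt) \<Rightarrow> (pt \<Rightarrow> pt \<Rightarrow> pt) \<Rightarrow> (pt \<Rightarrow> pt) \<Rightarrow> (pt \<Rightarrow> real) \<Rightarrow> bool" where
  "scaled_solution \<nu> f K s \<beta> \<epsilon> w E d q \<longleftrightarrow>
     sqi M1 w \<and> (\<forall>b\<in>hor. sqi M1 (E b)) \<and> sqi M1 d \<and> sqi M1 q \<and>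
     (\<exists>\<phi>. (\<forall>n. test_field 1 (\<phi> n) \<and> bottom_tangential (\<phi> n)) \<and>
        (\<lambda>n. \<integral>z. approx_error w E d (\<phi> n) z \<partial>M1) \<longlonglongrightarrow> 0) \<and>
     (AE z in M1. (\<Sum>b\<in>hor. E b z \<bullet> b) + (1 / \<epsilon>) * snd (d z) = 0) \<and>
     (\<forall>\<phi>. test_field 1 \<phi> \<and> bottom_tangential \<phi> \<longrightarrow> scaled_equation \<nu> f K s \<beta> \<epsilon> w E d q \<phi>)"

lemma approx_error_integrable:
  assumes "sqi M1 w" "\<And>b. b \<in> hor \<Longrightarrow> sqi M1 (E b)" "sqi M1 d" "test_field 1 \<phi>"
  shows "integrable M1 (approx_error w E d \<phi>)"
  unfolding approx_error_def[abs_def]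
  by (intro Bochner_Integration.integrable_add Bochner_Integration.integrable_sum sqiD(2) sqi_diff assms
      C1_sqi_Mdom C1_sqi_Mdom_pd test_fieldD(1,2)[OF assms(4)] zero_less_one)

lemma approx_error_ge:
  "(norm (\<phi> z - w z))\<^sup>2 \<le> approx_error w E d \<phi> z"
  "(norm (pd \<phi> e3 z - d z))\<^sup>2 \<le> approx_error w E d \<phi> z"
  "b \<in> hor \<Longrightarrow> (norm (pd \<phi> b z - E b z))\<^sup>2 \<le> approx_error w E d \<phi> z"
  "0 \<le> approx_error w E d \<phi> z"
proof -
  have s: "0 \<le> (\<Sum>b\<in>hor. (norm (pd \<phi> b z - E b z))\<^sup>2)" by (intro sum_nonneg) simp
  have p: "0 \<le> (norm (\<phi> z - w z))\<^sup>2" "0 \<le> (norm (pd \<phi> e3 z - d z))\<^sup>2" by simp_all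
  show "(norm (\<phi> z - w z))\<^sup>2 \<le> approx_error w E d \<phi> z" "(norm (pd \<phi> e3 z - d z))\<^sup>2 \<le> approx_error w E d \<phi> z"
    "0 \<le> approx_error w E d \<phi> z"
    unfolding approx_error_def using s p by linarith+
  assume b: "b \<in> hor"
  have "(norm (pd \<phi> b z - E b z))\<^sup>2 \<le> (\<Sum>b\<in>hor. (norm (pd \<phi> b z - E b z))\<^sup>2)"
    by (rule member_le_sum[OF b]) (use Basis_hor(3) in auto)
  then show "(norm (pd \<phi> b z - E b z))\<^sup>2 \<le> approx_error w E d \<phi> z"
    unfolding approx_error_def using p by linarith
qed

lemma approx_error_tendsto:
  assumes sq: "sqi M1 w" "\<And>b. b \<in> hor \<Longrightarrow> sqi M1 (E b)" "sqi M1 d" and t: "\<And>n. test_field 1 (\<phi> n)"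
    and lim: "(\<lambda>n. \<integral>z. approx_error w E d (\<phi> n) z \<partial>M1) \<longlonglongrightarrow> 0"
  shows "(\<lambda>n. \<integral>z. (norm (\<phi> n z - w z))\<^sup>2 \<partial>M1) \<longlonglongrightarrow> 0"
    and "(\<lambda>n. \<integral>z. (norm (pd (\<phi> n) e3 z - d z))\<^sup>2 \<partial>M1) \<longlonglongrightarrow> 0"
    and "b \<in> hor \<Longrightarrow> (\<lambda>n. \<integral>z. (norm (pd (\<phi> n) b z - E b z))\<^sup>2 \<partial>M1) \<longlonglongrightarrow> 0"
proof -
  have main: "(\<lambda>n. \<integral>z. (norm (X n z - Y z))\<^sup>2 \<partial>M1) \<longlonglongrightarrow> 0"
    if X: "\<And>n. sqi M1 (X n)" "sqi M1 Y" "\<And>n z. (norm (X n z - Y z))\<^sup>2 \<le> approx_error w E d (\<phi> n) z"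
    for X :: "nat \<Rightarrow> pt \<Rightarrow> pt" and Y
  proof (rule tendsto_sandwich[OF _ _ tendsto_const lim])
    show "\<forall>\<^sub>F n in sequentially. 0 \<le> (\<integral>z. (norm (X n z - Y z))\<^sup>2 \<partial>M1)" by simp
    show "\<forall>\<^sub>F n in sequentially. (\<integral>z. (norm (X n z - Y z))\<^sup>2 \<partial>M1) \<le> (\<integral>z. approx_error w E d (\<phi> n) z \<partial>M1)"
      by (intro always_eventually allI integral_mono sqiD(2) sqi_diff X approx_error_integrable sq t)
  qed
  note C = test_fieldD(1,2)[OF t]
  show "(\<lambda>n. \<integral>z. (norm (\<phi> n z - w z))\<^sup>2 \<partial>M1) \<longlonglongrightarrow> 0"
    by (intro main C1_sqi_Mdom C sq approx_error_ge zero_less_one)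
  show "(\<lambda>n. \<integral>z. (norm (pd (\<phi> n) e3 z - d z))\<^sup>2 \<partial>M1) \<longlonglongrightarrow> 0"
    by (intro main C1_sqi_Mdom_pd C sq approx_error_ge zero_less_one)
  show "b \<in> hor \<Longrightarrow> (\<lambda>n. \<integral>z. (norm (pd (\<phi> n) b z - E b z))\<^sup>2 \<partial>M1) \<longlonglongrightarrow> 0"
    by (intro main C1_sqi_Mdom_pd C sq approx_error_ge zero_less_one)
qed

text \<open>With u = \<open>\<epsilon>\<^sup>2 w\<close>, horizontal derivatives scale by
  \<open>\<epsilon>\<^sup>2\<close> and the vertical one by \<epsilon>, since one power is lost to
  the dilation. This imbalance makes the vertical viscous term dominant and puts 1/\<epsilon> into
  the divergence.\<close>

lemma weak_solution_scaled:
  assumes ws: "weak_solution \<omega> h \<nu> f K s \<gamma> \<epsilon> u p" and \<epsilon>: "0 < \<epsilon>" and K: "K \<in> borel_measurable lebesgue"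
    and f: "L2 \<omega> f"
  obtains E d where "scaled_solution \<nu> f K s (\<gamma> + 2 * s - 3) \<epsilon> (\<lambda>z. \<epsilon> powr (-2) *\<^sub>R u (fst z, \<epsilon> * snd z)) E d
      (\<lambda>z. p (fst z, \<epsilon> * snd z))"
proof -
  obtain Du g where V: "in_V \<omega> h \<epsilon> u Du" and tr: "trace_Gamma0 \<omega> (Dm \<epsilon>) u (Du e3) g" and Lp: "L2 (Dm \<epsilon>) p"
    and div: "AE x in lebesgue. x \<in> Dm \<epsilon> \<longrightarrow> (\<Sum>b\<in>Basis. Du b x \<bullet> b) = 0"
    and eq: "\<And>\<phi> D\<phi> g\<phi>. in_V \<omega> h \<epsilon> \<phi> D\<phi> \<Longrightarrow> trace_Gamma0 \<omega> (Dm \<epsilon>) \<phi> (D\<phi> e3) g\<phi> \<Longrightarrow>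
           \<nu> * SInt (Dm \<epsilon>) (\<lambda>x. \<Sum>b\<in>Basis. Du b x \<bullet> D\<phi> b x)
           + SInt (Dm \<epsilon>) (\<lambda>x. (\<Sum>b\<in>Basis. (u x \<bullet> b) *\<^sub>R Du b x) \<bullet> \<phi> x)
           + \<epsilon> powr \<gamma> * SInt \<omega> (\<lambda>y. slip s (K y) (fst (g y)) \<bullet> (K y *v fst (g\<phi> y)))
           - SInt (Dm \<epsilon>) (\<lambda>x. p x * (\<Sum>b\<in>Basis. D\<phi> b x \<bullet> b))
           = SInt (Dm \<epsilon>) (\<lambda>x. f (fst x) \<bullet> fst (\<phi> x))"
    using ws unfolding weak_solution_def Let_def by blast
  have su: "sqi (Mdom \<epsilon>) u" and sDu: "\<And>b. b \<in> Basis \<Longrightarrow> sqi (Mdom \<epsilon>) (Du b)"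
    using V unfolding in_V_def H1_def Let_def by (auto simp: L2_iff_sqi[OF sets_dom])
  obtain \<Phi> where \<Phi>a: "\<And>n. admissible \<omega> h \<epsilon> (\<Phi> n)" and \<Phi>lim: "(\<lambda>n. SInt (Dm \<epsilon>) (\<lambda>x. (norm (\<Phi> n x - u x))\<^sup>2) +
             (\<Sum>b\<in>Basis. SInt (Dm \<epsilon>) (\<lambda>x. (norm (pd (\<Phi> n) b x - Du b x))\<^sup>2))) \<longlonglongrightarrow> 0"
    using V unfolding in_V_def Let_def by auto
  have \<Phi>t: "test_field \<epsilon> (\<Phi> n)" "bottom_tangential (\<Phi> n)" for n
    using \<Phi>a[of n] unfolding admissible_iff bottom_tangential_def by auto
  have sp: "sqi (Mdom \<epsilon>) p" using Lp by (simp add: L2_iff_sqi[OF sets_dom])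
  define w where "w z = (1 / \<epsilon>\<^sup>2) *\<^sub>R u (stretch \<epsilon> z)" for z
  define E where "E b z = (1 / \<epsilon>\<^sup>2) *\<^sub>R Du b (stretch \<epsilon> z)" for b z
  define d where "d z = (1 / \<epsilon>) *\<^sub>R Du e3 (stretch \<epsilon> z)" for z
  define q where "q z = p (stretch \<epsilon> z)" for z
  define \<phi> where "\<phi> n z = (1 / \<epsilon>\<^sup>2) *\<^sub>R \<Phi> n (stretch \<epsilon> z)" for n z
  have hb: "b \<in> Basis" if "b \<in> hor" for b using that by (simp add: hor_def)
  have sw: "sqi M1 w" unfolding w_def by (intro sqi_scaleR stretch_sqi \<epsilon> su)
  have sE: "sqi M1 (E b)" if "b \<in> hor" for b unfolding E_def by (intro sqi_scaleR stretch_sqi \<epsilon> sDu hb that)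
  have sd: "sqi M1 d" unfolding d_def by (intro sqi_scaleR stretch_sqi \<epsilon> sDu e3_Basis)
  have sq: "sqi M1 q" unfolding q_def by (intro stretch_sqi \<epsilon> sp)
  have us: "u (stretch \<epsilon> z) = \<epsilon>\<^sup>2 *\<^sub>R w z" "Du b (stretch \<epsilon> z) = \<epsilon>\<^sup>2 *\<^sub>R E b z" "Du e3 (stretch \<epsilon> z) = \<epsilon> *\<^sub>R d z" for b z
    using \<epsilon> by (simp_all add: w_def E_def d_def)
  have \<phi>t: "test_field 1 (\<phi> n)" for n
    unfolding \<phi>_def by (intro test_field_linear[OF _ bounded_linear_scaleR_right] test_field_stretch) (use \<Phi>t \<epsilon> in simp_all)
  have \<phi>b: "bottom_tangential (\<phi> n)" for n
    using \<Phi>t(2)[of n] by (simp add: bottom_tangential_def \<phi>_def stretch_def)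
  have C\<Phi>: "C1fun (\<lambda>z. \<Phi> n (stretch \<epsilon> z))" for n by (rule pd_stretch(1)[OF test_fieldD(1)[OF \<Phi>t(1)]])
  have \<phi>h: "pd (\<phi> n) b z = (1 / \<epsilon>\<^sup>2) *\<^sub>R pd (\<Phi> n) b (stretch \<epsilon> z)" if "b \<in> hor" for n b z
    unfolding \<phi>_def C1fun_linear_compose(2)[OF C\<Phi> bounded_linear_scaleR_right] pd_stretch(2)[OF test_fieldD(1)[OF \<Phi>t(1)] that] ..
  have \<phi>3: "pd (\<phi> n) e3 z = (1 / \<epsilon>) *\<^sub>R pd (\<Phi> n) e3 (stretch \<epsilon> z)" for n z
    unfolding \<phi>_def C1fun_linear_compose(2)[OF C\<Phi> bounded_linear_scaleR_right] pd_stretch(3)[OF test_fieldD(1)[OF \<Phi>t(1)]]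
    using \<epsilon> by (simp add: power2_eq_square)
  define A where "A n x = (norm (\<Phi> n x - u x))\<^sup>2 + (\<Sum>b\<in>Basis. (norm (pd (\<Phi> n) b x - Du b x))\<^sup>2)" for n x
  have A_hor: "A n x = (norm (\<Phi> n x - u x))\<^sup>2 + ((\<Sum>b\<in>hor. (norm (pd (\<Phi> n) b x - Du b x))\<^sup>2) + (norm (pd (\<Phi> n) e3 x - Du e3 x))\<^sup>2)" for n x
    unfolding A_def sum_Basis_hor ..
  have s\<Phi>: "sqi (Mdom \<epsilon>) (\<Phi> n)" "sqi (Mdom \<epsilon>) (pd (\<Phi> n) b)" for n b
    by (intro C1_sqi_Mdom C1_sqi_Mdom_pd \<epsilon> test_fieldD[OF \<Phi>t(1)])+
  have Ai: "integrable (Mdom \<epsilon>) (A n)" for n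
    unfolding A_def by (intro Bochner_Integration.integrable_add Bochner_Integration.integrable_sum sqiD(2) sqi_diff s\<Phi> su sDu)
  have Aint: "integral\<^sup>L (Mdom \<epsilon>) (A n) = SInt (Dm \<epsilon>) (\<lambda>x. (norm (\<Phi> n x - u x))\<^sup>2) +
             (\<Sum>b\<in>Basis. SInt (Dm \<epsilon>) (\<lambda>x. (norm (pd (\<Phi> n) b x - Du b x))\<^sup>2))" for n
  proof -
    have i: "integrable (Mdom \<epsilon>) (\<lambda>x. (norm (pd (\<Phi> n) b x - Du b x))\<^sup>2)" if "b \<in> Basis" for b
      by (intro sqiD(2) sqi_diff s\<Phi> sDu that)
    have "integral\<^sup>L (Mdom \<epsilon>) (A n) = (\<integral>x. (norm (\<Phi> n x - u x))\<^sup>2 \<partial>Mdom \<epsilon>)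
        + (\<integral>x. (\<Sum>b\<in>Basis. (norm (pd (\<Phi> n) b x - Du b x))\<^sup>2) \<partial>Mdom \<epsilon>)"
      unfolding A_def by (intro Bochner_Integration.integral_add Bochner_Integration.integrable_sum sqiD(2) sqi_diff s\<Phi> su sDu)
    also have "(\<integral>x. (\<Sum>b\<in>Basis. (norm (pd (\<Phi> n) b x - Du b x))\<^sup>2) \<partial>Mdom \<epsilon>)
        = (\<Sum>b\<in>Basis. \<integral>x. (norm (pd (\<Phi> n) b x - Du b x))\<^sup>2 \<partial>Mdom \<epsilon>)"
      by (rule Bochner_Integration.integral_sum[OF i])
    finally show ?thesis by (simp only: integral_lebesgue_on_eq[OF sets_dom])
  qed
  have Alim: "(\<lambda>n. integral\<^sup>L (Mdom \<epsilon>) (A n)) \<longlonglongrightarrow> 0" unfolding Aint by (rule \<Phi>lim)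
  \<comment> \<open>Squared errors of the field and its horizontal derivatives carry
    \<epsilon>^(-4), the vertical one \<epsilon>^(-2); the sum bounds both factors.\<close>
  define c where "c = (1 / \<epsilon>\<^sup>2)\<^sup>2 + (1 / \<epsilon>)\<^sup>2"
  have e_le: "approx_error w E d (\<phi> n) z \<le> c * A n (stretch \<epsilon> z)" for n z
  proof -
    let ?a = "(norm (\<Phi> n (stretch \<epsilon> z) - u (stretch \<epsilon> z)))\<^sup>2"
    let ?b = "\<Sum>b\<in>hor. (norm (pd (\<Phi> n) b (stretch \<epsilon> z) - Du b (stretch \<epsilon> z)))\<^sup>2"
    let ?c = "(norm (pd (\<Phi> n) e3 (stretch \<epsilon> z) - Du e3 (stretch \<epsilon> z)))\<^sup>2"
    have sc: "(norm (k *\<^sub>R x - k *\<^sub>R y))\<^sup>2 = k\<^sup>2 * (norm (x - y))\<^sup>2" for k :: real and x y :: pt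
      unfolding scaleR_diff_right[symmetric] norm_scaleR power_mult_distrib by simp
    have "approx_error w E d (\<phi> n) z = (1 / \<epsilon>\<^sup>2)\<^sup>2 * ?a + (\<Sum>b\<in>hor. (1 / \<epsilon>\<^sup>2)\<^sup>2 * (norm (pd (\<Phi> n) b (stretch \<epsilon> z) - Du b (stretch \<epsilon> z)))\<^sup>2) + (1 / \<epsilon>)\<^sup>2 * ?c"
      unfolding approx_error_def \<phi>3 d_def sc
      by (simp only: \<phi>_def w_def sc E_def \<phi>h cong: sum.cong)
    also have "\<dots> = (1 / \<epsilon>\<^sup>2)\<^sup>2 * ?a + (1 / \<epsilon>\<^sup>2)\<^sup>2 * ?b + (1 / \<epsilon>)\<^sup>2 * ?c"
      by (simp only: sum_distrib_left)
    also have "\<dots> \<le> c * ?a + c * ?b + c * ?c"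
      by (intro add_mono mult_right_mono sum_nonneg) (simp_all add: c_def)
    also have "\<dots> = c * A n (stretch \<epsilon> z)" unfolding A_hor by (simp add: algebra_simps)
    finally show ?thesis .
  qed
  have Asi: "integrable M1 (\<lambda>z. A n (stretch \<epsilon> z))" for n
    using stretch_integral(1)[OF \<epsilon> borel_measurable_integrable[OF Ai]] Ai by blast
  have elim: "(\<lambda>n. \<integral>z. approx_error w E d (\<phi> n) z \<partial>M1) \<longlonglongrightarrow> 0"
  proof (rule tendsto_sandwich[OF _ _ tendsto_const])
    show "\<forall>\<^sub>F n in sequentially. 0 \<le> (\<integral>z. approx_error w E d (\<phi> n) z \<partial>M1)"
      by (intro always_eventually allI Bochner_Integration.integral_nonneg approx_error_ge(4))
    show "\<forall>\<^sub>F n in sequentially. (\<integral>z. approx_error w E d (\<phi> n) z \<partial>M1) \<le> (c / \<epsilon>) * integral\<^sup>L (Mdom \<epsilon>) (A n)"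
    proof (intro always_eventually allI)
      fix n
      have "(\<integral>z. approx_error w E d (\<phi> n) z \<partial>M1) \<le> (\<integral>z. c * A n (stretch \<epsilon> z) \<partial>M1)"
        by (intro integral_mono approx_error_integrable sw sE sd \<phi>t integrable_mult_right Asi e_le)
      also have "\<dots> = (c / \<epsilon>) * integral\<^sup>L (Mdom \<epsilon>) (A n)"
        using stretch_integral(2)[OF \<epsilon> borel_measurable_integrable[OF Ai], of n] \<epsilon> by simp
      finally show "(\<integral>z. approx_error w E d (\<phi> n) z \<partial>M1) \<le> (c / \<epsilon>) * integral\<^sup>L (Mdom \<epsilon>) (A n)" .
    qed
    show "(\<lambda>n. (c / \<epsilon>) * integral\<^sup>L (Mdom \<epsilon>) (A n)) \<longlonglongrightarrow> 0" by (rule tendsto_mult_right_zero[OF Alim])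
  qed
  have vap: "vapprox w d"
    unfolding vapprox_def using approx_error_tendsto(1,2)[OF sw sE sd \<phi>t elim] \<phi>t sw sd by blast
  have g_eq: "AE y in Mb. g y = \<epsilon>\<^sup>2 *\<^sub>R vtrace d y"
    using trace_unique[OF \<epsilon> su sDu[OF e3_Basis] tr] vap unfolding w_def[abs_def] d_def[abs_def] by blast
  have div1: "AE z in M1. (\<Sum>b\<in>hor. E b z \<bullet> b) + (1 / \<epsilon>) * snd (d z) = 0"
  proof -
    have "AE x in Mdom \<epsilon>. (\<Sum>b\<in>Basis. Du b x \<bullet> b) = 0" using div unfolding AE_lebesgue_on_iff[OF sets_dom] .
    from stretch_AE[OF \<epsilon> this] show ?thesis
    proof eventually_elim
      case (elim z)
      then have "\<epsilon>\<^sup>2 * ((\<Sum>b\<in>hor. E b z \<bullet> b) + (1 / \<epsilon>) * snd (d z)) = 0"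
        unfolding sum_Basis_hor us(1) us(3) unfolding us(2) inner_e3 using \<epsilon> by (simp add: sum_distrib_left distrib_left power2_eq_square)
      then show ?case using \<epsilon> by simp
    qed
  qed
  have equ: "scaled_equation \<nu> f K s (\<gamma> + 2 * s - 3) \<epsilon> w E d q \<phi>"
    if \<phi>: "test_field 1 \<phi>" "bottom_tangential \<phi>" for \<phi>
  proof -
    \<comment> \<open>Test fields of the thin domain are obtained by dilating those of the fixed
      domain without rescaling their values, so the test field brings in no power of \<epsilon> of
      its own.\<close>
    define F where "F x = \<phi> (stretch (1 / \<epsilon>) x)" for x
    have F: "test_field \<epsilon> F" unfolding F_def by (rule test_field_stretch) (use \<phi> \<epsilon> in simp_all)
    note C = test_fieldD(1,2)[OF F]
    have sF: "sqi (Mdom \<epsilon>) F" "sqi (Mdom \<epsilon>) (pd F b)" for b by (intro C1_sqi_Mdom C1_sqi_Mdom_pd C \<epsilon>)+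
    note mF = sF(1)[THEN sqiD(1)] sF(2)[THEN sqiD(1)] su[THEN sqiD(1)] sDu[THEN sqiD(1)] sp[THEN sqiD(1)]
    have F0: "F (y, 0) = \<phi> (y, 0)" for y by (simp add: F_def stretch_def)
    have "admissible \<omega> h \<epsilon> F" unfolding admissible_iff using F \<phi>(2) F0 by (simp add: bottom_tangential_def)
    from eq[OF in_V_C1[OF this \<epsilon>] trace_Gamma0_C1[OF C \<epsilon>]]
    have main: "\<nu> * (\<integral>x. (\<Sum>b\<in>Basis. Du b x \<bullet> pd F b x) \<partial>Mdom \<epsilon>)
       + (\<integral>x. (\<Sum>b\<in>Basis. (u x \<bullet> b) *\<^sub>R Du b x) \<bullet> F x \<partial>Mdom \<epsilon>)
       + \<epsilon> powr \<gamma> * (\<integral>y. slip s (K y) (fst (g y)) \<bullet> (K y *v fst (\<phi> (y, 0))) \<partial>Mb)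
       - (\<integral>x. p x * (\<Sum>b\<in>Basis. pd F b x \<bullet> b) \<partial>Mdom \<epsilon>)
       = (\<integral>x. f (fst x) \<bullet> fst (F x) \<partial>Mdom \<epsilon>)"
      unfolding F0 by (simp only: integral_lebesgue_on_eq[OF sets_dom] integral_lebesgue_on_eq[OF sets_base])
    have Fs: "F (stretch \<epsilon> z) = \<phi> z" "pd F e3 (stretch \<epsilon> z) = (1 / \<epsilon>) *\<^sub>R pd \<phi> e3 z" for z
      unfolding F_def pd_stretch(3)[OF test_fieldD(1)[OF \<phi>(1)]] using \<epsilon> by (simp_all add: stretch_inverse)
    have Fh: "pd F b (stretch \<epsilon> z) = pd \<phi> b z" if "b \<in> hor" for b z
      unfolding F_def pd_stretch(2)[OF test_fieldD(1)[OF \<phi>(1)] that] using \<epsilon> by (simp add: stretch_inverse)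
    have 1: "(\<integral>x. (\<Sum>b\<in>Basis. Du b x \<bullet> pd F b x) \<partial>Mdom \<epsilon>) = \<epsilon> * (\<integral>z. \<epsilon>\<^sup>2 * (\<Sum>b\<in>hor. E b z \<bullet> pd \<phi> b z) + d z \<bullet> pd \<phi> e3 z \<partial>M1)"
    proof -
      have "(\<Sum>b\<in>Basis. Du b (stretch \<epsilon> z) \<bullet> pd F b (stretch \<epsilon> z)) = \<epsilon>\<^sup>2 * (\<Sum>b\<in>hor. E b z \<bullet> pd \<phi> b z) + d z \<bullet> pd \<phi> e3 z" for z
        unfolding sum_Basis_hor us(1) us(3) Fs unfolding us(2) using \<epsilon> by (simp add: Fh sum_distrib_left)
      moreover have "(\<lambda>x. \<Sum>b\<in>Basis. Du b x \<bullet> pd F b x) \<in> borel_measurable (Mdom \<epsilon>)"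
        by (intro borel_measurable_sum borel_measurable_inner mF)
      ultimately show ?thesis using stretch_integral(2)[OF \<epsilon>, of "\<lambda>x. \<Sum>b\<in>Basis. Du b x \<bullet> pd F b x"] by simp
    qed
    have 2: "(\<integral>x. (\<Sum>b\<in>Basis. (u x \<bullet> b) *\<^sub>R Du b x) \<bullet> F x \<partial>Mdom \<epsilon>)
        = \<epsilon> * (\<integral>z. \<epsilon>^4 * (\<Sum>b\<in>hor. (w z \<bullet> b) * (E b z \<bullet> \<phi> z)) + \<epsilon>^3 * (snd (w z) * (d z \<bullet> \<phi> z)) \<partial>M1)"
    proof -
      have "(\<Sum>b\<in>Basis. (u (stretch \<epsilon> z) \<bullet> b) *\<^sub>R Du b (stretch \<epsilon> z)) \<bullet> F (stretch \<epsilon> z)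
          = \<epsilon>^4 * (\<Sum>b\<in>hor. (w z \<bullet> b) * (E b z \<bullet> \<phi> z)) + \<epsilon>^3 * (snd (w z) * (d z \<bullet> \<phi> z))" for z
        unfolding sum_Basis_hor us(1) us(3) Fs inner_e3 unfolding us(2)
        by (simp add: inner_add_left inner_sum_left sum_distrib_left algebra_simps power2_eq_square power3_eq_cube power4_eq_xxxx)
      moreover have "(\<lambda>x. (\<Sum>b\<in>Basis. (u x \<bullet> b) *\<^sub>R Du b x) \<bullet> F x) \<in> borel_measurable (Mdom \<epsilon>)"
        by (intro borel_measurable_sum borel_measurable_inner borel_measurable_scaleR borel_measurable_const mF)
      ultimately show ?thesis using stretch_integral(2)[OF \<epsilon>, of "\<lambda>x. (\<Sum>b\<in>Basis. (u x \<bullet> b) *\<^sub>R Du b x) \<bullet> F x"] by simp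
    qed
    have 4: "(\<integral>x. p x * (\<Sum>b\<in>Basis. pd F b x \<bullet> b) \<partial>Mdom \<epsilon>)
        = \<epsilon> * (\<integral>z. q z * ((\<Sum>b\<in>hor. pd \<phi> b z \<bullet> b) + (1 / \<epsilon>) * snd (pd \<phi> e3 z)) \<partial>M1)"
    proof -
      have "p (stretch \<epsilon> z) * (\<Sum>b\<in>Basis. pd F b (stretch \<epsilon> z) \<bullet> b) = q z * ((\<Sum>b\<in>hor. pd \<phi> b z \<bullet> b) + (1 / \<epsilon>) * snd (pd \<phi> e3 z))" for z
        unfolding sum_Basis_hor Fs inner_e3 q_def by (simp add: Fh)
      moreover have "(\<lambda>x. p x * (\<Sum>b\<in>Basis. pd F b x \<bullet> b)) \<in> borel_measurable (Mdom \<epsilon>)"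
        by (intro borel_measurable_times borel_measurable_sum borel_measurable_inner borel_measurable_const mF)
      ultimately show ?thesis using stretch_integral(2)[OF \<epsilon>, of "\<lambda>x. p x * (\<Sum>b\<in>Basis. pd F b x \<bullet> b)"] by simp
    qed
    have sf: "sqi (Mdom \<epsilon>) (\<lambda>x. f (fst x))"
      by (rule sqi_fst_dom[OF _ \<epsilon>]) (use f in \<open>simp add: L2_iff_sqi[OF sets_base]\<close>)
    have 5: "(\<integral>x. f (fst x) \<bullet> fst (F x) \<partial>Mdom \<epsilon>) = \<epsilon> * (\<integral>z. f (fst z) \<bullet> fst (\<phi> z) \<partial>M1)"
    proof -
      have "(\<lambda>x. f (fst x) \<bullet> fst (F x)) \<in> borel_measurable (Mdom \<epsilon>)"
        by (intro borel_measurable_inner sqiD(1)[OF sf] sqiD(1)[OF sqi_linear[OF sF(1) bounded_linear_fst]])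
      then show ?thesis using stretch_integral(2)[OF \<epsilon>, of "\<lambda>x. f (fst x) \<bullet> fst (F x)"] by (simp add: Fs)
    qed
    have 3: "(\<integral>y. slip s (K y) (fst (g y)) \<bullet> (K y *v fst (\<phi> (y, 0))) \<partial>Mb)
        = \<epsilon> powr (2 * (s - 1)) * (\<integral>y. slip s (K y) (fst (vtrace d y)) \<bullet> (K y *v fst (\<phi> (y, 0))) \<partial>Mb)"
    proof -
      have Km: "K \<in> borel_measurable Mb" by (rule measurable_restrict_space1[OF K])
      have gm: "(\<lambda>y. fst (g y)) \<in> borel_measurable Mb"
      proof -
        have "sqi Mb g" using tr unfolding trace_Gamma0_def L2_iff_sqi[OF sets_base] by blast
        from sqiD(1)[OF sqi_linear[OF this bounded_linear_fst]] show ?thesis .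
      qed
      have vm: "(\<lambda>y. fst (vtrace d y)) \<in> borel_measurable Mb"
        by (rule sqiD(1)[OF sqi_linear[OF vtrace_bound(1)[OF sd] bounded_linear_fst]])
      have \<phi>m: "(\<lambda>y. fst (\<phi> (y, 0))) \<in> borel_measurable Mb"
        by (rule sqiD(1)[OF sqi_linear[OF bottom_sqi[OF test_fieldD(1,2)[OF \<phi>(1)]] bounded_linear_fst]])
      have "(\<integral>y. slip s (K y) (fst (g y)) \<bullet> (K y *v fst (\<phi> (y, 0))) \<partial>Mb)
          = (\<integral>y. \<epsilon> powr (2 * (s - 1)) * (slip s (K y) (fst (vtrace d y)) \<bullet> (K y *v fst (\<phi> (y, 0)))) \<partial>Mb)"
      proof (rule integral_cong_AE)
        show "(\<lambda>y. slip s (K y) (fst (g y)) \<bullet> (K y *v fst (\<phi> (y, 0)))) \<in> borel_measurable Mb"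
          by (intro borel_measurable_inner slip_measurable matrix_vector_measurable Km gm \<phi>m)
        show "(\<lambda>y. \<epsilon> powr (2 * (s - 1)) * (slip s (K y) (fst (vtrace d y)) \<bullet> (K y *v fst (\<phi> (y, 0))))) \<in> borel_measurable Mb"
          by (intro borel_measurable_times borel_measurable_const borel_measurable_inner slip_measurable matrix_vector_measurable Km vm \<phi>m)
        show "AE y in Mb. slip s (K y) (fst (g y)) \<bullet> (K y *v fst (\<phi> (y, 0)))
            = \<epsilon> powr (2 * (s - 1)) * (slip s (K y) (fst (vtrace d y)) \<bullet> (K y *v fst (\<phi> (y, 0))))"
          using g_eq
        proof eventually_elim
          case (elim y)
          have e2: "(\<epsilon>\<^sup>2) powr (s - 1) = \<epsilon> powr (2 * (s - 1))"
          proof -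
            have "\<epsilon>\<^sup>2 = \<epsilon> powr 2" using \<epsilon> by (simp add: powr_numeral)
            then show ?thesis by (simp only: powr_powr)
          qed
          have "fst (g y) = \<epsilon>\<^sup>2 *\<^sub>R fst (vtrace d y)" using elim by simp
          then have "slip s (K y) (fst (g y)) = \<epsilon> powr (2 * (s - 1)) *\<^sub>R slip s (K y) (fst (vtrace d y))"
            using slip_scaleR[of "\<epsilon>\<^sup>2" s "K y" "fst (vtrace d y)"] \<epsilon> e2 by simp
          then show ?case by simp
        qed
      qed
      then show ?thesis by simp
    qed
    \<comment> \<open>The exponent is split as 1 + \<beta>: the factor \<epsilon> matches the
      Jacobian common to the volume integrals and is cancelled in \<open>fin\<close>.\<close>
    have pw: "\<epsilon> powr \<gamma> * \<epsilon> powr (2 * (s - 1)) = \<epsilon> * \<epsilon> powr (\<gamma> + 2 * s - 3)"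
    proof -
      have "\<epsilon> powr \<gamma> * \<epsilon> powr (2 * (s - 1)) = \<epsilon> powr (1 + (\<gamma> + 2 * s - 3))"
        unfolding powr_add[symmetric] by (simp add: algebra_simps)
      also have "\<dots> = \<epsilon> * \<epsilon> powr (\<gamma> + 2 * s - 3)" using \<epsilon> by (simp only: powr_add powr_one)
      finally show ?thesis .
    qed
    have fin: "\<epsilon> * (\<nu> * a + b + e * k - r) = \<epsilon> * t"
      if "\<nu> * (\<epsilon> * a) + \<epsilon> * b + (\<epsilon> * e) * k - \<epsilon> * r = \<epsilon> * t" for a b e k r t :: real
      using that by (simp add: algebra_simps)
    show ?thesis
      unfolding scaled_equation_def
      using fin[OF main[unfolded 1 2 3 4 5 mult.assoc[of "\<epsilon> powr \<gamma>", symmetric] pw]] \<epsilon> by simp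
  qed
  have "scaled_solution \<nu> f K s (\<gamma> + 2 * s - 3) \<epsilon> w E d q"
    unfolding scaled_solution_def using sw sE sd sq \<phi>t \<phi>b elim div1 equ by blast
  moreover have "w = (\<lambda>z. \<epsilon> powr (-2) *\<^sub>R u (fst z, \<epsilon> * snd z))"
    using \<epsilon> by (simp add: w_def fun_eq_iff stretch_def powr_minus powr_numeral divide_inverse)
  moreover have "q = (\<lambda>z. p (fst z, \<epsilon> * snd z))" by (simp add: q_def fun_eq_iff stretch_def)
  ultimately show thesis using that by blast
qed

end

section \<open>The energy identity\<close>

lemma sqi_dominated_convergence:
  fixes X :: "nat \<Rightarrow> 'a \<Rightarrow> 'b::euclidean_space"
  assumes Y: "sqi M Y" and R: "sqi M (R :: 'a \<Rightarrow> real)" and X: "\<And>k. X k \<in> borel_measurable M" "X0 \<in> borel_measurable M"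
    and lim: "AE x in M. (\<lambda>k. X k x) \<longlonglongrightarrow> X0 x" and dom: "\<And>k. AE x in M. norm (X k x) \<le> R x"
  shows "(\<lambda>k. \<integral>x. Y x \<bullet> X k x \<partial>M) \<longlonglongrightarrow> (\<integral>x. Y x \<bullet> X0 x \<partial>M)"
proof (rule integral_dominated_convergence)
  show "integrable M (\<lambda>x. norm (Y x) * norm (R x))" by (rule sqi_norm_mult_integrable[OF Y R])
  show "(\<lambda>x. Y x \<bullet> X0 x) \<in> borel_measurable M" "(\<lambda>x. Y x \<bullet> X k x) \<in> borel_measurable M" for k
    by (intro borel_measurable_inner sqiD(1)[OF Y] X)+
  show "AE x in M. (\<lambda>k. Y x \<bullet> X k x) \<longlonglongrightarrow> Y x \<bullet> X0 x"
    using lim by eventually_elim (intro tendsto_intros)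
  show "AE x in M. norm (Y x \<bullet> X k x) \<le> norm (Y x) * norm (R x)" for k
    using dom[of k]
  proof eventually_elim
    case (elim x)
    have "norm (Y x \<bullet> X k x) \<le> norm (Y x) * norm (X k x)" by (simp add: Cauchy_Schwarz_ineq2)
    also have "\<dots> \<le> norm (Y x) * norm (R x)"
      using order_trans[OF elim abs_ge_self[of "R x"]] by (intro mult_left_mono) simp_all
    finally show ?case .
  qed
qed

lemma norm_slip: "norm (slip s M v) = norm (M *v v) powr (s - 1)"
proof (cases "M *v v = 0")
  case False
  then have p: "0 < norm (M *v v)" by simp
  have "norm (slip s M v) = norm (M *v v) powr (s - 2) * norm (M *v v) powr 1"
    unfolding slip_def using p by simp
  also have "\<dots> = norm (M *v v) powr (s - 1)" unfolding powr_add[symmetric] by simp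
  finally show ?thesis .
qed (simp add: slip_def)

text \<open>Growth of order s - 1 < 1 is at most linear, so the friction of a square-integrable
  trace is again square-integrable.\<close>

lemma norm_slip_le:
  assumes "1 < s" "s < 2" shows "norm (slip s M v) \<le> 1 + norm (M *v v)"
proof (cases "norm (M *v v) \<le> 1")
  case True
  then have "norm (M *v v) powr (s - 1) \<le> 1 powr (s - 1)" using assms by (intro powr_mono2) simp_all
  then have "norm (M *v v) powr (s - 1) \<le> 1" by simp
  then show ?thesis unfolding norm_slip using norm_ge_zero[of "M *v v"] by linarith
next
  case False
  then have "norm (M *v v) powr (s - 1) \<le> norm (M *v v) powr 1" using assms by (intro powr_mono) simp_all
  then show ?thesis unfolding norm_slip using False by simp
qed

text \<open>The saturation \<open>v / (1 + \<delta> |v|\<^sup>2)\<^sup>2\<close> is bounded and is the gradient of the bounded function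
  \<open>|v|\<^sup>2 / (2 (1 + \<delta> |v|\<^sup>2))\<close>; the inertial term therefore vanishes when tested with a saturated
  solution, without any Sobolev embedding.\<close>

definition sat :: "real \<Rightarrow> 'b::real_inner \<Rightarrow> 'b" where
  "sat \<delta> v = (1 / (1 + \<delta> * (v \<bullet> v)))\<^sup>2 *\<^sub>R v"

text \<open>The derivative of \<open>sat \<delta>\<close> at \<open>v\<close> in the direction
  \<open>x\<close>.\<close>

definition dsat :: "real \<Rightarrow> 'b::real_inner \<Rightarrow> 'b \<Rightarrow> 'b" where
  "dsat \<delta> v x = (1 / (1 + \<delta> * (v \<bullet> v)))\<^sup>2 *\<^sub>R x - (4 * \<delta> * (v \<bullet> x) / (1 + \<delta> * (v \<bullet> v))^3) *\<^sub>R v"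

definition satpot :: "real \<Rightarrow> 'b::real_inner \<Rightarrow> real" where
  "satpot \<delta> v = (v \<bullet> v) / (2 * (1 + \<delta> * (v \<bullet> v)))"

lemma sat_den: "0 < \<delta> \<Longrightarrow> 1 \<le> 1 + \<delta> * (v \<bullet> v)" by simp

lemma square_C1:
  "C1fun (\<lambda>v::'b::euclidean_space. v \<bullet> v)" "pd (\<lambda>v::'b. v \<bullet> v) x v = 2 * (v \<bullet> x)"
proof -
  have i: "C1fun (\<lambda>v::'b. v)" "pd (\<lambda>v::'b. v) x v = x" for x v
    by (rule C1fun_bounded_linear[OF bounded_linear_ident])+
  show "C1fun (\<lambda>v::'b::euclidean_space. v \<bullet> v)" by (rule C1fun_inner(1)[OF i(1) i(1)])
  show "pd (\<lambda>v::'b. v \<bullet> v) x v = 2 * (v \<bullet> x)" unfolding C1fun_inner(2)[OF i(1) i(1)] i(2) by (simp add: inner_commute)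
qed

lemma affine_inverse_derivative:
  fixes \<delta> t :: real assumes "1 + \<delta> * t \<noteq> 0"
  shows "((\<lambda>t. inverse (1 + \<delta> * t)) has_real_derivative - (inverse (1 + \<delta> * t) * \<delta> * inverse (1 + \<delta> * t))) (at t)"
proof -
  have "((\<lambda>t. 1 + \<delta> * t) has_real_derivative \<delta>) (at t)" by (auto intro!: derivative_eq_intros)
  from DERIV_inverse'[OF this assms] show ?thesis .
qed

lemma inverse_square_derivative:
  fixes \<delta> t :: real assumes "1 + \<delta> * t \<noteq> 0"
  shows "((\<lambda>t. (1 / (1 + \<delta> * t))\<^sup>2) has_real_derivative - 2 * \<delta> / (1 + \<delta> * t)^3) (at t)"
proof -
  note D = affine_inverse_derivative[OF assms]
  have "(\<lambda>t. (1 / (1 + \<delta> * t))\<^sup>2) = (\<lambda>t. inverse (1 + \<delta> * t) * inverse (1 + \<delta> * t))"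
    by (simp add: fun_eq_iff power2_eq_square divide_inverse)
  moreover have "- 2 * \<delta> / (1 + \<delta> * t)^3 = - (inverse (1 + \<delta> * t) * \<delta> * inverse (1 + \<delta> * t)) * inverse (1 + \<delta> * t)
      + - (inverse (1 + \<delta> * t) * \<delta> * inverse (1 + \<delta> * t)) * inverse (1 + \<delta> * t)"
    by (simp add: divide_inverse power3_eq_cube)
  ultimately show ?thesis using DERIV_mult[OF D D] by simp
qed

lemma saturated_quotient_derivative:
  fixes \<delta> t :: real assumes nz: "1 + \<delta> * t \<noteq> 0"
  shows "((\<lambda>t. t / (2 * (1 + \<delta> * t))) has_real_derivative (1 / (1 + \<delta> * t))\<^sup>2 / 2) (at t)"
proof -
  define i where "i = inverse (1 + \<delta> * t)"
  have "i * (1 + \<delta> * t) = 1" using nz by (simp add: i_def)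
  then have "i * (i * (1 + \<delta> * t)) = i" by simp
  then have e: "1 * i + - (i * \<delta> * i) * t = i * i" by (simp add: algebra_simps)
  have "((\<lambda>t. t * inverse (1 + \<delta> * t)) has_real_derivative i * i) (at t)"
    using DERIV_mult[OF DERIV_ident affine_inverse_derivative[OF nz]] unfolding i_def[symmetric] e .
  then have D: "((\<lambda>t. t * inverse (1 + \<delta> * t) / 2) has_real_derivative i * i / 2) (at t)" by (rule DERIV_cdivide)
  have "(\<lambda>t. t / (2 * (1 + \<delta> * t))) = (\<lambda>t. t * inverse (1 + \<delta> * t) / 2)"
    by (rule ext) (simp only: divide_inverse inverse_mult_distrib mult_ac)
  moreover have "(1 / (1 + \<delta> * t))\<^sup>2 / 2 = i * i / 2"
    by (simp only: i_def power2_eq_square divide_inverse mult_1_left)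
  ultimately show ?thesis using D by (simp only:)
qed

lemma sat_C1:
  assumes d: "0 < \<delta>"
  shows "C1fun (sat \<delta> :: 'b::euclidean_space \<Rightarrow> 'b)" "pd (sat \<delta>) x (v::'b) = dsat \<delta> v x"
    and "C1fun (satpot \<delta> :: 'b \<Rightarrow> real)" "pd (satpot \<delta>) x (v::'b) = sat \<delta> v \<bullet> x"
proof -
  have den: "1 + \<delta> * (v \<bullet> v) \<noteq> 0" for v :: 'b using sat_den[OF d, of v] by linarith
  have sqc: "continuous_on UNIV (\<lambda>v::'b. v \<bullet> v)" by (intro continuous_intros)
  have r: "C1fun (\<lambda>v::'b. (1 / (1 + \<delta> * (v \<bullet> v)))\<^sup>2)"
    "pd (\<lambda>v::'b. (1 / (1 + \<delta> * (v \<bullet> v)))\<^sup>2) x v = - 2 * \<delta> / (1 + \<delta> * (v \<bullet> v))^3 * (2 * (v \<bullet> x))" for x v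
  proof -
    have D: "((\<lambda>t. (1 / (1 + \<delta> * t))\<^sup>2) has_real_derivative - 2 * \<delta> / (1 + \<delta> * (v \<bullet> v))^3) (at (v \<bullet> v))" for v :: 'b
      by (rule inverse_square_derivative[OF den])
    have c: "continuous_on UNIV (\<lambda>v::'b. - 2 * \<delta> / (1 + \<delta> * (v \<bullet> v))^3)"
      using den by (intro continuous_intros) auto
    show "C1fun (\<lambda>v::'b. (1 / (1 + \<delta> * (v \<bullet> v)))\<^sup>2)"
      by (rule C1fun_real_compose(1)[OF square_C1(1) D c])
    show "pd (\<lambda>v::'b. (1 / (1 + \<delta> * (v \<bullet> v)))\<^sup>2) x v = - 2 * \<delta> / (1 + \<delta> * (v \<bullet> v))^3 * (2 * (v \<bullet> x))"
      unfolding C1fun_real_compose(2)[OF square_C1(1) D c] square_C1(2) ..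
  qed
  have i: "C1fun (\<lambda>v::'b. v)" "pd (\<lambda>v::'b. v) x v = x" for x v
    by (rule C1fun_bounded_linear[OF bounded_linear_ident])+
  show "C1fun (sat \<delta> :: 'b \<Rightarrow> 'b)" unfolding sat_def[abs_def] by (rule C1fun_scaleR(1)[OF r(1) i(1)])
  show "pd (sat \<delta>) x (v::'b) = dsat \<delta> v x"
    unfolding sat_def[abs_def] C1fun_scaleR(2)[OF r(1) i(1)] r(2) i(2) dsat_def by (simp add: algebra_simps)
  have D: "((\<lambda>t. t / (2 * (1 + \<delta> * t))) has_real_derivative (1 / (1 + \<delta> * (v \<bullet> v)))\<^sup>2 / 2) (at (v \<bullet> v))" for v :: 'b
    by (rule saturated_quotient_derivative[OF den])
  have c: "continuous_on UNIV (\<lambda>v::'b. (1 / (1 + \<delta> * (v \<bullet> v)))\<^sup>2 / 2)"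
    using den by (intro continuous_intros) auto
  show "C1fun (satpot \<delta> :: 'b \<Rightarrow> real)"
    unfolding satpot_def[abs_def] by (rule C1fun_real_compose(1)[OF square_C1(1) D c])
  show "pd (satpot \<delta>) x (v::'b) = sat \<delta> v \<bullet> x"
    unfolding satpot_def[abs_def] C1fun_real_compose(2)[OF square_C1(1) D c] square_C1(2) sat_def by simp
qed

text \<open>Two kinds of bounds. Those independent of \<delta> furnish majorants for the limit
  \<delta> to 0; the 5 adds 1 from the scaling term and 4 from the term along \<open>v\<close>.
  Those with 1/\<delta> control the inertial integrals while \<delta> is fixed.\<close>

lemma sat_bounds:
  fixes v x :: "'b::real_inner"
  assumes d: "0 < \<delta>"
  shows "norm (sat \<delta> v) \<le> norm v" "norm (sat \<delta> v) \<le> 1 + 1 / \<delta>" "norm (dsat \<delta> v x) \<le> 5 * norm x"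
    "\<bar>satpot \<delta> v\<bar> \<le> 1 / \<delta>"
proof -
  define t where "t = v \<bullet> v"
  define D where "D = 1 + \<delta> * t"
  have t: "0 \<le> t" "t = (norm v)\<^sup>2" by (simp_all add: t_def power2_norm_eq_inner)
  have D: "1 \<le> D" "\<delta> * t \<le> D" using d t(1) by (simp_all add: D_def)
  have D2: "1 \<le> D\<^sup>2" "D \<le> D\<^sup>2" using one_le_power[OF D(1), of 2] power_increasing[OF _ D(1), of 1 2] by simp_all
  have n: "norm (sat \<delta> v) = norm v / D\<^sup>2"
    unfolding sat_def t_def[symmetric] D_def[symmetric] norm_scaleR by (simp add: power_divide)
  show 1: "norm (sat \<delta> v) \<le> norm v"
    unfolding n using D2 by (simp add: divide_le_eq mult_le_cancel_left1)
  \<comment> \<open>Bounding the norm by 1 plus its square lets the denominator absorb it, at the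
    price of 1/\<delta>.\<close>
  have "2 * norm v \<le> (norm v)\<^sup>2 + 1" using sum_squares_bound[of "norm v" 1] by simp
  then have "norm v \<le> 1 + t" unfolding t(2) using norm_ge_zero[of v] by linarith
  also have "\<dots> \<le> (1 + 1 / \<delta>) * D" using d t(1) by (simp add: D_def field_simps)
  also have "\<dots> \<le> (1 + 1 / \<delta>) * D\<^sup>2" using d D2 by (intro mult_left_mono) simp_all
  finally show "norm (sat \<delta> v) \<le> 1 + 1 / \<delta>"
    unfolding n using D2(1) D(1) by (subst pos_divide_le_eq) simp_all
  have "norm (dsat \<delta> v x) \<le> norm ((1 / D)\<^sup>2 *\<^sub>R x) + norm ((4 * \<delta> * (v \<bullet> x) / D^3) *\<^sub>R v)"
    unfolding dsat_def t_def[symmetric] D_def[symmetric] by (rule norm_triangle_ineq4)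
  also have "norm ((1 / D)\<^sup>2 *\<^sub>R x) \<le> 1 * norm x"
    unfolding norm_scaleR by (intro mult_right_mono) (use D in \<open>simp_all add: power_divide divide_le_eq\<close>)
  also have "norm ((4 * \<delta> * (v \<bullet> x) / D^3) *\<^sub>R v) \<le> 4 * norm x"
  proof -
    have "norm ((4 * \<delta> * (v \<bullet> x) / D^3) *\<^sub>R v) = 4 * \<delta> * \<bar>v \<bullet> x\<bar> / D^3 * norm v"
      unfolding norm_scaleR using d D(1) by (simp add: abs_mult)
    also have "\<dots> \<le> 4 * \<delta> * (norm v * norm x) / D^3 * norm v"
      using d D(1) by (intro mult_right_mono divide_right_mono mult_left_mono Cauchy_Schwarz_ineq2) simp_all
    also have "\<dots> = 4 * norm x * (\<delta> * t / D^3)" unfolding t(2) by (simp add: power2_eq_square)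
    also have "\<dots> \<le> 4 * norm x * 1"
    proof (intro mult_left_mono)
      have "\<delta> * t \<le> D^3" using D(2) D2(2) D(1) self_le_power[of D 3] by simp
      then show "\<delta> * t / D^3 \<le> 1" using D(1) by (simp add: divide_le_eq)
    qed simp
    finally show ?thesis by simp
  qed
  finally show "norm (dsat \<delta> v x) \<le> 5 * norm x" by simp
  have "\<bar>satpot \<delta> v\<bar> = t / (2 * D)" unfolding satpot_def t_def[symmetric] D_def[symmetric] using t D by simp
  also have "\<dots> \<le> 1 / \<delta>" using d D t by (simp add: field_simps)
  finally show "\<bar>satpot \<delta> v\<bar> \<le> 1 / \<delta>" .
qed

lemma sat_tendsto:
  fixes v x :: "'b::real_inner"
  shows "(\<lambda>j. sat (1 / real (Suc j)) v) \<longlonglongrightarrow> v" "(\<lambda>j. dsat (1 / real (Suc j)) v x) \<longlonglongrightarrow> x"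
proof -
  have d: "(\<lambda>j. 1 / real (Suc j)) \<longlonglongrightarrow> 0" by (rule LIMSEQ_Suc[OF lim_1_over_n])
  have "(\<lambda>j. (1 / (1 + 1 / real (Suc j) * (v \<bullet> v)))\<^sup>2 *\<^sub>R v) \<longlonglongrightarrow> (1 / (1 + 0 * (v \<bullet> v)))\<^sup>2 *\<^sub>R v"
    by (intro tendsto_intros d) simp
  then show "(\<lambda>j. sat (1 / real (Suc j)) v) \<longlonglongrightarrow> v" by (simp add: sat_def)
  have "(\<lambda>j. (1 / (1 + 1 / real (Suc j) * (v \<bullet> v)))\<^sup>2 *\<^sub>R x - (4 * (1 / real (Suc j)) * (v \<bullet> x) / (1 + 1 / real (Suc j) * (v \<bullet> v))^3) *\<^sub>R v)
      \<longlonglongrightarrow> (1 / (1 + 0 * (v \<bullet> v)))\<^sup>2 *\<^sub>R x - (4 * 0 * (v \<bullet> x) / (1 + 0 * (v \<bullet> v))^3) *\<^sub>R v"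
    by (intro tendsto_intros d) simp_all
  then show "(\<lambda>j. dsat (1 / real (Suc j)) v x) \<longlonglongrightarrow> x" by (simp add: dsat_def)
qed

lemma sat_lim:
  fixes v x :: "nat \<Rightarrow> 'b::real_inner"
  assumes d: "0 < \<delta>" and v: "v \<longlonglongrightarrow> v0" and x: "x \<longlonglongrightarrow> x0"
  shows "(\<lambda>k. sat \<delta> (v k)) \<longlonglongrightarrow> sat \<delta> v0" "(\<lambda>k. dsat \<delta> (v k) (x k)) \<longlonglongrightarrow> dsat \<delta> v0 x0"
    "(\<lambda>k. satpot \<delta> (v k)) \<longlonglongrightarrow> satpot \<delta> v0"
proof -
  have den: "1 + \<delta> * (v0 \<bullet> v0) \<noteq> 0" using sat_den[OF d, of v0] by linarith
  show "(\<lambda>k. sat \<delta> (v k)) \<longlonglongrightarrow> sat \<delta> v0" "(\<lambda>k. dsat \<delta> (v k) (x k)) \<longlonglongrightarrow> dsat \<delta> v0 x0"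
    "(\<lambda>k. satpot \<delta> (v k)) \<longlonglongrightarrow> satpot \<delta> v0"
    unfolding sat_def dsat_def satpot_def using den by (intro tendsto_intros v x; simp)+
qed

lemma sat_measurable:
  fixes v x :: "'a \<Rightarrow> 'b::euclidean_space"
  assumes [measurable]: "v \<in> borel_measurable M" "x \<in> borel_measurable M"
  shows "(\<lambda>z. sat \<delta> (v z)) \<in> borel_measurable M" "(\<lambda>z. dsat \<delta> (v z) (x z)) \<in> borel_measurable M"
    "(\<lambda>z. satpot \<delta> (v z)) \<in> borel_measurable M"
  unfolding sat_def dsat_def satpot_def by measurable

lemma L1_null_dominated_ex:
  fixes e :: "nat \<Rightarrow> 'a \<Rightarrow> real"
  assumes "\<And>k. integrable M (e k)" "\<And>k x. 0 \<le> e k x" "(\<lambda>k. \<integral>x. e k x \<partial>M) \<longlonglongrightarrow> 0"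
  shows "\<exists>r q. strict_mono (r :: nat \<Rightarrow> nat) \<and> integrable M q \<and> (\<forall>x. 0 \<le> q x) \<and>
    (\<forall>k. AE x in M. e (r k) x \<le> q x) \<and> (AE x in M. (\<lambda>k. e (r k) x) \<longlonglongrightarrow> 0)"
proof (rule L1_null_dominated_subseq[OF assms])
  fix r :: "nat \<Rightarrow> nat" and q :: "'a \<Rightarrow> real"
  assume "strict_mono r" "integrable M q" "\<And>x. 0 \<le> q x" "\<And>k. AE x in M. e (r k) x \<le> q x"
    "AE x in M. (\<lambda>k. e (r k) x) \<longlonglongrightarrow> 0"
  then show ?thesis by (intro exI[of _ r] exI[of _ q] conjI allI)
qed

lemma sqi_sqrt: assumes "integrable M q" "\<And>x. 0 \<le> q x" shows "sqi M (\<lambda>x. sqrt (q x))"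
proof -
  have "(\<lambda>x. (norm (sqrt (q x)))\<^sup>2) = q" using assms(2) by (simp add: fun_eq_iff)
  then show ?thesis unfolding sqi_def using borel_measurable_integrable[OF assms(1)] assms(1) by simp
qed

lemma norm_le_of_square_diff:
  fixes x y :: "'b::real_normed_vector"
  assumes "(norm (x - y))\<^sup>2 \<le> q" shows "norm x \<le> norm y + sqrt q"
proof -
  have "norm (x - y) \<le> sqrt q" using assms by (rule real_le_rsqrt)
  moreover have "norm x \<le> norm y + norm (x - y)" using norm_triangle_ineq[of y "x - y"] by simp
  ultimately show ?thesis by simp
qed

lemma tendsto_of_square_diff:
  fixes x :: "nat \<Rightarrow> 'b::real_normed_vector"
  assumes "\<And>k. (norm (x k - y))\<^sup>2 \<le> e k" "e \<longlonglongrightarrow> 0" shows "x \<longlonglongrightarrow> y"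
proof -
  have "(\<lambda>k. (norm (x k - y))\<^sup>2) \<longlonglongrightarrow> 0"
    by (rule tendsto_sandwich[OF _ _ tendsto_const assms(2)]) (use assms(1) in simp_all)
  then have "(\<lambda>k. sqrt ((norm (x k - y))\<^sup>2)) \<longlonglongrightarrow> sqrt 0" by (rule tendsto_real_sqrt)
  then show ?thesis by (simp add: tendsto_norm_zero_iff LIM_zero_iff)
qed

section \<open>The weak form at a fixed scale and dominated approximation\<close>

locale slip_problem = thin_domain +
  fixes \<nu> :: real and f :: "real^2 \<Rightarrow> real^2" and K :: "real^2 \<Rightarrow> real^2^2" and s Mk :: real
  assumes s: "1 < s" "s < 2" and K_meas: "K \<in> borel_measurable lebesgue"
    and K_bound: "y \<in> \<omega> \<Longrightarrow> norm (K y *v \<xi>) \<le> Mk * norm \<xi>" and Mk_nonneg: "0 \<le> Mk"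
    and f_sqi: "sqi (lebesgue_on \<omega>) f" and nu_pos: "0 < \<nu>"
begin

lemma K_meas_base: "K \<in> borel_measurable Mb" by (rule measurable_restrict_space1[OF K_meas])

lemma AE_base: "(\<And>y. y \<in> \<omega> \<Longrightarrow> P y) \<Longrightarrow> AE y in Mb. P y"
  by (rule AE_I2) (simp add: space_restrict_space)

lemma K_sqi: assumes "sqi Mb \<Gamma>" shows "sqi Mb (\<lambda>y. K y *v \<Gamma> y)"
  by (rule sqi_bound[OF matrix_vector_measurable[OF K_meas_base sqiD(1)[OF assms]] assms]) (rule AE_base, rule K_bound)

lemma slip_sqi:
  assumes "sqi Mb \<Gamma>" shows "sqi Mb (\<lambda>y. slip s (K y) (\<Gamma> y))"
proof -
  interpret finite_measure Mb by (rule finite_Mb)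
  have one: "sqi Mb (\<lambda>y. 1::real)" by (rule sqi_bounded[of _ 1]) simp_all
  have "sqi Mb (\<lambda>y. 1 + norm (K y *v \<Gamma> y))" by (rule sqi_add[OF one sqi_norm[OF K_sqi[OF assms]]])
  then show ?thesis
  proof (rule sqi_bound[OF slip_measurable[OF K_meas_base sqiD(1)[OF assms]]])
    show "AE y in Mb. norm (slip s (K y) (\<Gamma> y)) \<le> 1 * norm (1 + norm (K y *v \<Gamma> y))"
      using norm_slip_le[OF s] by (intro AE_I2) (simp add: add_nonneg_nonneg)
  qed
qed

definition trace_slip :: "(pt \<Rightarrow> pt) \<Rightarrow> real^2 \<Rightarrow> real^2" where
  "trace_slip d y = slip s (K y) (fst (vtrace d y))"

lemma trace_fst_sqi: "sqi M1 d \<Longrightarrow> sqi Mb (\<lambda>y. fst (vtrace d y))" for d :: "pt \<Rightarrow> pt"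
  by (rule sqi_linear[OF vtrace_bound(1) bounded_linear_fst])

lemma trace_slip_sqi: "sqi M1 d \<Longrightarrow> sqi Mb (trace_slip d)"
  unfolding trace_slip_def[abs_def] by (intro slip_sqi trace_fst_sqi)

lemma f_sqi_dom: "sqi M1 (\<lambda>z. (f (fst z), 0::real))"
  by (intro sqi_Pair sqi_zero sqi_fst_dom f_sqi zero_less_one)

text \<open>All terms of the scaled equation except inertia, moved to one side. The field, its
  derivatives and its bottom values enter as independent arguments, in each of which the form is
  linear; limits of saturated fields can be inserted without first showing that they are admissible
  tests.\<close>

definition wform :: "real \<Rightarrow> real \<Rightarrow> (pt \<Rightarrow> pt \<Rightarrow> pt) \<Rightarrow> (pt \<Rightarrow> pt) \<Rightarrow> (pt \<Rightarrow> real)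
    \<Rightarrow> (pt \<Rightarrow> pt) \<Rightarrow> (pt \<Rightarrow> pt \<Rightarrow> pt) \<Rightarrow> (pt \<Rightarrow> pt) \<Rightarrow> (real^2 \<Rightarrow> real^2) \<Rightarrow> real" where
  "wform \<beta> \<epsilon> E d q W X D \<Gamma> =
     \<nu> * (\<epsilon>\<^sup>2 * (\<Sum>b\<in>hor. \<integral>z. E b z \<bullet> X b z \<partial>M1) + (\<integral>z. d z \<bullet> D z \<partial>M1))
     + \<epsilon> powr \<beta> * (\<integral>y. trace_slip d y \<bullet> (K y *v \<Gamma> y) \<partial>Mb)
     - ((\<Sum>b\<in>hor. \<integral>z. (q z *\<^sub>R b) \<bullet> X b z \<partial>M1) + (1 / \<epsilon>) * (\<integral>z. (q z *\<^sub>R e3) \<bullet> D z \<partial>M1))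
     - (\<integral>z. (f (fst z), 0) \<bullet> W z \<partial>M1)"

text \<open>Kept apart from \<open>wform\<close> because square integrability of \<open>Z\<close>
  does not control it: passing to the limit needs a bounded \<open>Z\<close>.\<close>

definition inertia :: "real \<Rightarrow> (pt \<Rightarrow> pt) \<Rightarrow> (pt \<Rightarrow> pt \<Rightarrow> pt) \<Rightarrow> (pt \<Rightarrow> pt) \<Rightarrow> (pt \<Rightarrow> pt) \<Rightarrow> real" where
  "inertia \<epsilon> w E d Z = (\<integral>z. \<epsilon>^4 * (\<Sum>b\<in>hor. (w z \<bullet> b) * (E b z \<bullet> Z z)) + \<epsilon>^3 * (snd (w z) * (d z \<bullet> Z z)) \<partial>M1)"

lemma inner_pair_fst: "((a, 0) :: pt) \<bullet> z = a \<bullet> fst z"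
  by (cases z) simp

lemma scaled_equation_wform:
  assumes sq: "\<And>b. b \<in> hor \<Longrightarrow> sqi M1 (E b)" "sqi M1 d" "sqi M1 q" and \<phi>: "test_field 1 \<phi>"
    and eq: "scaled_equation \<nu> f K s \<beta> \<epsilon> w E d q \<phi>"
  shows "wform \<beta> \<epsilon> E d q \<phi> (pd \<phi>) (pd \<phi> e3) (\<lambda>y. fst (\<phi> (y, 0))) + inertia \<epsilon> w E d \<phi> = 0"
proof -
  note C = test_fieldD(1,2)[OF \<phi>]
  have sp: "sqi M1 (pd \<phi> b)" for b by (rule C1_sqi_Mdom_pd[OF zero_less_one C])
  have 1: "(\<integral>z. \<epsilon>\<^sup>2 * (\<Sum>b\<in>hor. E b z \<bullet> pd \<phi> b z) + d z \<bullet> pd \<phi> e3 z \<partial>M1)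
      = \<epsilon>\<^sup>2 * (\<Sum>b\<in>hor. \<integral>z. E b z \<bullet> pd \<phi> b z \<partial>M1) + (\<integral>z. d z \<bullet> pd \<phi> e3 z \<partial>M1)"
  proof -
    have i: "integrable M1 (\<lambda>z. E b z \<bullet> pd \<phi> b z)" if "b \<in> hor" for b by (rule sqi_inner_integrable[OF sq(1)[OF that] sp])
    have "(\<integral>z. \<epsilon>\<^sup>2 * (\<Sum>b\<in>hor. E b z \<bullet> pd \<phi> b z) + d z \<bullet> pd \<phi> e3 z \<partial>M1)
      = (\<integral>z. \<epsilon>\<^sup>2 * (\<Sum>b\<in>hor. E b z \<bullet> pd \<phi> b z) \<partial>M1) + (\<integral>z. d z \<bullet> pd \<phi> e3 z \<partial>M1)"
      by (intro Bochner_Integration.integral_add integrable_mult_right Bochner_Integration.integrable_sum i sqi_inner_integrable sq sp)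
    then show ?thesis by (simp add: Bochner_Integration.integral_sum[OF i])
  qed
  have 2: "(\<integral>z. q z * ((\<Sum>b\<in>hor. pd \<phi> b z \<bullet> b) + (1 / \<epsilon>) * snd (pd \<phi> e3 z)) \<partial>M1)
      = (\<Sum>b\<in>hor. \<integral>z. (q z *\<^sub>R b) \<bullet> pd \<phi> b z \<partial>M1) + (1 / \<epsilon>) * (\<integral>z. (q z *\<^sub>R e3) \<bullet> pd \<phi> e3 z \<partial>M1)"
  proof -
    have i: "integrable M1 (\<lambda>z. (q z *\<^sub>R b) \<bullet> pd \<phi> b z)" for b by (rule sqi_inner_integrable[OF sqi_scaleR_const[OF sq(3)] sp])
    have "(\<integral>z. q z * ((\<Sum>b\<in>hor. pd \<phi> b z \<bullet> b) + (1 / \<epsilon>) * snd (pd \<phi> e3 z)) \<partial>M1)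
      = (\<integral>z. (\<Sum>b\<in>hor. (q z *\<^sub>R b) \<bullet> pd \<phi> b z) + (1 / \<epsilon>) * ((q z *\<^sub>R e3) \<bullet> pd \<phi> e3 z) \<partial>M1)"
      by (rule Bochner_Integration.integral_cong[OF refl])
         (simp add: inner_e3[symmetric] sum_distrib_left distrib_left inner_commute)
    also have "\<dots> = (\<integral>z. (\<Sum>b\<in>hor. (q z *\<^sub>R b) \<bullet> pd \<phi> b z) \<partial>M1) + (\<integral>z. (1 / \<epsilon>) * ((q z *\<^sub>R e3) \<bullet> pd \<phi> e3 z) \<partial>M1)"
      by (intro Bochner_Integration.integral_add integrable_mult_right Bochner_Integration.integrable_sum i)
    also have "(\<integral>z. (\<Sum>b\<in>hor. (q z *\<^sub>R b) \<bullet> pd \<phi> b z) \<partial>M1) = (\<Sum>b\<in>hor. \<integral>z. (q z *\<^sub>R b) \<bullet> pd \<phi> b z \<partial>M1)"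
      by (rule Bochner_Integration.integral_sum[OF i])
    also have "(\<integral>z. (1 / \<epsilon>) * ((q z *\<^sub>R e3) \<bullet> pd \<phi> e3 z) \<partial>M1) = (1 / \<epsilon>) * (\<integral>z. (q z *\<^sub>R e3) \<bullet> pd \<phi> e3 z \<partial>M1)"
      by (rule integral_mult_right_zero)
    finally show ?thesis .
  qed
  show ?thesis
    using eq unfolding scaled_equation_def 1 2 wform_def inertia_def trace_slip_def inner_pair_fst by linarith
qed

lemma wform_tendsto:
  assumes sq: "\<And>b. b \<in> hor \<Longrightarrow> sqi M1 (E b)" "sqi M1 d" "sqi M1 q" and R: "sqi M1 (R :: pt \<Rightarrow> real)" "sqi Mb (S :: real^2 \<Rightarrow> real)"
    and W: "\<And>k. W k \<in> borel_measurable M1" "W0 \<in> borel_measurable M1" "AE z in M1. (\<lambda>k. W k z) \<longlonglongrightarrow> W0 z"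
      "\<And>k. AE z in M1. norm (W k z) \<le> R z"
    and X: "\<And>k b. b \<in> hor \<Longrightarrow> X k b \<in> borel_measurable M1" "\<And>b. b \<in> hor \<Longrightarrow> X0 b \<in> borel_measurable M1"
      "\<And>b. b \<in> hor \<Longrightarrow> AE z in M1. (\<lambda>k. X k b z) \<longlonglongrightarrow> X0 b z"
      "\<And>k b. b \<in> hor \<Longrightarrow> AE z in M1. norm (X k b z) \<le> R z"
    and D: "\<And>k. D k \<in> borel_measurable M1" "D0 \<in> borel_measurable M1" "AE z in M1. (\<lambda>k. D k z) \<longlonglongrightarrow> D0 z"
      "\<And>k. AE z in M1. norm (D k z) \<le> R z"
    and \<Gamma>: "\<And>k. \<Gamma> k \<in> borel_measurable Mb" "\<Gamma>0 \<in> borel_measurable Mb" "AE y in Mb. (\<lambda>k. \<Gamma> k y) \<longlonglongrightarrow> \<Gamma>0 y"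
      "\<And>k. AE y in Mb. norm (\<Gamma> k y) \<le> S y"
  shows "(\<lambda>k. wform \<beta> \<epsilon> E d q (W k) (X k) (D k) (\<Gamma> k)) \<longlonglongrightarrow> wform \<beta> \<epsilon> E d q W0 X0 D0 \<Gamma>0"
proof -
  have b: "(\<lambda>k. \<integral>y. trace_slip d y \<bullet> (K y *v \<Gamma> k y) \<partial>Mb) \<longlonglongrightarrow> (\<integral>y. trace_slip d y \<bullet> (K y *v \<Gamma>0 y) \<partial>Mb)"
  proof (rule sqi_dominated_convergence[OF trace_slip_sqi[OF sq(2)]])
    show "sqi Mb (\<lambda>y. Mk *\<^sub>R S y)" by (rule sqi_scaleR[OF R(2)])
    show "(\<lambda>y. K y *v \<Gamma> k y) \<in> borel_measurable Mb" "(\<lambda>y. K y *v \<Gamma>0 y) \<in> borel_measurable Mb" for k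
      by (intro matrix_vector_measurable K_meas_base \<Gamma>)+
    show "AE y in Mb. (\<lambda>k. K y *v \<Gamma> k y) \<longlonglongrightarrow> K y *v \<Gamma>0 y"
      using \<Gamma>(3)
    proof eventually_elim
      case (elim y)
      show ?case
        by (rule continuous_imp_tendsto[OF _ elim, unfolded o_def])
           (rule linear_continuous_at[OF matrix_vector_mul_bounded_linear])
    qed
    fix k
    have kb: "AE y in Mb. norm (K y *v \<Gamma> k y) \<le> Mk * norm (\<Gamma> k y)"
      by (rule AE_base) (rule K_bound)
    show "AE y in Mb. norm (K y *v \<Gamma> k y) \<le> Mk *\<^sub>R S y"
      using \<Gamma>(4)[of k] kb
    proof eventually_elim
      case (elim y)
      then show ?case using mult_left_mono[OF elim(1) Mk_nonneg] by simp
    qed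
  qed
  have t: "(\<lambda>k. \<integral>z. Y z \<bullet> X k b z \<partial>M1) \<longlonglongrightarrow> (\<integral>z. Y z \<bullet> X0 b z \<partial>M1)" if "sqi M1 Y" "b \<in> hor" for Y b
    by (rule sqi_dominated_convergence[OF that(1) R(1) X(1)[OF that(2)] X(2)[OF that(2)] X(3)[OF that(2)] X(4)[OF that(2)]])
  have tD: "(\<lambda>k. \<integral>z. Y z \<bullet> D k z \<partial>M1) \<longlonglongrightarrow> (\<integral>z. Y z \<bullet> D0 z \<partial>M1)" if "sqi M1 Y" for Y
    by (rule sqi_dominated_convergence[OF that R(1) D])
  have tW: "(\<lambda>k. \<integral>z. Y z \<bullet> W k z \<partial>M1) \<longlonglongrightarrow> (\<integral>z. Y z \<bullet> W0 z \<partial>M1)" if "sqi M1 Y" for Y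
    by (rule sqi_dominated_convergence[OF that R(1) W])
  have x1: "(\<lambda>k. \<Sum>b\<in>hor. \<integral>z. E b z \<bullet> X k b z \<partial>M1) \<longlonglongrightarrow> (\<Sum>b\<in>hor. \<integral>z. E b z \<bullet> X0 b z \<partial>M1)"
    by (rule tendsto_sum) (rule t[OF sq(1)])
  have x2: "(\<lambda>k. \<Sum>b\<in>hor. \<integral>z. (q z *\<^sub>R b) \<bullet> X k b z \<partial>M1) \<longlonglongrightarrow> (\<Sum>b\<in>hor. \<integral>z. (q z *\<^sub>R b) \<bullet> X0 b z \<partial>M1)"
    by (rule tendsto_sum) (rule t[OF sqi_scaleR_const[OF sq(3)]])
  show ?thesis
    unfolding wform_def
    by (intro tendsto_add tendsto_diff tendsto_mult tendsto_const b x1 x2 tD[OF sq(2)] tD[OF sqi_scaleR_const[OF sq(3)]] tW[OF f_sqi_dom])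
qed

text \<open>Norm convergence is not enough for inserting nonlinear saturations, so it is turned into
  almost-everywhere convergence with square-integrable majorants. Two extractions are needed: one on
  the domain, and one on the base for the bottom values.\<close>

lemma scaled_solution_dominated_approx:
  assumes ss: "scaled_solution \<nu> f K s \<beta> \<epsilon> w E d q"
  shows "\<exists>\<phi> R S. (\<forall>k. test_field 1 (\<phi> k) \<and> bottom_tangential (\<phi> k)) \<and> sqi M1 (R :: pt \<Rightarrow> real) \<and> sqi Mb (S :: real^2 \<Rightarrow> real) \<and>
    (AE z in M1. (\<lambda>k. \<phi> k z) \<longlonglongrightarrow> w z) \<and> (\<forall>k. AE z in M1. norm (\<phi> k z) \<le> R z) \<and>
    (\<forall>b\<in>hor. (AE z in M1. (\<lambda>k. pd (\<phi> k) b z) \<longlonglongrightarrow> E b z) \<and> (\<forall>k. AE z in M1. norm (pd (\<phi> k) b z) \<le> R z)) \<and>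
    (AE z in M1. (\<lambda>k. pd (\<phi> k) e3 z) \<longlonglongrightarrow> d z) \<and> (\<forall>k. AE z in M1. norm (pd (\<phi> k) e3 z) \<le> R z) \<and>
    (AE y in Mb. (\<lambda>k. \<phi> k (y, 0)) \<longlonglongrightarrow> vtrace d y) \<and> (\<forall>k. AE y in Mb. norm (\<phi> k (y, 0)) \<le> S y)"
proof -
  have sq: "sqi M1 w" "\<And>b. b \<in> hor \<Longrightarrow> sqi M1 (E b)" "sqi M1 d" using ss unfolding scaled_solution_def by auto
  obtain \<phi>0 where \<phi>0: "\<forall>n. test_field 1 (\<phi>0 n) \<and> bottom_tangential (\<phi>0 n)"
    and lim0: "(\<lambda>n. \<integral>z. approx_error w E d (\<phi>0 n) z \<partial>M1) \<longlonglongrightarrow> 0"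
    using ss unfolding scaled_solution_def by blast
  have t0: "test_field 1 (\<phi>0 n)" for n using \<phi>0 by blast
  obtain r q1 where r: "strict_mono (r :: nat \<Rightarrow> nat)" and q1: "integrable M1 q1" "\<forall>x. 0 \<le> q1 x"
    and ae1: "\<forall>k. AE z in M1. approx_error w E d (\<phi>0 (r k)) z \<le> q1 z"
    and ae2: "AE z in M1. (\<lambda>k. approx_error w E d (\<phi>0 (r k)) z) \<longlonglongrightarrow> 0"
    using L1_null_dominated_ex[OF approx_error_integrable[OF sq t0] approx_error_ge(4) lim0] by blast
  define e' where "e' k y = (norm (\<phi>0 (r k) (y, 0) - vtrace d y))\<^sup>2" for k y
  note C0 = test_fieldD(1,2)[OF t0]
  have sb: "sqi Mb (\<lambda>y. \<phi>0 n (y, 0))" for n by (rule bottom_sqi[OF C0])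
  have sv: "sqi Mb (vtrace d)" by (rule vtrace_bound(1)[OF sq(3)])
  have s3: "sqi M1 (pd (\<phi>0 n) e3)" for n by (rule C1_sqi_Mdom_pd[OF zero_less_one C0])
  have e'i: "integrable Mb (e' k)" for k unfolding e'_def by (rule sqiD(2)[OF sqi_diff[OF sb sv]])
  \<comment> \<open>The trace is linear almost everywhere, so the error of the bottom values is the
    trace of the error of the vertical derivatives and inherits its bound.\<close>
  have e'le: "integral\<^sup>L Mb (e' k) \<le> H * (\<integral>z. (norm (pd (\<phi>0 (r k)) e3 z - d z))\<^sup>2 \<partial>M1)" for k
  proof -
    have "integral\<^sup>L Mb (e' k) = (\<integral>y. (norm (vtrace (\<lambda>z. pd (\<phi>0 (r k)) e3 z - d z) y))\<^sup>2 \<partial>Mb)"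
    proof (rule integral_cong_AE[OF borel_measurable_integrable[OF e'i]])
      show "(\<lambda>y. (norm (vtrace (\<lambda>z. pd (\<phi>0 (r k)) e3 z - d z) y))\<^sup>2) \<in> borel_measurable Mb"
        by (rule borel_measurable_integrable[OF sqiD(2)[OF vtrace_bound(1)[OF sqi_diff[OF s3 sq(3)]]]])
      show "AE y in Mb. e' k y = (norm (vtrace (\<lambda>z. pd (\<phi>0 (r k)) e3 z - d z) y))\<^sup>2"
      proof -
        have "AE y in Mb. vtrace (pd (\<phi>0 (r k)) e3) y = \<phi>0 (r k) (y, 0)"
          by (rule AE_base) (rule vtrace_pd[OF t0])
        with vtrace_diff[OF s3[of "r k"] sq(3)] show ?thesis
          by eventually_elim (simp add: e'_def)
      qed
    qed
    also have "\<dots> \<le> H * (\<integral>z. (norm (pd (\<phi>0 (r k)) e3 z - d z))\<^sup>2 \<partial>M1)"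
      by (rule vtrace_bound(2)[OF sqi_diff[OF s3 sq(3)]])
    finally show ?thesis .
  qed
  have "(\<lambda>k. H * (\<integral>z. (norm (pd (\<phi>0 (r k)) e3 z - d z))\<^sup>2 \<partial>M1)) \<longlonglongrightarrow> 0"
    using tendsto_mult_right_zero[OF LIMSEQ_subseq_LIMSEQ[OF approx_error_tendsto(2)[OF sq t0 lim0] r, unfolded o_def]] .
  then have e'lim: "(\<lambda>k. integral\<^sup>L Mb (e' k)) \<longlonglongrightarrow> 0"
    by (rule tendsto_sandwich[OF _ _ tendsto_const, rotated 2]) (use e'le in \<open>auto simp: e'_def\<close>)
  have e'nn: "0 \<le> e' k y" for k y by (simp add: e'_def)
  obtain r' q2 where r': "strict_mono (r' :: nat \<Rightarrow> nat)" and q2: "integrable Mb q2" "\<forall>x. 0 \<le> q2 x"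
    and ae3: "\<forall>k. AE y in Mb. e' (r' k) y \<le> q2 y" and ae4: "AE y in Mb. (\<lambda>k. e' (r' k) y) \<longlonglongrightarrow> 0"
    using L1_null_dominated_ex[OF e'i e'nn e'lim] by blast
  define \<phi> where "\<phi> k = \<phi>0 (r (r' k))" for k
  define R where "R z = norm (w z) + (\<Sum>b\<in>hor. norm (E b z)) + norm (d z) + sqrt (q1 z)" for z
  define S where "S y = norm (vtrace d y) + sqrt (q2 y)" for y
  have R: "sqi M1 R" unfolding R_def by (intro sqi_add sqi_sum sqi_norm sq sqi_sqrt q1(1) q1(2)[rule_format])
  have S: "sqi Mb S" unfolding S_def by (intro sqi_add sqi_norm sv sqi_sqrt q2(1) q2(2)[rule_format])
  have Rge: "norm (w z) + sqrt (q1 z) \<le> R z" "norm (d z) + sqrt (q1 z) \<le> R z" "b \<in> hor \<Longrightarrow> norm (E b z) + sqrt (q1 z) \<le> R z" for b z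
  proof -
    have 0: "0 \<le> (\<Sum>b\<in>hor. norm (E b z))" by (intro sum_nonneg) simp
    show "norm (w z) + sqrt (q1 z) \<le> R z" "norm (d z) + sqrt (q1 z) \<le> R z"
      unfolding R_def using 0 norm_ge_zero[of "w z"] norm_ge_zero[of "d z"] by linarith+
    assume b: "b \<in> hor"
    have "norm (E b z) \<le> (\<Sum>b\<in>hor. norm (E b z))" by (rule member_le_sum[OF b]) (use Basis_hor(3) in auto)
    then show "norm (E b z) + sqrt (q1 z) \<le> R z"
      unfolding R_def using norm_ge_zero[of "w z"] norm_ge_zero[of "d z"] by linarith
  qed
  have lim: "AE z in M1. (\<lambda>k. approx_error w E d (\<phi> k) z) \<longlonglongrightarrow> 0"
    using ae2 by eventually_elim (unfold \<phi>_def, erule LIMSEQ_subseq_LIMSEQ[OF _ r', unfolded o_def])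
  have dom: "AE z in M1. approx_error w E d (\<phi> k) z \<le> q1 z" for k unfolding \<phi>_def using ae1 by blast
  have dom1: "norm (\<phi> k z) \<le> R z" if "approx_error w E d (\<phi> k) z \<le> q1 z" for k z
    by (rule order_trans[OF norm_le_of_square_diff Rge(1)]) (rule order_trans[OF approx_error_ge(1) that])
  have dom2: "norm (pd (\<phi> k) e3 z) \<le> R z" if "approx_error w E d (\<phi> k) z \<le> q1 z" for k z
    by (rule order_trans[OF norm_le_of_square_diff Rge(2)]) (rule order_trans[OF approx_error_ge(2) that])
  have dom3: "norm (pd (\<phi> k) b z) \<le> R z" if "b \<in> hor" "approx_error w E d (\<phi> k) z \<le> q1 z" for k z b
    by (rule order_trans[OF norm_le_of_square_diff Rge(3)[OF that(1)]]) (rule order_trans[OF approx_error_ge(3)[OF that(1)] that(2)])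
  show ?thesis
  proof (intro exI[of _ \<phi>] exI[of _ R] exI[of _ S] conjI allI ballI)
    show "test_field 1 (\<phi> k)" "bottom_tangential (\<phi> k)" for k using \<phi>0 unfolding \<phi>_def by auto
    show "sqi M1 R" "sqi Mb S" by (fact R, fact S)
    show "AE z in M1. (\<lambda>k. \<phi> k z) \<longlonglongrightarrow> w z"
      using lim by eventually_elim (rule tendsto_of_square_diff[OF approx_error_ge(1)])
    show "AE z in M1. (\<lambda>k. pd (\<phi> k) e3 z) \<longlonglongrightarrow> d z"
      using lim by eventually_elim (rule tendsto_of_square_diff[OF approx_error_ge(2)])
    show "AE z in M1. (\<lambda>k. pd (\<phi> k) b z) \<longlonglongrightarrow> E b z" if "b \<in> hor" for b
      using lim by eventually_elim (rule tendsto_of_square_diff[OF approx_error_ge(3)[OF that]])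
    show "AE z in M1. norm (\<phi> k z) \<le> R z" for k
      using dom[of k] by eventually_elim (rule dom1)
    show "AE z in M1. norm (pd (\<phi> k) e3 z) \<le> R z" for k
      using dom[of k] by eventually_elim (rule dom2)
    show "AE z in M1. norm (pd (\<phi> k) b z) \<le> R z" if "b \<in> hor" for k b
      using dom[of k] by eventually_elim (rule dom3[OF that])
    show "AE y in Mb. (\<lambda>k. \<phi> k (y, 0)) \<longlonglongrightarrow> vtrace d y"
      using ae4
    proof eventually_elim
      case (elim y)
      show ?case by (rule tendsto_of_square_diff[OF _ elim]) (simp add: e'_def \<phi>_def)
    qed
    show "AE y in Mb. norm (\<phi> k (y, 0)) \<le> S y" for k
      using ae3[rule_format, of k]
      by eventually_elim (unfold S_def \<phi>_def e'_def, erule norm_le_of_square_diff)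
  qed
qed

end

lemma integral_dominated_convergence_real:
  fixes F :: "nat \<Rightarrow> 'a \<Rightarrow> real"
  assumes "integrable M G" "\<And>k. F k \<in> borel_measurable M" "F0 \<in> borel_measurable M"
    "AE x in M. (\<lambda>k. F k x) \<longlonglongrightarrow> F0 x" "\<And>k. AE x in M. \<bar>F k x\<bar> \<le> G x"
  shows "(\<lambda>k. \<integral>x. F k x \<partial>M) \<longlonglongrightarrow> (\<integral>x. F0 x \<partial>M)"
  by (rule integral_dominated_convergence[OF assms(3,2,1,4)]) (use assms(5) in simp)

section \<open>Cancellation of inertia and the energy balance\<close>

context slip_problem
begin

lemma norm_hor: "b \<in> hor \<Longrightarrow> norm b = 1" by (simp add: hor_def)

text \<open>With \<open>Z\<close> bounded, each product has two square-integrable factors, so a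
  constant multiple of \<open>(R z)\<^sup>2\<close> dominates the integrand.\<close>

lemma inertia_tendsto:
  assumes R: "sqi M1 (R :: pt \<Rightarrow> real)" and \<epsilon>: "0 < \<epsilon>" and C: "0 \<le> C"
    and w: "\<And>k. w k \<in> borel_measurable M1" "w0 \<in> borel_measurable M1" "AE z in M1. (\<lambda>k. w k z) \<longlonglongrightarrow> w0 z"
      "\<And>k. AE z in M1. norm (w k z) \<le> R z"
    and E: "\<And>k b. b \<in> hor \<Longrightarrow> E k b \<in> borel_measurable M1" "\<And>b. b \<in> hor \<Longrightarrow> E0 b \<in> borel_measurable M1"
      "\<And>b. b \<in> hor \<Longrightarrow> AE z in M1. (\<lambda>k. E k b z) \<longlonglongrightarrow> E0 b z"
      "\<And>k b. b \<in> hor \<Longrightarrow> AE z in M1. norm (E k b z) \<le> R z"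
    and d: "\<And>k. d k \<in> borel_measurable M1" "d0 \<in> borel_measurable M1" "AE z in M1. (\<lambda>k. d k z) \<longlonglongrightarrow> d0 z"
      "\<And>k. AE z in M1. norm (d k z) \<le> R z"
    and Z: "\<And>k. Z k \<in> borel_measurable M1" "Z0 \<in> borel_measurable M1" "AE z in M1. (\<lambda>k. Z k z) \<longlonglongrightarrow> Z0 z"
      "\<And>k z. norm (Z k z) \<le> C"
  shows "(\<lambda>k. inertia \<epsilon> (w k) (E k) (d k) (Z k)) \<longlonglongrightarrow> inertia \<epsilon> w0 E0 d0 Z0"
  unfolding inertia_def
proof (rule integral_dominated_convergence_real)
  define G where "G z = (\<epsilon>^4 * (\<Sum>b\<in>hor. C) + \<epsilon>^3 * C) * (R z)\<^sup>2" for z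
  have "integrable M1 (\<lambda>z. (R z)\<^sup>2)" using sqiD(2)[OF R] by simp
  then show "integrable M1 G" unfolding G_def by (rule integrable_mult_right)
  have sndm: "(\<lambda>z. snd (u z)) \<in> borel_measurable M1" if "u \<in> borel_measurable M1" for u :: "pt \<Rightarrow> pt"
    unfolding inner_e3[symmetric] by (intro borel_measurable_inner that borel_measurable_const)
  show "(\<lambda>z. \<epsilon>^4 * (\<Sum>b\<in>hor. (w k z \<bullet> b) * (E k b z \<bullet> Z k z)) + \<epsilon>^3 * (snd (w k z) * (d k z \<bullet> Z k z))) \<in> borel_measurable M1" for k
    by (intro borel_measurable_add borel_measurable_times borel_measurable_sum borel_measurable_inner borel_measurable_const
        sndm w E d Z)
  show "(\<lambda>z. \<epsilon>^4 * (\<Sum>b\<in>hor. (w0 z \<bullet> b) * (E0 b z \<bullet> Z0 z)) + \<epsilon>^3 * (snd (w0 z) * (d0 z \<bullet> Z0 z))) \<in> borel_measurable M1"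
    by (intro borel_measurable_add borel_measurable_times borel_measurable_sum borel_measurable_inner borel_measurable_const
        sndm w E d Z)
  have Eall: "AE z in M1. \<forall>b\<in>hor. (\<lambda>k. E k b z) \<longlonglongrightarrow> E0 b z"
    by (intro AE_finite_allI Basis_hor(3) E(3))
  show "AE z in M1. (\<lambda>k. \<epsilon>^4 * (\<Sum>b\<in>hor. (w k z \<bullet> b) * (E k b z \<bullet> Z k z)) + \<epsilon>^3 * (snd (w k z) * (d k z \<bullet> Z k z)))
      \<longlonglongrightarrow> \<epsilon>^4 * (\<Sum>b\<in>hor. (w0 z \<bullet> b) * (E0 b z \<bullet> Z0 z)) + \<epsilon>^3 * (snd (w0 z) * (d0 z \<bullet> Z0 z))"
    using w(3) Eall d(3) Z(3)
  proof eventually_elim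
    case (elim z)
    show ?case
      by (intro tendsto_add tendsto_mult tendsto_const tendsto_sum tendsto_inner tendsto_snd elim(1) elim(2)[rule_format] elim(3,4))
  qed
  show "AE z in M1. \<bar>\<epsilon>^4 * (\<Sum>b\<in>hor. (w k z \<bullet> b) * (E k b z \<bullet> Z k z)) + \<epsilon>^3 * (snd (w k z) * (d k z \<bullet> Z k z))\<bar> \<le> G z" for k
  proof -
    have Eb: "AE z in M1. \<forall>b\<in>hor. norm (E k b z) \<le> R z" by (intro AE_finite_allI Basis_hor(3) E(4))
    show ?thesis using w(4)[of k] Eb d(4)[of k]
    proof eventually_elim
      case (elim z)
      have R0: "0 \<le> R z" using norm_ge_zero[of "w k z"] elim(1) by linarith
      have prod: "\<bar>a * (x \<bullet> Z k z)\<bar> \<le> C * (R z)\<^sup>2" if "\<bar>a\<bar> \<le> R z" "norm x \<le> R z" for a :: real and x :: pt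
      proof -
        have "\<bar>x \<bullet> Z k z\<bar> \<le> norm x * norm (Z k z)" by (rule Cauchy_Schwarz_ineq2)
        also have "\<dots> \<le> R z * C" by (intro mult_mono that(2) Z(4) R0 norm_ge_zero)
        finally have "\<bar>a\<bar> * \<bar>x \<bullet> Z k z\<bar> \<le> R z * (R z * C)" by (intro mult_mono that(1) R0 abs_ge_zero)
        then show ?thesis by (simp add: abs_mult power2_eq_square mult_ac)
      qed
      have wb: "\<bar>w k z \<bullet> b\<bar> \<le> R z" if "b \<in> hor" for b
        using Cauchy_Schwarz_ineq2[of "w k z" b] norm_hor[OF that] elim(1) by simp
      have ws: "\<bar>snd (w k z)\<bar> \<le> R z"
        using Cauchy_Schwarz_ineq2[of "w k z" e3] e3_Basis elim(1) by (simp add: inner_e3)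
      have "\<bar>\<Sum>b\<in>hor. (w k z \<bullet> b) * (E k b z \<bullet> Z k z)\<bar> \<le> (\<Sum>b\<in>hor. \<bar>(w k z \<bullet> b) * (E k b z \<bullet> Z k z)\<bar>)"
        by (rule sum_abs)
      also have "\<dots> \<le> (\<Sum>b\<in>hor. C * (R z)\<^sup>2)"
        by (intro sum_mono prod wb elim(2)[rule_format])
      finally have s1: "\<bar>\<Sum>b\<in>hor. (w k z \<bullet> b) * (E k b z \<bullet> Z k z)\<bar> \<le> (\<Sum>b\<in>hor. C * (R z)\<^sup>2)" .
      have "\<bar>\<epsilon>^4 * (\<Sum>b\<in>hor. (w k z \<bullet> b) * (E k b z \<bullet> Z k z)) + \<epsilon>^3 * (snd (w k z) * (d k z \<bullet> Z k z))\<bar>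
          \<le> \<epsilon>^4 * \<bar>\<Sum>b\<in>hor. (w k z \<bullet> b) * (E k b z \<bullet> Z k z)\<bar> + \<epsilon>^3 * \<bar>snd (w k z) * (d k z \<bullet> Z k z)\<bar>"
        by (rule order_trans[OF abs_triangle_ineq]) (use \<epsilon> in \<open>simp add: abs_mult\<close>)
      also have "\<dots> \<le> \<epsilon>^4 * (\<Sum>b\<in>hor. C * (R z)\<^sup>2) + \<epsilon>^3 * (C * (R z)\<^sup>2)"
        using \<epsilon> by (intro add_mono mult_left_mono s1 prod ws elim(3)) simp_all
      also have "\<dots> = G z" by (simp add: G_def algebra_simps sum_distrib_right)
      finally show ?case .
    qed
  qed
qed

text \<open>Because \<open>sat\<close> is the gradient of \<open>satpot\<close>, the transport term
  equals the divergence of \<open>satpot \<delta> \<phi>\<close> times \<phi>, minus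
  \<open>satpot\<close> times the divergence of \<phi>. The first part integrates to 0: laterally
  and above by the support condition, on the bottom by tangency.\<close>

lemma inertia_test:
  assumes \<phi>: "test_field 1 \<phi>" "bottom_tangential \<phi>" and \<epsilon>: "0 < \<epsilon>" and \<delta>: "0 < \<delta>"
  shows "inertia \<epsilon> \<phi> (pd \<phi>) (pd \<phi> e3) (\<lambda>z. sat \<delta> (\<phi> z))
    = - (\<epsilon>^4 * (\<integral>z. satpot \<delta> (\<phi> z) * ((\<Sum>b\<in>hor. pd \<phi> b z \<bullet> b) + (1 / \<epsilon>) * snd (pd \<phi> e3 z)) \<partial>M1))"
proof -
  note C = test_fieldD(1,2)[OF \<phi>(1)]
  interpret finite_measure M1 by (rule finite_Mdom) simp
  define P where "P z = satpot \<delta> (\<phi> z)" for z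
  have PC: "C1fun P" and Ppd: "pd P v z = sat \<delta> (\<phi> z) \<bullet> pd \<phi> v z" for v z
    unfolding P_def using C1fun_compose[OF C(1) sat_C1(3)[OF \<delta>]] sat_C1(4)[OF \<delta>] by auto
  have P0: "\<phi> z \<noteq> 0" if "P z \<noteq> 0" for z using that by (auto simp: P_def satpot_def)
  have Psub: "supp P \<subseteq> supp \<phi>" by (rule supp_subsetI[OF closed_supp in_supp]) (rule P0)
  have Ptest: "test_field 1 (\<lambda>z. P z * g z)" if g: "C1fun g" for g :: "pt \<Rightarrow> real"
    by (rule test_field_subset[OF C1fun_mult(1)[OF PC g] _ \<phi>(1)])
       (rule supp_subsetI[OF closed_supp in_supp], rule P0, simp)
  have sP: "sqi M1 P" by (rule C1_sqi_Mdom[OF zero_less_one PC compact_suppI[OF C(2) Psub]])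
  have inC: "C1fun (\<lambda>z. \<phi> z \<bullet> b)" "pd (\<lambda>z. \<phi> z \<bullet> b) v z = pd \<phi> v z \<bullet> b" for b v z
    by (rule C1fun_linear_compose[OF C(1) bounded_linear_inner_left])+
  define G where "G b z = P z * (\<phi> z \<bullet> b)" for b z
  have Gt: "test_field 1 (G b)" for b unfolding G_def by (rule Ptest[OF inC(1)])
  have Gpd: "pd (G b) v z = P z * (pd \<phi> v z \<bullet> b) + (sat \<delta> (\<phi> z) \<bullet> pd \<phi> v z) * (\<phi> z \<bullet> b)" for b v z
    unfolding G_def C1fun_mult(2)[OF PC inC(1)] inC(2) Ppd ..
  have Gi: "integrable M1 (pd (G b) v)" for b v
    by (rule sqi_integrable[OF C1_sqi_Mdom_pd[OF zero_less_one test_fieldD(1,2)[OF Gt]]])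
  have Gh: "integral\<^sup>L M1 (pd (G b) b) = 0" if "b \<in> hor" for b
    using horizontal_integral_eq_0[OF Gt snd_hor[OF that]] by (simp add: integral_lebesgue_on_eq[OF sets_dom])
  have G3: "integral\<^sup>L M1 (pd (G e3) e3) = 0"
  proof -
    have "(\<integral>y. G e3 (y, 0) \<partial>Mb) = (\<integral>y. 0 \<partial>Mb)"
      by (rule Bochner_Integration.integral_cong[OF refl])
         (use \<phi>(2) in \<open>simp add: G_def inner_e3 bottom_tangential_def space_restrict_space\<close>)
    then show ?thesis
      using vertical_integral_dom[OF Gt zero_less_one]
      by (simp add: integral_lebesgue_on_eq[OF sets_dom, symmetric] integral_lebesgue_on_eq[OF sets_base, symmetric])
  qed
  let ?dv = "\<lambda>z. (\<Sum>b\<in>hor. pd \<phi> b z \<bullet> b) + (1 / \<epsilon>) * snd (pd \<phi> e3 z)"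
  have sdv: "sqi M1 ?dv"
    unfolding inner_e3[symmetric] real_scaleR_def[symmetric]
    by (intro sqi_add sqi_sum sqi_inner_right sqi_scaleR C1_sqi_Mdom_pd[OF zero_less_one C])
  have Pi: "integrable M1 (\<lambda>z. P z * ?dv z)" using sqi_inner_integrable[OF sP sdv] by simp
  \<comment> \<open>The powers of the two inertial terms differ by exactly the factor 1/\<epsilon>
    of the scaled divergence, so both terms form one divergence.\<close>
  have e34: "\<epsilon>^3 = \<epsilon>^4 * (1 / \<epsilon>)" using \<epsilon> by (simp add: power3_eq_cube power4_eq_xxxx)
  have "\<epsilon>^4 * (\<Sum>b\<in>hor. (\<phi> z \<bullet> b) * (pd \<phi> b z \<bullet> sat \<delta> (\<phi> z))) + \<epsilon>^3 * (snd (\<phi> z) * (pd \<phi> e3 z \<bullet> sat \<delta> (\<phi> z)))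
      = \<epsilon>^4 * ((\<Sum>b\<in>hor. pd (G b) b z) + (1 / \<epsilon>) * pd (G e3) e3 z - P z * ?dv z)" for z
    unfolding Gpd inner_e3 e34 by (simp add: algebra_simps sum.distrib sum_distrib_left inner_commute)
  then have "inertia \<epsilon> \<phi> (pd \<phi>) (pd \<phi> e3) (\<lambda>z. sat \<delta> (\<phi> z))
      = (\<integral>z. \<epsilon>^4 * ((\<Sum>b\<in>hor. pd (G b) b z) + (1 / \<epsilon>) * pd (G e3) e3 z - P z * ?dv z) \<partial>M1)"
    unfolding inertia_def by (simp only:)
  also have "\<dots> = \<epsilon>^4 * (\<integral>z. (\<Sum>b\<in>hor. pd (G b) b z) + (1 / \<epsilon>) * pd (G e3) e3 z - P z * ?dv z \<partial>M1)"
    by (rule integral_mult_right_zero)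
  also have "(\<integral>z. (\<Sum>b\<in>hor. pd (G b) b z) + (1 / \<epsilon>) * pd (G e3) e3 z - P z * ?dv z \<partial>M1)
      = (\<integral>z. (\<Sum>b\<in>hor. pd (G b) b z) + (1 / \<epsilon>) * pd (G e3) e3 z \<partial>M1) - (\<integral>z. P z * ?dv z \<partial>M1)"
    by (intro Bochner_Integration.integral_diff Bochner_Integration.integrable_add Bochner_Integration.integrable_sum
        integrable_mult_right Gi Pi)
  also have "(\<integral>z. (\<Sum>b\<in>hor. pd (G b) b z) + (1 / \<epsilon>) * pd (G e3) e3 z \<partial>M1)
      = (\<integral>z. (\<Sum>b\<in>hor. pd (G b) b z) \<partial>M1) + (\<integral>z. (1 / \<epsilon>) * pd (G e3) e3 z \<partial>M1)"
    by (intro Bochner_Integration.integral_add Bochner_Integration.integrable_sum integrable_mult_right Gi)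
  also have "(\<integral>z. (\<Sum>b\<in>hor. pd (G b) b z) \<partial>M1) = (\<Sum>b\<in>hor. integral\<^sup>L M1 (pd (G b) b))"
    by (rule Bochner_Integration.integral_sum[OF Gi])
  also have "(\<integral>z. (1 / \<epsilon>) * pd (G e3) e3 z \<partial>M1) = (1 / \<epsilon>) * integral\<^sup>L M1 (pd (G e3) e3)"
    by (rule integral_mult_right_zero)
  finally show ?thesis by (simp add: Gh G3 P_def)
qed

lemma scaled_solution_sqi:
  assumes "scaled_solution \<nu> f K s \<beta> \<epsilon> w E d q"
  shows "sqi M1 w" "\<And>b. b \<in> hor \<Longrightarrow> sqi M1 (E b)" "sqi M1 d" "sqi M1 q"
  using assms unfolding scaled_solution_def by auto

text \<open>The approximants are not divergence free, so an error term with \<open>satpot\<close>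
  remains. The potential is bounded for fixed \<delta>, hence this term converges to its value at
  the solution, where the scaled divergence vanishes.\<close>

lemma inertia_sat_eq_0:
  assumes ss: "scaled_solution \<nu> f K s \<beta> \<epsilon> w E d q" and \<epsilon>: "0 < \<epsilon>" and \<delta>: "0 < \<delta>"
  shows "inertia \<epsilon> w E d (\<lambda>z. sat \<delta> (w z)) = 0"
proof -
  note sq = scaled_solution_sqi[OF ss]
  interpret finite_measure M1 by (rule finite_Mdom) simp
  obtain \<phi> and R :: "pt \<Rightarrow> real" and S :: "real^2 \<Rightarrow> real" where \<phi>: "\<forall>k. test_field 1 (\<phi> k) \<and> bottom_tangential (\<phi> k)" and R: "sqi M1 R"
    and w: "AE z in M1. (\<lambda>k. \<phi> k z) \<longlonglongrightarrow> w z" "\<forall>k. AE z in M1. norm (\<phi> k z) \<le> R z"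
    and E: "\<forall>b\<in>hor. (AE z in M1. (\<lambda>k. pd (\<phi> k) b z) \<longlonglongrightarrow> E b z) \<and> (\<forall>k. AE z in M1. norm (pd (\<phi> k) b z) \<le> R z)"
    and d: "AE z in M1. (\<lambda>k. pd (\<phi> k) e3 z) \<longlonglongrightarrow> d z" "\<forall>k. AE z in M1. norm (pd (\<phi> k) e3 z) \<le> R z"
    using scaled_solution_dominated_approx[OF ss] by blast
  have t: "test_field 1 (\<phi> k)" "bottom_tangential (\<phi> k)" for k using \<phi> by auto
  note C = test_fieldD(1,2)[OF t(1)]
  have m: "\<phi> k \<in> borel_measurable M1" "pd (\<phi> k) b \<in> borel_measurable M1" for k b
    by (rule sqiD(1)[OF C1_sqi_Mdom[OF zero_less_one C]], rule sqiD(1)[OF C1_sqi_Mdom_pd[OF zero_less_one C]])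
  note mw = sq(1,3)[THEN sqiD(1)] and mE = sq(2)[THEN sqiD(1)]
  have lim1: "(\<lambda>k. inertia \<epsilon> (\<phi> k) (pd (\<phi> k)) (pd (\<phi> k) e3) (\<lambda>z. sat \<delta> (\<phi> k z))) \<longlonglongrightarrow> inertia \<epsilon> w E d (\<lambda>z. sat \<delta> (w z))"
  proof (rule inertia_tendsto[OF R \<epsilon>])
    show "0 \<le> 1 + 1 / \<delta>" using \<delta> by simp
    show "AE z in M1. (\<lambda>k. sat \<delta> (\<phi> k z)) \<longlonglongrightarrow> sat \<delta> (w z)"
      using w(1) by eventually_elim (rule sat_lim(1)[OF \<delta> _ tendsto_const])
    show "norm (sat \<delta> (\<phi> k z)) \<le> 1 + 1 / \<delta>" for k z by (rule sat_bounds(2)[OF \<delta>])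
    show "(\<lambda>z. sat \<delta> (\<phi> k z)) \<in> borel_measurable M1" "(\<lambda>z. sat \<delta> (w z)) \<in> borel_measurable M1" for k
      by (intro sat_measurable(1)[where x="\<lambda>z. 0"] m mw borel_measurable_const)+
  qed (use m mw mE w E d in blast)+
  let ?dv = "\<lambda>k z. (\<Sum>b\<in>hor. pd (\<phi> k) b z \<bullet> b) + (1 / \<epsilon>) * snd (pd (\<phi> k) e3 z)"
  let ?dlim = "\<lambda>z. (\<Sum>b\<in>hor. E b z \<bullet> b) + (1 / \<epsilon>) * snd (d z)"
  have lim2: "(\<lambda>k. \<integral>z. satpot \<delta> (\<phi> k z) * ?dv k z \<partial>M1) \<longlonglongrightarrow> (\<integral>z. satpot \<delta> (w z) * ?dlim z \<partial>M1)"
  proof (rule integral_dominated_convergence_real)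
    define G where "G z = (1 / \<delta>) * (((\<Sum>b\<in>hor. 1) + (1 / \<epsilon>)) * R z)" for z
    show "integrable M1 G" unfolding G_def by (intro integrable_mult_right sqi_integrable R)
    show "(\<lambda>z. satpot \<delta> (\<phi> k z) * ?dv k z) \<in> borel_measurable M1" for k
      unfolding inner_e3[symmetric]
      by (intro borel_measurable_times borel_measurable_add borel_measurable_sum borel_measurable_inner borel_measurable_const
          sat_measurable(3)[where x="\<lambda>z. 0"] m)
    show "(\<lambda>z. satpot \<delta> (w z) * ?dlim z) \<in> borel_measurable M1"
      unfolding inner_e3[symmetric]
      by (intro borel_measurable_times borel_measurable_add borel_measurable_sum borel_measurable_inner borel_measurable_const
          sat_measurable(3)[where x="\<lambda>z. 0"] mw mE)
    have Eall: "AE z in M1. \<forall>b\<in>hor. (\<lambda>k. pd (\<phi> k) b z) \<longlonglongrightarrow> E b z"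
      by (intro AE_finite_allI Basis_hor(3)) (use E in blast)
    show "AE z in M1. (\<lambda>k. satpot \<delta> (\<phi> k z) * ?dv k z) \<longlonglongrightarrow> satpot \<delta> (w z) * ?dlim z"
      using w(1) Eall d(1)
    proof eventually_elim
      case (elim z)
      show ?case
        by (intro tendsto_mult tendsto_add tendsto_sum tendsto_inner tendsto_const tendsto_snd
            sat_lim(3)[OF \<delta> elim(1) tendsto_const] elim(2)[rule_format] elim(3))
    qed
    fix k
    have Eb: "AE z in M1. \<forall>b\<in>hor. norm (pd (\<phi> k) b z) \<le> R z"
      by (intro AE_finite_allI Basis_hor(3)) (use E in blast)
    show "AE z in M1. \<bar>satpot \<delta> (\<phi> k z) * ?dv k z\<bar> \<le> G z"
      using Eb d(2)[rule_format, of k]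
    proof eventually_elim
      case (elim z)
      have "\<bar>\<Sum>b\<in>hor. pd (\<phi> k) b z \<bullet> b\<bar> \<le> (\<Sum>b\<in>hor. \<bar>pd (\<phi> k) b z \<bullet> b\<bar>)" by (rule sum_abs)
      also have "\<dots> \<le> (\<Sum>b\<in>hor. 1 * R z)"
      proof (rule sum_mono)
        fix b assume b: "b \<in> hor"
        have "\<bar>pd (\<phi> k) b z \<bullet> b\<bar> \<le> norm (pd (\<phi> k) b z) * norm b" by (rule Cauchy_Schwarz_ineq2)
        then show "\<bar>pd (\<phi> k) b z \<bullet> b\<bar> \<le> 1 * R z" using elim(1) b norm_hor[OF b] by force
      qed
      finally have a: "\<bar>\<Sum>b\<in>hor. pd (\<phi> k) b z \<bullet> b\<bar> \<le> (\<Sum>b\<in>hor. 1) * R z" by (simp only: sum_distrib_right)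
      have "\<bar>snd (pd (\<phi> k) e3 z)\<bar> \<le> R z"
        using Cauchy_Schwarz_ineq2[of "pd (\<phi> k) e3 z" e3] e3_Basis elim(2) by (simp add: inner_e3)
      then have b: "\<bar>(1 / \<epsilon>) * snd (pd (\<phi> k) e3 z)\<bar> \<le> (1 / \<epsilon>) * R z"
        using \<epsilon> by (simp add: abs_mult divide_right_mono)
      have "\<bar>?dv k z\<bar> \<le> (\<Sum>b\<in>hor. 1) * R z + (1 / \<epsilon>) * R z"
        by (rule order_trans[OF abs_triangle_ineq add_mono[OF a b]])
      then have "\<bar>?dv k z\<bar> \<le> ((\<Sum>b\<in>hor. 1) + (1 / \<epsilon>)) * R z" by (simp only: distrib_right)
      then show ?case unfolding G_def abs_mult
        by (intro mult_mono sat_bounds(4)[OF \<delta>]) (use \<delta> in simp_all)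
    qed
  qed
  have "AE z in M1. ?dlim z = 0" using ss unfolding scaled_solution_def by blast
  then have "AE z in M1. satpot \<delta> (w z) * ?dlim z = 0" by eventually_elim simp
  then have z: "(\<integral>z. satpot \<delta> (w z) * ?dlim z \<partial>M1) = 0" by (rule integral_eq_zero_AE)
  have "(\<lambda>k. - (\<epsilon>^4 * (\<integral>z. satpot \<delta> (\<phi> k z) * ?dv k z \<partial>M1))) \<longlonglongrightarrow> - (\<epsilon>^4 * 0)"
    by (intro tendsto_minus tendsto_mult_left) (use lim2 z in simp)
  then have "(\<lambda>k. inertia \<epsilon> (\<phi> k) (pd (\<phi> k)) (pd (\<phi> k) e3) (\<lambda>z. sat \<delta> (\<phi> k z))) \<longlonglongrightarrow> 0"
    unfolding inertia_test[OF t \<epsilon> \<delta>] by simp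
  with lim1 show ?thesis by (rule LIMSEQ_unique)
qed

text \<open>The saturated solution is not itself C1. The equation is tested with saturations of the
  approximants while its coefficients stay at the solution, and the approximation index goes to
  infinity with \<delta> fixed.\<close>

lemma wform_sat_eq_0:
  assumes ss: "scaled_solution \<nu> f K s \<beta> \<epsilon> w E d q" and \<epsilon>: "0 < \<epsilon>" and \<delta>: "0 < \<delta>"
  shows "wform \<beta> \<epsilon> E d q (\<lambda>z. sat \<delta> (w z)) (\<lambda>b z. dsat \<delta> (w z) (E b z)) (\<lambda>z. dsat \<delta> (w z) (d z))
      (\<lambda>y. fst (sat \<delta> (vtrace d y))) = 0"
proof -
  note sq = scaled_solution_sqi[OF ss]
  obtain \<phi> and R :: "pt \<Rightarrow> real" and S :: "real^2 \<Rightarrow> real" where \<phi>: "\<forall>k. test_field 1 (\<phi> k) \<and> bottom_tangential (\<phi> k)" and R: "sqi M1 R"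
    and S: "sqi Mb S"
    and w: "AE z in M1. (\<lambda>k. \<phi> k z) \<longlonglongrightarrow> w z" "\<forall>k. AE z in M1. norm (\<phi> k z) \<le> R z"
    and E: "\<forall>b\<in>hor. (AE z in M1. (\<lambda>k. pd (\<phi> k) b z) \<longlonglongrightarrow> E b z) \<and> (\<forall>k. AE z in M1. norm (pd (\<phi> k) b z) \<le> R z)"
    and d: "AE z in M1. (\<lambda>k. pd (\<phi> k) e3 z) \<longlonglongrightarrow> d z" "\<forall>k. AE z in M1. norm (pd (\<phi> k) e3 z) \<le> R z"
    and g: "AE y in Mb. (\<lambda>k. \<phi> k (y, 0)) \<longlonglongrightarrow> vtrace d y" "\<forall>k. AE y in Mb. norm (\<phi> k (y, 0)) \<le> S y"
    using scaled_solution_dominated_approx[OF ss] by blast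
  have t: "test_field 1 (\<phi> k)" "bottom_tangential (\<phi> k)" for k using \<phi> by auto
  note C = test_fieldD(1,2)[OF t(1)]
  have m: "\<phi> k \<in> borel_measurable M1" "pd (\<phi> k) b \<in> borel_measurable M1" for k b
    by (rule sqiD(1)[OF C1_sqi_Mdom[OF zero_less_one C]], rule sqiD(1)[OF C1_sqi_Mdom_pd[OF zero_less_one C]])
  note mw = sq(1,3)[THEN sqiD(1)] and mE = sq(2)[THEN sqiD(1)]
  define \<zeta> where "\<zeta> k z = sat \<delta> (\<phi> k z)" for k z
  have \<zeta>C: "C1fun (\<zeta> k)" and \<zeta>pd: "pd (\<zeta> k) v z = dsat \<delta> (\<phi> k z) (pd (\<phi> k) v z)" for k v z
    unfolding \<zeta>_def using C1fun_compose[OF C(1) sat_C1(1)[OF \<delta>]] sat_C1(2)[OF \<delta>] by auto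
  have \<zeta>t: "test_field 1 (\<zeta> k)" for k
    by (rule test_field_subset[OF \<zeta>C _ t(1)]) (rule supp_subsetI[OF closed_supp in_supp], auto simp: \<zeta>_def sat_def)
  \<comment> \<open>Saturation multiplies a vector by a scalar, so a vanishing normal component
    stays zero.\<close>
  have \<zeta>b: "bottom_tangential (\<zeta> k)" for k using t(2)[of k] by (simp add: bottom_tangential_def \<zeta>_def sat_def)
  have eq: "wform \<beta> \<epsilon> E d q (\<zeta> k) (pd (\<zeta> k)) (pd (\<zeta> k) e3) (\<lambda>y. fst (\<zeta> k (y, 0))) + inertia \<epsilon> w E d (\<zeta> k) = 0" for k
  proof (rule scaled_equation_wform[OF sq(2-4) \<zeta>t])
    show "scaled_equation \<nu> f K s \<beta> \<epsilon> w E d q (\<zeta> k)"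
      using ss \<zeta>t[of k] \<zeta>b[of k] unfolding scaled_solution_def by blast
  qed
  have R5: "sqi M1 (\<lambda>z. 5 * R z)" using sqi_scaleR[OF R, of 5] by simp
  have l1: "(\<lambda>k. wform \<beta> \<epsilon> E d q (\<zeta> k) (pd (\<zeta> k)) (pd (\<zeta> k) e3) (\<lambda>y. fst (\<zeta> k (y, 0)))) \<longlonglongrightarrow>
      wform \<beta> \<epsilon> E d q (\<lambda>z. sat \<delta> (w z)) (\<lambda>b z. dsat \<delta> (w z) (E b z)) (\<lambda>z. dsat \<delta> (w z) (d z)) (\<lambda>y. fst (sat \<delta> (vtrace d y)))"
  proof (rule wform_tendsto[OF sq(2-4) R5 S])
    have bb: "(\<lambda>y. \<phi> k (y, 0)) \<in> borel_measurable Mb" for k by (rule sqiD(1)[OF bottom_sqi[OF C]])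
    have vv: "vtrace d \<in> borel_measurable Mb" by (rule sqiD(1)[OF vtrace_bound(1)[OF sq(3)]])
    have fm: "(\<lambda>y. fst (u y)) \<in> borel_measurable Mb" if "u \<in> borel_measurable Mb" for u :: "real^2 \<Rightarrow> pt"
      by (rule borel_measurable_continuous_on[OF continuous_on_fst[OF continuous_on_id] that])
    show "(\<lambda>y. fst (\<zeta> k (y, 0))) \<in> borel_measurable Mb" "(\<lambda>y. fst (sat \<delta> (vtrace d y))) \<in> borel_measurable Mb" for k
      unfolding \<zeta>_def by (intro fm sat_measurable(1)[where x="\<lambda>z. 0"] bb vv borel_measurable_const)+
    show "\<zeta> k \<in> borel_measurable M1" "(\<lambda>z. sat \<delta> (w z)) \<in> borel_measurable M1" for k
      unfolding \<zeta>_def by (intro sat_measurable(1)[where x="\<lambda>z. 0"] m mw borel_measurable_const)+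
    have pdm: "pd (\<zeta> k) v \<in> borel_measurable M1" for k v
      unfolding \<zeta>pd[abs_def] by (intro sat_measurable(2) m)
    then show "pd (\<zeta> k) b \<in> borel_measurable M1" "pd (\<zeta> k) e3 \<in> borel_measurable M1" for k b by auto
    show "(\<lambda>z. dsat \<delta> (w z) (E b z)) \<in> borel_measurable M1" if "b \<in> hor" for b
      by (intro sat_measurable(2) mw mE that)
    show "(\<lambda>z. dsat \<delta> (w z) (d z)) \<in> borel_measurable M1" by (intro sat_measurable(2) mw)
    show "AE z in M1. (\<lambda>k. \<zeta> k z) \<longlonglongrightarrow> sat \<delta> (w z)"
      unfolding \<zeta>_def using w(1) by eventually_elim (rule sat_lim(1)[OF \<delta> _ tendsto_const])
    show "AE z in M1. norm (\<zeta> k z) \<le> 5 * R z" for k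
      using w(2)[rule_format, of k]
    proof eventually_elim
      case (elim z)
      show ?case using sat_bounds(1)[OF \<delta>, of "\<phi> k z"] elim norm_ge_zero[of "\<phi> k z"] unfolding \<zeta>_def by linarith
    qed
    have pdl: "AE z in M1. (\<lambda>k. pd (\<zeta> k) v z) \<longlonglongrightarrow> dsat \<delta> (w z) (X z)" if "AE z in M1. (\<lambda>k. pd (\<phi> k) v z) \<longlonglongrightarrow> X z" for v X
      unfolding \<zeta>pd using w(1) that by eventually_elim (rule sat_lim(2)[OF \<delta>])
    then show "AE z in M1. (\<lambda>k. pd (\<zeta> k) b z) \<longlonglongrightarrow> dsat \<delta> (w z) (E b z)" if "b \<in> hor" for b using E that by blast
    show "AE z in M1. (\<lambda>k. pd (\<zeta> k) e3 z) \<longlonglongrightarrow> dsat \<delta> (w z) (d z)" by (rule pdl[OF d(1)])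
    have pdb: "AE z in M1. norm (pd (\<zeta> k) v z) \<le> 5 * R z" if "AE z in M1. norm (pd (\<phi> k) v z) \<le> R z" for k v
      unfolding \<zeta>pd using that
    proof eventually_elim
      case (elim z)
      show ?case using sat_bounds(3)[OF \<delta>, of "\<phi> k z" "pd (\<phi> k) v z"] elim by linarith
    qed
    show "AE z in M1. norm (pd (\<zeta> k) b z) \<le> 5 * R z" if "b \<in> hor" for k b by (rule pdb) (use E that in blast)
    show "AE z in M1. norm (pd (\<zeta> k) e3 z) \<le> 5 * R z" for k by (rule pdb) (use d in blast)
    show "AE y in Mb. (\<lambda>k. fst (\<zeta> k (y, 0))) \<longlonglongrightarrow> fst (sat \<delta> (vtrace d y))"
      unfolding \<zeta>_def using g(1) by eventually_elim (rule tendsto_fst[OF sat_lim(1)[OF \<delta> _ tendsto_const]])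
    show "AE y in Mb. norm (fst (\<zeta> k (y, 0))) \<le> S y" for k
      using g(2)[rule_format, of k]
    proof eventually_elim
      case (elim y)
      have "norm (fst (\<zeta> k (y, 0))) \<le> norm (\<zeta> k (y, 0))" by (rule norm_fst_le[of "fst (\<zeta> k (y, 0))" "snd (\<zeta> k (y, 0))", unfolded prod.collapse])
      then show ?case using sat_bounds(1)[OF \<delta>, of "\<phi> k (y, 0)"] elim unfolding \<zeta>_def by linarith
    qed
  qed
  have R': "sqi M1 (\<lambda>z. norm (w z) + (\<Sum>b\<in>hor. norm (E b z)) + norm (d z))" by (intro sqi_add sqi_sum sqi_norm sq)
  have s0: "0 \<le> (\<Sum>b\<in>hor. norm (E b z))" for z by (intro sum_nonneg) simp
  have l2: "(\<lambda>k. inertia \<epsilon> w E d (\<zeta> k)) \<longlonglongrightarrow> inertia \<epsilon> w E d (\<lambda>z. sat \<delta> (w z))"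
  proof (rule inertia_tendsto[OF R' \<epsilon>])
    show "0 \<le> 1 + 1 / \<delta>" using \<delta> by simp
    show "norm (\<zeta> k z) \<le> 1 + 1 / \<delta>" for k z unfolding \<zeta>_def by (rule sat_bounds(2)[OF \<delta>])
    show "AE z in M1. (\<lambda>k. \<zeta> k z) \<longlonglongrightarrow> sat \<delta> (w z)"
      unfolding \<zeta>_def using w(1) by eventually_elim (rule sat_lim(1)[OF \<delta> _ tendsto_const])
    show "\<zeta> k \<in> borel_measurable M1" "(\<lambda>z. sat \<delta> (w z)) \<in> borel_measurable M1" for k
      unfolding \<zeta>_def by (intro sat_measurable(1)[where x="\<lambda>z. 0"] m mw borel_measurable_const)+
    show "AE z in M1. norm (w z) \<le> norm (w z) + (\<Sum>b\<in>hor. norm (E b z)) + norm (d z)"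
      "AE z in M1. norm (d z) \<le> norm (w z) + (\<Sum>b\<in>hor. norm (E b z)) + norm (d z)"
      using s0 by (intro AE_I2, simp add: add_nonneg_nonneg)+
    show "AE z in M1. norm (E b z) \<le> norm (w z) + (\<Sum>b\<in>hor. norm (E b z)) + norm (d z)" if "b \<in> hor" for b
    proof (rule AE_I2)
      fix z
      have "norm (E b z) \<le> (\<Sum>b\<in>hor. norm (E b z))" by (rule member_le_sum[OF that]) (use Basis_hor(3) in auto)
      then show "norm (E b z) \<le> norm (w z) + (\<Sum>b\<in>hor. norm (E b z)) + norm (d z)"
        using norm_ge_zero[of "w z"] norm_ge_zero[of "d z"] by linarith
    qed
  qed (use mw mE in auto)
  show ?thesis
    using tendsto_add[OF l1 l2] unfolding eq inertia_sat_eq_0[OF ss \<epsilon> \<delta>] by (simp add: LIMSEQ_const_iff)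
qed

text \<open>Now \<delta> tends to 0 under majorants that do not depend on it. Inertia is already
  gone for each positive \<delta>, so the possibly undefined inertial integral of the solution
  against itself is never formed.\<close>

lemma energy_identity:
  assumes ss: "scaled_solution \<nu> f K s \<beta> \<epsilon> w E d q" and \<epsilon>: "0 < \<epsilon>"
  shows "\<nu> * (\<epsilon>\<^sup>2 * (\<Sum>b\<in>hor. \<integral>z. (norm (E b z))\<^sup>2 \<partial>M1) + (\<integral>z. (norm (d z))\<^sup>2 \<partial>M1))
     + \<epsilon> powr \<beta> * (\<integral>y. trace_slip d y \<bullet> (K y *v fst (vtrace d y)) \<partial>Mb) = (\<integral>z. (f (fst z), 0) \<bullet> w z \<partial>M1)"
proof -
  note sq = scaled_solution_sqi[OF ss]
  note mw = sq(1,3)[THEN sqiD(1)] and mE = sq(2)[THEN sqiD(1)]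
  define \<delta> where "\<delta> j = 1 / real (Suc j)" for j
  have \<delta>: "0 < \<delta> j" for j by (simp add: \<delta>_def)
  define R where "R z = norm (w z) + (\<Sum>b\<in>hor. norm (E b z)) + norm (d z)" for z
  have R: "sqi M1 (\<lambda>z. 5 * R z)" unfolding R_def using sqi_scaleR[of M1 "\<lambda>z. norm (w z) + (\<Sum>b\<in>hor. norm (E b z)) + norm (d z)" 5]
    by (simp add: sqi_add sqi_sum sqi_norm sq)
  have s0: "0 \<le> (\<Sum>b\<in>hor. norm (E b z))" for z by (intro sum_nonneg) simp
  have Rge: "norm (w z) \<le> R z" "norm (d z) \<le> R z" "b \<in> hor \<Longrightarrow> norm (E b z) \<le> R z" for b z
  proof -
    show "norm (w z) \<le> R z" "norm (d z) \<le> R z"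
      unfolding R_def using s0[of z] norm_ge_zero[of "w z"] norm_ge_zero[of "d z"] by linarith+
    assume "b \<in> hor"
    then have "norm (E b z) \<le> (\<Sum>b\<in>hor. norm (E b z))" by (rule member_le_sum) (use Basis_hor(3) in auto)
    then show "norm (E b z) \<le> R z"
      unfolding R_def using norm_ge_zero[of "w z"] norm_ge_zero[of "d z"] by linarith
  qed
  have vs: "sqi Mb (vtrace d)" by (rule vtrace_bound(1)[OF sq(3)])
  have fm: "(\<lambda>y. fst (u y)) \<in> borel_measurable Mb" if "u \<in> borel_measurable Mb" for u :: "real^2 \<Rightarrow> pt"
    by (rule borel_measurable_continuous_on[OF continuous_on_fst[OF continuous_on_id] that])
  have lim: "(\<lambda>j. wform \<beta> \<epsilon> E d q (\<lambda>z. sat (\<delta> j) (w z)) (\<lambda>b z. dsat (\<delta> j) (w z) (E b z)) (\<lambda>z. dsat (\<delta> j) (w z) (d z))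
      (\<lambda>y. fst (sat (\<delta> j) (vtrace d y)))) \<longlonglongrightarrow> wform \<beta> \<epsilon> E d q w E d (\<lambda>y. fst (vtrace d y))"
  proof (rule wform_tendsto[OF sq(2-4) R sqi_norm[OF vs]])
    show "(\<lambda>y. fst (sat (\<delta> j) (vtrace d y))) \<in> borel_measurable Mb" "(\<lambda>y. fst (vtrace d y)) \<in> borel_measurable Mb" for j
      by (intro fm sat_measurable(1)[where x="\<lambda>z. 0"] sqiD(1)[OF vs] borel_measurable_const)+
    show "(\<lambda>z. sat (\<delta> j) (w z)) \<in> borel_measurable M1" for j
      by (intro sat_measurable(1)[where x="\<lambda>z. 0"] mw borel_measurable_const)
    show "(\<lambda>z. dsat (\<delta> j) (w z) (E b z)) \<in> borel_measurable M1" if "b \<in> hor" for b j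
      by (intro sat_measurable(2) mw mE that)
    show "(\<lambda>z. dsat (\<delta> j) (w z) (d z)) \<in> borel_measurable M1" for j by (intro sat_measurable(2) mw)
    show "AE z in M1. (\<lambda>j. sat (\<delta> j) (w z)) \<longlonglongrightarrow> w z" "AE z in M1. (\<lambda>j. dsat (\<delta> j) (w z) (d z)) \<longlonglongrightarrow> d z"
      "AE z in M1. (\<lambda>j. dsat (\<delta> j) (w z) (E b z)) \<longlonglongrightarrow> E b z"
      "AE y in Mb. (\<lambda>j. fst (sat (\<delta> j) (vtrace d y))) \<longlonglongrightarrow> fst (vtrace d y)" for b
      unfolding \<delta>_def by (intro AE_I2 sat_tendsto tendsto_fst)+
    show "AE z in M1. norm (sat (\<delta> j) (w z)) \<le> 5 * R z" for j
    proof (rule AE_I2)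
      fix z show "norm (sat (\<delta> j) (w z)) \<le> 5 * R z"
        using sat_bounds(1)[OF \<delta>, of j "w z"] Rge(1)[of z] norm_ge_zero[of "w z"] by linarith
    qed
    have b5: "AE z in M1. norm (dsat (\<delta> j) (w z) (X z)) \<le> 5 * R z" if "\<And>z. norm (X z) \<le> R z" for X j
    proof (rule AE_I2)
      fix z show "norm (dsat (\<delta> j) (w z) (X z)) \<le> 5 * R z"
        using sat_bounds(3)[OF \<delta>, of j "w z" "X z"] that[of z] by linarith
    qed
    show "AE z in M1. norm (dsat (\<delta> j) (w z) (d z)) \<le> 5 * R z" for j by (rule b5[OF Rge(2)])
    show "AE z in M1. norm (dsat (\<delta> j) (w z) (E b z)) \<le> 5 * R z" if "b \<in> hor" for j b by (rule b5[OF Rge(3)[OF that]])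
    show "AE y in Mb. norm (fst (sat (\<delta> j) (vtrace d y))) \<le> norm (vtrace d y)" for j
    proof (rule AE_I2)
      fix y
      have "norm (fst (sat (\<delta> j) (vtrace d y))) \<le> norm (sat (\<delta> j) (vtrace d y))"
        by (rule norm_fst_le[of "fst (sat (\<delta> j) (vtrace d y))" "snd (sat (\<delta> j) (vtrace d y))", unfolded prod.collapse])
      then show "norm (fst (sat (\<delta> j) (vtrace d y))) \<le> norm (vtrace d y)"
        using sat_bounds(1)[OF \<delta>, of j "vtrace d y"] by linarith
    qed
  qed (use mw mE in auto)
  have "wform \<beta> \<epsilon> E d q w E d (\<lambda>y. fst (vtrace d y)) = 0"
    using lim unfolding wform_sat_eq_0[OF ss \<epsilon> \<delta>] by (simp add: LIMSEQ_const_iff)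
  \<comment> \<open>The pressure terms recombine to \<open>q\<close> times the scaled divergence of
    the solution, which is zero almost everywhere.\<close>
  moreover have "(\<Sum>b\<in>hor. \<integral>z. (q z *\<^sub>R b) \<bullet> E b z \<partial>M1) + (1 / \<epsilon>) * (\<integral>z. (q z *\<^sub>R e3) \<bullet> d z \<partial>M1) = 0"
  proof -
    have i: "integrable M1 (\<lambda>z. (q z *\<^sub>R b) \<bullet> E b z)" if "b \<in> hor" for b
      by (rule sqi_inner_integrable[OF sqi_scaleR_const[OF sq(4)] sq(2)[OF that]])
    have i3: "integrable M1 (\<lambda>z. (q z *\<^sub>R e3) \<bullet> d z)" by (rule sqi_inner_integrable[OF sqi_scaleR_const[OF sq(4)] sq(3)])
    have "(\<Sum>b\<in>hor. \<integral>z. (q z *\<^sub>R b) \<bullet> E b z \<partial>M1) + (1 / \<epsilon>) * (\<integral>z. (q z *\<^sub>R e3) \<bullet> d z \<partial>M1)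
        = (\<integral>z. (\<Sum>b\<in>hor. (q z *\<^sub>R b) \<bullet> E b z) \<partial>M1) + (\<integral>z. (1 / \<epsilon>) * ((q z *\<^sub>R e3) \<bullet> d z) \<partial>M1)"
      by (simp only: Bochner_Integration.integral_sum[OF i] integral_mult_right_zero)
    also have "\<dots> = (\<integral>z. (\<Sum>b\<in>hor. (q z *\<^sub>R b) \<bullet> E b z) + (1 / \<epsilon>) * ((q z *\<^sub>R e3) \<bullet> d z) \<partial>M1)"
      by (intro Bochner_Integration.integral_add[symmetric] Bochner_Integration.integrable_sum integrable_mult_right i i3)
    also have "\<dots> = 0"
    proof (rule integral_eq_zero_AE)
      have "AE z in M1. (\<Sum>b\<in>hor. E b z \<bullet> b) + (1 / \<epsilon>) * snd (d z) = 0" using ss unfolding scaled_solution_def by blast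
      then show "AE z in M1. (\<Sum>b\<in>hor. (q z *\<^sub>R b) \<bullet> E b z) + (1 / \<epsilon>) * ((q z *\<^sub>R e3) \<bullet> d z) = 0"
      proof eventually_elim
        case (elim z)
        have "(\<Sum>b\<in>hor. (q z *\<^sub>R b) \<bullet> E b z) + (1 / \<epsilon>) * ((q z *\<^sub>R e3) \<bullet> d z)
            = q z * ((\<Sum>b\<in>hor. E b z \<bullet> b) + (1 / \<epsilon>) * snd (d z))"
          by (simp add: inner_e3[symmetric] inner_commute sum_distrib_left distrib_left)
        then show ?case using elim by simp
      qed
    qed
    finally show ?thesis .
  qed
  ultimately show ?thesis unfolding wform_def power2_norm_eq_inner by linarith
qed

end

section \<open>Passage to the limit\<close>

lemma slip_inner: "slip s M v \<bullet> (M *v v) = norm (M *v v) powr s"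
proof (cases "M *v v = 0")
  case False
  then have p: "0 < norm (M *v v)" by simp
  have "slip s M v \<bullet> (M *v v) = norm (M *v v) powr (s - 2) * (norm (M *v v))\<^sup>2"
    by (simp add: slip_def power2_norm_eq_inner)
  also have "(norm (M *v v))\<^sup>2 = norm (M *v v) powr 2" using p by (simp add: powr_numeral)
  also have "norm (M *v v) powr (s - 2) * norm (M *v v) powr 2 = norm (M *v v) powr s"
    unfolding powr_add[symmetric] by simp
  finally show ?thesis .
qed (simp add: slip_def)

text \<open>Cauchy-Schwarz on the two mixed terms reduces the claim to real numbers: t^(s - 1) is
  increasing, so its increments and those of t have the same sign.\<close>

lemma slip_monotone:
  assumes "1 < s"
  shows "0 \<le> (slip s M v - slip s M v') \<bullet> (M *v v - M *v v')"
proof -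
  define a b where "a = norm (M *v v)" and "b = norm (M *v v')"
  have ab: "0 \<le> a" "0 \<le> b" by (simp_all add: a_def b_def)
  have n: "norm (slip s M v) = a powr (s - 1)" "norm (slip s M v') = b powr (s - 1)"
    by (simp_all add: norm_slip a_def b_def)
  have p: "x powr s = x powr (s - 1) * x" if "0 \<le> x" for x :: real
  proof (cases "x = 0")
    case False
    have "x powr s = x powr ((s - 1) + 1)" by simp
    then show ?thesis using that False unfolding powr_add by simp
  qed simp
  have "slip s M v \<bullet> (M *v v') \<le> a powr (s - 1) * b" "slip s M v' \<bullet> (M *v v) \<le> b powr (s - 1) * a"
    using norm_cauchy_schwarz[of "slip s M v" "M *v v'"] norm_cauchy_schwarz[of "slip s M v'" "M *v v"]
    unfolding n a_def[symmetric] b_def[symmetric] by auto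
  moreover have "slip s M v \<bullet> (M *v v) = a powr (s - 1) * a" "slip s M v' \<bullet> (M *v v') = b powr (s - 1) * b"
    unfolding slip_inner a_def[symmetric] b_def[symmetric] by (rule p[OF ab(1)], rule p[OF ab(2)])
  ultimately have "(a powr (s - 1) - b powr (s - 1)) * (a - b) \<le> (slip s M v - slip s M v') \<bullet> (M *v v - M *v v')"
    by (simp add: inner_diff_left inner_diff_right algebra_simps)
  moreover have "0 \<le> (a powr (s - 1) - b powr (s - 1)) * (a - b)"
  proof (cases "a \<le> b")
    case True
    then have "a powr (s - 1) \<le> b powr (s - 1)" using ab assms by (intro powr_mono2) simp_all
    then show ?thesis using True by (intro mult_nonpos_nonpos) simp_all
  next
    case False
    then have "b powr (s - 1) \<le> a powr (s - 1)" using ab assms by (intro powr_mono2) simp_all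
    then show ?thesis using False by (intro mult_nonneg_nonneg) simp_all
  qed
  ultimately show ?thesis by linarith
qed

lemma slip_tendsto:
  assumes s: "1 < s" and v: "v \<longlonglongrightarrow> v0"
  shows "(\<lambda>k. slip s M (v k)) \<longlonglongrightarrow> slip s M v0"
proof -
  have Mv: "(\<lambda>k. M *v v k) \<longlonglongrightarrow> M *v v0"
    by (rule continuous_imp_tendsto[OF linear_continuous_at[OF matrix_vector_mul_bounded_linear] v, unfolded o_def])
  show ?thesis
  proof (cases "M *v v0 = 0")
    \<comment> \<open>At the zero vector the factor with exponent s - 2 is singular, so continuity
      is read off from the norm, which is t^(s - 1) with positive exponent.\<close>
    case True
    have "(\<lambda>k. norm (M *v v k) powr (s - 1)) \<longlonglongrightarrow> 0 powr (s - 1)"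
      by (rule tendsto_powr') (use s tendsto_norm[OF Mv] True in auto)
    then have "(\<lambda>k. norm (slip s M (v k))) \<longlonglongrightarrow> 0" by (simp add: norm_slip)
    then have "(\<lambda>k. slip s M (v k)) \<longlonglongrightarrow> 0" by (rule tendsto_norm_zero_cancel)
    moreover have "slip s M v0 = 0" using True by (simp add: slip_def)
    ultimately show ?thesis by (simp only:)
  next
    case False
    show ?thesis unfolding slip_def
      by (intro tendsto_scaleR tendsto_powr tendsto_norm Mv tendsto_const) (use False in simp)
  qed
qed

text \<open>Interchange of limits: the approximation by a convergent sequence must be uniform in the
  index. It is used with bounds on \<open>stress_form\<close> that are uniform in its first
  argument.\<close>

lemma tendsto_approximation:
  fixes a :: "nat \<Rightarrow> real"
  assumes "\<And>\<eta>. 0 < \<eta> \<Longrightarrow> \<exists>b c. b \<longlonglongrightarrow> c \<and> (\<forall>n. \<bar>a n - b n\<bar> \<le> \<eta>) \<and> \<bar>L - c\<bar> \<le> \<eta>"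
  shows "a \<longlonglongrightarrow> L"
  unfolding tendsto_iff dist_real_def
proof (intro allI impI)
  fix e :: real assume "0 < e"
  then obtain b c where b: "b \<longlonglongrightarrow> c" "\<And>n. \<bar>a n - b n\<bar> \<le> e / 4" "\<bar>L - c\<bar> \<le> e / 4"
    using assms[of "e / 4"] by auto
  have "\<forall>\<^sub>F n in sequentially. \<bar>b n - c\<bar> < e / 4"
    using b(1)[unfolded tendsto_iff dist_real_def, rule_format, of "e / 4"] \<open>0 < e\<close> by simp
  then show "\<forall>\<^sub>F n in sequentially. \<bar>a n - L\<bar> < e"
  proof eventually_elim
    case (elim n)
    then show ?case using b(2)[of n] b(3) \<open>0 < e\<close> by linarith
  qed
qed

lemma symmetric_matrix_inner:
  fixes A :: "real^'n^'n" assumes "transpose A = A" shows "x \<bullet> (A *v y) = (A *v x) \<bullet> y"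
  using dot_lmul_matrix[of x A y] transpose_matrix_vector[of A x] assms by simp

lemma sqi_inner_norm_bound:
  assumes "sqi M f" "sqi M g" "(\<integral>x. (norm (f x))\<^sup>2 \<partial>M) \<le> A" "(\<integral>x. (norm (g x))\<^sup>2 \<partial>M) \<le> B"
  shows "\<bar>\<integral>x. f x \<bullet> g x \<partial>M\<bar> \<le> sqrt A * sqrt B"
proof -
  have "0 \<le> A" by (rule order_trans[OF _ assms(3)]) simp
  then show ?thesis
    by (intro order_trans[OF sqi_Cauchy_Schwarz[OF assms(1,2)]] mult_mono real_sqrt_le_mono assms(3,4)) simp_all
qed

section \<open>Flux condition and admissible test pairs\<close>

context slip_problem
begin

lemma hor_eq: "hor = (\<lambda>u. (u, 0)) ` (Basis :: (real^2) set)"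
proof -
  have "(Basis :: pt set) = (\<lambda>u. (u, 0)) ` Basis \<union> {e3}" by (simp add: Basis_prod_def e3_def)
  moreover have "e3 \<notin> (\<lambda>u. (u, 0)) ` (Basis :: (real^2) set)" by (auto simp: e3_def)
  ultimately show ?thesis unfolding hor_def by blast
qed

lemma sum_hor: "(\<Sum>b\<in>hor. F b) = (\<Sum>b\<in>Basis. F (b, 0))" for F :: "pt \<Rightarrow> 'b::comm_monoid_add"
  unfolding hor_eq by (subst sum.reindex) (simp_all add: inj_on_def)

lemma continuous_base_sqi:
  fixes g :: "real^2 \<Rightarrow> 'b::euclidean_space"
  assumes "continuous_on UNIV g" shows "sqi Mb g"
proof -
  interpret finite_measure Mb by (rule finite_Mb)
  have "compact (g ` closure \<omega>)"
    by (intro compact_continuous_image continuous_on_subset[OF assms]) (use bounded_base in \<open>auto simp: compact_closure\<close>)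
  then obtain B where B: "\<forall>x\<in>g ` closure \<omega>. norm x \<le> B" using compact_imp_bounded bounded_iff by metis
  have "AE y in Mb. norm (g y) \<le> B" by (rule AE_base) (use B closure_subset[of \<omega>] in blast)
  moreover have "g \<in> borel_measurable Mb"
    by (intro measurable_restrict_space1 measurable_completion) (use borel_measurable_continuous_onI[OF assms] in simp)
  ultimately show ?thesis by (rule sqi_bounded[rotated])
qed

lemma vapprox_scaled_solution:
  assumes "scaled_solution \<nu> f K s \<beta> \<epsilon> w E d q" shows "vapprox w d"
proof -
  note sq = scaled_solution_sqi[OF assms]
  obtain \<phi> where \<phi>: "\<forall>n. test_field 1 (\<phi> n) \<and> bottom_tangential (\<phi> n)"
    "(\<lambda>n. \<integral>z. approx_error w E d (\<phi> n) z \<partial>M1) \<longlonglongrightarrow> 0"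
    using assms unfolding scaled_solution_def by blast
  then have t: "test_field 1 (\<phi> n)" for n by blast
  show ?thesis unfolding vapprox_def
    using approx_error_tendsto(1,2)[OF sq(1-3) t \<phi>(2)] t sq(1,3) by blast
qed

lemma Vz3_iff: "Vz3 (Dm 1) w d \<longleftrightarrow> sqi M1 w \<and> sqi M1 d \<and> weak_deriv (Dm 1) e3 w d"
  unfolding Vz3_def L2_iff_sqi[OF sets_dom] ..

text \<open>Fields independent of z3 have zero vertical derivative and hence are legitimate partners
  in the V_z3 pairing, isolating the velocity from its derivative.\<close>

lemma Vz3_horizontal:
  fixes a :: "real^2 \<Rightarrow> pt"
  assumes a: "sqi Mb a" shows "Vz3 (Dm 1) (\<lambda>z. a (fst z)) (\<lambda>z. 0)"
  unfolding Vz3_iff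
proof (intro conjI sqi_fst_dom a zero_less_one sqi_zero)
  show "weak_deriv (Dm 1) e3 (\<lambda>z. a (fst z)) (\<lambda>z. 0)"
    unfolding weak_deriv_def
  proof (intro allI impI)
    fix \<psi> :: "pt \<Rightarrow> real" assume "C1fun \<psi> \<and> compact (supp \<psi>) \<and> supp \<psi> \<subseteq> Dm 1"
    then have C: "C1fun \<psi>" "compact (supp \<psi>)" and sub: "supp \<psi> \<subseteq> Dm 1" by auto
    have t: "test_field 1 \<psi>" unfolding test_field_def frontier_dom_eq using C sub by blast
    have sp: "sqi M1 (pd \<psi> e3)" by (rule C1_sqi_Mdom_pd[OF zero_less_one C])
    have a1: "sqi M1 (\<lambda>z. a (fst z))" by (rule sqi_fst_dom[OF a zero_less_one])
    have z0: "vtrace (pd \<psi> e3) y = 0" if "y \<in> \<omega>" for y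
    proof -
      have "(y, 0) \<notin> supp \<psi>" using sub by (auto simp: mem_dom)
      then show ?thesis unfolding vtrace_pd[OF t that] by (rule not_in_supp(1))
    qed
    have "(\<integral>z. pd \<psi> e3 z *\<^sub>R a (fst z) \<partial>M1) = 0"
    proof (rule euclidean_eqI)
      fix b :: pt
      have "(\<integral>z. pd \<psi> e3 z *\<^sub>R a (fst z) \<partial>M1) \<bullet> b = (\<integral>z. (a (fst z) \<bullet> b) \<bullet> pd \<psi> e3 z \<partial>M1)"
        unfolding integral_scaleR_inner[OF sp a1] by (simp add: mult.commute)
      also have "\<dots> = - (\<integral>y. (a y \<bullet> b) \<bullet> vtrace (pd \<psi> e3) y \<partial>Mb)"
        using vtrace_inner[OF sp sqi_inner_right[OF a, of b]] by simp
      also have "(\<integral>y. (a y \<bullet> b) \<bullet> vtrace (pd \<psi> e3) y \<partial>Mb) = (\<integral>y. 0 \<partial>Mb)"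
        by (rule Bochner_Integration.integral_cong[OF refl]) (simp add: space_restrict_space z0)
      finally show "(\<integral>z. pd \<psi> e3 z *\<^sub>R a (fst z) \<partial>M1) \<bullet> b = 0 \<bullet> b" by simp
    qed
    then show "SInt (Dm 1) (\<lambda>x. pd \<psi> e3 x *\<^sub>R a (fst x)) = - SInt (Dm 1) (\<lambda>x. \<psi> x *\<^sub>R 0)"
      by (simp add: integral_lebesgue_on_eq[OF sets_dom, symmetric])
  qed
qed

lemma grad2_sqi:
  fixes \<psi> :: "real^2 \<Rightarrow> real"
  assumes "C1fun \<psi>" shows "sqi M1 (\<lambda>z. (grad2 \<psi> (fst z), 0::real))"
  unfolding grad2_def
  by (intro sqi_Pair sqi_zero sqi_sum sqi_scaleR_const sqi_fst_dom[of "\<lambda>y. pd \<psi> _ y"] continuous_base_sqi C1fun_continuous_pd assms zero_less_one)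

lemma divergence_tested:
  assumes ss: "scaled_solution \<nu> f K s \<beta> \<epsilon> w E d q" and s\<Psi>: "sqi M1 (\<Psi> :: pt \<Rightarrow> real)"
  shows "(\<Sum>b\<in>hor. \<integral>z. E b z \<bullet> (\<Psi> z *\<^sub>R b) \<partial>M1) + (1 / \<epsilon>) * (\<integral>z. d z \<bullet> (\<Psi> z *\<^sub>R e3) \<partial>M1) = 0"
proof -
  note sq = scaled_solution_sqi[OF ss]
  have i: "integrable M1 (\<lambda>z. E b z \<bullet> (\<Psi> z *\<^sub>R b))" if "b \<in> hor" for b
    by (rule sqi_inner_integrable[OF sq(2)[OF that] sqi_scaleR_const[OF s\<Psi>]])
  have i3: "integrable M1 (\<lambda>z. d z \<bullet> (\<Psi> z *\<^sub>R e3))" by (rule sqi_inner_integrable[OF sq(3) sqi_scaleR_const[OF s\<Psi>]])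
  have "(\<Sum>b\<in>hor. \<integral>z. E b z \<bullet> (\<Psi> z *\<^sub>R b) \<partial>M1) + (1 / \<epsilon>) * (\<integral>z. d z \<bullet> (\<Psi> z *\<^sub>R e3) \<partial>M1)
      = (\<integral>z. (\<Sum>b\<in>hor. E b z \<bullet> (\<Psi> z *\<^sub>R b)) \<partial>M1) + (\<integral>z. (1 / \<epsilon>) * (d z \<bullet> (\<Psi> z *\<^sub>R e3)) \<partial>M1)"
    by (simp only: Bochner_Integration.integral_sum[OF i] integral_mult_right_zero)
  also have "\<dots> = (\<integral>z. (\<Sum>b\<in>hor. E b z \<bullet> (\<Psi> z *\<^sub>R b)) + (1 / \<epsilon>) * (d z \<bullet> (\<Psi> z *\<^sub>R e3)) \<partial>M1)"
    by (intro Bochner_Integration.integral_add[symmetric] Bochner_Integration.integrable_sum integrable_mult_right i i3)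
  also have "\<dots> = 0"
  proof (rule integral_eq_zero_AE)
    have "AE z in M1. (\<Sum>b\<in>hor. E b z \<bullet> b) + (1 / \<epsilon>) * snd (d z) = 0" using ss unfolding scaled_solution_def by blast
    then show "AE z in M1. (\<Sum>b\<in>hor. E b z \<bullet> (\<Psi> z *\<^sub>R b)) + (1 / \<epsilon>) * (d z \<bullet> (\<Psi> z *\<^sub>R e3)) = 0"
    proof eventually_elim
      case (elim z)
      have "(\<Sum>b\<in>hor. E b z \<bullet> (\<Psi> z *\<^sub>R b)) + (1 / \<epsilon>) * (d z \<bullet> (\<Psi> z *\<^sub>R e3))
          = \<Psi> z * ((\<Sum>b\<in>hor. E b z \<bullet> b) + (1 / \<epsilon>) * snd (d z))"
        by (simp add: inner_e3 sum_distrib_left distrib_left)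
      then show ?case using elim by simp
    qed
  qed
  finally show ?thesis .
qed

text \<open>The divergence constraint is tested with \<psi> of the horizontal variable, for which
  the vertical term drops out. No support condition is put on \<psi>, so the identity contains both
  the equation in the base and the normal flux condition on its boundary; the lateral terms vanish
  through the approximating fields.\<close>

lemma scaled_solution_flux:
  fixes \<psi> :: "real^2 \<Rightarrow> real"
  assumes ss: "scaled_solution \<nu> f K s \<beta> \<epsilon> w E d q" and \<psi>: "C1fun \<psi>"
  shows "(\<integral>z. w z \<bullet> (grad2 \<psi> (fst z), 0) \<partial>M1) = 0"
proof -
  note sq = scaled_solution_sqi[OF ss]
  interpret finite_measure M1 by (rule finite_Mdom) simp
  obtain \<phi> where \<phi>: "\<forall>n. test_field 1 (\<phi> n) \<and> bottom_tangential (\<phi> n)"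
    and lim: "(\<lambda>n. \<integral>z. approx_error w E d (\<phi> n) z \<partial>M1) \<longlonglongrightarrow> 0"
    using ss unfolding scaled_solution_def by blast
  have t: "test_field 1 (\<phi> n)" "bottom_tangential (\<phi> n)" for n using \<phi> by auto
  note at = approx_error_tendsto[OF sq(1-3) t(1) lim]
  note C = test_fieldD(1,2)[OF t(1)]
  have s\<phi>: "sqi M1 (\<phi> n)" "sqi M1 (pd (\<phi> n) v)" for n v
    by (intro C1_sqi_Mdom C1_sqi_Mdom_pd C zero_less_one)+
  define \<Psi> where "\<Psi> z = \<psi> (fst z)" for z :: pt
  have \<Psi>C: "C1fun \<Psi>" and \<Psi>pd: "pd \<Psi> v z = pd \<psi> (fst v) (fst z)" for v z
    unfolding \<Psi>_def C1fun_compose(2)[OF C1fun_bounded_linear(1)[OF bounded_linear_fst] \<psi>]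
      C1fun_bounded_linear(2)[OF bounded_linear_fst]
    by (rule C1fun_compose(1)[OF C1fun_bounded_linear(1)[OF bounded_linear_fst] \<psi>], rule refl)
  have s\<Psi>: "sqi M1 \<Psi>" unfolding \<Psi>_def by (intro sqi_fst_dom continuous_base_sqi C1fun_continuous \<psi> zero_less_one)
  note sg = grad2_sqi[OF \<psi>]
  have grad: "z' \<bullet> (grad2 \<psi> (fst z), 0) = (\<Sum>b\<in>hor. pd \<Psi> b z * (z' \<bullet> b))" for z' :: pt and z :: pt
    unfolding sum_hor \<Psi>pd grad2_def by (cases z') (simp add: inner_sum_right)
  have G0: "pd \<Psi> e3 z = 0" for z unfolding \<Psi>pd by (simp add: e3_def linear_0[OF pd_linear[OF \<psi>]])
  have test: "(\<integral>z. \<phi> n z \<bullet> (grad2 \<psi> (fst z), 0) \<partial>M1)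
      = - ((\<Sum>b\<in>hor. \<integral>z. pd (\<phi> n) b z \<bullet> (\<Psi> z *\<^sub>R b) \<partial>M1) + (1 / \<epsilon>) * (\<integral>z. pd (\<phi> n) e3 z \<bullet> (\<Psi> z *\<^sub>R e3) \<partial>M1))" for n
  proof -
    have inC: "C1fun (\<lambda>z. \<phi> n z \<bullet> b)" "pd (\<lambda>z. \<phi> n z \<bullet> b) v z = pd (\<phi> n) v z \<bullet> b" for b v z
      by (rule C1fun_linear_compose[OF C(1) bounded_linear_inner_left])+
    define G where "G b z = \<Psi> z * (\<phi> n z \<bullet> b)" for b z
    have Gt: "test_field 1 (G b)" for b unfolding G_def
      by (rule test_field_subset[OF C1fun_mult(1)[OF \<Psi>C inC(1)] _ t(1)[of n]])
         (rule supp_subsetI[OF closed_supp in_supp], auto)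
    have Gpd: "pd (G b) v z = pd (\<phi> n) v z \<bullet> (\<Psi> z *\<^sub>R b) + pd \<Psi> v z * (\<phi> n z \<bullet> b)" for b v z
      unfolding G_def C1fun_mult(2)[OF \<Psi>C inC(1)] inC(2) by simp
    have i1: "integrable M1 (\<lambda>z. pd (\<phi> n) v z \<bullet> (\<Psi> z *\<^sub>R b))" for v b
      by (rule sqi_inner_integrable[OF s\<phi>(2) sqi_scaleR_const[OF s\<Psi>]])
    have Gi: "integrable M1 (pd (G b) v)" for b v
      by (rule sqi_integrable[OF C1_sqi_Mdom_pd[OF zero_less_one test_fieldD(1,2)[OF Gt]]])
    have i2: "integrable M1 (\<lambda>z. pd \<Psi> v z * (\<phi> n z \<bullet> b))" for v b
      using Bochner_Integration.integrable_diff[OF Gi[of b v] i1[of v b]] unfolding Gpd by simp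
    have sp: "integral\<^sup>L M1 (pd (G b) v) = (\<integral>z. pd (\<phi> n) v z \<bullet> (\<Psi> z *\<^sub>R b) \<partial>M1) + (\<integral>z. pd \<Psi> v z * (\<phi> n z \<bullet> b) \<partial>M1)" for b v
      unfolding Gpd[abs_def] by (rule Bochner_Integration.integral_add[OF i1 i2])
    have Gh: "integral\<^sup>L M1 (pd (G b) b) = 0" if "b \<in> hor" for b
      using horizontal_integral_eq_0[OF Gt snd_hor[OF that]] by (simp add: integral_lebesgue_on_eq[OF sets_dom])
    have G3: "integral\<^sup>L M1 (pd (G e3) e3) = 0"
    proof -
      have "(\<integral>y. G e3 (y, 0) \<partial>Mb) = (\<integral>y. 0 \<partial>Mb)"
        by (rule Bochner_Integration.integral_cong[OF refl])
           (use t(2)[of n] in \<open>simp add: G_def inner_e3 bottom_tangential_def space_restrict_space\<close>)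
      then show ?thesis
        using vertical_integral_dom[OF Gt zero_less_one]
        by (simp add: integral_lebesgue_on_eq[OF sets_dom, symmetric] integral_lebesgue_on_eq[OF sets_base, symmetric])
    qed
    have "(\<integral>z. \<phi> n z \<bullet> (grad2 \<psi> (fst z), 0) \<partial>M1) = (\<Sum>b\<in>hor. \<integral>z. pd \<Psi> b z * (\<phi> n z \<bullet> b) \<partial>M1)"
      unfolding grad by (rule Bochner_Integration.integral_sum[OF i2])
    also have "\<dots> = (\<Sum>b\<in>hor. - (\<integral>z. pd (\<phi> n) b z \<bullet> (\<Psi> z *\<^sub>R b) \<partial>M1))"
      by (rule sum.cong[OF refl]) (use sp Gh in \<open>simp add: eq_neg_iff_add_eq_0 add.commute\<close>)
    finally have 1: "(\<integral>z. \<phi> n z \<bullet> (grad2 \<psi> (fst z), 0) \<partial>M1) = - (\<Sum>b\<in>hor. \<integral>z. pd (\<phi> n) b z \<bullet> (\<Psi> z *\<^sub>R b) \<partial>M1)"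
      by (simp add: sum_negf)
    have "(\<integral>z. pd (\<phi> n) e3 z \<bullet> (\<Psi> z *\<^sub>R e3) \<partial>M1) = 0" using sp[of e3 e3] G3 by (simp add: G0)
    then show ?thesis using 1 by simp
  qed
  have "(\<lambda>n. \<integral>z. \<phi> n z \<bullet> (grad2 \<psi> (fst z), 0) \<partial>M1) \<longlonglongrightarrow> (\<integral>z. w z \<bullet> (grad2 \<psi> (fst z), 0) \<partial>M1)"
    by (rule sqi_inner_tendsto[OF s\<phi>(1) sq(1) sg at(1)])
  moreover have "(\<lambda>n. - ((\<Sum>b\<in>hor. \<integral>z. pd (\<phi> n) b z \<bullet> (\<Psi> z *\<^sub>R b) \<partial>M1) + (1 / \<epsilon>) * (\<integral>z. pd (\<phi> n) e3 z \<bullet> (\<Psi> z *\<^sub>R e3) \<partial>M1)))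
      \<longlonglongrightarrow> - ((\<Sum>b\<in>hor. \<integral>z. E b z \<bullet> (\<Psi> z *\<^sub>R b) \<partial>M1) + (1 / \<epsilon>) * (\<integral>z. d z \<bullet> (\<Psi> z *\<^sub>R e3) \<partial>M1))"
    by (intro tendsto_minus tendsto_add tendsto_mult_left tendsto_sum sqi_inner_tendsto s\<phi> sq at sqi_scaleR_const s\<Psi>)
  ultimately have eq: "(\<integral>z. w z \<bullet> (grad2 \<psi> (fst z), 0) \<partial>M1)
      = - ((\<Sum>b\<in>hor. \<integral>z. E b z \<bullet> (\<Psi> z *\<^sub>R b) \<partial>M1) + (1 / \<epsilon>) * (\<integral>z. d z \<bullet> (\<Psi> z *\<^sub>R e3) \<partial>M1))"
    unfolding test by (rule LIMSEQ_unique)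
  show ?thesis unfolding eq divergence_tested[OF ss s\<Psi>] by simp
qed

lemma vtrace_snd_eq_0:
  assumes ss: "scaled_solution \<nu> f K s \<beta> \<epsilon> w E d q" shows "AE y in Mb. snd (vtrace d y) = 0"
proof -
  obtain \<phi> where \<phi>: "\<forall>k. test_field 1 (\<phi> k) \<and> bottom_tangential (\<phi> k)"
    and g: "AE y in Mb. (\<lambda>k. \<phi> k (y, 0)) \<longlonglongrightarrow> vtrace d y"
    using scaled_solution_dominated_approx[OF ss] by blast
  have "AE y in Mb. \<forall>k. snd (\<phi> k (y, 0)) = 0"
    by (rule AE_base) (use \<phi> in \<open>auto simp: bottom_tangential_def\<close>)
  with g show ?thesis
  proof eventually_elim
    case (elim y)
    have "(\<lambda>k. snd (\<phi> k (y, 0))) \<longlonglongrightarrow> snd (vtrace d y)" by (rule tendsto_snd[OF elim(1)])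
    then show ?case using elim(2) by (simp add: LIMSEQ_const_iff)
  qed
qed

end

lemma sqi_mult_integrable: "sqi M f \<Longrightarrow> sqi M g \<Longrightarrow> integrable M (\<lambda>x. f x * g x)" for f g :: "'a \<Rightarrow> real"
  using sqi_inner_integrable[of M f g] by simp

section \<open>Uniform bounds and the limit equation\<close>

locale slip_sequence = slip_problem +
  fixes \<beta> \<alpha> :: real and \<epsilon> :: "nat \<Rightarrow> real" and w :: "nat \<Rightarrow> pt \<Rightarrow> pt" and E :: "nat \<Rightarrow> pt \<Rightarrow> pt \<Rightarrow> pt"
    and d :: "nat \<Rightarrow> pt \<Rightarrow> pt" and q :: "nat \<Rightarrow> pt \<Rightarrow> real" and U dU :: "pt \<Rightarrow> pt" and P :: "real^2 \<Rightarrow> real"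
  assumes sol: "scaled_solution \<nu> f K s \<beta> (\<epsilon> n) (w n) (E n) (d n) (q n)"
    and \<epsilon>_pos: "0 < \<epsilon> n" and \<epsilon>_lim: "\<epsilon> \<longlonglongrightarrow> 0"
    and U: "Vz3 (Dm 1) U dU"
    and weak_u: "Vz3 (Dm 1) \<psi> d\<psi> \<Longrightarrow> (\<lambda>n. \<integral>z. w n z \<bullet> \<psi> z + d n z \<bullet> d\<psi> z \<partial>lebesgue_on (Dm 1))
        \<longlonglongrightarrow> (\<integral>z. U z \<bullet> \<psi> z + dU z \<bullet> d\<psi> z \<partial>lebesgue_on (Dm 1))"
    and P: "sqi (lebesgue_on (Dm 1)) (\<lambda>z. P (fst z))"
    and weak_q: "sqi (lebesgue_on (Dm 1)) r \<Longrightarrow> (\<lambda>n. \<integral>z. q n z * r z \<partial>lebesgue_on (Dm 1)) \<longlonglongrightarrow> (\<integral>z. P (fst z) * r z \<partial>lebesgue_on (Dm 1))"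
    and K_sym: "y \<in> \<omega> \<Longrightarrow> transpose (K y) = K y"
    and \<alpha>_pos: "0 < \<alpha>" and K_lower: "y \<in> \<omega> \<Longrightarrow> \<alpha> * norm \<xi> \<le> norm (K y *v \<xi>)"
begin

lemmas sol_sqi = scaled_solution_sqi[OF sol]
lemmas sol_vapprox = vapprox_scaled_solution[OF sol]

lemma sol_Vz3: "Vz3 (Dm 1) (w n) (d n)"
  unfolding Vz3_iff using sol_sqi(1,3) vapprox_weak_deriv[OF sol_vapprox] by blast

lemma U_sqi: "sqi M1 U" "sqi M1 dU" using U unfolding Vz3_iff by blast+

text \<open>Available before any bound, since (f, 0) is constant along fibres. A convergent sequence
  is bounded, and that starts the energy estimate.\<close>

lemma force_tendsto: "(\<lambda>n. \<integral>z. (f (fst z), 0) \<bullet> w n z \<partial>M1) \<longlonglongrightarrow> (\<integral>z. (f (fst z), 0) \<bullet> U z \<partial>M1)"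
proof -
  have "sqi Mb (\<lambda>y. (f y, 0 :: real))" by (intro sqi_Pair f_sqi sqi_zero)
  from weak_u[OF Vz3_horizontal[OF this]] show ?thesis by (simp add: inner_commute)
qed

lemma friction_energy:
  "(\<integral>y. trace_slip (d n) y \<bullet> (K y *v fst (vtrace (d n) y)) \<partial>Mb) = (\<integral>y. norm (K y *v fst (vtrace (d n) y)) powr s \<partial>Mb)"
  by (simp add: trace_slip_def slip_inner)

text \<open>All terms on the left of the energy identity are nonnegative, so the bound on the work
  of the force bounds each of them; the velocity itself follows from the vertical Poincare
  inequality.\<close>

lemma energy_bounds:
  "\<exists>C\<ge>0. \<forall>n. (\<integral>z. (norm (d n z))\<^sup>2 \<partial>M1) \<le> C \<and> (\<integral>z. (norm (w n z))\<^sup>2 \<partial>M1) \<le> C \<and>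
     (\<forall>b\<in>hor. (\<epsilon> n)\<^sup>2 * (\<integral>z. (norm (E n b z))\<^sup>2 \<partial>M1) \<le> C) \<and>
     \<epsilon> n powr \<beta> * (\<integral>y. norm (K y *v fst (vtrace (d n) y)) powr s \<partial>Mb) \<le> C"
proof -
  obtain B where B: "\<And>n. norm (\<integral>z. (f (fst z), 0) \<bullet> w n z \<partial>M1) \<le> B"
    using convergent_imp_Bseq[OF convergentI[OF force_tendsto]] unfolding Bseq_def by blast
  have B0: "0 \<le> B" by (rule order_trans[OF norm_ge_zero B])
  define C where "C = B + B / \<nu> + (2 * H)\<^sup>2 * (B / \<nu>)"
  have parts: "0 \<le> B / \<nu>" "0 \<le> (2 * H)\<^sup>2 * (B / \<nu>)" using B0 nu_pos by (simp_all add: zero_le_mult_iff)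
  have "(\<integral>z. (norm (d n z))\<^sup>2 \<partial>M1) \<le> C \<and> (\<integral>z. (norm (w n z))\<^sup>2 \<partial>M1) \<le> C \<and>
     (\<forall>b\<in>hor. (\<epsilon> n)\<^sup>2 * (\<integral>z. (norm (E n b z))\<^sup>2 \<partial>M1) \<le> C) \<and>
     \<epsilon> n powr \<beta> * (\<integral>y. norm (K y *v fst (vtrace (d n) y)) powr s \<partial>Mb) \<le> C" for n
  proof -
    define A where "A = (\<epsilon> n)\<^sup>2 * (\<Sum>b\<in>hor. \<integral>z. (norm (E n b z))\<^sup>2 \<partial>M1)"
    define D where "D = (\<integral>z. (norm (d n z))\<^sup>2 \<partial>M1)"
    define F where "F = \<epsilon> n powr \<beta> * (\<integral>y. norm (K y *v fst (vtrace (d n) y)) powr s \<partial>Mb)"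
    have eq: "\<nu> * (A + D) + F = (\<integral>z. (f (fst z), 0) \<bullet> w n z \<partial>M1)"
      using energy_identity[OF sol \<epsilon>_pos, of n] unfolding friction_energy A_def D_def F_def .
    have nn: "0 \<le> A" "0 \<le> D" "0 \<le> F" unfolding A_def D_def F_def
      by (intro mult_nonneg_nonneg sum_nonneg Bochner_Integration.integral_nonneg zero_le_power2 powr_ge_zero)+
    have le: "\<nu> * (A + D) + F \<le> B" using eq B[of n] by simp
    have nAD: "0 \<le> \<nu> * (A + D)" using nn nu_pos by simp
    then have F: "F \<le> B" and AD: "\<nu> * (A + D) \<le> B" using le nn(3) by linarith+
    have AD': "A + D \<le> B / \<nu>" using AD nu_pos by (simp add: pos_le_divide_eq mult.commute)
    have W: "(\<integral>z. (norm (w n z))\<^sup>2 \<partial>M1) \<le> (2 * H)\<^sup>2 * (B / \<nu>)"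
      by (rule order_trans[OF Poincare[OF sol_vapprox]], fold D_def)
         (intro mult_left_mono zero_le_power2, use AD' nn in linarith)
    have Eb: "(\<epsilon> n)\<^sup>2 * (\<integral>z. (norm (E n b z))\<^sup>2 \<partial>M1) \<le> A" if "b \<in> hor" for b
      unfolding A_def
      by (intro mult_left_mono zero_le_power2 member_le_sum[OF that] Bochner_Integration.integral_nonneg Basis_hor(3))
    have "A \<le> C" "D \<le> C" "F \<le> C" "(\<integral>z. (norm (w n z))\<^sup>2 \<partial>M1) \<le> C"
      using AD' F W nn parts B0 unfolding C_def by linarith+
    then show ?thesis using Eb unfolding D_def F_def by (meson order_trans)
  qed
  moreover have "0 \<le> C" using parts B0 unfolding C_def by linarith
  ultimately show ?thesis by blast
qed

text \<open>Arbitrary square-integrable \<open>b\<close> and \<open>c\<close> need not form a V_z3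
  pair. The Gram criterion requires testing only with the solution pairs and the limit pair, all of
  which do belong to V_z3, together with the energy bound.\<close>

lemma weak_pair:
  assumes b: "sqi M1 b" and c: "sqi M1 c"
  shows "(\<lambda>n. \<integral>z. w n z \<bullet> b z + d n z \<bullet> c z \<partial>M1) \<longlonglongrightarrow> (\<integral>z. U z \<bullet> b z + dU z \<bullet> c z \<partial>M1)"
proof -
  obtain C where C: "\<And>n. (\<integral>z. (norm (d n z))\<^sup>2 \<partial>M1) \<le> C" "\<And>n. (\<integral>z. (norm (w n z))\<^sup>2 \<partial>M1) \<le> C"
    using energy_bounds by blast
  have n2: "(norm (x, y))\<^sup>2 = (norm x)\<^sup>2 + (norm y)\<^sup>2" for x y :: pt by (simp add: norm_Pair)
  have "(\<lambda>n. \<integral>z. (w n z, d n z) \<bullet> (b z, c z) \<partial>M1) \<longlonglongrightarrow> (\<integral>z. (U z, dU z) \<bullet> (b z, c z) \<partial>M1)"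
  proof (rule sqi_weak_convergence_from_gram[where C="C + C"])
    show "sqi M1 (\<lambda>z. (w n z, d n z))" for n by (intro sqi_Pair sol_sqi)
    show "sqi M1 (\<lambda>z. (U z, dU z))" by (intro sqi_Pair U_sqi)
    show "sqi M1 (\<lambda>z. (b z, c z))" by (intro sqi_Pair b c)
    show "(\<integral>z. (norm (w n z, d n z))\<^sup>2 \<partial>M1) \<le> C + C" for n
      unfolding n2 Bochner_Integration.integral_add[OF sqiD(2)[OF sol_sqi(1)] sqiD(2)[OF sol_sqi(3)]]
      by (rule add_mono[OF C(2) C(1)])
    show "(\<lambda>n. \<integral>z. (w n z, d n z) \<bullet> (w m z, d m z) \<partial>M1) \<longlonglongrightarrow> (\<integral>z. (U z, dU z) \<bullet> (w m z, d m z) \<partial>M1)" for m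
      unfolding inner_Pair by (rule weak_u[OF sol_Vz3])
    show "(\<lambda>n. \<integral>z. (w n z, d n z) \<bullet> (U z, dU z) \<partial>M1) \<longlonglongrightarrow> (\<integral>z. (U z, dU z) \<bullet> (U z, dU z) \<partial>M1)"
      unfolding inner_Pair by (rule weak_u[OF U])
  qed
  then show ?thesis unfolding inner_Pair .
qed

lemma weak_w: "sqi M1 b \<Longrightarrow> (\<lambda>n. \<integral>z. w n z \<bullet> b z \<partial>M1) \<longlonglongrightarrow> (\<integral>z. U z \<bullet> b z \<partial>M1)"
  using weak_pair[OF _ sqi_zero, of b] by simp

lemma weak_d: "sqi M1 b \<Longrightarrow> (\<lambda>n. \<integral>z. d n z \<bullet> b z \<partial>M1) \<longlonglongrightarrow> (\<integral>z. dU z \<bullet> b z \<partial>M1)"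
  using weak_pair[OF sqi_zero, of b] by simp

lemma flux_limit:
  fixes \<psi> :: "real^2 \<Rightarrow> real"
  assumes \<psi>: "C1fun \<psi>" shows "(\<integral>z. U z \<bullet> (grad2 \<psi> (fst z), 0) \<partial>M1) = 0"
proof -
  from weak_w[OF grad2_sqi[OF \<psi>]] show ?thesis unfolding scaled_solution_flux[OF sol \<psi>] by (simp add: LIMSEQ_const_iff)
qed

text \<open>Linear identities with fixed multipliers survive weak convergence, so the boundary
  conditions pass to the limit in the same integrated form that was used for approximation.\<close>

lemma identity_limit:
  assumes sq: "sqi M1 a" "sqi M1 b" "sqi M1 c"
    and eq: "\<And>n. (\<integral>z. a z *\<^sub>R d n z + b z *\<^sub>R w n z \<partial>M1) = (\<integral>z. c z *\<^sub>R d n z \<partial>M1)"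
  shows "(\<integral>z. a z *\<^sub>R dU z + b z *\<^sub>R U z \<partial>M1) = (\<integral>z. c z *\<^sub>R dU z \<partial>M1)"
proof (rule euclidean_eqI)
  fix k :: pt
  have split: "(\<integral>z. a z *\<^sub>R D z + b z *\<^sub>R W z \<partial>M1) \<bullet> k = (\<integral>z. D z \<bullet> (a z *\<^sub>R k) \<partial>M1) + (\<integral>z. W z \<bullet> (b z *\<^sub>R k) \<partial>M1)"
    if "sqi M1 D" "sqi M1 W" for D W :: "pt \<Rightarrow> pt"
    unfolding Bochner_Integration.integral_add[OF sqi_scaleR_integrable[OF sq(1) that(1)] sqi_scaleR_integrable[OF sq(2) that(2)]]
      inner_add_left integral_scaleR_inner[OF sq(1) that(1)] integral_scaleR_inner[OF sq(2) that(2)] ..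
  have "(\<lambda>n. (\<integral>z. d n z \<bullet> (a z *\<^sub>R k) \<partial>M1) + (\<integral>z. w n z \<bullet> (b z *\<^sub>R k) \<partial>M1))
      \<longlonglongrightarrow> (\<integral>z. dU z \<bullet> (a z *\<^sub>R k) \<partial>M1) + (\<integral>z. U z \<bullet> (b z *\<^sub>R k) \<partial>M1)"
    by (intro tendsto_add weak_d weak_w sqi_scaleR_const sq)
  moreover have "(\<lambda>n. \<integral>z. d n z \<bullet> (c z *\<^sub>R k) \<partial>M1) \<longlonglongrightarrow> (\<integral>z. dU z \<bullet> (c z *\<^sub>R k) \<partial>M1)"
    by (intro weak_d sqi_scaleR_const sq)
  moreover have "(\<integral>z. d n z \<bullet> (a z *\<^sub>R k) \<partial>M1) + (\<integral>z. w n z \<bullet> (b z *\<^sub>R k) \<partial>M1) = (\<integral>z. d n z \<bullet> (c z *\<^sub>R k) \<partial>M1)" for n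
    unfolding split[OF sol_sqi(3,1), symmetric] eq integral_scaleR_inner[OF sq(3) sol_sqi(3)] ..
  ultimately have "(\<integral>z. dU z \<bullet> (a z *\<^sub>R k) \<partial>M1) + (\<integral>z. U z \<bullet> (b z *\<^sub>R k) \<partial>M1) = (\<integral>z. dU z \<bullet> (c z *\<^sub>R k) \<partial>M1)"
    by (simp only: LIMSEQ_unique)
  then show "(\<integral>z. a z *\<^sub>R dU z + b z *\<^sub>R U z \<partial>M1) \<bullet> k = (\<integral>z. c z *\<^sub>R dU z \<partial>M1) \<bullet> k"
    unfolding split[OF U_sqi(2,1)] integral_scaleR_inner[OF sq(3) U_sqi(2)] .
qed

lemma limit_vanishes_Gamma1: "vanishes_Gamma1 \<omega> h (Dm 1) U dU"
  unfolding vanishes_Gamma1_def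
proof (intro allI impI, elim conjE)
  fix \<psi> :: "pt \<Rightarrow> real"
  assume \<psi>: "C1fun \<psi>" "compact (supp \<psi>)" "supp \<psi> \<inter> (frontier (Dm 1) - Gamma1 \<omega> h) = {}"
  have "(\<integral>z. \<psi> z *\<^sub>R dU z + pd \<psi> e3 z *\<^sub>R U z \<partial>M1) = (\<integral>z. (0::real) *\<^sub>R dU z \<partial>M1)"
  proof (rule identity_limit)
    show "sqi M1 \<psi>" "sqi M1 (pd \<psi> e3)" by (rule C1_sqi_Mdom[OF zero_less_one \<psi>(1,2)], rule C1_sqi_Mdom_pd[OF zero_less_one \<psi>(1,2)])
    show "(\<integral>z. \<psi> z *\<^sub>R d n z + pd \<psi> e3 z *\<^sub>R w n z \<partial>M1) = (\<integral>z. (0::real) *\<^sub>R d n z \<partial>M1)" for n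
      using vapprox_top[OF sol_vapprox \<psi>] by simp
  qed (rule sqi_zero)
  then show "SInt (Dm 1) (\<lambda>x. \<psi> x *\<^sub>R dU x + pd \<psi> e3 x *\<^sub>R U x) = 0"
    by (simp add: integral_lebesgue_on_eq[OF sets_dom, symmetric])
qed

lemma limit_trace: "trace_Gamma0 \<omega> (Dm 1) U dU (vtrace dU)"
  unfolding trace_Gamma0_def
proof (intro conjI allI impI, goal_cases)
  case 1
  show ?case unfolding L2_iff_sqi[OF sets_base] by (rule vtrace_bound(1)[OF U_sqi(2)])
next
  case (2 \<psi>)
  then have t: "test_field 1 \<psi>" unfolding test_field_def .
  note \<psi> = test_fieldD(1,2)[OF t]
  have "(\<integral>z. \<psi> z *\<^sub>R dU z + pd \<psi> e3 z *\<^sub>R U z \<partial>M1) = (\<integral>z. \<psi> (fst z, 0) *\<^sub>R dU z \<partial>M1)"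
  proof (rule identity_limit)
    show "sqi M1 \<psi>" "sqi M1 (pd \<psi> e3)" by (rule C1_sqi_Mdom[OF zero_less_one \<psi>], rule C1_sqi_Mdom_pd[OF zero_less_one \<psi>])
    show "sqi M1 (\<lambda>z. \<psi> (fst z, 0))" by (rule sqi_fst_dom[OF bottom_sqi[OF \<psi>] zero_less_one])
    show "(\<integral>z. \<psi> z *\<^sub>R d n z + pd \<psi> e3 z *\<^sub>R w n z \<partial>M1) = (\<integral>z. \<psi> (fst z, 0) *\<^sub>R d n z \<partial>M1)" for n
      by (rule vapprox_trace[OF sol_vapprox t])
  qed
  also have "\<dots> = - (\<integral>y. \<psi> (y, 0) *\<^sub>R vtrace dU y \<partial>Mb)"
    using vtrace_scaleR[OF U_sqi(2) bottom_sqi[OF \<psi>]] by simp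
  finally show ?case
    by (simp add: integral_lebesgue_on_eq[OF sets_dom, symmetric] integral_lebesgue_on_eq[OF sets_base, symmetric])
qed

text \<open>The energy controls \<epsilon> times the norm of the horizontal derivatives; one of the
  two powers of \<epsilon> is left over.\<close>

lemma horizontal_stress_tendsto:
  assumes b: "b \<in> hor" and Z: "sqi M1 Z" shows "(\<lambda>n. (\<epsilon> n)\<^sup>2 * (\<integral>z. E n b z \<bullet> Z z \<partial>M1)) \<longlonglongrightarrow> 0"
proof -
  obtain C where C: "\<And>n. (\<epsilon> n)\<^sup>2 * (\<integral>z. (norm (E n b z))\<^sup>2 \<partial>M1) \<le> C" using energy_bounds b by blast
  have bd: "norm ((\<epsilon> n)\<^sup>2 * (\<integral>z. E n b z \<bullet> Z z \<partial>M1)) \<le> \<epsilon> n * (sqrt C * sqrt (\<integral>z. (norm (Z z))\<^sup>2 \<partial>M1))" for n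
  proof -
    have "(\<epsilon> n)\<^sup>2 * \<bar>\<integral>z. E n b z \<bullet> Z z \<partial>M1\<bar> \<le> (\<epsilon> n)\<^sup>2 * (sqrt (\<integral>z. (norm (E n b z))\<^sup>2 \<partial>M1) * sqrt (\<integral>z. (norm (Z z))\<^sup>2 \<partial>M1))"
      by (intro mult_left_mono sqi_Cauchy_Schwarz sol_sqi(2)[OF b] Z zero_le_power2)
    also have "\<dots> = \<epsilon> n * (sqrt ((\<epsilon> n)\<^sup>2 * (\<integral>z. (norm (E n b z))\<^sup>2 \<partial>M1)) * sqrt (\<integral>z. (norm (Z z))\<^sup>2 \<partial>M1))"
      using \<epsilon>_pos[of n] by (simp add: real_sqrt_mult power2_eq_square)
    also have "\<dots> \<le> \<epsilon> n * (sqrt C * sqrt (\<integral>z. (norm (Z z))\<^sup>2 \<partial>M1))"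
      using \<epsilon>_pos[of n] by (intro mult_left_mono mult_right_mono real_sqrt_le_mono C) simp_all
    finally show ?thesis by (simp add: abs_mult)
  qed
  have "(\<lambda>n. \<epsilon> n * (sqrt C * sqrt (\<integral>z. (norm (Z z))\<^sup>2 \<partial>M1))) \<longlonglongrightarrow> 0"
    by (rule tendsto_mult_left_zero[OF \<epsilon>_lim])
  then show ?thesis by (rule Lim_null_comparison[OF always_eventually[rule_format, OF bd]])
qed

text \<open>For bounded \<open>Z\<close> both parts are of order \<epsilon>^3: in the horizontal one
  a factor \<epsilon> is lent to the derivative to use its energy bound.\<close>

lemma inertia_vanishes:
  assumes "\<And>z. norm (Z z) \<le> C'" shows "(\<lambda>n. inertia (\<epsilon> n) (w n) (E n) (d n) Z) \<longlonglongrightarrow> 0"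
proof -
  obtain C where C0: "0 \<le> C" and C: "\<And>n. (\<integral>z. (norm (d n z))\<^sup>2 \<partial>M1) \<le> C" "\<And>n. (\<integral>z. (norm (w n z))\<^sup>2 \<partial>M1) \<le> C"
    "\<And>n b. b \<in> hor \<Longrightarrow> (\<epsilon> n)\<^sup>2 * (\<integral>z. (norm (E n b z))\<^sup>2 \<partial>M1) \<le> C" using energy_bounds by blast
  have C'0: "0 \<le> C'" by (rule order_trans[OF norm_ge_zero assms])
  define A where "A n b = (\<integral>z. norm (w n z) * norm (E n b z) \<partial>M1)" for n b
  define D where "D n = (\<integral>z. norm (w n z) * norm (d n z) \<partial>M1)" for n
  have Ab: "\<epsilon> n * A n b \<le> C" if b: "b \<in> hor" for n b
  proof (rule power2_le_imp_le[OF _ C0])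
    have "(\<epsilon> n * A n b)\<^sup>2 \<le> (\<epsilon> n)\<^sup>2 * ((\<integral>z. (norm (w n z))\<^sup>2 \<partial>M1) * (\<integral>z. (norm (E n b z))\<^sup>2 \<partial>M1))"
      unfolding power_mult_distrib A_def by (intro mult_left_mono sqi_Cauchy_Schwarz_norm sol_sqi(1) sol_sqi(2)[OF b] zero_le_power2)
    also have "\<dots> = (\<integral>z. (norm (w n z))\<^sup>2 \<partial>M1) * ((\<epsilon> n)\<^sup>2 * (\<integral>z. (norm (E n b z))\<^sup>2 \<partial>M1))" by (simp only: ac_simps)
    also have "\<dots> \<le> C * C" by (intro mult_mono C(2) C(3)[OF b] C0 mult_nonneg_nonneg zero_le_power2 Bochner_Integration.integral_nonneg)
    finally show "(\<epsilon> n * A n b)\<^sup>2 \<le> C\<^sup>2" by (simp only: power2_eq_square)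
  qed
  have Db: "D n \<le> C" for n
  proof (rule power2_le_imp_le[OF _ C0])
    have "(D n)\<^sup>2 \<le> (\<integral>z. (norm (w n z))\<^sup>2 \<partial>M1) * (\<integral>z. (norm (d n z))\<^sup>2 \<partial>M1)"
      unfolding D_def by (rule sqi_Cauchy_Schwarz_norm[OF sol_sqi(1,3)])
    also have "\<dots> \<le> C * C" by (intro mult_mono C(1,2) C0 zero_le_power2 Bochner_Integration.integral_nonneg)
    finally show "(D n)\<^sup>2 \<le> C\<^sup>2" by (simp only: power2_eq_square)
  qed
  have bd: "norm (inertia (\<epsilon> n) (w n) (E n) (d n) Z) \<le> (\<epsilon> n)^3 * (C' * ((\<Sum>b\<in>hor. C) + C))" for n
  proof -
    let ?g = "\<lambda>z. (\<epsilon> n)^4 * (\<Sum>b\<in>hor. (w n z \<bullet> b) * (E n b z \<bullet> Z z)) + (\<epsilon> n)^3 * (snd (w n z) * (d n z \<bullet> Z z))"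
    let ?G = "\<lambda>z. (\<epsilon> n)^3 * (C' * ((\<Sum>b\<in>hor. \<epsilon> n * (norm (w n z) * norm (E n b z))) + norm (w n z) * norm (d n z)))"
    have e0: "0 \<le> \<epsilon> n" using \<epsilon>_pos[of n] by simp
    have iA: "integrable M1 (\<lambda>z. norm (w n z) * norm (E n b z))" if "b \<in> hor" for b
      by (rule sqi_norm_mult_integrable[OF sol_sqi(1) sol_sqi(2)[OF that]])
    have iD: "integrable M1 (\<lambda>z. norm (w n z) * norm (d n z))" by (rule sqi_norm_mult_integrable[OF sol_sqi(1,3)])
    have iG: "integrable M1 ?G"
      by (intro integrable_mult_right Bochner_Integration.integrable_add Bochner_Integration.integrable_sum iA iD)
    have ptw: "norm (?g z) \<le> ?G z" for z
    proof -
      have x: "\<bar>a \<bullet> Z z\<bar> \<le> norm a * C'" for a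
        by (rule order_trans[OF Cauchy_Schwarz_ineq2]) (intro mult_left_mono assms norm_ge_zero)
      have hb: "\<bar>(w n z \<bullet> b) * (E n b z \<bullet> Z z)\<bar> \<le> C' * (norm (w n z) * norm (E n b z))" if "b \<in> hor" for b
      proof -
        have "\<bar>w n z \<bullet> b\<bar> \<le> norm (w n z)" using Cauchy_Schwarz_ineq2[of "w n z" b] norm_hor[OF that] by simp
        then have "\<bar>w n z \<bullet> b\<bar> * \<bar>E n b z \<bullet> Z z\<bar> \<le> norm (w n z) * (norm (E n b z) * C')"
          by (intro mult_mono x) simp_all
        then show ?thesis by (simp add: abs_mult mult.commute mult.left_commute)
      qed
      have "\<bar>snd (w n z)\<bar> * \<bar>d n z \<bullet> Z z\<bar> \<le> norm (w n z) * (norm (d n z) * C')"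
        using norm_snd_le[of "snd (w n z)" "fst (w n z)"] by (intro mult_mono x) simp_all
      then have 3: "\<bar>snd (w n z) * (d n z \<bullet> Z z)\<bar> \<le> C' * (norm (w n z) * norm (d n z))"
        by (simp add: abs_mult mult.commute mult.left_commute)
      have "norm (?g z) \<le> (\<epsilon> n)^4 * (\<Sum>b\<in>hor. C' * (norm (w n z) * norm (E n b z))) + (\<epsilon> n)^3 * (C' * (norm (w n z) * norm (d n z)))"
      proof (unfold real_norm_def, rule order_trans[OF abs_triangle_ineq], rule add_mono)
        show "\<bar>(\<epsilon> n)^4 * (\<Sum>b\<in>hor. (w n z \<bullet> b) * (E n b z \<bullet> Z z))\<bar> \<le> (\<epsilon> n)^4 * (\<Sum>b\<in>hor. C' * (norm (w n z) * norm (E n b z)))"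
          unfolding abs_mult abs_of_nonneg[OF zero_le_power[OF e0]]
          by (intro mult_left_mono order_trans[OF sum_abs] sum_mono hb zero_le_power[OF e0])
        show "\<bar>(\<epsilon> n)^3 * (snd (w n z) * (d n z \<bullet> Z z))\<bar> \<le> (\<epsilon> n)^3 * (C' * (norm (w n z) * norm (d n z)))"
          unfolding abs_mult[of "(\<epsilon> n)^3"] abs_of_nonneg[OF zero_le_power[OF e0]]
          by (intro mult_left_mono 3 zero_le_power[OF e0])
      qed
      also have "\<dots> = ?G z"
        by (simp add: sum_distrib_left distrib_left eval_nat_numeral mult_ac)
      finally show ?thesis .
    qed
    have "norm (inertia (\<epsilon> n) (w n) (E n) (d n) Z) \<le> integral\<^sup>L M1 ?G"
    proof (cases "integrable M1 ?g")
      case True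
      show ?thesis unfolding inertia_def 
        by (rule order_trans[OF integral_norm_bound Bochner_Integration.integral_mono[OF integrable_norm[OF True] iG ptw]])
    next
      \<comment> \<open>\<open>Z\<close> is not assumed measurable; a nonintegrable integrand has
        integral 0 by convention, which obeys the same bound.\<close>
      case False
      have "0 \<le> integral\<^sup>L M1 ?G"
        by (rule Bochner_Integration.integral_nonneg) (rule order_trans[OF norm_ge_zero ptw])
      then show ?thesis unfolding inertia_def not_integrable_integral_eq[OF False] by simp
    qed
    also have "integral\<^sup>L M1 ?G = (\<epsilon> n)^3 * (C' * ((\<Sum>b\<in>hor. \<epsilon> n * A n b) + D n))"
    proof -
      have "(\<integral>z. (\<Sum>b\<in>hor. \<epsilon> n * (norm (w n z) * norm (E n b z))) + norm (w n z) * norm (d n z) \<partial>M1)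
          = (\<integral>z. (\<Sum>b\<in>hor. \<epsilon> n * (norm (w n z) * norm (E n b z))) \<partial>M1) + D n"
        unfolding D_def
        by (intro Bochner_Integration.integral_add Bochner_Integration.integrable_sum integrable_mult_right iA iD)
      also have "(\<integral>z. (\<Sum>b\<in>hor. \<epsilon> n * (norm (w n z) * norm (E n b z))) \<partial>M1) = (\<Sum>b\<in>hor. \<epsilon> n * A n b)"
        unfolding A_def by (subst Bochner_Integration.integral_sum) (use iA in simp_all)
      finally show ?thesis by (simp only: integral_mult_right_zero)
    qed
    also have "\<dots> \<le> (\<epsilon> n)^3 * (C' * ((\<Sum>b\<in>hor. C) + C))"
      by (intro mult_left_mono add_mono sum_mono Ab Db C'0 zero_le_power[OF e0])
    finally show ?thesis .
  qed
  have "(\<lambda>n. (\<epsilon> n)^3 * (C' * ((\<Sum>b\<in>hor. C) + C))) \<longlonglongrightarrow> 0"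
    by (rule tendsto_mult_left_zero) (use tendsto_power[OF \<epsilon>_lim, of 3] in simp)
  then show ?thesis by (rule Lim_null_comparison[OF always_eventually[rule_format, OF bd]])
qed

definition friction :: "nat \<Rightarrow> (pt \<Rightarrow> real^2) \<Rightarrow> real" where
  "friction n \<phi> = (\<integral>y. trace_slip (d n) y \<bullet> (K y *v \<phi> (y, 0)) \<partial>Mb)"

text \<open>The value that the boundary functional must take on \<phi> for the limit momentum
  equation to hold; it is independent of the friction regime.\<close>

definition residual :: "(pt \<Rightarrow> real^2) \<Rightarrow> real" where
  "residual \<phi> = (\<integral>z. f (fst z) \<bullet> \<phi> z \<partial>M1) + (\<integral>z. P (fst z) * div2 \<phi> z \<partial>M1) - \<nu> * (\<integral>z. fst (dU z) \<bullet> pd \<phi> e3 z \<partial>M1)"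

text \<open>Testing with (\<phi>, 0) removes the singular pressure term, because the third component
  and its vertical derivative vanish. All remaining terms have known limits, so the friction term
  must converge too, before anything is known about the traces.\<close>

lemma friction_tendsto:
  assumes \<phi>: "test_field 1 \<phi>" shows "(\<lambda>n. \<epsilon> n powr \<beta> * friction n \<phi>) \<longlonglongrightarrow> residual \<phi>"
proof -
  define \<Phi> where "\<Phi> z = (\<phi> z, 0::real)" for z
  have bl: "bounded_linear (\<lambda>x::real^2. (x, 0::real))" by (intro bounded_linear_Pair bounded_linear_ident bounded_linear_zero)
  have t: "test_field 1 \<Phi>" unfolding \<Phi>_def by (rule test_field_linear[OF \<phi> bl])
  have bt: "bottom_tangential \<Phi>" by (simp add: bottom_tangential_def \<Phi>_def)
  note C = test_fieldD(1,2)[OF t]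
  have pd\<Phi>: "pd \<Phi> v z = (pd \<phi> v z, 0)" for v z
    unfolding \<Phi>_def by (rule C1fun_linear_compose(2)[OF test_fieldD(1)[OF \<phi>] bl])
  have s\<Phi>: "sqi M1 (pd \<Phi> v)" for v by (rule C1_sqi_Mdom_pd[OF zero_less_one C])
  obtain B where B: "\<And>z. norm (\<Phi> z) \<le> B" using C1fun_bounded[OF C] by blast
  have sb: "sqi M1 (\<lambda>z. pd \<Phi> b z \<bullet> b)" for b by (rule sqi_inner_right[OF s\<Phi>])
  have eq: "\<epsilon> n powr \<beta> * friction n \<phi> = (\<integral>z. f (fst z) \<bullet> \<phi> z \<partial>M1) + (\<Sum>b\<in>hor. \<integral>z. q n z * (pd \<Phi> b z \<bullet> b) \<partial>M1)
      - \<nu> * ((\<Sum>b\<in>hor. (\<epsilon> n)\<^sup>2 * (\<integral>z. E n b z \<bullet> pd \<Phi> b z \<partial>M1)) + (\<integral>z. d n z \<bullet> pd \<Phi> e3 z \<partial>M1))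
      - inertia (\<epsilon> n) (w n) (E n) (d n) \<Phi>" for n
  proof -
    have "scaled_equation \<nu> f K s \<beta> (\<epsilon> n) (w n) (E n) (d n) (q n) \<Phi>"
      using sol[of n] t bt unfolding scaled_solution_def by blast
    have wf: "wform \<beta> (\<epsilon> n) (E n) (d n) (q n) \<Phi> (pd \<Phi>) (pd \<Phi> e3) (\<lambda>y. fst (\<Phi> (y, 0))) + inertia (\<epsilon> n) (w n) (E n) (d n) \<Phi> = 0"
      by (rule scaled_equation_wform[OF _ sol_sqi(3,4) t \<open>scaled_equation _ _ _ _ _ _ _ _ _ _ _\<close>]) (rule sol_sqi(2))
    have e: "(q n z *\<^sub>R e3) \<bullet> pd \<Phi> e3 z = 0" "(f (fst z), 0) \<bullet> \<Phi> z = f (fst z) \<bullet> \<phi> z"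
      "(q n z *\<^sub>R b) \<bullet> pd \<Phi> b z = q n z * (pd \<Phi> b z \<bullet> b)" "fst (\<Phi> z) = \<phi> z" for b z
      by (simp_all add: pd\<Phi> e3_def \<Phi>_def inner_commute)
    show ?thesis
      using wf unfolding wform_def e(1) unfolding e(2-4) friction_def sum_distrib_left[symmetric] Bochner_Integration.integral_zero mult_zero_right
      by linarith
  qed
  have lim: "(\<lambda>n. \<epsilon> n powr \<beta> * friction n \<phi>) \<longlonglongrightarrow> (\<integral>z. f (fst z) \<bullet> \<phi> z \<partial>M1) + (\<Sum>b\<in>hor. \<integral>z. P (fst z) * (pd \<Phi> b z \<bullet> b) \<partial>M1)
      - \<nu> * ((\<Sum>b\<in>hor. 0) + (\<integral>z. dU z \<bullet> pd \<Phi> e3 z \<partial>M1)) - 0"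
    unfolding eq
    by (intro tendsto_diff tendsto_add tendsto_mult_left tendsto_sum tendsto_const weak_q sb weak_d s\<Phi>
        horizontal_stress_tendsto inertia_vanishes[OF B])
  have "(\<Sum>b\<in>hor. \<integral>z. P (fst z) * (pd \<Phi> b z \<bullet> b) \<partial>M1) = (\<integral>z. (\<Sum>b\<in>hor. P (fst z) * (pd \<Phi> b z \<bullet> b)) \<partial>M1)"
    by (rule Bochner_Integration.integral_sum[symmetric]) (rule sqi_mult_integrable[OF P sb])
  also have "(\<lambda>z. \<Sum>b\<in>hor. P (fst z) * (pd \<Phi> b z \<bullet> b)) = (\<lambda>z. P (fst z) * div2 \<phi> z)"
    by (simp add: div2_def sum_hor pd\<Phi> sum_distrib_left)
  finally have 1: "(\<Sum>b\<in>hor. \<integral>z. P (fst z) * (pd \<Phi> b z \<bullet> b) \<partial>M1) = (\<integral>z. P (fst z) * div2 \<phi> z \<partial>M1)" .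
  have 2: "dU z \<bullet> pd \<Phi> e3 z = fst (dU z) \<bullet> pd \<phi> e3 z" for z by (cases "dU z") (simp add: pd\<Phi>)
  show ?thesis using lim unfolding 1 2 residual_def by simp
qed

lemma momentum_eq_iff: "momentum_eq \<omega> h \<nu> f dU P bd \<phi> \<longleftrightarrow> bd \<phi> = residual \<phi>"
  unfolding momentum_eq_def Let_def residual_def integral_lebesgue_on_eq[OF sets_dom, symmetric] by linarith

lemma powr_eps_tendsto: "0 < c \<Longrightarrow> (\<lambda>n. \<epsilon> n powr c) \<longlonglongrightarrow> 0"
  using tendsto_powr'[OF \<epsilon>_lim tendsto_const[of c]] \<epsilon>_pos by (simp add: less_imp_le)

text \<open>The bound comes from the viscous energy through the trace inequality, not from the
  friction energy, so it is free of \<beta>.\<close>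

lemma trace_slip_bound: "\<exists>B\<ge>0. \<forall>n. (\<integral>y. (norm (trace_slip (d n) y))\<^sup>2 \<partial>Mb) \<le> B"
proof -
  interpret finite_measure Mb by (rule finite_Mb)
  obtain C where C0: "0 \<le> C" and C: "\<And>n. (\<integral>z. (norm (d n z))\<^sup>2 \<partial>M1) \<le> C" using energy_bounds by blast
  have "(\<integral>y. (norm (trace_slip (d n) y))\<^sup>2 \<partial>Mb) \<le> 2 * measure Mb (space Mb) + 2 * Mk\<^sup>2 * (H * C)" for n
  proof -
    note g = vtrace_bound[OF sol_sqi(3)[of n]]
    have "(\<integral>y. (norm (trace_slip (d n) y))\<^sup>2 \<partial>Mb) \<le> (\<integral>y. 2 + 2 * Mk\<^sup>2 * (norm (vtrace (d n) y))\<^sup>2 \<partial>Mb)"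
    proof (rule integral_mono_AE)
      show "integrable Mb (\<lambda>y. (norm (trace_slip (d n) y))\<^sup>2)" by (rule sqiD(2)[OF trace_slip_sqi[OF sol_sqi(3)]])
      show "integrable Mb (\<lambda>y. 2 + 2 * Mk\<^sup>2 * (norm (vtrace (d n) y))\<^sup>2)"
        by (intro Bochner_Integration.integrable_add integrable_mult_right sqiD(2)[OF g(1)]) simp
      show "AE y in Mb. (norm (trace_slip (d n) y))\<^sup>2 \<le> 2 + 2 * Mk\<^sup>2 * (norm (vtrace (d n) y))\<^sup>2"
      proof (rule AE_base)
        fix y assume y: "y \<in> \<omega>"
        define a where "a = Mk * norm (vtrace (d n) y)"
        have "norm (K y *v fst (vtrace (d n) y)) \<le> a" unfolding a_def
          using K_bound[OF y] norm_fst_le[of "fst (vtrace (d n) y)" "snd (vtrace (d n) y)"] Mk_nonneg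
          by (metis (no_types) mult_left_mono order_trans prod.collapse)
        then have "norm (trace_slip (d n) y) \<le> 1 + a"
          using norm_slip_le[OF s, of "K y" "fst (vtrace (d n) y)"] unfolding trace_slip_def by linarith
        then have "(norm (trace_slip (d n) y))\<^sup>2 \<le> (1 + a)\<^sup>2" by (intro power_mono) simp_all
        also have "\<dots> \<le> 2 + 2 * a\<^sup>2" using zero_le_power2[of "1 - a"] by (simp add: power2_eq_square algebra_simps)
        finally show "(norm (trace_slip (d n) y))\<^sup>2 \<le> 2 + 2 * Mk\<^sup>2 * (norm (vtrace (d n) y))\<^sup>2"
          by (simp add: a_def power_mult_distrib)
      qed
    qed
    also have "\<dots> = 2 * measure Mb (space Mb) + 2 * Mk\<^sup>2 * (\<integral>y. (norm (vtrace (d n) y))\<^sup>2 \<partial>Mb)"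
      by (subst Bochner_Integration.integral_add) (simp_all add: sqiD(2)[OF g(1)])
    also have "\<dots> \<le> 2 * measure Mb (space Mb) + 2 * Mk\<^sup>2 * (H * C)"
      by (intro add_left_mono mult_left_mono order_trans[OF g(2)] C H_nonneg) simp
    finally show ?thesis .
  qed
  moreover have "0 \<le> 2 * measure Mb (space Mb) + 2 * Mk\<^sup>2 * (H * C)" using C0 H_nonneg by simp
  ultimately show ?thesis by blast
qed

section \<open>Weak friction (\<beta> > 0) and strong friction (\<beta> < 0)\<close>

lemma perfect_slip:
  assumes \<beta>: "0 < \<beta>" and \<phi>: "test_field 1 \<phi>" shows "residual \<phi> = 0"
proof -
  obtain B where B: "\<And>n. (\<integral>y. (norm (trace_slip (d n) y))\<^sup>2 \<partial>Mb) \<le> B" using trace_slip_bound by blast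
  have sK: "sqi Mb (\<lambda>y. K y *v \<phi> (y, 0))" by (rule K_sqi[OF bottom_sqi[OF test_fieldD(1,2)[OF \<phi>]]])
  have bd: "norm (\<epsilon> n powr \<beta> * friction n \<phi>) \<le> \<epsilon> n powr \<beta> * (sqrt B * sqrt (\<integral>y. (norm (K y *v \<phi> (y, 0)))\<^sup>2 \<partial>Mb))" for n
    unfolding friction_def real_norm_def abs_mult abs_of_nonneg[OF powr_ge_zero]
    by (intro mult_left_mono sqi_inner_norm_bound[OF trace_slip_sqi[OF sol_sqi(3)] sK B order_refl] powr_ge_zero)
  have "(\<lambda>n. \<epsilon> n powr \<beta> * friction n \<phi>) \<longlonglongrightarrow> 0"
    by (rule Lim_null_comparison[OF always_eventually[rule_format, OF bd]])
       (rule tendsto_mult_left_zero[OF powr_eps_tendsto[OF \<beta>]])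
  then show ?thesis using LIMSEQ_unique[OF friction_tendsto[OF \<phi>]] by simp
qed

lemma interior_residual:
  assumes \<phi>: "C1fun \<phi>" "compact (supp \<phi>)" "supp \<phi> \<subseteq> Dm 1" shows "residual \<phi> = 0"
proof -
  have t: "test_field 1 \<phi>" unfolding test_field_def frontier_dom_eq using \<phi> by blast
  have z: "\<phi> (y, 0) = 0" for y
  proof -
    have "(y, 0) \<notin> supp \<phi>" using \<phi>(3) by (auto simp: mem_dom)
    then show ?thesis by (rule not_in_supp(1))
  qed
  show ?thesis using friction_tendsto[OF t] by (simp add: friction_def z LIMSEQ_const_iff)
qed

text \<open>The friction energy controls \<open>\<integral> |K g|\<^sup>s\<close> by \<open>\<epsilon>\<^sup>-\<^sup>\<beta>\<close>; splitting at the level \<open>|K g| = \<epsilon>\<^sup>\<delta>\<close>,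
  with \<open>\<delta> = -\<beta> / (2 (s - 1))\<close>, gives convergence to zero in \<open>L\<^sup>1\<close>.\<close>

lemma trace_L1_null:
  assumes \<beta>: "\<beta> < 0" shows "(\<lambda>n. \<integral>y. norm (fst (vtrace (d n) y)) \<partial>Mb) \<longlonglongrightarrow> 0"
proof -
  interpret finite_measure Mb by (rule finite_Mb)
  obtain C where C: "\<And>n. \<epsilon> n powr \<beta> * (\<integral>y. norm (K y *v fst (vtrace (d n) y)) powr s \<partial>Mb) \<le> C" using energy_bounds by blast
  define \<delta> where "\<delta> = - \<beta> / (2 * (s - 1))"
  \<comment> \<open>With this exponent \<open>\<eta> powr (1 - s)\<close> equals
    \<epsilon>^(\<beta>/2). The friction bound supplies \<epsilon>^(-\<beta>), so
    \<epsilon>^(-\<beta>/2) is left as decay.\<close>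
  have \<delta>: "0 < \<delta>" "\<delta> * (1 - s) = \<beta> / 2" using \<beta> s by (simp_all add: \<delta>_def field_simps)
  define bd where "bd n = (1 / \<alpha>) * (\<epsilon> n powr \<delta> * measure Mb (space Mb) + \<epsilon> n powr (- \<beta> / 2) * C)" for n
  have le: "norm (\<integral>y. norm (fst (vtrace (d n) y)) \<partial>Mb) \<le> bd n" for n
  proof -
    define J where "J = (\<integral>y. norm (K y *v fst (vtrace (d n) y)) powr s \<partial>Mb)"
    define \<eta> where "\<eta> = \<epsilon> n powr \<delta>"
    have \<eta>: "0 < \<eta>" using \<epsilon>_pos[of n] by (simp add: \<eta>_def)
    note g = trace_fst_sqi[OF sol_sqi(3)[of n]]
    have iJ: "integrable Mb (\<lambda>y. norm (K y *v fst (vtrace (d n) y)) powr s)"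
      using sqi_inner_integrable[OF trace_slip_sqi[OF sol_sqi(3)[of n]] K_sqi[OF g]] by (simp add: trace_slip_def slip_inner)
    \<comment> \<open>Below the level the first summand suffices. Above it, write t as t^(1 - s)
      times t^s and use that t^(1 - s) decreases.\<close>
    have split: "t \<le> \<eta> + \<eta> powr (1 - s) * t powr s" if "0 \<le> t" for t
    proof (cases "t \<le> \<eta>")
      case True then show ?thesis by (simp add: add_increasing2)
    next
      case False
      then have t: "0 < t" "\<eta> \<le> t" using \<eta> by simp_all
      have "t = t powr (1 - s) * t powr s" using t by (simp add: powr_add[symmetric])
      also have "\<dots> \<le> \<eta> powr (1 - s) * t powr s"
        by (intro mult_right_mono powr_mono2' powr_ge_zero t \<eta>) (use s in simp)
      finally show ?thesis using \<eta> by linarith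
    qed
    have "(\<integral>y. norm (fst (vtrace (d n) y)) \<partial>Mb)
        \<le> (\<integral>y. (1 / \<alpha>) * (\<eta> + \<eta> powr (1 - s) * norm (K y *v fst (vtrace (d n) y)) powr s) \<partial>Mb)"
    proof (rule integral_mono_AE)
      show "integrable Mb (\<lambda>y. norm (fst (vtrace (d n) y)))" by (rule integrable_norm[OF sqi_integrable[OF g]])
      show "integrable Mb (\<lambda>y. (1 / \<alpha>) * (\<eta> + \<eta> powr (1 - s) * norm (K y *v fst (vtrace (d n) y)) powr s))"
        by (intro integrable_mult_right Bochner_Integration.integrable_add iJ) simp
      show "AE y in Mb. norm (fst (vtrace (d n) y)) \<le> (1 / \<alpha>) * (\<eta> + \<eta> powr (1 - s) * norm (K y *v fst (vtrace (d n) y)) powr s)"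
      proof (rule AE_base)
        fix y assume "y \<in> \<omega>"
        from order_trans[OF K_lower[OF this] split[OF norm_ge_zero]]
        have "\<alpha> * norm (fst (vtrace (d n) y)) \<le> \<eta> + \<eta> powr (1 - s) * norm (K y *v fst (vtrace (d n) y)) powr s" .
        then show "norm (fst (vtrace (d n) y)) \<le> (1 / \<alpha>) * (\<eta> + \<eta> powr (1 - s) * norm (K y *v fst (vtrace (d n) y)) powr s)"
          using \<alpha>_pos by (simp add: pos_le_divide_eq mult.commute)
      qed
    qed
    also have "\<dots> = (1 / \<alpha>) * (\<eta> * measure Mb (space Mb) + \<eta> powr (1 - s) * J)"
      unfolding J_def by (simp add: Bochner_Integration.integral_add[OF integrable_const integrable_mult_right[OF iJ]])
    also have "\<dots> \<le> bd n"
    proof -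
      have e: "0 < \<epsilon> n powr \<beta>" using \<epsilon>_pos[of n] by simp
      have "\<eta> powr (1 - s) * J = \<epsilon> n powr (\<beta> / 2) * J" by (simp add: \<eta>_def powr_powr \<delta>(2))
      also have "\<dots> = \<epsilon> n powr (- \<beta> / 2) * (\<epsilon> n powr \<beta> * J)"
        unfolding mult.assoc[symmetric] powr_add[symmetric] by simp
      also have "\<dots> \<le> \<epsilon> n powr (- \<beta> / 2) * C" by (intro mult_left_mono powr_ge_zero C[of n, folded J_def])
      finally have "\<eta> powr (1 - s) * J \<le> \<epsilon> n powr (- \<beta> / 2) * C" .
      then show ?thesis unfolding bd_def \<eta>_def[symmetric] using \<alpha>_pos by (intro mult_left_mono add_left_mono) simp_all
    qed
    finally show ?thesis by simp
  qed
  have "bd \<longlonglongrightarrow> (1 / \<alpha>) * (0 * measure Mb (space Mb) + 0 * C)"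
    unfolding bd_def[abs_def] by (intro tendsto_mult_left tendsto_add tendsto_mult_right powr_eps_tendsto \<delta>) (use \<beta> in simp)
  then have "bd \<longlonglongrightarrow> 0" by simp
  then show ?thesis by (rule Lim_null_comparison[OF always_eventually[rule_format, OF le]])
qed

text \<open>The boundary pairings converge to those of \<open>vtrace dU\<close> by weak convergence
  and to 0 by the L^1 estimate. The latter concerns the tangential part only; the normal part of
  each trace already vanishes.\<close>

lemma no_slip_trace:
  assumes \<beta>: "\<beta> < 0" shows "trace_Gamma0 \<omega> (Dm 1) U dU (\<lambda>_. 0)"
  unfolding trace_Gamma0_def
proof (intro conjI allI impI, goal_cases)
  case 1
  show ?case unfolding L2_iff_sqi[OF sets_base] by (rule sqi_zero)
next
  case (2 \<psi>)
  interpret finite_measure Mb by (rule finite_Mb)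
  from 2 have t: "test_field 1 \<psi>" unfolding test_field_def .
  note \<psi> = test_fieldD(1,2)[OF t]
  note s\<psi> = bottom_sqi[OF \<psi>]
  obtain B where B0: "0 \<le> B" and B: "\<And>x. norm (\<psi> x) \<le> B" using C1fun_bounded[OF \<psi>] by blast
  have "(\<integral>y. \<psi> (y, 0) *\<^sub>R vtrace dU y \<partial>Mb) = 0"
  proof (rule euclidean_eqI)
    fix k :: pt
    have sk: "sqi Mb (\<lambda>y. \<psi> (y, 0) *\<^sub>R k)" by (rule sqi_scaleR_const[OF s\<psi>])
    have "(\<lambda>n. - (\<integral>z. d n z \<bullet> (\<psi> (fst z, 0) *\<^sub>R k) \<partial>M1)) \<longlonglongrightarrow> - (\<integral>z. dU z \<bullet> (\<psi> (fst z, 0) *\<^sub>R k) \<partial>M1)"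
      by (intro tendsto_minus weak_d sqi_fst_dom[OF sk] zero_less_one)
    then have "(\<lambda>n. \<integral>y. (\<psi> (y, 0) *\<^sub>R k) \<bullet> vtrace (d n) y \<partial>Mb) \<longlonglongrightarrow> (\<integral>y. (\<psi> (y, 0) *\<^sub>R k) \<bullet> vtrace dU y \<partial>Mb)"
      unfolding vtrace_inner[OF sol_sqi(3) sk] vtrace_inner[OF U_sqi(2) sk] by (simp add: inner_commute)
    moreover have "(\<lambda>n. \<integral>y. (\<psi> (y, 0) *\<^sub>R k) \<bullet> vtrace (d n) y \<partial>Mb) \<longlonglongrightarrow> 0"
    proof (rule Lim_null_comparison[OF always_eventually[rule_format]])
      fix n
      note g = trace_fst_sqi[OF sol_sqi(3)[of n]]
      have i: "integrable Mb (\<lambda>y. (\<psi> (y, 0) *\<^sub>R k) \<bullet> vtrace (d n) y)"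
        by (rule sqi_inner_integrable[OF sk vtrace_bound(1)[OF sol_sqi(3)]])
      have "norm (\<integral>y. (\<psi> (y, 0) *\<^sub>R k) \<bullet> vtrace (d n) y \<partial>Mb) \<le> (\<integral>y. norm ((\<psi> (y, 0) *\<^sub>R k) \<bullet> vtrace (d n) y) \<partial>Mb)"
        by (rule integral_norm_bound)
      also have "\<dots> \<le> (\<integral>y. (B * norm k) * norm (fst (vtrace (d n) y)) \<partial>Mb)"
      proof (rule integral_mono_AE[OF integrable_norm[OF i]])
        show "integrable Mb (\<lambda>y. (B * norm k) * norm (fst (vtrace (d n) y)))"
          by (intro integrable_mult_right integrable_norm sqi_integrable g)
        show "AE y in Mb. norm ((\<psi> (y, 0) *\<^sub>R k) \<bullet> vtrace (d n) y) \<le> (B * norm k) * norm (fst (vtrace (d n) y))"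
          using vtrace_snd_eq_0[OF sol[of n]]
        proof eventually_elim
          case (elim y)
          then have e: "norm (vtrace (d n) y) = norm (fst (vtrace (d n) y))" by (simp add: norm_prod_def)
          have 1: "norm ((\<psi> (y, 0) *\<^sub>R k) \<bullet> vtrace (d n) y) \<le> norm (\<psi> (y, 0) *\<^sub>R k) * norm (vtrace (d n) y)"
            unfolding real_norm_def by (rule Cauchy_Schwarz_ineq2)
          have 2: "norm (\<psi> (y, 0) *\<^sub>R k) * norm (vtrace (d n) y) \<le> (B * norm k) * norm (vtrace (d n) y)"
            unfolding norm_scaleR real_norm_def[symmetric] by (intro mult_right_mono B norm_ge_zero)
          show ?case using order_trans[OF 1 2] unfolding e .
        qed
      qed
      finally show "norm (\<integral>y. (\<psi> (y, 0) *\<^sub>R k) \<bullet> vtrace (d n) y \<partial>Mb) \<le> (B * norm k) * (\<integral>y. norm (fst (vtrace (d n) y)) \<partial>Mb)"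
        by (simp only: integral_mult_right_zero)
    qed (rule tendsto_mult_right_zero[OF trace_L1_null[OF \<beta>]])
    ultimately have "(\<integral>y. (\<psi> (y, 0) *\<^sub>R k) \<bullet> vtrace dU y \<partial>Mb) = 0" by (rule LIMSEQ_unique)
    then show "(\<integral>y. \<psi> (y, 0) *\<^sub>R vtrace dU y \<partial>Mb) \<bullet> k = 0 \<bullet> k"
      unfolding integral_scaleR_inner[OF s\<psi> vtrace_bound(1)[OF U_sqi(2)]] by (simp add: inner_commute)
  qed
  then show ?case
    using limit_trace 2 unfolding trace_Gamma0_def integral_lebesgue_on_eq[OF sets_base] by simp
qed

section \<open>Critical friction (\<beta> = 0): strong convergence of the traces\<close>

lemma vtrace_fst:
  fixes D :: "pt \<Rightarrow> pt"
  assumes D: "sqi M1 D" shows "AE y in Mb. vtrace (\<lambda>z. fst (D z)) y = fst (vtrace D y)"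
proof -
  interpret finite_measure M1 by (rule finite_Mdom) simp
  from Fubini_dom(1)[OF sqi_integrable[OF D]] show ?thesis
  proof eventually_elim
    case (elim y)
    show ?case unfolding vtrace_def using integral_bounded_linear[OF bounded_linear_fst elim] by simp
  qed
qed

lemma fst_sqi: "sqi M D \<Longrightarrow> sqi M (\<lambda>z. fst (D z))" for D :: "'z \<Rightarrow> pt"
  by (rule sqi_linear[OF _ bounded_linear_fst])

text \<open>Viscous plus friction work as a function of vertical derivatives alone: nonlinear and
  monotone in \<open>e\<close>, linear in \<open>D\<close>. The bottom trace is a fibre integral of
  \<open>D\<close>, so no field has to be attached to it.\<close>

definition stress_form :: "(pt \<Rightarrow> pt) \<Rightarrow> (pt \<Rightarrow> pt) \<Rightarrow> real" where
  "stress_form e D = \<nu> * (\<integral>z. fst (e z) \<bullet> fst (D z) \<partial>M1) + (\<integral>y. trace_slip e y \<bullet> (K y *v fst (vtrace D y)) \<partial>Mb)"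

text \<open>The field representing \<open>stress_form e\<close> as an inner product over the domain;
  the friction part is extended constantly along fibres, and its sign is that of
  \<open>vtrace\<close>.\<close>

definition stress :: "(pt \<Rightarrow> pt) \<Rightarrow> pt \<Rightarrow> pt" where
  "stress e z = (\<nu> *\<^sub>R fst (e z) - K (fst z) *v trace_slip e (fst z), 0)"

lemma stress_sqi: "sqi M1 e \<Longrightarrow> sqi M1 (stress e)"
  unfolding stress_def[abs_def]
  by (intro sqi_Pair sqi_zero sqi_diff sqi_scaleR fst_sqi sqi_fst_dom[of "\<lambda>y. K y *v trace_slip e y"] K_sqi trace_slip_sqi zero_less_one)

text \<open>Symmetry of \<open>K\<close> moves it onto the slip stress, and the adjoint of the trace
  moves the boundary integral into the domain.\<close>

lemma stress_form_eq:
  assumes e: "sqi M1 e" and D: "sqi M1 D" shows "stress_form e D = (\<integral>z. stress e z \<bullet> D z \<partial>M1)"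
proof -
  have sK: "sqi Mb (\<lambda>y. (K y *v trace_slip e y, 0::real))" by (intro sqi_Pair sqi_zero K_sqi trace_slip_sqi e)
  have i1: "integrable M1 (\<lambda>z. fst (e z) \<bullet> fst (D z))" by (intro sqi_inner_integrable fst_sqi e D)
  have i2: "integrable M1 (\<lambda>z. (K (fst z) *v trace_slip e (fst z), 0::real) \<bullet> D z)"
    by (rule sqi_inner_integrable[OF sqi_fst_dom[OF sK zero_less_one] D])
  have "(\<integral>y. trace_slip e y \<bullet> (K y *v fst (vtrace D y)) \<partial>Mb) = (\<integral>y. (K y *v trace_slip e y, 0) \<bullet> vtrace D y \<partial>Mb)"
    by (rule Bochner_Integration.integral_cong[OF refl])
       (use symmetric_matrix_inner[OF K_sym] in \<open>simp add: space_restrict_space inner_pair_fst\<close>)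
  also have "\<dots> = - (\<integral>z. (K (fst z) *v trace_slip e (fst z), 0) \<bullet> D z \<partial>M1)" by (rule vtrace_inner[OF D sK])
  finally have "stress_form e D = (\<integral>z. \<nu> * (fst (e z) \<bullet> fst (D z)) - (K (fst z) *v trace_slip e (fst z), 0) \<bullet> D z \<partial>M1)"
    unfolding stress_form_def by (simp add: Bochner_Integration.integral_diff[OF integrable_mult_right[OF i1] i2])
  also have "\<dots> = (\<integral>z. stress e z \<bullet> D z \<partial>M1)"
    by (rule Bochner_Integration.integral_cong[OF refl]) (simp add: stress_def inner_pair_fst inner_diff_left)
  finally show ?thesis .
qed

lemma stress_form_diff:
  assumes e: "sqi M1 e" and D: "sqi M1 D" "sqi M1 D'"
  shows "stress_form e (\<lambda>z. D z - D' z) = stress_form e D - stress_form e D'"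
  unfolding stress_form_eq[OF e D(1)] stress_form_eq[OF e D(2)] stress_form_eq[OF e sqi_diff[OF D]] inner_diff_right
  by (intro Bochner_Integration.integral_diff sqi_inner_integrable stress_sqi e D)

lemma stress_form_average:
  assumes e: "sqi M1 e" and D: "\<And>i. i \<in> J \<Longrightarrow> sqi M1 (D i)"
  shows "stress_form e (\<lambda>z. c *\<^sub>R (\<Sum>i\<in>J. D i z)) = c * (\<Sum>i\<in>J. stress_form e (D i))"
proof -
  have "stress_form e (\<lambda>z. c *\<^sub>R (\<Sum>i\<in>J. D i z)) = (\<integral>z. c * (\<Sum>i\<in>J. stress e z \<bullet> D i z) \<partial>M1)"
    by (subst stress_form_eq[OF e]) (simp_all add: sqi_scaleR sqi_sum D inner_sum_right)
  also have "\<dots> = c * (\<Sum>i\<in>J. \<integral>z. stress e z \<bullet> D i z \<partial>M1)"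
    by (subst integral_mult_right_zero, subst Bochner_Integration.integral_sum)
       (simp_all add: sqi_inner_integrable stress_sqi e D)
  also have "\<dots> = c * (\<Sum>i\<in>J. stress_form e (D i))"
    using stress_form_eq[OF e D] by simp
  finally show ?thesis .
qed

text \<open>The bound is uniform in \<open>n\<close>, which permits replacing \<open>D\<close> by a
  strongly close field before the limit in \<open>n\<close> is taken.\<close>

lemma stress_form_bound:
  "\<exists>B>0. \<forall>n D. sqi M1 D \<longrightarrow> \<bar>stress_form (d n) D\<bar> \<le> B * sqrt (\<integral>z. (norm (D z))\<^sup>2 \<partial>M1)"
proof -
  obtain C where C0: "0 \<le> C" and C: "\<And>n. (\<integral>z. (norm (d n z))\<^sup>2 \<partial>M1) \<le> C" using energy_bounds by blast
  obtain T where T0: "0 \<le> T" and T: "\<And>n. (\<integral>y. (norm (trace_slip (d n) y))\<^sup>2 \<partial>Mb) \<le> T" using trace_slip_bound by blast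
  define B where "B = \<nu> * sqrt C + sqrt T * sqrt (Mk\<^sup>2 * H) + 1"
  have fst_le: "(norm (fst x))\<^sup>2 \<le> (norm x)\<^sup>2" for x :: pt
    by (intro power_mono) (use norm_fst_le[of "fst x" "snd x"] in simp_all)
  have int_fst: "(\<integral>z. (norm (fst (X z)))\<^sup>2 \<partial>M) \<le> (\<integral>z. (norm (X z))\<^sup>2 \<partial>M)" if "sqi M X" for X :: "'z \<Rightarrow> pt" and M
    by (intro Bochner_Integration.integral_mono sqiD(2) fst_sqi that fst_le)
  have "\<bar>stress_form (d n) D\<bar> \<le> B * sqrt (\<integral>z. (norm (D z))\<^sup>2 \<partial>M1)" if D: "sqi M1 D" for n D
  proof -
    define N where "N = (\<integral>z. (norm (D z))\<^sup>2 \<partial>M1)"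
    have N0: "0 \<le> N" unfolding N_def by (rule Bochner_Integration.integral_nonneg) simp
    note g = vtrace_bound[OF D] trace_fst_sqi[OF D]
    have "\<bar>\<integral>z. fst (d n z) \<bullet> fst (D z) \<partial>M1\<bar> \<le> sqrt C * sqrt N"
      unfolding N_def by (rule sqi_inner_norm_bound[OF fst_sqi[OF sol_sqi(3)] fst_sqi[OF D] order_trans[OF int_fst[OF sol_sqi(3)] C] int_fst[OF D]])
    then have 1: "\<bar>\<nu> * (\<integral>z. fst (d n z) \<bullet> fst (D z) \<partial>M1)\<bar> \<le> \<nu> * (sqrt C * sqrt N)"
      using nu_pos by (simp add: abs_mult)
    have "(\<integral>y. (norm (K y *v fst (vtrace D y)))\<^sup>2 \<partial>Mb) \<le> (\<integral>y. Mk\<^sup>2 * (norm (fst (vtrace D y)))\<^sup>2 \<partial>Mb)"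
    proof (rule integral_mono_AE[OF sqiD(2)[OF K_sqi[OF g(3)]] integrable_mult_right[OF sqiD(2)[OF g(3)]] AE_base])
      fix y assume "y \<in> \<omega>"
      then show "(norm (K y *v fst (vtrace D y)))\<^sup>2 \<le> Mk\<^sup>2 * (norm (fst (vtrace D y)))\<^sup>2"
        unfolding power_mult_distrib[symmetric] by (intro power_mono K_bound) simp_all
    qed
    also have "\<dots> \<le> Mk\<^sup>2 * (H * N)" unfolding integral_mult_right_zero N_def
      by (intro mult_left_mono order_trans[OF int_fst[OF g(1)] g(2)]) simp
    finally have 2: "\<bar>\<integral>y. trace_slip (d n) y \<bullet> (K y *v fst (vtrace D y)) \<partial>Mb\<bar> \<le> sqrt T * sqrt (Mk\<^sup>2 * (H * N))"
      by (intro sqi_inner_norm_bound trace_slip_sqi sol_sqi K_sqi g(3) T)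
    have "\<bar>stress_form (d n) D\<bar> \<le> \<nu> * (sqrt C * sqrt N) + sqrt T * sqrt (Mk\<^sup>2 * (H * N))"
      unfolding stress_form_def by (rule order_trans[OF abs_triangle_ineq add_mono[OF 1 2]])
    also have "\<dots> \<le> B * sqrt N" unfolding B_def using N0 by (simp add: real_sqrt_mult algebra_simps)
    finally show ?thesis unfolding N_def .
  qed
  moreover have "0 < B" unfolding B_def using nu_pos C0 T0 H_nonneg by (intro add_nonneg_pos add_nonneg_nonneg mult_nonneg_nonneg) simp_all
  ultimately show ?thesis by blast
qed

text \<open>The limit pressure is constant along each fibre, so the fibre integral reduces to the
  endpoint values of the third component: zero above by support, zero below by tangency.\<close>

lemma pressure_annihilates_pd_e3:
  assumes \<phi>: "test_field 1 \<phi>" "bottom_tangential \<phi>"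
  shows "(\<integral>z. pd \<phi> e3 z \<bullet> (P (fst z) *\<^sub>R e3) \<partial>M1) = 0"
proof -
  note C = test_fieldD(1,2)[OF \<phi>(1)]
  have G: "test_field 1 (\<lambda>z. snd (\<phi> z))" by (rule test_field_linear[OF \<phi>(1) bounded_linear_snd])
  have pdG: "pd (\<lambda>z. snd (\<phi> z)) e3 z = snd (pd \<phi> e3 z)" for z by (rule C1fun_linear_compose(2)[OF C(1) bounded_linear_snd])
  have "integrable M1 (\<lambda>z. pd \<phi> e3 z \<bullet> (P (fst z) *\<^sub>R e3))"
    by (rule sqi_inner_integrable[OF C1_sqi_Mdom_pd[OF zero_less_one C] sqi_scaleR_const[OF P]])
  from Fubini_dom(3)[OF this]
  have "(\<integral>z. pd \<phi> e3 z \<bullet> (P (fst z) *\<^sub>R e3) \<partial>M1)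
      = (\<integral>y. \<integral>t. pd \<phi> e3 (y, t) \<bullet> (P (fst (y, t)) *\<^sub>R e3) \<partial>lebesgue_on {0<..<1 * h y} \<partial>Mb)" ..
  also have "\<dots> = (\<integral>y. 0 \<partial>Mb)"
  proof (rule Bochner_Integration.integral_cong[OF refl])
    fix y assume "y \<in> space Mb"
    then have y: "y \<in> \<omega>" by (simp add: space_restrict_space)
    have "(\<integral>t. pd \<phi> e3 (y, t) \<bullet> (P (fst (y, t)) *\<^sub>R e3) \<partial>lebesgue_on {0<..<1 * h y})
        = (\<integral>t. P y * pd (\<lambda>z. snd (\<phi> z)) e3 (y, t) \<partial>lebesgue_on {0<..<1 * h y})"
      by (rule Bochner_Integration.integral_cong[OF refl]) (simp add: pdG inner_e3)
    also have "\<dots> = P y * - snd (\<phi> (y, 0))" unfolding integral_mult_right_zero vertical_integral[OF G zero_less_one y] ..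
    also have "\<dots> = 0" using \<phi>(2) y by (simp add: bottom_tangential_def)
    finally show "(\<integral>t. pd \<phi> e3 (y, t) \<bullet> (P (fst (y, t)) *\<^sub>R e3) \<partial>lebesgue_on {0<..<1 * h y}) = 0" .
  qed
  finally show ?thesis by simp
qed

text \<open>For a solution the horizontal divergence is -1/\<epsilon> times the vertical derivative
  of the third component, and the latter is orthogonal to the limit pressure. So the pressure
  contribution of the approximants fades, although it need not vanish for any one of them.\<close>

lemma pressure_div_tendsto:
  assumes t: "\<And>k. test_field 1 (\<phi> k)" "\<And>k. bottom_tangential (\<phi> k)"
    and lim: "(\<lambda>k. \<integral>z. approx_error (w m) (E m) (d m) (\<phi> k) z \<partial>M1) \<longlonglongrightarrow> 0"
  shows "(\<lambda>k. \<integral>z. P (fst z) * div2 (\<lambda>z. fst (\<phi> k z)) z \<partial>M1) \<longlonglongrightarrow> 0"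
proof -
  note C = test_fieldD(1,2)[OF t(1)]
  have s\<phi>: "sqi M1 (pd (\<phi> k) v)" for k v by (rule C1_sqi_Mdom_pd[OF zero_less_one C])
  have sP: "sqi M1 (\<lambda>z. P (fst z) *\<^sub>R b)" for b :: pt by (rule sqi_scaleR_const[OF P])
  note at = approx_error_tendsto[OF sol_sqi(1) sol_sqi(2) sol_sqi(3) t(1) lim]
  have pdf: "pd (\<lambda>z. fst (\<phi> k z)) v z = fst (pd (\<phi> k) v z)" for k v z by (rule C1fun_linear_compose(2)[OF C(1) bounded_linear_fst])
  have "div2 (\<lambda>z. fst (\<phi> k z)) z = (\<Sum>b\<in>hor. pd (\<phi> k) b z \<bullet> b)" for k z
    unfolding div2_def sum_hor pdf by (intro sum.cong[OF refl]) (simp add: inner_prod_def)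
  then have eq: "(\<integral>z. P (fst z) * div2 (\<lambda>z. fst (\<phi> k z)) z \<partial>M1) = (\<Sum>b\<in>hor. \<integral>z. pd (\<phi> k) b z \<bullet> (P (fst z) *\<^sub>R b) \<partial>M1)" for k
    by (subst Bochner_Integration.integral_sum[symmetric]) (simp_all add: sum_distrib_left sqi_mult_integrable[OF P sqi_inner_right[OF s\<phi>]])
  have "(\<lambda>k. \<integral>z. pd (\<phi> k) e3 z \<bullet> (P (fst z) *\<^sub>R e3) \<partial>M1) \<longlonglongrightarrow> (\<integral>z. d m z \<bullet> (P (fst z) *\<^sub>R e3) \<partial>M1)"
    by (rule sqi_inner_tendsto[OF s\<phi> sol_sqi(3) sP at(2)])
  then have "(\<integral>z. d m z \<bullet> (P (fst z) *\<^sub>R e3) \<partial>M1) = 0"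
    unfolding pressure_annihilates_pd_e3[OF t] by (simp add: LIMSEQ_const_iff)
  with divergence_tested[OF sol P, of m] have "(\<Sum>b\<in>hor. \<integral>z. E m b z \<bullet> (P (fst z) *\<^sub>R b) \<partial>M1) = 0" by simp
  moreover have "(\<lambda>k. \<Sum>b\<in>hor. \<integral>z. pd (\<phi> k) b z \<bullet> (P (fst z) *\<^sub>R b) \<partial>M1) \<longlonglongrightarrow> (\<Sum>b\<in>hor. \<integral>z. E m b z \<bullet> (P (fst z) *\<^sub>R b) \<partial>M1)"
    by (intro tendsto_sum sqi_inner_tendsto s\<phi> sol_sqi(2) sP at(3))
  ultimately show ?thesis unfolding eq by simp
qed

lemma eps_powr_0: "\<beta> = 0 \<Longrightarrow> \<epsilon> n powr \<beta> = 1" using \<epsilon>_pos[of n] by simp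

lemma stress_form_test:
  assumes \<beta>: "\<beta> = 0" and \<phi>: "test_field 1 \<phi>"
  shows "(\<lambda>n. stress_form (d n) (pd \<phi> e3)) \<longlonglongrightarrow> (\<integral>z. (f (fst z), 0) \<bullet> \<phi> z \<partial>M1) + (\<integral>z. P (fst z) * div2 (\<lambda>z. fst (\<phi> z)) z \<partial>M1)"
proof -
  note C = test_fieldD(1,2)[OF \<phi>]
  have t: "test_field 1 (\<lambda>z. fst (\<phi> z))" by (rule test_field_linear[OF \<phi> bounded_linear_fst])
  have pdf: "pd (\<lambda>z. fst (\<phi> z)) v z = fst (pd \<phi> v z)" for v z by (rule C1fun_linear_compose(2)[OF C(1) bounded_linear_fst])
  have sX: "sqi M1 (\<lambda>z. (fst (pd \<phi> e3 z), 0::real))" by (intro sqi_Pair sqi_zero fst_sqi C1_sqi_Mdom_pd zero_less_one C)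
  have fr: "friction n (\<lambda>z. fst (\<phi> z)) = (\<integral>y. trace_slip (d n) y \<bullet> (K y *v fst (vtrace (pd \<phi> e3) y)) \<partial>Mb)" for n
    unfolding friction_def
    by (rule Bochner_Integration.integral_cong[OF refl]) (simp add: vtrace_pd[OF \<phi>] space_restrict_space)
  have "(\<lambda>n. \<integral>z. d n z \<bullet> (fst (pd \<phi> e3 z), 0) \<partial>M1) \<longlonglongrightarrow> (\<integral>z. dU z \<bullet> (fst (pd \<phi> e3 z), 0) \<partial>M1)" by (rule weak_d[OF sX])
  moreover have "D \<bullet> (x, 0) = fst D \<bullet> x" for D :: pt and x by (simp add: inner_prod_def)
  ultimately have "(\<lambda>n. \<integral>z. fst (d n z) \<bullet> fst (pd \<phi> e3 z) \<partial>M1) \<longlonglongrightarrow> (\<integral>z. fst (dU z) \<bullet> fst (pd \<phi> e3 z) \<partial>M1)" by simp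
  from tendsto_add[OF tendsto_mult_left[OF this, of \<nu>] friction_tendsto[OF t]]
  show ?thesis unfolding stress_form_def eps_powr_0[OF \<beta>] fr residual_def pdf inner_pair_fst mult_1_left by (simp add: algebra_simps)
qed

text \<open>Here \<open>m\<close> is fixed and \<open>n\<close> tends to infinity. The equation
  gives the limit for each test field; the uniform bound carries it to \<open>d m\<close>, and the
  pressure term disappears in the approximation.\<close>

lemma stress_form_solution:
  assumes \<beta>: "\<beta> = 0" shows "(\<lambda>n. stress_form (d n) (d m)) \<longlonglongrightarrow> (\<integral>z. (f (fst z), 0) \<bullet> w m z \<partial>M1)"
proof (rule tendsto_approximation)
  fix \<eta> :: real assume \<eta>: "0 < \<eta>"
  obtain B where B: "0 < B" and bd: "\<And>n D. sqi M1 D \<Longrightarrow> \<bar>stress_form (d n) D\<bar> \<le> B * sqrt (\<integral>z. (norm (D z))\<^sup>2 \<partial>M1)"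
    using stress_form_bound by blast
  obtain \<phi> where \<phi>: "\<forall>k. test_field 1 (\<phi> k) \<and> bottom_tangential (\<phi> k)"
    and lim: "(\<lambda>k. \<integral>z. approx_error (w m) (E m) (d m) (\<phi> k) z \<partial>M1) \<longlonglongrightarrow> 0"
    using sol[of m] unfolding scaled_solution_def by blast
  have t: "test_field 1 (\<phi> k)" "bottom_tangential (\<phi> k)" for k using \<phi> by auto
  note C = test_fieldD(1,2)[OF t(1)]
  note at = approx_error_tendsto[OF sol_sqi(1) sol_sqi(2) sol_sqi(3) t(1) lim]
  have s\<phi>: "sqi M1 (\<phi> k)" "sqi M1 (pd (\<phi> k) e3)" for k by (intro C1_sqi_Mdom C1_sqi_Mdom_pd C zero_less_one)+
  define c where "c k = (\<integral>z. (f (fst z), 0) \<bullet> \<phi> k z \<partial>M1) + (\<integral>z. P (fst z) * div2 (\<lambda>z. fst (\<phi> k z)) z \<partial>M1)" for k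
  have "(\<lambda>k. \<integral>z. \<phi> k z \<bullet> (f (fst z), 0) \<partial>M1) \<longlonglongrightarrow> (\<integral>z. w m z \<bullet> (f (fst z), 0) \<partial>M1)"
    by (rule sqi_inner_tendsto[OF s\<phi>(1) sol_sqi(1) f_sqi_dom at(1)])
  from tendsto_add[OF this[unfolded inner_commute[of _ "(f _, 0)"]] pressure_div_tendsto[OF t lim]]
  have "c \<longlonglongrightarrow> (\<integral>z. (f (fst z), 0) \<bullet> w m z \<partial>M1)" unfolding c_def[abs_def] by simp
  moreover have "(\<lambda>k. B * sqrt (\<integral>z. (norm (pd (\<phi> k) e3 z - d m z))\<^sup>2 \<partial>M1)) \<longlonglongrightarrow> B * sqrt 0"
    by (intro tendsto_mult_left tendsto_real_sqrt at(2))
  ultimately have "\<forall>\<^sub>F k in sequentially. \<bar>c k - (\<integral>z. (f (fst z), 0) \<bullet> w m z \<partial>M1)\<bar> < \<eta>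
      \<and> \<bar>B * sqrt (\<integral>z. (norm (pd (\<phi> k) e3 z - d m z))\<^sup>2 \<partial>M1) - B * sqrt 0\<bar> < \<eta>"
    unfolding tendsto_iff dist_real_def using \<eta> eventually_conj by blast
  then obtain k where k: "\<bar>c k - (\<integral>z. (f (fst z), 0) \<bullet> w m z \<partial>M1)\<bar> < \<eta>"
    "\<bar>B * sqrt (\<integral>z. (norm (pd (\<phi> k) e3 z - d m z))\<^sup>2 \<partial>M1) - B * sqrt 0\<bar> < \<eta>"
    using eventually_happens by fastforce
  have "\<bar>stress_form (d n) (d m) - stress_form (d n) (pd (\<phi> k) e3)\<bar> \<le> \<eta>" for n
  proof -
    have "\<bar>stress_form (d n) (\<lambda>z. pd (\<phi> k) e3 z - d m z)\<bar> \<le> \<eta>"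
      by (rule order_trans[OF bd[OF sqi_diff[OF s\<phi>(2) sol_sqi(3)]]]) (use k(2) in simp)
    then show ?thesis unfolding stress_form_diff[OF sol_sqi(3) s\<phi>(2) sol_sqi(3)] by linarith
  qed
  moreover have "(\<lambda>n. stress_form (d n) (pd (\<phi> k) e3)) \<longlonglongrightarrow> c k" unfolding c_def by (rule stress_form_test[OF \<beta> t(1)])
  moreover have "\<bar>(\<integral>z. (f (fst z), 0) \<bullet> w m z \<partial>M1) - c k\<bar> \<le> \<eta>" using k(1) by linarith
  ultimately show "\<exists>b c. b \<longlonglongrightarrow> c \<and> (\<forall>n. \<bar>stress_form (d n) (d m) - b n\<bar> \<le> \<eta>) \<and> \<bar>(\<integral>z. (f (fst z), 0) \<bullet> w m z \<partial>M1) - c\<bar> \<le> \<eta>"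
    by blast
qed

text \<open>The limit pressure term vanishes on \<open>d m\<close> but a priori not on \<open>dU\<close>; approximating \<open>dU\<close> strongly by
  averages of the \<open>d m\<close> transfers the limit.\<close>

lemma weak_averages_ex:
  assumes "infinite I" "0 < \<eta>"
  shows "\<exists>J. finite J \<and> J \<noteq> {} \<and> J \<subseteq> I \<and> (\<integral>z. (norm ((1 / real (card J)) *\<^sub>R (\<Sum>i\<in>J. d i z) - dU z))\<^sup>2 \<partial>M1) < \<eta>"
proof -
  obtain C where C: "\<And>n. (\<integral>z. (norm (d n z))\<^sup>2 \<partial>M1) \<le> C" using energy_bounds by blast
  show ?thesis
    by (rule sqi_weak_averages[OF sol_sqi(3) U_sqi(2) C weak_d[OF sol_sqi(3)] weak_d[OF U_sqi(2)] assms]) (intro exI conjI)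
qed

lemma stress_form_limit:
  assumes \<beta>: "\<beta> = 0" shows "(\<lambda>n. stress_form (d n) dU) \<longlonglongrightarrow> (\<integral>z. (f (fst z), 0) \<bullet> U z \<partial>M1)"
proof (rule tendsto_approximation)
  fix \<eta> :: real assume \<eta>: "0 < \<eta>"
  let ?L = "\<integral>z. (f (fst z), 0) \<bullet> U z \<partial>M1"
  define l where "l m = (\<integral>z. (f (fst z), 0) \<bullet> w m z \<partial>M1)" for m
  obtain B where B: "0 < B" and bd: "\<And>n D. sqi M1 D \<Longrightarrow> \<bar>stress_form (d n) D\<bar> \<le> B * sqrt (\<integral>z. (norm (D z))\<^sup>2 \<partial>M1)"
    using stress_form_bound by blast
  \<comment> \<open>Averaging only indices beyond \<open>N\<close> makes the averaged work of the
    force close to its limit, independently of which indices the averaging lemma picks.\<close>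
  obtain N where N: "\<And>m. N \<le> m \<Longrightarrow> \<bar>l m - ?L\<bar> < \<eta>"
    using force_tendsto \<eta> unfolding LIMSEQ_def dist_real_def l_def by blast
  have "infinite {N..}" "0 < (\<eta> / B)\<^sup>2" using \<eta> B by (simp_all add: infinite_Ici)
  from weak_averages_ex[OF this] obtain J where J: "finite J" "J \<noteq> {}" "J \<subseteq> {N..}"
    and close: "(\<integral>z. (norm ((1 / real (card J)) *\<^sub>R (\<Sum>i\<in>J. d i z) - dU z))\<^sup>2 \<partial>M1) < (\<eta> / B)\<^sup>2" by blast
  define D where "D z = (1 / real (card J)) *\<^sub>R (\<Sum>i\<in>J. d i z)" for z
  define c where "c = (1 / real (card J)) * (\<Sum>i\<in>J. l i)"
  have card: "0 < real (card J)" using J by (simp add: card_gt_0_iff)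
  have sD: "sqi M1 D" unfolding D_def[abs_def] by (intro sqi_scaleR sqi_sum sol_sqi)
  have eq: "stress_form (d n) D = (1 / real (card J)) * (\<Sum>i\<in>J. stress_form (d n) (d i))" for n
    unfolding D_def[abs_def] by (rule stress_form_average[OF sol_sqi(3) sol_sqi(3)])
  have "(\<lambda>n. stress_form (d n) D) \<longlonglongrightarrow> c"
    unfolding eq c_def l_def by (intro tendsto_mult_left tendsto_sum stress_form_solution \<beta>)
  moreover have "\<bar>stress_form (d n) dU - stress_form (d n) D\<bar> \<le> \<eta>" for n
  proof -
    have "\<bar>stress_form (d n) (\<lambda>z. D z - dU z)\<bar> \<le> B * sqrt (\<integral>z. (norm (D z - dU z))\<^sup>2 \<partial>M1)" by (rule bd[OF sqi_diff[OF sD U_sqi(2)]])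
    also have "\<dots> \<le> B * sqrt ((\<eta> / B)\<^sup>2)"
      using close B unfolding D_def[symmetric] by (intro mult_left_mono real_sqrt_le_mono) simp_all
    also have "\<dots> = \<eta>" using B \<eta> by simp
    finally show ?thesis unfolding stress_form_diff[OF sol_sqi(3) sD U_sqi(2)] by linarith
  qed
  moreover have "\<bar>?L - c\<bar> \<le> \<eta>"
  proof -
    have "c - ?L = (1 / real (card J)) * (\<Sum>i\<in>J. l i - ?L)"
      unfolding c_def sum_subtractf using card by (simp add: field_simps)
    also have "\<bar>\<dots>\<bar> \<le> (1 / real (card J)) * (\<Sum>i\<in>J. \<eta>)"
      unfolding abs_mult using card J(3) N by (intro mult_mono order_trans[OF sum_abs] sum_mono) (auto intro: less_imp_le)
    also have "\<dots> = \<eta>" using card by simp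
    finally show ?thesis by linarith
  qed
  ultimately show "\<exists>b c. b \<longlonglongrightarrow> c \<and> (\<forall>n. \<bar>stress_form (d n) dU - b n\<bar> \<le> \<eta>) \<and> \<bar>?L - c\<bar> \<le> \<eta>" by blast
qed

text \<open>Monotonicity bounds \<nu> times the squared distance by the difference of
  \<open>stress_form (d n)\<close> and \<open>stress_form dU\<close> on \<open>d n - dU\<close>.
  Three of the four resulting terms have known limits, and the energy identity bounds the fourth
  from above by the work of the force.\<close>

lemma horizontal_strong_convergence:
  assumes \<beta>: "\<beta> = 0" shows "(\<lambda>n. \<integral>z. (norm (fst (d n z) - fst (dU z)))\<^sup>2 \<partial>M1) \<longlonglongrightarrow> 0"
proof -
  let ?I = "\<lambda>n. \<integral>z. (norm (fst (d n z) - fst (dU z)))\<^sup>2 \<partial>M1"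
  let ?l = "\<lambda>n. \<integral>z. (f (fst z), 0) \<bullet> w n z \<partial>M1"
  let ?R = "\<lambda>n. ((?l n - stress_form (d n) dU) - (stress_form dU (d n) - stress_form dU dU)) / \<nu>"
  have le: "norm (?I n) \<le> ?R n" for n
  proof -
    have sd: "sqi M1 (\<lambda>z. d n z - dU z)" by (rule sqi_diff[OF sol_sqi(3) U_sqi(2)])
    note sf = fst_sqi[OF sol_sqi(3)[of n]] fst_sqi[OF U_sqi(2)]
    \<comment> \<open>Dropping the horizontal gradients and the third component turns the energy
      identity into an inequality, in the direction that is required.\<close>
    have energy: "stress_form (d n) (d n) \<le> ?l n"
    proof -
      have "(\<integral>z. fst (d n z) \<bullet> fst (d n z) \<partial>M1) \<le> (\<integral>z. (norm (d n z))\<^sup>2 \<partial>M1)"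
      proof (rule Bochner_Integration.integral_mono[OF sqi_inner_integrable[OF sf(1) sf(1)] sqiD(2)[OF sol_sqi(3)]])
        fix z show "fst (d n z) \<bullet> fst (d n z) \<le> (norm (d n z))\<^sup>2"
          by (simp add: power2_norm_eq_inner inner_prod_def)
      qed
      moreover have "0 \<le> (\<epsilon> n)\<^sup>2 * (\<Sum>b\<in>hor. \<integral>z. (norm (E n b z))\<^sup>2 \<partial>M1)"
        by (intro mult_nonneg_nonneg sum_nonneg Bochner_Integration.integral_nonneg zero_le_power2)
      ultimately have "\<nu> * (\<integral>z. fst (d n z) \<bullet> fst (d n z) \<partial>M1)
          \<le> \<nu> * ((\<epsilon> n)\<^sup>2 * (\<Sum>b\<in>hor. \<integral>z. (norm (E n b z))\<^sup>2 \<partial>M1) + (\<integral>z. (norm (d n z))\<^sup>2 \<partial>M1))"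
        using nu_pos by (intro mult_left_mono) linarith+
      then show ?thesis
        using energy_identity[OF sol \<epsilon>_pos, of n] unfolding stress_form_def eps_powr_0[OF \<beta>] mult_1_left by linarith
    qed
    have nI: "?I n = (\<integral>z. fst (d n z) \<bullet> (fst (d n z) - fst (dU z)) \<partial>M1) - (\<integral>z. fst (dU z) \<bullet> (fst (d n z) - fst (dU z)) \<partial>M1)"
      by (subst Bochner_Integration.integral_diff[symmetric])
         (simp_all add: sqi_inner_integrable sf sqi_diff power2_norm_eq_inner inner_diff_left)
    define G where "G y = K y *v fst (vtrace (\<lambda>z. d n z - dU z) y)" for y
    have sG: "sqi Mb G" unfolding G_def[abs_def] by (rule K_sqi[OF trace_fst_sqi[OF sd]])
    have "0 \<le> (\<integral>y. (trace_slip (d n) y - trace_slip dU y) \<bullet> G y \<partial>Mb)"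
    proof (rule integral_nonneg_AE)
      show "AE y in Mb. 0 \<le> (trace_slip (d n) y - trace_slip dU y) \<bullet> G y"
        using vtrace_diff[OF sol_sqi(3)[of n] U_sqi(2)]
      proof eventually_elim
        case (elim y)
        show ?case unfolding G_def elim trace_slip_def fst_diff matrix_vector_mult_diff_distrib by (rule slip_monotone[OF s(1)])
      qed
    qed
    also have "\<dots> = (\<integral>y. trace_slip (d n) y \<bullet> G y \<partial>Mb) - (\<integral>y. trace_slip dU y \<bullet> G y \<partial>Mb)"
      unfolding inner_diff_left
      by (intro Bochner_Integration.integral_diff sqi_inner_integrable trace_slip_sqi sol_sqi U_sqi sG)
    finally have mono: "0 \<le> (\<integral>y. trace_slip (d n) y \<bullet> G y \<partial>Mb) - (\<integral>y. trace_slip dU y \<bullet> G y \<partial>Mb)" .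
    have "\<nu> * ?I n \<le> stress_form (d n) (\<lambda>z. d n z - dU z) - stress_form dU (\<lambda>z. d n z - dU z)"
      using mono unfolding stress_form_def G_def nI fst_diff right_diff_distrib by linarith
    also have "\<dots> = (stress_form (d n) (d n) - stress_form (d n) dU) - (stress_form dU (d n) - stress_form dU dU)"
      unfolding stress_form_diff[OF sol_sqi(3) sol_sqi(3) U_sqi(2)] stress_form_diff[OF U_sqi(2) sol_sqi(3) U_sqi(2)] ..
    also have "\<dots> \<le> (?l n - stress_form (d n) dU) - (stress_form dU (d n) - stress_form dU dU)" using energy by linarith
    finally have "?I n \<le> ?R n" using nu_pos by (simp add: pos_le_divide_eq mult.commute)
    moreover have "0 \<le> ?I n" by (rule Bochner_Integration.integral_nonneg) simp
    ultimately show ?thesis by simp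
  qed
  \<comment> \<open>The nonlinear argument is frozen at \<open>dU\<close>, so weak convergence is
    enough for this term.\<close>
  have "(\<lambda>n. \<integral>z. d n z \<bullet> stress dU z \<partial>M1) \<longlonglongrightarrow> (\<integral>z. dU z \<bullet> stress dU z \<partial>M1)" by (rule weak_d[OF stress_sqi[OF U_sqi(2)]])
  then have sU: "(\<lambda>n. stress_form dU (d n)) \<longlonglongrightarrow> stress_form dU dU"
    unfolding stress_form_eq[OF U_sqi(2) sol_sqi(3)] stress_form_eq[OF U_sqi(2) U_sqi(2)] by (simp add: inner_commute)
  have "?R \<longlonglongrightarrow> (((\<integral>z. (f (fst z), 0) \<bullet> U z \<partial>M1) - (\<integral>z. (f (fst z), 0) \<bullet> U z \<partial>M1)) - (stress_form dU dU - stress_form dU dU)) / \<nu>"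
    by (intro tendsto_divide tendsto_diff force_tendsto stress_form_limit[OF \<beta>] sU tendsto_const) (use nu_pos in simp)
  then have "?R \<longlonglongrightarrow> 0" by simp
  then show ?thesis by (rule Lim_null_comparison[OF always_eventually[rule_format, OF le]])
qed

lemma trace_strong_convergence:
  assumes \<beta>: "\<beta> = 0" shows "(\<lambda>n. \<integral>y. (norm (fst (vtrace (d n) y) - fst (vtrace dU y)))\<^sup>2 \<partial>Mb) \<longlonglongrightarrow> 0"
proof (rule Lim_null_comparison[OF always_eventually[rule_format]])
  fix n
  have sd: "sqi M1 (\<lambda>z. d n z - dU z)" by (rule sqi_diff[OF sol_sqi(3) U_sqi(2)])
  have sf: "sqi M1 (\<lambda>z. fst (d n z - dU z))" by (rule fst_sqi[OF sd])
  have ae: "AE y in Mb. (norm (fst (vtrace (d n) y) - fst (vtrace dU y)))\<^sup>2 = (norm (vtrace (\<lambda>z. fst (d n z - dU z)) y))\<^sup>2"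
    using vtrace_diff[OF sol_sqi(3)[of n] U_sqi(2)] vtrace_fst[OF sd]
    by eventually_elim simp
  have "(\<integral>y. (norm (fst (vtrace (d n) y) - fst (vtrace dU y)))\<^sup>2 \<partial>Mb) = (\<integral>y. (norm (vtrace (\<lambda>z. fst (d n z - dU z)) y))\<^sup>2 \<partial>Mb)"
    by (rule integral_cong_AE[OF _ _ ae])
       (intro borel_measurable_integrable sqiD(2) sqi_diff trace_fst_sqi sol_sqi U_sqi vtrace_bound(1)[OF sf])+
  also have "\<dots> \<le> H * (\<integral>z. (norm (fst (d n z - dU z)))\<^sup>2 \<partial>M1)" by (rule vtrace_bound(2)[OF sf])
  finally show "norm (\<integral>y. (norm (fst (vtrace (d n) y) - fst (vtrace dU y)))\<^sup>2 \<partial>Mb) \<le> H * (\<integral>z. (norm (fst (d n z) - fst (dU z)))\<^sup>2 \<partial>M1)"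
    by simp
qed (rule tendsto_mult_right_zero[OF horizontal_strong_convergence[OF \<beta>]])

text \<open>Pointwise convergence of the traces is obtained only along a subsequence. That suffices:
  the whole friction sequence is already known to converge to the residual.\<close>

lemma power_law_slip:
  assumes \<beta>: "\<beta> = 0" and \<phi>: "test_field 1 \<phi>"
  shows "residual \<phi> = (\<integral>y. slip s (K y) (fst (vtrace dU y)) \<bullet> (K y *v \<phi> (y, 0)) \<partial>Mb)"
proof -
  interpret finite_measure Mb by (rule finite_Mb)
  let ?g = "\<lambda>n y. fst (vtrace (d n) y)" and ?G = "\<lambda>y. fst (vtrace dU y)"
  note sg = trace_fst_sqi[OF sol_sqi(3)] and sG = trace_fst_sqi[OF U_sqi(2)]
  have "\<exists>r Q. strict_mono (r :: nat \<Rightarrow> nat) \<and> integrable Mb Q \<and> (\<forall>y. 0 \<le> Q y) \<and>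
      (\<forall>k. AE y in Mb. (norm (?g (r k) y - ?G y))\<^sup>2 \<le> Q y) \<and> (AE y in Mb. (\<lambda>k. (norm (?g (r k) y - ?G y))\<^sup>2) \<longlonglongrightarrow> 0)"
    by (rule L1_null_dominated_ex[OF sqiD(2)[OF sqi_diff[OF sg sG]] zero_le_power2 trace_strong_convergence[OF \<beta>]])
  then obtain r Q where r: "strict_mono (r :: nat \<Rightarrow> nat)" and Q: "integrable Mb Q" "\<forall>y. 0 \<le> Q y"
    and dom: "\<forall>k. AE y in Mb. (norm (?g (r k) y - ?G y))\<^sup>2 \<le> Q y"
    and conv: "AE y in Mb. (\<lambda>k. (norm (?g (r k) y - ?G y))\<^sup>2) \<longlonglongrightarrow> 0" by blast
  have sK: "sqi Mb (\<lambda>y. K y *v \<phi> (y, 0))" by (rule K_sqi[OF bottom_sqi[OF test_fieldD(1,2)[OF \<phi>]]])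
  define R where "R y = 1 + Mk * (norm (?G y) + sqrt (Q y))" for y
  have sqQ: "sqi Mb (\<lambda>y. sqrt (Q y))" by (rule sqi_sqrt[OF Q(1)]) (use Q(2) in blast)
  have sR: "sqi Mb R"
  proof -
    have "sqi Mb (\<lambda>y. Mk *\<^sub>R (norm (?G y) + sqrt (Q y)))" by (intro sqi_scaleR sqi_add sqi_norm sG sqQ)
    moreover have "sqi Mb (\<lambda>y. 1 :: real)" by (rule sqi_bounded[where C=1]) simp_all
    ultimately show ?thesis unfolding R_def[abs_def] using sqi_add by fastforce
  qed
  have "(\<lambda>k. \<integral>y. (K y *v \<phi> (y, 0)) \<bullet> trace_slip (d (r k)) y \<partial>Mb) \<longlonglongrightarrow> (\<integral>y. (K y *v \<phi> (y, 0)) \<bullet> trace_slip dU y \<partial>Mb)"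
  proof (rule sqi_dominated_convergence[OF sK sR])
    show "trace_slip (d (r k)) \<in> borel_measurable Mb" for k by (rule sqiD(1)[OF trace_slip_sqi[OF sol_sqi(3)]])
    show "trace_slip dU \<in> borel_measurable Mb" by (rule sqiD(1)[OF trace_slip_sqi[OF U_sqi(2)]])
    show "AE y in Mb. (\<lambda>k. trace_slip (d (r k)) y) \<longlonglongrightarrow> trace_slip dU y"
      using conv
    proof eventually_elim
      case (elim y)
      have "(\<lambda>k. ?g (r k) y) \<longlonglongrightarrow> ?G y" by (rule tendsto_of_square_diff[OF order_refl elim])
      then show ?case unfolding trace_slip_def by (rule slip_tendsto[OF s(1)])
    qed
    fix k
    have "AE y in Mb. y \<in> \<omega>" by (rule AE_base)
    with dom[rule_format, of k] show "AE y in Mb. norm (trace_slip (d (r k)) y) \<le> R y"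
    proof eventually_elim
      case (elim y)
      have "norm (K y *v ?g (r k) y) \<le> Mk * (norm (?G y) + sqrt (Q y))"
        by (rule order_trans[OF K_bound[OF elim(2)] mult_left_mono[OF norm_le_of_square_diff[OF elim(1)] Mk_nonneg]])
      then show ?case using norm_slip_le[OF s, of "K y" "?g (r k) y"] unfolding trace_slip_def R_def by linarith
    qed
  qed
  then have "(\<lambda>k. friction (r k) \<phi>) \<longlonglongrightarrow> (\<integral>y. trace_slip dU y \<bullet> (K y *v \<phi> (y, 0)) \<partial>Mb)"
    unfolding friction_def by (simp add: inner_commute)
  moreover have "(\<lambda>k. friction (r k) \<phi>) \<longlonglongrightarrow> residual \<phi>"
    using LIMSEQ_subseq_LIMSEQ[OF friction_tendsto[OF \<phi>] r] unfolding eps_powr_0[OF \<beta>] o_def by simp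
  ultimately show ?thesis unfolding trace_slip_def using LIMSEQ_unique by blast
qed

end

section \<open>Assembling the three friction regimes\<close>

theorem mainTheorem6:
  fixes \<omega> :: "(real^2) set" and h :: "real^2 \<Rightarrow> real"
    and \<nu> s \<gamma> :: real and f :: "real^2 \<Rightarrow> real^2" and K :: "real^2 \<Rightarrow> real^2^2"
    and eps :: "nat \<Rightarrow> real" and u :: "nat \<Rightarrow> pt \<Rightarrow> pt" and p :: "nat \<Rightarrow> pt \<Rightarrow> real"
    and dw :: "nat \<Rightarrow> pt \<Rightarrow> pt" and U dU :: "pt \<Rightarrow> pt" and P :: "real^2 \<Rightarrow> real"
  assumes dom: "smooth_bounded_domain \<omega>"
    and h_pos: "\<forall>y\<in>\<omega>. 0 < h y" and h_bdd: "bounded (h ` \<omega>)" and h_C1: "C1_on h \<omega>"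
    and nu: "\<nu> > 0"
    and f: "L2 \<omega> f"
    and K_meas: "K \<in> borel_measurable lebesgue"
    and K_sym: "\<forall>y\<in>\<omega>. transpose (K y) = K y"
    and K_bdd: "\<exists>M. \<forall>y\<in>\<omega>. \<forall>\<xi>. norm (K y *v \<xi>) \<le> M * norm \<xi>"
    and K_pd: "\<exists>\<alpha>>0. \<forall>y\<in>\<omega>. \<forall>\<xi>. \<alpha> * (norm \<xi>)\<^sup>2 \<le> \<xi> \<bullet> (K y *v \<xi>)"
    and s: "1 < s" "s < 2"
    and eps: "\<forall>n. 0 < eps n" "eps \<longlonglongrightarrow> 0"
    and sol: "\<forall>n. weak_solution \<omega> h \<nu> f K s \<gamma> (eps n) (u n) (p n)"
    and conv_u: "weak_conv_Vz3 (Omega_eps \<omega> h 1)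
                   (\<lambda>n z. (eps n) powr (-2) *\<^sub>R u n (fst z, eps n * snd z)) dw U dU"
    and U3: "\<forall>z\<in>Omega_eps \<omega> h 1. snd (U z) = 0"
    and P_L20: "L2 (Omega_eps \<omega> h 1) (\<lambda>z. P (fst z))" "SInt (Omega_eps \<omega> h 1) (\<lambda>z. P (fst z)) = 0"
    and conv_p: "weak_conv_L2 (Omega_eps \<omega> h 1) (\<lambda>n z. p n (fst z, eps n * snd z)) (\<lambda>z. P (fst z))"
  shows "flux_condition \<omega> h U \<and> vanishes_Gamma1 \<omega> h (Omega_eps \<omega> h 1) U dU \<and>
    (\<gamma> = 3 - 2 * s \<longrightarrow>
       (\<exists>g. trace_Gamma0 \<omega> (Omega_eps \<omega> h 1) U dU g \<and>
          (\<forall>\<phi> :: pt \<Rightarrow> real^2. C1fun \<phi> \<and> compact (supp \<phi>) \<and>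
              supp \<phi> \<inter> (frontier (Omega_eps \<omega> h 1) - Gamma0 \<omega>) = {} \<longrightarrow>
             momentum_eq \<omega> h \<nu> f dU P
               (\<lambda>\<phi>. SInt \<omega> (\<lambda>y. slip s (K y) (fst (g y)) \<bullet> (K y *v \<phi> (y, 0)))) \<phi>))) \<and>
    (\<gamma> > 3 - 2 * s \<longrightarrow>
       (\<forall>\<phi> :: pt \<Rightarrow> real^2. C1fun \<phi> \<and> compact (supp \<phi>) \<and>
           supp \<phi> \<inter> (frontier (Omega_eps \<omega> h 1) - Gamma0 \<omega>) = {} \<longrightarrow>
          momentum_eq \<omega> h \<nu> f dU P (\<lambda>_. 0) \<phi>)) \<and>
    (\<gamma> < 3 - 2 * s \<longrightarrow>
       trace_Gamma0 \<omega> (Omega_eps \<omega> h 1) U dU (\<lambda>_. 0) \<and>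
       (\<forall>\<phi> :: pt \<Rightarrow> real^2. C1fun \<phi> \<and> compact (supp \<phi>) \<and> supp \<phi> \<subseteq> Omega_eps \<omega> h 1 \<longrightarrow>
          momentum_eq \<omega> h \<nu> f dU P (\<lambda>_. 0) \<phi>))"
proof -
  obtain H where H: "0 < H" "\<forall>x\<in>h ` \<omega>. norm x \<le> H" using h_bdd unfolding bounded_pos by blast
  have "continuous_on \<omega> h"
    using h_C1 unfolding C1_on_def by (meson continuous_at_imp_continuous_on has_derivative_continuous)
  then interpret thin_domain \<omega> h H
    using dom h_pos H unfolding smooth_bounded_domain_def by unfold_locales auto
  obtain M where M: "\<forall>y\<in>\<omega>. \<forall>\<xi>. norm (K y *v \<xi>) \<le> M * norm \<xi>" using K_bdd by blast
  \<comment> \<open>The given bound might be negative; its positive part keeps the inequality and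
    has the sign needed when it multiplies estimates.\<close>
  have Mk: "norm (K y *v \<xi>) \<le> max 0 M * norm \<xi>" if "y \<in> \<omega>" for y \<xi>
    by (rule order_trans[OF M[rule_format, OF that]]) (simp add: mult_right_mono)
  obtain \<alpha> where \<alpha>: "0 < \<alpha>" "\<forall>y\<in>\<omega>. \<forall>\<xi>. \<alpha> * (norm \<xi>)\<^sup>2 \<le> \<xi> \<bullet> (K y *v \<xi>)" using K_pd by blast
  \<comment> \<open>Coercivity and Cauchy-Schwarz give the claim multiplied by
    \<open>norm \<xi>\<close>, which is then cancelled.\<close>
  have lower: "\<alpha> * norm \<xi> \<le> norm (K y *v \<xi>)" if "y \<in> \<omega>" for y \<xi>
  proof (cases "\<xi> = 0")
    case False
    have "norm \<xi> * (\<alpha> * norm \<xi>) \<le> norm \<xi> * norm (K y *v \<xi>)"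
      using order_trans[OF \<alpha>(2)[rule_format, OF that] norm_cauchy_schwarz] by (simp add: power2_eq_square mult_ac)
    then show ?thesis using False by simp
  qed simp
  have f': "sqi Mb f" using f unfolding L2_iff_sqi[OF sets_base] .
  interpret slip_problem \<omega> h H \<nu> f K s "max 0 M"
    by unfold_locales (use s K_meas Mk f' nu in simp_all)
  let ?w = "\<lambda>n z. eps n powr (-2) *\<^sub>R u n (fst z, eps n * snd z)"
  let ?q = "\<lambda>n z. p n (fst z, eps n * snd z)"
  have "\<exists>X. scaled_solution \<nu> f K s (\<gamma> + 2 * s - 3) (eps n) (?w n) (fst X) (snd X) (?q n)" for n
  proof (rule weak_solution_scaled[OF sol[rule_format] eps(1)[rule_format] K_meas f, of n])
    fix E d assume "scaled_solution \<nu> f K s (\<gamma> + 2 * s - 3) (eps n) (?w n) E d (?q n)"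
    then show ?thesis by (intro exI[of _ "(E, d)"]) simp
  qed
  then have "\<forall>n. \<exists>X. scaled_solution \<nu> f K s (\<gamma> + 2 * s - 3) (eps n) (?w n) (fst X) (snd X) (?q n)" by blast
  from choice[OF this] obtain X
    where X: "\<forall>n. scaled_solution \<nu> f K s (\<gamma> + 2 * s - 3) (eps n) (?w n) (fst (X n)) (snd (X n)) (?q n)" ..
  define E where "E n = fst (X n)" for n
  define d where "d n = snd (X n)" for n
  have ss: "scaled_solution \<nu> f K s (\<gamma> + 2 * s - 3) (eps n) (?w n) (E n) (d n) (?q n)" for n
    using X unfolding E_def d_def by blast
  note sq = scaled_solution_sqi[OF ss]
  have dw: "Vz3 (Dm 1) (?w n) (dw n)" for n using conv_u unfolding weak_conv_Vz3_def by blast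
  \<comment> \<open>The convergence hypothesis comes with its own vertical derivative; uniqueness of
    weak derivatives allows it to be exchanged for the rescaled gradient of the solution, to which
    the energy estimates apply.\<close>
  have dw_eq: "AE z in M1. dw n z = d n z" for n
  proof (rule weak_deriv_unique[OF open_dom lmeasurable_dom[OF zero_less_one]])
    show "sqi M1 (dw n)" "weak_deriv (Dm 1) e3 (?w n) (dw n)" using dw[of n] unfolding Vz3_iff by blast+
    show "sqi M1 (d n)" by (rule sq(3))
    show "weak_deriv (Dm 1) e3 (?w n) (d n)" by (rule vapprox_weak_deriv[OF vapprox_scaled_solution[OF ss]])
  qed (rule C1_sqi_Mdom[OF zero_less_one])
  interpret slip_sequence \<omega> h H \<nu> f K s "max 0 M" "\<gamma> + 2 * s - 3" \<alpha> eps ?w E d ?q U dU P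
  proof unfold_locales
    show "Vz3 (Dm 1) U dU" using conv_u unfolding weak_conv_Vz3_def by blast
    show "sqi (lebesgue_on (Dm 1)) (\<lambda>z. P (fst z))" using P_L20(1) unfolding L2_iff_sqi[OF sets_dom] .
    show "(\<lambda>n. \<integral>z. ?q n z * r z \<partial>M1) \<longlonglongrightarrow> (\<integral>z. P (fst z) * r z \<partial>M1)" if "sqi M1 r" for r
      using conv_p that unfolding weak_conv_L2_def L2_iff_sqi[OF sets_dom] integral_lebesgue_on_eq[OF sets_dom] by blast
    show "(\<lambda>n. \<integral>z. ?w n z \<bullet> \<psi> z + d n z \<bullet> d\<psi> z \<partial>M1) \<longlonglongrightarrow> (\<integral>z. U z \<bullet> \<psi> z + dU z \<bullet> d\<psi> z \<partial>M1)"
      if \<psi>: "Vz3 (Dm 1) \<psi> d\<psi>" for \<psi> d\<psi>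
    proof -
      have s\<psi>: "sqi M1 \<psi>" "sqi M1 d\<psi>" and sdw: "sqi M1 (dw n)" for n using \<psi> dw[of n] unfolding Vz3_iff by blast+
      have "(\<integral>z. ?w n z \<bullet> \<psi> z + d n z \<bullet> d\<psi> z \<partial>M1) = (\<integral>z. ?w n z \<bullet> \<psi> z + dw n z \<bullet> d\<psi> z \<partial>M1)" for n
      proof (rule integral_cong_AE)
        show "AE z in M1. ?w n z \<bullet> \<psi> z + d n z \<bullet> d\<psi> z = ?w n z \<bullet> \<psi> z + dw n z \<bullet> d\<psi> z"
          using dw_eq[of n] by eventually_elim simp
      qed (intro borel_measurable_add borel_measurable_inner sqiD(1) sq s\<psi> sdw)+
      then show ?thesis
        using conv_u \<psi> unfolding weak_conv_Vz3_def integral_lebesgue_on_eq[OF sets_dom] by simp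
    qed
  qed (use ss eps K_sym \<alpha>(1) lower in simp_all)
  have test: "test_field 1 \<phi>" if "C1fun \<phi> \<and> compact (supp \<phi>) \<and> supp \<phi> \<inter> (frontier (Dm 1) - Gamma0 \<omega>) = {}"
    for \<phi> :: "pt \<Rightarrow> real^2" using that unfolding test_field_def .
  show ?thesis
  proof (intro conjI impI)
    show "flux_condition \<omega> h U"
      unfolding flux_condition_def
    proof (intro allI impI)
      fix \<psi> :: "real^2 \<Rightarrow> real" assume "C1fun \<psi>"
      from flux_limit[OF this] show "SInt (Dm 1) (\<lambda>z. fst (U z) \<bullet> grad2 \<psi> (fst z)) = 0"
        by (simp add: integral_lebesgue_on_eq[OF sets_dom, symmetric] inner_prod_def)
    qed
    show "vanishes_Gamma1 \<omega> h (Dm 1) U dU" by (rule limit_vanishes_Gamma1)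
    show "\<exists>g. trace_Gamma0 \<omega> (Dm 1) U dU g \<and> (\<forall>\<phi> :: pt \<Rightarrow> real^2. C1fun \<phi> \<and> compact (supp \<phi>) \<and>
        supp \<phi> \<inter> (frontier (Dm 1) - Gamma0 \<omega>) = {} \<longrightarrow>
        momentum_eq \<omega> h \<nu> f dU P (\<lambda>\<phi>. SInt \<omega> (\<lambda>y. slip s (K y) (fst (g y)) \<bullet> (K y *v \<phi> (y, 0)))) \<phi>)" if "\<gamma> = 3 - 2 * s"
    proof (intro exI[of _ "vtrace dU"] conjI allI impI limit_trace)
      fix \<phi> :: "pt \<Rightarrow> real^2"
      assume "C1fun \<phi> \<and> compact (supp \<phi>) \<and> supp \<phi> \<inter> (frontier (Dm 1) - Gamma0 \<omega>) = {}"
      from power_law_slip[OF _ test[OF this]] that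
      show "momentum_eq \<omega> h \<nu> f dU P (\<lambda>\<phi>. SInt \<omega> (\<lambda>y. slip s (K y) (fst (vtrace dU y)) \<bullet> (K y *v \<phi> (y, 0)))) \<phi>"
        unfolding momentum_eq_iff integral_lebesgue_on_eq[OF sets_base] by simp
    qed
    show "\<forall>\<phi> :: pt \<Rightarrow> real^2. C1fun \<phi> \<and> compact (supp \<phi>) \<and> supp \<phi> \<inter> (frontier (Dm 1) - Gamma0 \<omega>) = {} \<longrightarrow>
        momentum_eq \<omega> h \<nu> f dU P (\<lambda>_. 0) \<phi>" if "3 - 2 * s < \<gamma>"
    proof (intro allI impI)
      fix \<phi> :: "pt \<Rightarrow> real^2"
      assume "C1fun \<phi> \<and> compact (supp \<phi>) \<and> supp \<phi> \<inter> (frontier (Dm 1) - Gamma0 \<omega>) = {}"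
      from perfect_slip[OF _ test[OF this]] that show "momentum_eq \<omega> h \<nu> f dU P (\<lambda>_. 0) \<phi>"
        unfolding momentum_eq_iff by simp
    qed
    show "trace_Gamma0 \<omega> (Dm 1) U dU (\<lambda>_. 0)" if "\<gamma> < 3 - 2 * s" by (rule no_slip_trace) (use that in simp)
    show "\<forall>\<phi> :: pt \<Rightarrow> real^2. C1fun \<phi> \<and> compact (supp \<phi>) \<and> supp \<phi> \<subseteq> Dm 1 \<longrightarrow> momentum_eq \<omega> h \<nu> f dU P (\<lambda>_. 0) \<phi>"
      unfolding momentum_eq_iff using interior_residual by simp
  qed
qed

end
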